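(* Let $n\ge3$. (i) Let $1\le p<n/(n-2)$. Every function $\varphi\in\tilde L^p(\mathscr{H})$ can be reconstructed from $(R^*\varphi)(\ell)$, $\ell\in\mathscr{L}$, by the formula $$\varphi(h)=|h|^{1-n}\,(\tilde R^{-1}\Phi)(\nu(h)),\qquad \Phi(\pi)=\frac{\sigma_{n-2}}{2|\pi|}\,(R^*\varphi)(\nu^{-1}(\pi)),$$ where $\pi$ is an $(n-2)$-plane not passing through the origin and $\tilde R^{-1}$ denotes the inverse of the Radon–John $(n-2)$-plane transform in $\mathbb{R}^n$, which can be represented as $$(\tilde R^{-1}\Phi)(x)=\lim_{r\to0}\,\pi^{1-n/2}\,(\mathcal{D}^{n/2-1}_{-,2}\tilde R^*_x\Phi)(r),$$ where the number $\pi^{1-n/2}$ is a power of the constant $\pi=3.14\ldots$ and the limit is understood in the $L^p(\mathbb{R}^n)$-norm (in $x$). (ii) If $\varphi\in\tilde C_\mu(\mathscr{H})$ with $\mu>n-2$, then the same reconstruction formulas hold with the limit interpreted in the $\sup$-norm.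
   Context: $\mathscr{L}$ and $\mathscr{H}$ are the sets of all non-oriented lines and all non-oriented hyperplanes in $\mathbb{R}^n$. Lines are written $\ell=\ell(\omega,u)=\mathbb{R}\omega+u$, $\omega\in\mathbb{S}^{n-1}$, $u\in\omega^\perp$; hyperplanes are written $h=h(\theta,t)=\{x:x\cdot\theta=t\}$, $\theta\in\mathbb{S}^{n-1}$, $t\in\mathbb{R}$. A function on $\mathscr{H}$ is identified with $\varphi(\theta,t)$ satisfying $\varphi(\theta,t)=\varphi(-\theta,-t)$, and $dh=d_*\theta\,dt$, where $d_*\theta$ is normalized surface measure on $\mathbb{S}^{n-1}$. For an affine plane $\tau$, $|\tau|$ is its Euclidean distance to the origin (so $|h(\theta,t)|=|t|$). $\sigma_{m-1}=2\pi^{m/2}/\Gamma(m/2)$ is the area of $\mathbb{S}^{m-1}$. Dual Radon transform: $(R^*\varphi)(\omega,u)=\int_{\mathbb{S}^{n-1}\cap\omega^\perp}\varphi(\theta,\theta\cdot u)\,d_\omega\theta$, with $d_\omega\theta$ the invariant probability measure on $\mathbb{S}^{n-1}\cap\omega^\perp$. Quasi-orthogonal inversion $\nu$: for a line $\ell(\omega,u)$ with $u\ne0$, $\nu(\ell)=\{\omega,u\}^\perp-u/|u|^2$, an $(n-2)$-plane not passing through the origin, where $\{\omega,u\}^\perp$ is the orthogonal complement of $\mathrm{span}(\omega,u)$; this is a bijection from lines not through $0$ onto $(n-2)$-planes not through $0$, and $\nu^{-1}$ in the definition of $\Phi$ is its inverse. For a hyperplane $h(\theta,t)$ with $t\neq0$,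 $\nu(h)=-\theta/t\in\mathbb{R}^n\setminus\{0\}$. The Radon–John transform $\tilde R$ sends a function $g$ on $\mathbb{R}^n$ to $(\tilde Rg)(\pi)=\int_\pi g$ (Lebesgue measure on $\pi$), $\pi$ ranging over $(n-2)$-dimensional affine planes. Mean value operator: with $\mathbb{R}^{n-2}=\mathrm{span}(e_1,\dots,e_{n-2})$, $$(\tilde R^*_x\Phi)(r)=\int_{SO(n)}\Phi(\gamma\mathbb{R}^{n-2}+x+r\gamma e_n)\,d\gamma,\qquad r>0,$$ with $d\gamma$ normalized Haar measure. With $D=\frac{1}{2r}\frac{d}{dr}$ and $(I^{\alpha}_{-,2}\chi)(t)=\frac{2}{\Gamma(\alpha)}\int_t^\infty(r^2-t^2)^{\alpha-1}\chi(r)\,r\,dr$, the Erdélyi–Kober derivative (acting in $r$) is $\mathcal{D}^{n/2-1}_{-,2}\chi=(-D)^{n/2-1}\chi$ if $n$ is even and $\mathcal{D}^{n/2-1}_{-,2}\chi=r(-D)^{(n-1)/2}r^{n-2}I^{1/2}_{-,2}r^{1-n}\chi$ if $n$ is odd (powers of $r$ are multiplication operators). Function spaces: for $1\le p<\infty$, $$\tilde L^p(\mathscr{H})=\Bigl\{\varphi:\int_{\mathscr{H}}|h|^{(n-1)(p-1)-2}|\varphi(h)|^p\,dh<\infty\Bigr\}.$$ For $\mu>0$, $\tilde C_\mu(\mathscr{H})$ is the space of functions $\varphi$ continuous on the set of hyperplanes not passing through the origin with $|h|^{n-1-\mu}\varphi(h)=O(1)$ as $|h|\to0$ and $|h|^{n-1}\varphi(h)\to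 c=\mathrm{const}$ as $|h|\to\infty$. *)

theory Defs
  imports "HOL-Analysis.Analysis"
begin

text \<open>
  Functions on the set of lines, hyperplanes or (n-2)-planes are functions of point sets; their
  values on other sets never matter. Thus the symmetry condition for a function of (theta, t) on
  the set of hyperplanes holds by construction. Integrals are taken with respect to completed
  measures, so that a function may be changed on any null set without losing measurability.
\<close>

definition line :: "real^'n \<Rightarrow> real^'n \<Rightarrow> (real^'n) set" where
  "line \<omega> u = range (\<lambda>s. s *\<^sub>R \<omega> + u)"

definition lines :: "(real^'n) set set" where
  "lines = {line \<omega> u |\<omega> u. norm \<omega> = 1 \<and> \<omega> \<bullet> u = 0}"

definition hyperplane :: "real^'n \<Rightarrow> real \<Rightarrow> (real^'n) set" where
  "hyperplane \<theta> t = {x. x \<bullet> \<theta> = t}"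

definition hyperplanes :: "(real^'n) set set" where
  "hyperplanes = {hyperplane \<theta> t |\<theta> t. norm \<theta> = 1}"

text \<open>Distance to the origin.\<close>

abbreviation dist0 :: "(real^'n) set \<Rightarrow> real" where
  "dist0 \<equiv> infdist 0"


subsection \<open>Measures\<close>

text \<open>
  Borel version of Lebesgue measure on an affine plane, carried over from coordinate space by an
  orthonormal system of coordinates in the plane; it does not depend on the coordinates chosen.
  This generalises the library's definition of \<open>lborel\<close>.
\<close>

definition plane_lborel :: "(real^'n) set \<Rightarrow> (real^'n) measure" where
  "plane_lborel T =
     (let (q, B) = (SOME (q, B). pairwise orthogonal B \<and> (\<forall>b\<in>B. norm b = 1) \<and>
                      T = (\<lambda>v. q + v) ` span B)
      in distr (\<Pi>\<^sub>M b\<in>B. lborel) borel (\<lambda>c. q + (\<Sum>b\<in>B. c b *\<^sub>R b)))"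

text \<open>
  Normalized surface measure (the rotation invariant probability measure) on the unit sphere of
  the linear subspace \<open>V\<close>: the measure of a set of directions is the proportion of the unit ball
  of \<open>V\<close> that lies in the cone over this set.
\<close>

definition sphere_prob :: "(real^'n) set \<Rightarrow> (real^'n) measure" where
  "sphere_prob V = distr (uniform_measure (plane_lborel V) (ball 0 1)) borel sgn"

text \<open>The measure dh in the coordinates (theta, t).\<close>

definition hyperplane_measure :: "((real^'n) \<times> real) measure" where
  "hyperplane_measure = completion (sphere_prob UNIV \<Otimes>\<^sub>M lborel)"

text \<open>
  Normalized Haar measure on SO(n), as a Borel measure on the set of rotation matrices; it is
  uniquely determined by these conditions.
\<close>

definition haar_SO :: "(real^'n^'n) measure" where
  "haar_SO = (SOME M. emeasure M (space M) = 1 \<and>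
                sets M = sets (restrict_space borel {A. rotation_matrix A}) \<and>
                (\<forall>A. rotation_matrix A \<longrightarrow> distr M M (\<lambda>B. A ** B) = M))"

text \<open>The surface area of the unit sphere of dimension \<open>k\<close>.\<close>

definition sphere_area :: "nat \<Rightarrow> real" where
  "sphere_area k = 2 * pi powr ((real k + 1) / 2) / Gamma ((real k + 1) / 2)"


subsection \<open>Dual Radon transform and quasi-orthogonal inversion\<close>

definition dual_radon :: "((real^'n) set \<Rightarrow> real) \<Rightarrow> (real^'n) set \<Rightarrow> real" where
  "dual_radon \<phi> l =
     (let (\<omega>, u) = (SOME (\<omega>, u). norm \<omega> = 1 \<and> \<omega> \<bullet> u = 0 \<and> l = line \<omega> u)
      in LINT \<theta>|completion (sphere_prob {\<theta>. \<theta> \<bullet> \<omega> = 0}). \<phi> (hyperplane \<theta> (\<theta> \<bullet> u)))"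

definition nu_line :: "(real^'n) set \<Rightarrow> (real^'n) set" where
  "nu_line l =
     (let (\<omega>, u) = (SOME (\<omega>, u). norm \<omega> = 1 \<and> \<omega> \<bullet> u = 0 \<and> l = line \<omega> u)
      in (\<lambda>v. v - u /\<^sub>R (norm u)\<^sup>2) ` {v. v \<bullet> \<omega> = 0 \<and> v \<bullet> u = 0})"

definition nu_line_inv :: "(real^'n) set \<Rightarrow> (real^'n) set" where
  "nu_line_inv = inv_into {l \<in> lines. 0 \<notin> l} nu_line"

definition nu_hyperplane :: "(real^'n) set \<Rightarrow> real^'n" where
  "nu_hyperplane h =
     (let (\<theta>, t) = (SOME (\<theta>, t). norm \<theta> = 1 \<and> h = hyperplane \<theta> t) in - (\<theta> /\<^sub>R t))"

definition Phi :: "((real^'n) set \<Rightarrow> real) \<Rightarrow> (real^'n) set \<Rightarrow> real" where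
  "Phi \<phi> P = sphere_area (CARD('n) - 2) / (2 * dist0 P) * dual_radon \<phi> (nu_line_inv P)"

text \<open>The following three facts show that the choices of coordinates above are immaterial.\<close>

lemma line_eq_iff:
  assumes "norm \<omega> = 1" "\<omega> \<bullet> u = 0" "norm \<omega>' = 1" "\<omega>' \<bullet> u' = 0"
  shows "line \<omega> u = line \<omega>' u' \<longleftrightarrow> u = u' \<and> (\<omega> = \<omega>' \<or> \<omega> = - \<omega>')"
proof
  assume eq: "line \<omega> u = line \<omega>' u'"
  have "u \<in> line \<omega> u" "\<omega> + u \<in> line \<omega> u"
    unfolding line_def by (auto intro: image_eqI[of _ _ 0] image_eqI[of _ _ 1])
  then have "u \<in> range (\<lambda>s. s *\<^sub>R \<omega>' + u')" "\<omega> + u \<in> range (\<lambda>s. s *\<^sub>R \<omega>' + u')"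
    unfolding eq by (simp_all only: line_def)
  then obtain a b where a: "u = a *\<^sub>R \<omega>' + u'" and b: "\<omega> + u = b *\<^sub>R \<omega>' + u'"
    by (elim rangeE)
  have w: "\<omega> = (b - a) *\<^sub>R \<omega>'"
    using a b by (simp add: algebra_simps)
  then have ba: "\<bar>b - a\<bar> = 1"
    using assms(1,3) by (metis mult.right_neutral norm_scaleR)
  then have "\<omega>' \<bullet> u = 0"
    using assms(2) w by (auto simp: inner_left_distrib)
  then have "a = 0"
    using assms(3,4) arg_cong[OF a, of "\<lambda>x. \<omega>' \<bullet> x"]
    by (simp add: inner_right_distrib dot_square_norm)
  with a have "u = u'" by simp
  moreover have "\<omega> = \<omega>' \<or> \<omega> = - \<omega>'"
  proof (cases "b - a \<ge> 0")
    case True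
    with ba w show ?thesis by simp
  next
    case False
    with ba have "b - a = -1" by simp
    with w show ?thesis by simp
  qed
  ultimately show "u = u' \<and> (\<omega> = \<omega>' \<or> \<omega> = - \<omega>')" by blast
next
  have "line (- \<omega>') u' \<subseteq> line \<omega>' u'" "line \<omega>' u' \<subseteq> line (- \<omega>') u'"
    unfolding line_def by (force intro: image_eqI[of _ _ "- s" for s])+
  then show "line \<omega> u = line \<omega>' u'" if "u = u' \<and> (\<omega> = \<omega>' \<or> \<omega> = - \<omega>')"
    using that by blast
qed

lemma hyperplane_eq_iff:
  assumes "norm \<theta> = 1" "norm \<theta>' = 1"
  shows "hyperplane \<theta> t = hyperplane \<theta>' t' \<longleftrightarrow> (\<theta> = \<theta>' \<and> t = t') \<or> (\<theta> = - \<theta>' \<and> t = - t')"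
proof
  assume eq: "hyperplane \<theta> t = hyperplane \<theta>' t'"
  have sq: "\<theta> \<bullet> \<theta> = 1" "\<theta>' \<bullet> \<theta>' = 1"
    using assms by (simp_all add: dot_square_norm)
  define c where "c = \<theta>' \<bullet> \<theta>"
  have "t *\<^sub>R \<theta> \<in> hyperplane \<theta> t"
    by (simp add: hyperplane_def sq)
  then have t': "t * c = t'"
    unfolding eq by (simp add: hyperplane_def c_def inner_commute)
  have "t *\<^sub>R \<theta> + (\<theta>' - c *\<^sub>R \<theta>) \<in> hyperplane \<theta> t"
    by (simp add: hyperplane_def inner_left_distrib inner_diff_left sq c_def)
  then have "t *\<^sub>R \<theta> + (\<theta>' - c *\<^sub>R \<theta>) \<in> hyperplane \<theta>' t'"
    unfolding eq .
  then have "(\<theta>' - c *\<^sub>R \<theta>) \<bullet> \<theta>' = 0"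
    using t' inner_commute[of \<theta> \<theta>'] by (simp add: hyperplane_def inner_left_distrib c_def)
  moreover have "(\<theta>' - c *\<^sub>R \<theta>) \<bullet> \<theta> = 0"
    by (simp add: inner_diff_left sq c_def)
  ultimately have "(\<theta>' - c *\<^sub>R \<theta>) \<bullet> (\<theta>' - c *\<^sub>R \<theta>) = 0"
    by (simp only: inner_diff_right inner_scaleR_right)
  then have w: "\<theta>' = c *\<^sub>R \<theta>" by simp
  then have "\<bar>c\<bar> = 1"
    using assms by (metis mult.right_neutral norm_scaleR)
  then have "c = 1 \<or> c = -1" by linarith
  then show "(\<theta> = \<theta>' \<and> t = t') \<or> (\<theta> = - \<theta>' \<and> t = - t')"
    using w t' by auto
qed (auto simp: hyperplane_def)

lemma coordinates_immaterial:
  fixes \<omega> u \<theta> :: "real^'n"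
  shows "norm \<omega> = 1 \<Longrightarrow> \<omega> \<bullet> u = 0 \<Longrightarrow> dual_radon \<phi> (line \<omega> u) =
      (LINT \<theta>|completion (sphere_prob {\<theta>. \<theta> \<bullet> \<omega> = 0}). \<phi> (hyperplane \<theta> (\<theta> \<bullet> u)))"
    and "norm \<omega> = 1 \<Longrightarrow> \<omega> \<bullet> u = 0 \<Longrightarrow> nu_line (line \<omega> u) =
      (\<lambda>v. v - u /\<^sub>R (norm u)\<^sup>2) ` {v. v \<bullet> \<omega> = 0 \<and> v \<bullet> u = 0}"
    and "norm \<theta> = 1 \<Longrightarrow> nu_hyperplane (hyperplane \<theta> t) = - (\<theta> /\<^sub>R t)"
proof -
  assume l: "norm \<omega> = 1" "\<omega> \<bullet> u = 0"
  define P where "P = (\<lambda>(\<omega>', u'). norm \<omega>' = 1 \<and> \<omega>' \<bullet> u' = 0 \<and> line \<omega> u = line \<omega>' u')"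
  obtain \<omega>' u' where eq: "(SOME x. P x) = (\<omega>', u')" by force
  have "P (\<omega>, u)" using l by (simp add: P_def)
  then have "P (SOME x. P x)" by (rule someI)
  then have *: "u = u' \<and> (\<omega> = \<omega>' \<or> \<omega> = - \<omega>')"
    using line_eq_iff[OF l, of \<omega>' u'] unfolding eq by (simp add: P_def)
  then show "dual_radon \<phi> (line \<omega> u) =
      (LINT \<theta>|completion (sphere_prob {\<theta>. \<theta> \<bullet> \<omega> = 0}). \<phi> (hyperplane \<theta> (\<theta> \<bullet> u)))"
    using eq unfolding dual_radon_def P_def by auto
  show "nu_line (line \<omega> u) =
      (\<lambda>v. v - u /\<^sub>R (norm u)\<^sup>2) ` {v. v \<bullet> \<omega> = 0 \<and> v \<bullet> u = 0}"
    using eq * unfolding nu_line_def P_def by auto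
next
  assume l: "norm \<theta> = 1"
  define P where "P = (\<lambda>(\<theta>', t'). norm \<theta>' = 1 \<and> hyperplane \<theta> t = hyperplane \<theta>' t')"
  obtain \<theta>' t' where eq: "(SOME x. P x) = (\<theta>', t')" by force
  have "P (\<theta>, t)" using l by (simp add: P_def)
  then have "P (SOME x. P x)" by (rule someI)
  then have "(\<theta> = \<theta>' \<and> t = t') \<or> (\<theta> = - \<theta>' \<and> t = - t')"
    using hyperplane_eq_iff[OF l, of \<theta>' t t'] unfolding eq by (simp add: P_def)
  then show "nu_hyperplane (hyperplane \<theta> t) = - (\<theta> /\<^sub>R t)"
    using eq unfolding nu_hyperplane_def P_def by auto
qed


subsection \<open>Radon--John transform and the inversion operator\<close>

definition radon_john :: "(real^'n \<Rightarrow> real) \<Rightarrow> (real^'n) set \<Rightarrow> real" where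
  "radon_john g P = (LINT x|completion (plane_lborel P). g x)"

text \<open>
  In what follows \<open>e 1, \<dots>, e n\<close> is an enumeration of the standard basis, and
  \<open>plane e A y\<close> is \<open>A\<real>\<^sup>n\<^sup>-\<^sup>2 + y\<close>, where \<open>\<real>\<^sup>n\<^sup>-\<^sup>2\<close> is spanned by \<open>e 1, \<dots>, e (n - 2)\<close>.
\<close>

definition plane :: "(nat \<Rightarrow> real^'n) \<Rightarrow> real^'n^'n \<Rightarrow> real^'n \<Rightarrow> (real^'n) set" where
  "plane e A y = (\<lambda>v. A *v v + y) ` span (e ` {1..CARD('n) - 2})"

definition planes :: "(nat \<Rightarrow> real^'n) \<Rightarrow> (real^'n) set set" where
  "planes e = {plane e A y |A y. rotation_matrix A}"

definition mean_value ::
  "(nat \<Rightarrow> real^'n) \<Rightarrow> ((real^'n) set \<Rightarrow> real) \<Rightarrow> real^'n \<Rightarrow> real \<Rightarrow> real" where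
  "mean_value e \<Psi> x r =
     (LINT A|completion haar_SO. \<Psi> (plane e A (x + r *\<^sub>R (A *v e CARD('n)))))"

definition EK_integral :: "real \<Rightarrow> (real \<Rightarrow> real) \<Rightarrow> real \<Rightarrow> real" where
  "EK_integral \<alpha> g t =
     2 / Gamma \<alpha> * (LINT r:{t<..}|lebesgue. (r\<^sup>2 - t\<^sup>2) powr (\<alpha> - 1) * g r * r)"

text \<open>The operator -D.\<close>

definition minus_D :: "(real \<Rightarrow> real) \<Rightarrow> real \<Rightarrow> real" where
  "minus_D g r = - (1 / (2 * r) * deriv g r)"

text \<open>The derivative of order n/2 - 1.\<close>

definition EK_deriv :: "nat \<Rightarrow> (real \<Rightarrow> real) \<Rightarrow> real \<Rightarrow> real" where
  "EK_deriv n g =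
     (if even n then (minus_D ^^ (n div 2 - 1)) g
      else (\<lambda>r. r * (minus_D ^^ ((n - 1) div 2))
                     (\<lambda>s. s ^ (n - 2) * EK_integral (1/2) (\<lambda>q. g q / q ^ (n - 1)) s) r))"

definition approx_inverse ::
  "(nat \<Rightarrow> real^'n) \<Rightarrow> ((real^'n) set \<Rightarrow> real) \<Rightarrow> real \<Rightarrow> real^'n \<Rightarrow> real" where
  "approx_inverse e \<Psi> r x =
     pi powr (1 - real CARD('n) / 2) * EK_deriv CARD('n) (mean_value e \<Psi> x) r"


subsection \<open>Function spaces and the meaning of the inverse transform\<close>

definition Lp_tilde :: "real \<Rightarrow> ((real^'n) set \<Rightarrow> real) set" where
  "Lp_tilde p = {\<phi>.
     (\<lambda>(\<theta>, t). \<phi> (hyperplane \<theta> t)) \<in> borel_measurable hyperplane_measure \<and>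
     (\<integral>\<^sup>+ (\<theta>, t). ennreal (dist0 (hyperplane \<theta> t) powr ((real CARD('n) - 1) * (p - 1) - 2) *
        \<bar>\<phi> (hyperplane \<theta> t)\<bar> powr p) \<partial>hyperplane_measure) < \<infinity>}"

definition C_tilde :: "real \<Rightarrow> ((real^'n) set \<Rightarrow> real) set" where
  "C_tilde \<mu> = {\<phi>.
     continuous_on (sphere 0 1 \<times> (- {0})) (\<lambda>(\<theta>, t). \<phi> (hyperplane \<theta> t)) \<and>
     (\<lambda>h. dist0 h powr (real CARD('n) - 1 - \<mu>) * \<phi> h)
        \<in> O[inf (filtercomap dist0 (at_right 0)) (principal hyperplanes)](\<lambda>_. 1) \<and>
     (\<exists>c. ((\<lambda>h. dist0 h powr (real CARD('n) - 1) * \<phi> h) \<longlongrightarrow> c)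
        (inf (filtercomap dist0 at_top) (principal hyperplanes)))}"

definition Lp :: "real \<Rightarrow> (real^'n \<Rightarrow> real) set" where
  "Lp p = {f. f \<in> borel_measurable lebesgue \<and> integrable lebesgue (\<lambda>x. \<bar>f x\<bar> powr p)}"

definition Lp_limit :: "real \<Rightarrow> (real \<Rightarrow> real^'n \<Rightarrow> real) \<Rightarrow> (real^'n \<Rightarrow> real) \<Rightarrow> bool" where
  "Lp_limit p G f \<longleftrightarrow>
     (\<forall>\<^sub>F r in at_right 0. G r \<in> borel_measurable lebesgue) \<and>
     ((\<lambda>r. \<integral>\<^sup>+ x. ennreal (\<bar>G r x - f x\<bar> powr p) \<partial>lebesgue) \<longlongrightarrow> 0) (at_right 0)"

text \<open>
  The counterpart of \<open>C_tilde \<mu>\<close> on \<open>\<real>\<^sup>n\<close> under \<open>f (nu h) = |h|\<^sup>n\<^sup>-\<^sup>1 \<phi> h\<close>.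
\<close>

definition C_decay :: "real \<Rightarrow> (real^'n \<Rightarrow> real) set" where
  "C_decay \<mu> = {f. continuous_on UNIV f \<and> f \<in> O[at_infinity](\<lambda>x. norm x powr - \<mu>)}"

text \<open>
  \<open>f\<close> is a preimage of \<open>\<Psi>\<close> under the Radon--John transform, for almost every plane
  or for every plane not through the origin. A set of planes is null for the motion invariant
  measure iff the pairs (A, y) with \<open>plane e A y\<close> in the set form a null set.
\<close>

definition is_preimage_ae ::
  "(nat \<Rightarrow> real^'n) \<Rightarrow> (real^'n \<Rightarrow> real) \<Rightarrow> ((real^'n) set \<Rightarrow> real) \<Rightarrow> bool" where
  "is_preimage_ae e f \<Psi> \<longleftrightarrow>
     (AE (A, y) in haar_SO \<Otimes>\<^sub>M lborel.
        integrable (completion (plane_lborel (plane e A y))) f \<and>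
        radon_john f (plane e A y) = \<Psi> (plane e A y))"

definition is_preimage ::
  "(nat \<Rightarrow> real^'n) \<Rightarrow> (real^'n \<Rightarrow> real) \<Rightarrow> ((real^'n) set \<Rightarrow> real) \<Rightarrow> bool" where
  "is_preimage e f \<Psi> \<longleftrightarrow>
     (\<forall>P\<in>planes e. 0 \<notin> P \<longrightarrow>
        integrable (completion (plane_lborel P)) f \<and> radon_john f P = \<Psi> P)"

end

theory Submission
  imports Defs "HOL-Probability.Probability"
begin

text \<open>
  Under \<open>\<nu>\<close> the hyperplane \<open>{y. y \<bullet> x = -1}\<close> corresponds to the point \<open>x\<close>; put
  \<open>f x = |x|\<^sup>1\<^sup>-\<^sup>n \<phi> {y. y \<bullet> x = -1}\<close>. In suitable cone coordinates the dual Radon transform of \<open>\<phi>\<close> at a line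
  becomes an integral of \<open>f\<close> over the dual \<open>(n - 2)\<close>-plane, so that \<open>\<Phi>\<close> is the Radon--John transform of
  \<open>f\<close>. Averaging over rotations turns the integrals over the planes at distance \<open>r\<close> from \<open>x\<close> into a
  one-dimensional integral of the spherical means of \<open>f\<close> around \<open>x\<close> against
  \<open>s (s\<^sup>2 - r\<^sup>2)\<^sup>n\<^sup>/\<^sup>2\<^sup>-\<^sup>2\<close>, and the Erdelyi--Kober derivative inverts this integral at every Lebesgue
  point \<open>r\<close> of the spherical means. For fixed \<open>r\<close> almost every \<open>x\<close> has this property, by a maximal
  inequality for shells. Hence the approximate inverse is the spherical mean of radius \<open>r\<close>, which
  tends to \<open>f\<close> as \<open>r \<rightarrow> 0\<close>; since the spherical means are determined by the plane integrals,
  \<open>f\<close> is the only preimage.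
\<close>

text \<open>The approximate inverse is a pointwise derivative at one fixed r, and the limit runs
  over all r. Lebesgue differentiation for each x followed by Fubini would only give, for almost
  every r, that almost every x is good; the maximal inequality for shells around the sphere of
  radius r makes every r > 0 good for almost every x. Both integrability hypotheses have the same
  meaning: p < n/(n-2), like \<mu> > n-2, makes f integrable against |y - x|^(-2) away from x. The
  parity of n decides the inversion: for even n the kernel is polynomial and n/2 - 1 derivatives
  undo it; for odd n a half-order integral first raises the order to an integer, through a Beta
  integral. Spherical averages are integrals over SO(n), as in the mean value operator; what is used
  of the group is that its Haar measure is invariant on both sides and that it acts transitively on
  spheres.\<close>

section \<open>Lebesgue measure on affine subspaces\<close>

lemma unit_ball_vol_neq_0 [simp]: "unit_ball_vol (real k) \<noteq> 0"
  by (metis unit_ball_vol_pos less_irrefl of_nat_0_le_iff)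

text \<open>Serves twice: translating all coordinates of a plane at once, and rotating all vectors
  of a random frame at once. Boxes pull back to boxes, and boxes determine the product
  measure.\<close>

lemma PiM_shift:
  fixes N :: "'a measure"
  assumes N: "sigma_finite_measure N" and I: "finite I"
    and T[measurable]: "\<And>i. i \<in> I \<Longrightarrow> T i \<in> measurable N N" "\<And>i. i \<in> I \<Longrightarrow> distr N N (T i) = N"
  shows "distr (Pi\<^sub>M I (\<lambda>_. N)) (Pi\<^sub>M I (\<lambda>_. N)) (\<lambda>c. \<lambda>i\<in>I. T i (c i)) = Pi\<^sub>M I (\<lambda>_. N)"
proof -
  interpret product_sigma_finite "\<lambda>_. N" using N by (simp add: product_sigma_finite_def)
  show ?thesis
  proof (rule PiM_eqI)
    fix A assume A: "\<And>i. i \<in> I \<Longrightarrow> A i \<in> sets N"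
    have eq: "(\<lambda>c. \<lambda>i\<in>I. T i (c i)) -` Pi\<^sub>E I A \<inter> space (Pi\<^sub>M I (\<lambda>_. N)) =
        Pi\<^sub>E I (\<lambda>i. T i -` A i \<inter> space N)"
      by (auto simp: space_PiM PiE_iff extensional_def)
    have "emeasure (distr (Pi\<^sub>M I (\<lambda>_. N)) (Pi\<^sub>M I (\<lambda>_. N)) (\<lambda>c. \<lambda>i\<in>I. T i (c i))) (Pi\<^sub>E I A) =
        (\<Prod>i\<in>I. emeasure N (T i -` A i \<inter> space N))"
      using A I by (subst emeasure_distr) (auto simp: eq sets_PiM_I_finite emeasure_PiM intro!: measurable_restrict)
    also have "\<dots> = (\<Prod>i\<in>I. emeasure (distr N N (T i)) (A i))"
      using A by (intro prod.cong) (auto simp: emeasure_distr)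
    finally show "emeasure (distr (Pi\<^sub>M I (\<lambda>_. N)) (Pi\<^sub>M I (\<lambda>_. N)) (\<lambda>c. \<lambda>i\<in>I. T i (c i))) (Pi\<^sub>E I A) = (\<Prod>i\<in>I. emeasure N (A i))"
      by (simp add: T)
  qed (use I in auto)
qed

section \<open>Uniqueness of translation invariant measures\<close>

text \<open>Comparing the double integral of \<open>1\<^bsub>E\<^esub>(x) 1\<^bsub>B\<^esub>(x + y)\<close> in both orders.\<close>

lemma invariant_measure_exchange:
  fixes \<mu> \<nu> :: "'a::euclidean_space measure"
  assumes [measurable_cong]: "sets \<mu> = sets borel" "sets \<nu> = sets borel"
    and sf: "sigma_finite_measure \<mu>" "sigma_finite_measure \<nu>"
    and V: "AE x in \<mu>. x \<in> V" "AE x in \<nu>. x \<in> V" "\<And>x. x \<in> V \<Longrightarrow> - x \<in> V"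
    and inv: "\<And>a. a \<in> V \<Longrightarrow> distr \<mu> borel (\<lambda>x. a + x) = \<mu>" "\<And>a. a \<in> V \<Longrightarrow> distr \<nu> borel (\<lambda>x. a + x) = \<nu>"
    and [measurable]: "E \<in> sets borel" "B \<in> sets borel"
  shows "emeasure \<mu> E * emeasure \<nu> B = emeasure \<mu> B * emeasure \<nu> (uminus ` E)"
proof -
  interpret m: sigma_finite_measure \<mu> by fact
  interpret n: sigma_finite_measure \<nu> by fact
  interpret pair_sigma_finite \<mu> \<nu> ..
  have E': "uminus ` E = {x. - x \<in> E}" by force
  have Em[measurable]: "{x. - x \<in> E} \<in> sets borel" by measurable
  have shift: "(\<integral>\<^sup>+x. h (a + x) \<partial>N) = (\<integral>\<^sup>+x. h x \<partial>N)"
    if "N = \<mu> \<or> N = \<nu>" "a \<in> V" "h \<in> borel_measurable borel" for h N and a :: 'a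
  proof -
    have "sets N = sets borel" using that assms by auto
    then have "(\<integral>\<^sup>+x. h (a + x) \<partial>N) = (\<integral>\<^sup>+x. h x \<partial>distr N borel (\<lambda>x. a + x))"
      using that by (subst nn_integral_distr) (auto cong: measurable_cong_sets)
    also have "distr N borel (\<lambda>x. a + x) = N" using inv that by auto
    finally show ?thesis .
  qed
  have "emeasure \<mu> E * emeasure \<nu> B = (\<integral>\<^sup>+x. indicator E x * emeasure \<nu> B \<partial>\<mu>)"
    by (subst nn_integral_multc) auto
  also have "\<dots> = (\<integral>\<^sup>+x. (\<integral>\<^sup>+y. indicator E x * indicator B y \<partial>\<nu>) \<partial>\<mu>)"
    by (subst nn_integral_cmult) auto
  also have "\<dots> = (\<integral>\<^sup>+x. (\<integral>\<^sup>+y. indicator E x * indicator B (x + y) \<partial>\<nu>) \<partial>\<mu>)"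
  proof (rule nn_integral_cong_AE, use V(1) in eventually_elim)
    fix x assume x: "x \<in> V"
    show "(\<integral>\<^sup>+y. indicator E x * indicator B y \<partial>\<nu>) = (\<integral>\<^sup>+y. indicator E x * indicator B (x + y) \<partial>\<nu> :: ennreal)"
      by (rule shift[symmetric, of \<nu> x "\<lambda>y. indicator E x * indicator B y"]) (use x in auto)
  qed
  also have "\<dots> = (\<integral>\<^sup>+y. (\<integral>\<^sup>+x. indicator E x * indicator B (x + y) \<partial>\<mu>) \<partial>\<nu>)"
    by (subst Fubini') measurable
  also have "\<dots> = (\<integral>\<^sup>+y. (\<integral>\<^sup>+x. indicator E (x - y) * indicator B x \<partial>\<mu>) \<partial>\<nu>)"
  proof (rule nn_integral_cong_AE, use V(2) in eventually_elim)
    fix y assume y: "y \<in> V"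
    show "(\<integral>\<^sup>+x. indicator E x * indicator B (x + y) \<partial>\<mu>) = (\<integral>\<^sup>+x. indicator E (x - y) * indicator B x \<partial>\<mu> :: ennreal)"
      using shift[of \<mu> "-y" "\<lambda>x. indicator E x * indicator B (x + y)"] V(3)[OF y] by simp
  qed
  also have "\<dots> = (\<integral>\<^sup>+x. (\<integral>\<^sup>+y. indicator E (x - y) * indicator B x \<partial>\<nu>) \<partial>\<mu>)"
    by (subst Fubini') measurable
  also have "\<dots> = (\<integral>\<^sup>+x. indicator B x * emeasure \<nu> {x. - x \<in> E} \<partial>\<mu>)"
  proof (rule nn_integral_cong_AE, use V(1) in eventually_elim)
    fix x assume x: "x \<in> V"
    have "(\<integral>\<^sup>+y. indicator E (x - y) * indicator B x \<partial>\<nu>) = (\<integral>\<^sup>+y. indicator E (- y) * indicator B x \<partial>\<nu> :: ennreal)"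
      using shift[of \<nu> "-x" "\<lambda>y. indicator E (- y) * indicator B x"] V(3)[OF x] by simp
    also have "\<dots> = (\<integral>\<^sup>+y. indicator E (- y) \<partial>\<nu>) * indicator B x"
      by (rule nn_integral_multc) measurable
    also have "(\<integral>\<^sup>+y. indicator E (- y) \<partial>\<nu>) = (\<integral>\<^sup>+y. indicator {x. - x \<in> E} y \<partial>\<nu>)"
      by (intro nn_integral_cong) (auto simp: indicator_def)
    also have "\<dots> = emeasure \<nu> {x. - x \<in> E}" by (rule nn_integral_indicator) measurable
    finally show "(\<integral>\<^sup>+y. indicator E (x - y) * indicator B x \<partial>\<nu>) = indicator B x * emeasure \<nu> {x. - x \<in> E}"
      by (simp add: mult.commute)
  qed
  also have "\<dots> = emeasure \<mu> B * emeasure \<nu> (uminus ` E)"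
    by (subst nn_integral_multc) (auto simp: E')
  finally show ?thesis .
qed

text \<open>Exchange \<mu> with \<nu>, then \<nu> with itself: since \<open>B\<close> has the same
  finite positive measure under both, the right-hand sides coincide and \<open>B\<close> cancels.
  The set \<open>V\<close> admits measures that live on a subspace and are invariant only along
  it.\<close>

lemma invariant_measure_unique:
  fixes \<mu> \<nu> :: "'a::euclidean_space measure"
  assumes s: "sets \<mu> = sets borel" "sets \<nu> = sets borel"
    and sf: "sigma_finite_measure \<mu>" "sigma_finite_measure \<nu>"
    and V: "AE x in \<mu>. x \<in> V" "AE x in \<nu>. x \<in> V" "\<And>x. x \<in> V \<Longrightarrow> - x \<in> V"
    and inv: "\<And>a. a \<in> V \<Longrightarrow> distr \<mu> borel (\<lambda>x. a + x) = \<mu>" "\<And>a. a \<in> V \<Longrightarrow> distr \<nu> borel (\<lambda>x. a + x) = \<nu>"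
    and B: "B \<in> sets borel" "emeasure \<mu> B = emeasure \<nu> B" "emeasure \<nu> B \<noteq> 0" "emeasure \<nu> B \<noteq> \<infinity>"
  shows "\<mu> = \<nu>"
proof (rule measure_eqI)
  fix E assume "E \<in> sets \<mu>"
  then have E: "E \<in> sets borel" using s by simp
  have "emeasure \<mu> E * emeasure \<nu> B = emeasure \<nu> B * emeasure \<nu> (uminus ` E)"
    using invariant_measure_exchange[OF s sf V inv E B(1)] B by simp
  moreover have "emeasure \<nu> E * emeasure \<nu> B = emeasure \<nu> B * emeasure \<nu> (uminus ` E)"
    using invariant_measure_exchange[OF s(2) s(2) sf(2) sf(2) V(2) V(2) V(3) inv(2) inv(2) E B(1)] by simp
  ultimately have "emeasure \<nu> B * emeasure \<mu> E = emeasure \<nu> B * emeasure \<nu> E" by (simp add: mult.commute)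
  then show "emeasure \<mu> E = emeasure \<nu> E"
    using B by (simp add: ennreal_mult_cancel_left)
qed (use s in simp)

lemma lborel_translation:
  "distr lborel borel (\<lambda>x. a + x) = (lborel :: 'a::euclidean_space measure)"
proof -
  have "(lborel :: 'a measure) = density (distr lborel borel (\<lambda>x. a + 1 *\<^sub>R x)) (\<lambda>_. ennreal (\<bar>1\<bar> ^ DIM('a)))"
    by (rule lborel_affine) simp
  also have "\<dots> = distr lborel borel (\<lambda>x. a + x)" by (simp add: density_1)
  finally show ?thesis by (rule sym)
qed

text \<open>The image measure is again translation invariant, because a + T x = T (T' a + x), and
  the unit ball, which \<open>T\<close> preserves, fixes the constant.\<close>

lemma lborel_distr_orthogonal_transformation:
  fixes T :: "'a::euclidean_space \<Rightarrow> 'a"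
  assumes T: "orthogonal_transformation T"
  shows "distr lborel borel T = lborel"
proof -
  obtain T' where T': "orthogonal_transformation T'" "\<And>x. T (T' x) = x" "\<And>x. T' (T x) = x"
    using orthogonal_transformation_inv[OF T] orthogonal_transformation_bij[OF T]
    by (metis bij_inv_eq_iff)
  have lin: "linear T" using T by (rule orthogonal_transformation_linear)
  have M[measurable]: "T \<in> borel_measurable borel" "T' \<in> borel_measurable borel"
    using T T' by (auto intro!: borel_measurable_continuous_onI linear_continuous_on orthogonal_transformation_linear simp: linear_linear)
  have nT: "norm (T x) = norm x" for x using T by (rule orthogonal_transformation_norm)
  show ?thesis
  proof (rule invariant_measure_unique[where V=UNIV and B="ball 0 1"])
    have "distr lborel borel T = distr lborel borel T" ..
    show "sigma_finite_measure (distr lborel borel T)"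
    proof
      show "\<exists>A. countable A \<and> A \<subseteq> sets (distr lborel borel T) \<and> \<Union> A = space (distr lborel borel T) \<and>
         (\<forall>a\<in>A. emeasure (distr lborel borel T) a \<noteq> \<infinity>)"
      proof (intro exI[of _ "range (\<lambda>n::nat. ball 0 (real n))"] conjI ballI)
        show "\<Union> (range (\<lambda>n. ball 0 (real n))) = space (distr lborel borel T)"
          by (auto simp: reals_Archimedean2)
        fix a assume "a \<in> range (\<lambda>n. ball (0::'a) (real n))"
        then obtain n :: nat where a: "a = ball 0 (real n)" by auto
        have "T -` ball 0 (real n) = ball 0 (real n)" by (auto simp: nT)
        then show "emeasure (distr lborel borel T) a \<noteq> \<infinity>"
          by (simp add: a emeasure_distr) (metis emeasure_bounded_finite bounded_ball less_irrefl infinity_ennreal_def)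
      qed auto
    qed
    show "distr (distr lborel borel T) borel (\<lambda>x. a + x) = distr lborel borel T" for a
    proof -
      have "distr (distr lborel borel T) borel (\<lambda>x. a + x) = distr lborel borel (\<lambda>x. a + T x)"
        by (subst distr_distr) (auto simp: comp_def)
      also have "\<dots> = distr lborel borel (\<lambda>x. T (T' a + x))"
        using lin by (simp add: linear_add T')
      also have "\<dots> = distr (distr lborel borel (\<lambda>x. T' a + x)) borel T"
        by (subst distr_distr) (auto simp: comp_def)
      finally show ?thesis by (simp add: lborel_translation)
    qed
    have "T -` ball 0 1 = ball 0 1" by (auto simp: nT)
    then show "emeasure (distr lborel borel T) (ball 0 1) = emeasure lborel (ball (0::'a) 1)"
      using emeasure_distr[of T lborel borel "ball 0 1"] by simp
    show "emeasure lborel (ball (0::'a) 1) \<noteq> \<infinity>"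
      by (metis emeasure_bounded_finite bounded_ball less_irrefl infinity_ennreal_def)
    have "emeasure lborel (ball (0::'a) 1) = ennreal (unit_ball_vol (real DIM('a)))"
      by (simp add: emeasure_ball)
    then show "emeasure lborel (ball (0::'a) 1) \<noteq> 0"
      by simp
  qed (auto simp: sigma_finite_lborel lborel_translation)
qed

text \<open>The case q = 0 of \<open>plane_lborel\<close>, as a Borel measure on the ambient space
  concentrated on \<open>span B\<close>, so that the measures of all subspaces share one
  sigma-algebra.\<close>

definition subspace_lborel :: "'a::euclidean_space set \<Rightarrow> 'a measure" where
  "subspace_lborel B = distr (\<Pi>\<^sub>M b\<in>B. lborel) borel (\<lambda>c. \<Sum>b\<in>B. c b *\<^sub>R b)"

definition orthonormal :: "'a::euclidean_space set \<Rightarrow> bool" where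
  "orthonormal B \<longleftrightarrow> pairwise orthogonal B \<and> (\<forall>b\<in>B. norm b = 1)"

lemma orthonormal_indep: "orthonormal B \<Longrightarrow> independent B"
  unfolding orthonormal_def by (metis norm_zero pairwise_orthogonal_independent zero_neq_one)

lemma orthonormal_finite: "orthonormal B \<Longrightarrow> finite B"
  using orthonormal_indep independent_imp_finite by blast

lemma norm_sum_orthonormal:
  assumes "orthonormal B"
  shows "norm (\<Sum>b\<in>B. c b *\<^sub>R b) = sqrt (\<Sum>b\<in>B. (c b)\<^sup>2)"
proof -
  have "(norm (\<Sum>b\<in>B. c b *\<^sub>R b))\<^sup>2 = (\<Sum>b\<in>B. (norm (c b *\<^sub>R b))\<^sup>2)"
    using assms orthonormal_finite[OF assms]
    by (intro norm_sum_Pythagorean) (auto simp: orthonormal_def pairwise_def orthogonal_def)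
  also have "\<dots> = (\<Sum>b\<in>B. (c b)\<^sup>2)"
    using assms by (intro sum.cong) (auto simp: orthonormal_def power_mult_distrib)
  finally show ?thesis by (metis norm_ge_zero real_sqrt_unique)
qed

lemma measurable_sum_coord[measurable]:
  fixes B :: "'a::euclidean_space set"
  shows "(\<lambda>c. \<Sum>b\<in>B. c b *\<^sub>R b) \<in> borel_measurable (\<Pi>\<^sub>M b\<in>B. lborel)"
proof (cases "finite B")
  case True
  then show ?thesis
    by (intro borel_measurable_sum borel_measurable_scaleR) (auto intro: measurable_component_singleton)
qed simp

lemma sets_subspace_lborel[measurable_cong, simp]: "sets (subspace_lborel B) = sets borel"
  by (simp add: subspace_lborel_def)

lemma space_subspace_lborel[simp]: "space (subspace_lborel B) = UNIV"
  by (simp add: subspace_lborel_def)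

lemma emeasure_subspace_lborel_cball:
  assumes "orthonormal B" "r > 0"
  shows "emeasure (subspace_lborel B) (cball 0 r) = ennreal (unit_ball_vol (real (card B)) * r ^ card B)"
proof -
  have "emeasure (subspace_lborel B) (cball 0 r) =
      emeasure (Pi\<^sub>M B (\<lambda>_. lborel)) ({f. sqrt (\<Sum>i\<in>B. (f i)\<^sup>2) \<le> r} \<inter> space (Pi\<^sub>M B (\<lambda>_. lborel)))"
    unfolding subspace_lborel_def
    by (subst emeasure_distr) (auto intro!: arg_cong2[where f=emeasure] simp: norm_sum_orthonormal[OF assms(1)])
  then show ?thesis
    using emeasure_cball_aux[OF orthonormal_finite[OF assms(1)] assms(2)] by simp
qed

lemma sigma_finite_subspace_lborel:
  assumes "orthonormal B" shows "sigma_finite_measure (subspace_lborel B)"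
proof
  show "\<exists>A. countable A \<and> A \<subseteq> sets (subspace_lborel B) \<and> \<Union> A = space (subspace_lborel B) \<and>
     (\<forall>a\<in>A. emeasure (subspace_lborel B) a \<noteq> \<infinity>)"
  proof (intro exI[of _ "range (\<lambda>n::nat. cball 0 (real (Suc n)))"] conjI ballI)
    show "\<Union> (range (\<lambda>n. cball 0 (real (Suc n)))) = space (subspace_lborel B)"
      by auto (metis real_arch_simple of_nat_Suc le_add_same_cancel1 order_trans zero_le_one add.commute)
    fix a assume "a \<in> range (\<lambda>n. cball (0::'a) (real (Suc n)))"
    then obtain n :: nat where a: "a = cball 0 (real (Suc n))" by blast
    show "emeasure (subspace_lborel B) a \<noteq> \<infinity>"
      unfolding a by (subst emeasure_subspace_lborel_cball[OF assms]) auto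
  qed auto
qed

lemma AE_subspace_lborel: "AE x in subspace_lborel B. x \<in> span B"
  unfolding subspace_lborel_def
proof (subst AE_distr_iff)
  show "{x \<in> space borel. x \<in> span B} \<in> sets borel"
    using closed_subspace[OF subspace_span] by simp
  show "AE c in \<Pi>\<^sub>M b\<in>B. lborel. (\<Sum>b\<in>B. c b *\<^sub>R b) \<in> span B"
    by (intro AE_I2 span_sum span_scale span_base)
qed simp

lemma subspace_lborel_translation:
  assumes B: "orthonormal B" and a: "a \<in> span B"
  shows "distr (subspace_lborel B) borel (\<lambda>x. a + x) = subspace_lborel B"
proof -
  have fin: "finite B" using B by (rule orthonormal_finite)
  obtain u where u: "a = (\<Sum>b\<in>B. u b *\<^sub>R b)"
    using a span_finite[OF fin] by auto
  have "distr (subspace_lborel B) borel (\<lambda>x. a + x) =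
      distr (\<Pi>\<^sub>M b\<in>B. lborel) borel (\<lambda>c. a + (\<Sum>b\<in>B. c b *\<^sub>R b))"
    unfolding subspace_lborel_def by (subst distr_distr) (auto simp: comp_def)
  also have "\<dots> = distr (\<Pi>\<^sub>M b\<in>B. lborel) borel (\<lambda>c. \<Sum>b\<in>B. (\<lambda>b\<in>B. u b + c b) b *\<^sub>R b)"
    by (intro distr_cong refl) (auto simp: u sum.distrib scaleR_add_left)
  also have "\<dots> = distr (distr (\<Pi>\<^sub>M b\<in>B. lborel) (\<Pi>\<^sub>M b\<in>B. lborel) (\<lambda>c. \<lambda>b\<in>B. u b + c b)) borel (\<lambda>c. \<Sum>b\<in>B. c b *\<^sub>R b)"
    by (subst distr_distr) (auto simp: comp_def intro!: measurable_restrict)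
  also have "distr (\<Pi>\<^sub>M b\<in>B. lborel) (\<Pi>\<^sub>M b\<in>B. lborel) (\<lambda>c. \<lambda>b\<in>B. u b + c b) = (\<Pi>\<^sub>M b\<in>B. lborel)"
    using lborel_translation[where 'a=real]
    by (intro PiM_shift) (auto simp: sigma_finite_lborel fin cong: distr_cong)
  finally show ?thesis by (simp add: subspace_lborel_def)
qed

text \<open>Independence of the basis, the image under isometries and the scaling rule all come from
  this: invariance along \<open>span B\<close> and the volume of one ball replace every Jacobian
  computation.\<close>

lemma subspace_lborel_unique:
  assumes B: "orthonormal B" and s: "sets \<mu> = sets borel" and sf: "sigma_finite_measure \<mu>"
    and V: "AE x in \<mu>. x \<in> span B"
    and inv: "\<And>a. a \<in> span B \<Longrightarrow> distr \<mu> borel (\<lambda>x. a + x) = \<mu>"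
    and ball: "emeasure \<mu> (cball 0 1) = ennreal (unit_ball_vol (real (card B)))"
  shows "\<mu> = subspace_lborel B"
proof (rule invariant_measure_unique[where V="span B" and B="cball 0 1"])
  show "emeasure (subspace_lborel B) (cball 0 1) \<noteq> 0"
    using emeasure_subspace_lborel_cball[OF B, of 1] by simp
  show "emeasure \<mu> (cball 0 1) = emeasure (subspace_lborel B) (cball 0 1)"
    using ball emeasure_subspace_lborel_cball[OF B, of 1] by simp
  show "emeasure (subspace_lborel B) (cball 0 1) \<noteq> \<infinity>"
    using emeasure_subspace_lborel_cball[OF B, of 1] by simp
qed (use assms in \<open>simp_all add: sigma_finite_subspace_lborel AE_subspace_lborel
        subspace_lborel_translation span_neg\<close>)

lemma subspace_lborel_cong:
  assumes "orthonormal B" "orthonormal B'" "span B = span B'"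
  shows "subspace_lborel B = subspace_lborel B'"
proof (rule subspace_lborel_unique)
  have "card B = card B'"
    using assms orthonormal_indep by (metis dim_eq_card_independent dim_span)
  then show "emeasure (subspace_lborel B) (cball 0 1) = ennreal (unit_ball_vol (real (card B')))"
    using assms by (simp add: emeasure_subspace_lborel_cball)
qed (use assms(1,2) in \<open>simp_all add: sigma_finite_subspace_lborel AE_subspace_lborel subspace_lborel_translation
        flip: assms(3)\<close>)

lemma lborel_eq_subspace_lborel:
  fixes B :: "'a::euclidean_space set"
  assumes B: "orthonormal B" "span B = UNIV"
  shows "lborel = subspace_lborel B"
proof (rule subspace_lborel_unique)
  have "card B = DIM('a)"
    using assms orthonormal_indep by (metis dim_eq_card_independent dim_span dim_UNIV)
  then show "emeasure lborel (cball (0::'a) 1) = ennreal (unit_ball_vol (real (card B)))"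
    by (simp add: emeasure_cball)
qed (use assms in \<open>simp_all add: sigma_finite_lborel lborel_translation\<close>)

text \<open>Removes the Hilbert choice from \<open>plane_lborel\<close>: two descriptions of one
  affine plane have the same direction space, and their base points differ by a direction
  \<open>d\<close>, which translation invariance absorbs.\<close>

lemma plane_lborel_eq:
  fixes B :: "(real^'n) set"
  assumes B: "orthonormal B"
  shows "plane_lborel ((\<lambda>v. q + v) ` span B) = distr (subspace_lborel B) borel (\<lambda>v. q + v)"
proof -
  define P where "P = (\<lambda>(q', B'). pairwise orthogonal B' \<and> (\<forall>b\<in>B'. norm b = 1) \<and>
     (\<lambda>v. q + v) ` span B = (\<lambda>v. q' + v) ` span B')"
  obtain q' B' where eq: "(SOME x. P x) = (q', B')" by force
  have "P (q, B)" using B by (simp add: P_def orthonormal_def)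
  then have "P (SOME x. P x)" by (rule someI)
  then have B': "orthonormal B'" and T: "(\<lambda>v. q + v) ` span B = (\<lambda>v. q' + v) ` span B'"
    unfolding eq by (auto simp: P_def orthonormal_def)
  have sp: "span B = span B'"
  proof -
    have *: "span C \<subseteq> span D" if "(\<lambda>v. p + v) ` span C = (\<lambda>v. r + v) ` span D" for C D and p r :: "real^'n"
    proof
      fix x assume x: "x \<in> span C"
      have "p + x \<in> (\<lambda>v. r + v) ` span D" "p + 0 \<in> (\<lambda>v. r + v) ` span D"
        using x span_zero unfolding that[symmetric] by blast+
      then obtain y z where "p + x = r + y" "y \<in> span D" "p = r + z" "z \<in> span D" by auto
      then have "x = y - z" by (simp add: algebra_simps)
      then show "x \<in> span D" using \<open>y \<in> span D\<close> \<open>z \<in> span D\<close> by (simp add: span_diff)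
    qed
    show ?thesis using *[OF T] *[OF T[symmetric]] by blast
  qed
  have "q + 0 \<in> (\<lambda>v. q' + v) ` span B'" using T span_zero by blast
  then obtain d where d: "q = q' + d" "d \<in> span B'" by auto
  have "plane_lborel ((\<lambda>v. q + v) ` span B) = distr (\<Pi>\<^sub>M b\<in>B'. lborel) borel (\<lambda>c. q' + (\<Sum>b\<in>B'. c b *\<^sub>R b))"
    unfolding plane_lborel_def eq[unfolded P_def] by simp
  also have "\<dots> = distr (subspace_lborel B') borel (\<lambda>v. q' + v)"
    unfolding subspace_lborel_def by (subst distr_distr) (auto simp: comp_def)
  also have "\<dots> = distr (distr (subspace_lborel B') borel (\<lambda>v. d + v)) borel (\<lambda>v. q' + v)"
    using subspace_lborel_translation[OF B' d(2)] by simp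
  also have "\<dots> = distr (subspace_lborel B') borel (\<lambda>v. q + v)"
    by (subst distr_distr) (auto simp: comp_def d intro!: distr_cong)
  also have "subspace_lborel B' = subspace_lborel B"
    by (rule subspace_lborel_cong[OF B' B]) (simp add: sp)
  finally show ?thesis .
qed

section \<open>Haar measure on the rotation group\<close>

lemma borel_measurable_vec_iff:
  fixes f :: "'a \<Rightarrow> ('b::euclidean_space)^'n"
  shows "f \<in> borel_measurable M \<longleftrightarrow> (\<forall>i. (\<lambda>x. f x $ i) \<in> borel_measurable M)"
proof
  assume f: "f \<in> borel_measurable M"
  have "(\<lambda>v. v $ i) \<in> borel_measurable borel" for i :: 'n
    by (intro borel_measurable_continuous_onI continuous_intros)
  then show "\<forall>i. (\<lambda>x. f x $ i) \<in> borel_measurable M"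
    using measurable_compose[OF f] by blast
next
  assume *: "\<forall>i. (\<lambda>x. f x $ i) \<in> borel_measurable M"
  show "f \<in> borel_measurable M"
  proof (rule borel_measurable_euclidean_space[THEN iffD2], rule)
    fix b :: "'b^'n" assume "b \<in> Basis"
    then obtain i u where b: "b = axis i u" unfolding Basis_vec_def by blast
    have [measurable]: "(\<lambda>x. f x $ i) \<in> borel_measurable M" using * by blast
    show "(\<lambda>x. f x \<bullet> b) \<in> borel_measurable M" unfolding b inner_axis by measurable
  qed
qed

lemma borel_measurable_nth[measurable (raw)]:
  fixes f :: "'a \<Rightarrow> ('b::euclidean_space)^'n"
  shows "f \<in> borel_measurable M \<Longrightarrow> (\<lambda>x. f x $ i) \<in> borel_measurable M"
  by (simp add: borel_measurable_vec_iff)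

lemma borel_measurable_vec_lambda[measurable (raw)]:
  fixes f :: "'a \<Rightarrow> 'n::finite \<Rightarrow> ('b::euclidean_space)"
  shows "(\<And>i. (\<lambda>x. f x i) \<in> borel_measurable M) \<Longrightarrow> (\<lambda>x. \<chi> i. f x i) \<in> borel_measurable M"
  by (simp add: borel_measurable_vec_iff)

lemma borel_measurable_matrix_vector_mult[measurable (raw)]:
  fixes A :: "'a \<Rightarrow> real^'n^'m"
  assumes [measurable]: "A \<in> borel_measurable M" "v \<in> borel_measurable M"
  shows "(\<lambda>x. A x *v v x) \<in> borel_measurable M"
  unfolding matrix_vector_mult_def by measurable

lemma borel_measurable_matrix_matrix_mult[measurable (raw)]:
  fixes A :: "'a \<Rightarrow> real^'n^'m" and B :: "'a \<Rightarrow> real^'k^'n"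
  assumes [measurable]: "A \<in> borel_measurable M" "B \<in> borel_measurable M"
  shows "(\<lambda>x. A x ** B x) \<in> borel_measurable M"
  unfolding matrix_matrix_mult_def by measurable

lemma borel_measurable_det[measurable (raw)]:
  fixes A :: "'a \<Rightarrow> real^'n^'n"
  assumes [measurable]: "A \<in> borel_measurable M"
  shows "(\<lambda>x. det (A x)) \<in> borel_measurable M"
  unfolding det_def by measurable

lemma borel_measurable_transpose[measurable (raw)]:
  fixes A :: "'a \<Rightarrow> real^'n^'m"
  assumes [measurable]: "A \<in> borel_measurable M"
  shows "(\<lambda>x. transpose (A x)) \<in> borel_measurable M"
  unfolding transpose_def by measurable

text \<open>Gram--Schmidt orthonormalisation of a sequence. As \<open>sgn 0 = 0\<close>, linear
  dependence on the earlier vectors shows as the value 0, and the degenerate samples can be excluded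
  afterwards as a null event.\<close>

function gs :: "(nat \<Rightarrow> 'a::euclidean_space) \<Rightarrow> nat \<Rightarrow> 'a" where
  "gs X j = sgn (X j - (\<Sum>i<j. (X j \<bullet> gs X i) *\<^sub>R gs X i))"
  by pat_completeness auto
termination by (relation "Wellfounded.measure snd") auto

declare gs.simps[simp del]

lemma gs_cong: "(\<And>i. i \<le> j \<Longrightarrow> X i = Y i) \<Longrightarrow> gs X j = gs Y j"
proof (induction j rule: less_induct)
  case (less j)
  then have "gs X i = gs Y i" if "i < j" for i using that by simp
  then show ?case using less.prems by (subst (1 2) gs.simps) simp
qed

text \<open>Equivariance: this is what turns the rotation invariance of Lebesgue measure into the
  left invariance of Haar measure.\<close>

lemma gs_orthogonal_transformation:
  assumes "orthogonal_transformation T"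
  shows "gs (\<lambda>i. T (X i)) j = T (gs X j)"
proof (induction j rule: less_induct)
  case (less j)
  have lin: "linear T" using assms by (rule orthogonal_transformation_linear)
  have "gs (\<lambda>i. T (X i)) j = sgn (T (X j - (\<Sum>i<j. (X j \<bullet> gs X i) *\<^sub>R gs X i)))"
    using assms by (subst gs.simps)
      (simp add: less linear_diff[OF lin] linear_sum[OF lin] linear_scale[OF lin] orthogonal_transformation_def)
  also have "\<dots> = T (sgn (X j - (\<Sum>i<j. (X j \<bullet> gs X i) *\<^sub>R gs X i)))"
    using assms by (simp add: sgn_div_norm linear_scale[OF lin] orthogonal_transformation_norm)
  finally show ?case by (subst (2) gs.simps)
qed

lemma gs_norm: "gs X j = 0 \<or> norm (gs X j) = 1"
  by (subst (1 2) gs.simps) (simp add: norm_sgn sgn_zero_iff)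

lemma gs_orthogonal: "i < j \<Longrightarrow> gs X i \<bullet> gs X j = 0"
proof (induction j arbitrary: i rule: less_induct)
  case (less j)
  have orth: "gs X k \<bullet> gs X i = 0" if "k < j" "k \<noteq> i" for k
    using less.IH[of i k] less.IH[of k i] that less.prems by (cases "k < i") (auto simp: inner_commute)
  have "(\<Sum>k<j. (X j \<bullet> gs X k) *\<^sub>R gs X k) \<bullet> gs X i = (\<Sum>k<j. (X j \<bullet> gs X k) * (gs X k \<bullet> gs X i))"
    by (simp add: inner_sum_left)
  also have "\<dots> = (\<Sum>k\<in>{i}. (X j \<bullet> gs X k) * (gs X k \<bullet> gs X i))"
    using less.prems orth by (intro sum.mono_neutral_right) auto
  also have "\<dots> = X j \<bullet> gs X i"
    using gs_norm[of X i] by (auto simp: dot_square_norm)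
  finally have "(X j - (\<Sum>k<j. (X j \<bullet> gs X k) *\<^sub>R gs X k)) \<bullet> gs X i = 0"
    by (simp add: inner_diff_left)
  then show ?case
    by (subst (2) gs.simps) (simp add: sgn_div_norm inner_commute)
qed

lemma gs_measurable[measurable]:
  fixes n :: nat
  assumes "j < n"
  shows "(\<lambda>X. gs X j) \<in> borel_measurable (\<Pi>\<^sub>M i\<in>{..<n}. (lborel :: 'a::euclidean_space measure))"
  using assms
proof (induction j rule: less_induct)
  case (less j)
  have [measurable]: "(\<lambda>X. X j) \<in> borel_measurable (\<Pi>\<^sub>M i\<in>{..<n}. (lborel :: 'a measure))"
    using measurable_component_singleton[of j "{..<n}" "\<lambda>_. lborel"] less.prems by simp
  have IH: "(\<lambda>X. gs X i) \<in> borel_measurable (\<Pi>\<^sub>M i\<in>{..<n}. (lborel :: 'a measure))" if "i \<in> {..<j}" for i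
    using less that by auto
  have [measurable]: "(\<lambda>X. \<Sum>i<j. (X j \<bullet> gs X i) *\<^sub>R gs X i) \<in> borel_measurable (\<Pi>\<^sub>M i\<in>{..<n}. (lborel :: 'a measure))"
    by (intro borel_measurable_sum borel_measurable_scaleR borel_measurable_inner IH) auto
  show ?case
    by (subst gs.simps) (simp only: sgn_div_norm, measurable)
qed

text \<open>By Fubini in the j-th vector: with the others fixed, \<open>gs X j = 0\<close> puts
  \<open>X j\<close> into the span of at most j < n earlier outputs, a proper subspace and hence
  null. Varying the j-th vector does not alter the outputs below j.\<close>

lemma AE_gs_nonzero:
  assumes n: "n \<le> DIM('a::euclidean_space)" and j: "j < n"
  shows "AE X in \<Pi>\<^sub>M i\<in>{..<n}. (lborel :: 'a measure). gs X j \<noteq> 0"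
proof -
  interpret product_sigma_finite "\<lambda>_::nat. lborel :: 'a measure"
    by (simp add: product_sigma_finite_def sigma_finite_lborel)
  note gs_measurable[OF j, measurable]
  define I where "I = {..<n} - {j}"
  have I: "finite I" "j \<notin> I" "insert j I = {..<n}" using j by (auto simp: I_def)
  let ?Z = "{X \<in> space (\<Pi>\<^sub>M i\<in>{..<n}. (lborel :: 'a measure)). gs X j = 0}"
  have Z[measurable]: "?Z \<in> sets (\<Pi>\<^sub>M i\<in>{..<n}. lborel)" by measurable
  have "emeasure (\<Pi>\<^sub>M i\<in>{..<n}. lborel) ?Z = (\<integral>\<^sup>+X. indicator ?Z X \<partial>(\<Pi>\<^sub>M i\<in>insert j I. lborel))"
    using I by simp
  also have "\<dots> = (\<integral>\<^sup>+x. (\<integral>\<^sup>+y. indicator ?Z (x(j := y)) \<partial>lborel) \<partial>(\<Pi>\<^sub>M i\<in>I. lborel))"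
    using I by (intro product_nn_integral_insert) auto
  also have "\<dots> = (\<integral>\<^sup>+x. 0 \<partial>(\<Pi>\<^sub>M i\<in>I. (lborel :: 'a measure)))"
  proof (intro nn_integral_cong)
    fix x :: "nat \<Rightarrow> 'a"
    define W where "W = span (gs x ` {..<j})"
    have cl: "closed W" unfolding W_def by (rule closed_subspace[OF subspace_span])
    have "dim W \<le> card (gs x ` {..<j})" unfolding W_def by (simp add: dim_le_card')
    also have "\<dots> \<le> j" using card_image_le[of "{..<j}" "gs x"] by simp
    finally have "negligible W" using n j by (intro negligible_lowdim) simp
    then have "W \<in> null_sets lborel"
      using cl by (simp add: negligible_iff_null_sets null_sets_completion_iff)
    then have W0: "emeasure lborel W = 0" by (rule null_setsD1)
    have "indicator ?Z (x(j := y)) \<le> (indicator W y :: ennreal)" for y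
    proof (cases "x(j := y) \<in> ?Z")
      case True
      have g: "gs (x(j := y)) i = gs x i" if "i < j" for i
        using that by (intro gs_cong) auto
      have "gs (x(j := y)) j = 0" using True by simp
      then have "y = (\<Sum>i<j. (y \<bullet> gs x i) *\<^sub>R gs x i)"
        by (subst (asm) gs.simps) (simp add: g sgn_zero_iff)
      also have "\<dots> \<in> W" unfolding W_def by (intro span_sum span_scale span_base) auto
      finally show ?thesis by (simp add: indicator_def)
    qed simp
    then have "(\<integral>\<^sup>+y. indicator ?Z (x(j := y)) \<partial>lborel) \<le> (\<integral>\<^sup>+y. indicator W y \<partial>lborel)"
      by (intro nn_integral_mono)
    also have "\<dots> = 0" using cl W0 by simp
    finally show "(\<integral>\<^sup>+y. indicator ?Z (x(j := y)) \<partial>lborel) = 0" by simp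
  qed
  finally have "emeasure (\<Pi>\<^sub>M i\<in>{..<n}. lborel) ?Z = 0" by simp
  then show ?thesis
    by (intro AE_I[of _ _ ?Z]) auto
qed

section \<open>Construction of the Haar measure\<close>

lemma rows_matrix_mult:
  fixes A :: "real^'n^'n"
  shows "(\<chi> i. A *v r i) = (\<chi> i. r i) ** transpose A"
  by (simp add: vec_eq_iff matrix_matrix_mult_def matrix_vector_mult_def transpose_def mult.commute)

lemma rotation_matrix_orthogonal_transformation:
  fixes A :: "real^'n^'n"
  shows "rotation_matrix A \<Longrightarrow> orthogonal_transformation (\<lambda>v. A *v v)"
  by (simp add: rotation_matrix_def orthogonal_transformation_matrix)

lemma rotation_matrix_mult:
  fixes A B :: "real^'n^'n"
  shows "rotation_matrix A \<Longrightarrow> rotation_matrix B \<Longrightarrow> rotation_matrix (A ** B)"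
  using orthogonal_matrix_mul[of A B] by (auto simp: rotation_matrix_def det_mul)

lemma rotation_matrix_transpose:
  fixes A :: "real^'n^'n"
  shows "rotation_matrix A \<Longrightarrow> rotation_matrix (transpose A)"
  by (simp add: rotation_matrix_def)

text \<open>Haar measure as the law of a random frame: draw n independent uniform vectors in the
  unit ball, orthonormalise them, and correct the orientation by multiplying one vector with the
  determinant. A rotation of all vectors preserves their law and multiplies the frame from the
  left.\<close>

lemma haar_SO_exists:
  "\<exists>M :: (real^'n^'n) measure. emeasure M (space M) = 1 \<and>
      sets M = sets (restrict_space borel {A. rotation_matrix A}) \<and>
      (\<forall>A. rotation_matrix A \<longrightarrow> distr M M (\<lambda>B. A ** B) = M)"
proof -
  define n where "n = CARD('n)"
  define L where "L = (\<Pi>\<^sub>M i\<in>{..<n}. (lborel :: (real^'n) measure))"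
  obtain idx :: "'n \<Rightarrow> nat" where idx: "bij_betw idx UNIV {..<n}"
    using ex_bij_betw_finite_nat[of "UNIV :: 'n set"] by (auto simp: n_def atLeast0LessThan)
  have idx_lt: "idx i < n" for i using idx by (auto simp: bij_betw_def)
  have idx_inj: "idx i = idx j \<longleftrightarrow> i = j" for i j using idx by (auto simp: bij_betw_def inj_on_def)
  obtain i0 :: 'n where True by simp
  \<comment> \<open>Unit balls make the total mass finite; the nondegenerate samples fill the
    product of the balls up to a null set.\<close>
  define S where "S = {X \<in> space L. (\<forall>j<n. gs X j \<noteq> 0) \<and> (\<forall>j<n. norm (X j) < 1)}"
  define Q :: "(nat \<Rightarrow> real^'n) \<Rightarrow> real^'n^'n" where "Q = (\<lambda>X. \<chi> i. gs X (idx i))"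
  \<comment> \<open>The vectors become columns, so that rotating them is multiplication from the
    left. Scaling vector \<open>i0\<close> by \<open>det (Q X)\<close>, which is 1 or -1, makes the
    determinant 1.\<close>
  define R :: "(nat \<Rightarrow> real^'n) \<Rightarrow> real^'n^'n" where
    "R = (\<lambda>X. transpose (\<chi> i. if i = i0 then det (Q X) *\<^sub>R gs X (idx i) else gs X (idx i)))"
  have gm[measurable]: "(\<lambda>X. gs X j) \<in> borel_measurable L" if "j < n" for j
    unfolding L_def using that by (rule gs_measurable)
  have gi[measurable]: "(\<lambda>X. gs X (idx i)) \<in> borel_measurable L" for i
    using idx_lt by (rule gm)
  have cm[measurable]: "(\<lambda>X. X j) \<in> borel_measurable L" if "j < n" for j
    using measurable_component_singleton[of j "{..<n}" "\<lambda>_. lborel"] that unfolding L_def by simp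
  have [measurable]: "Q \<in> borel_measurable L" unfolding Q_def by measurable
  have Rm[measurable]: "R \<in> borel_measurable L" unfolding R_def by measurable
  have Sm[measurable]: "S \<in> sets L"
  proof -
    have "S = space L \<inter> (\<Inter>j<n. {X \<in> space L. gs X j \<noteq> 0 \<and> norm (X j) < 1})"
      by (auto simp: S_def)
    also have "\<dots> \<in> sets L"
    proof (cases "n = 0")
      case False
      then show ?thesis by (intro sets.Int sets.top sets.finite_INT) (auto intro!: pred_intros_logic borel_measurable_pred_less)
    qed simp
    finally show ?thesis .
  qed
  have orthQ: "orthogonal_matrix (Q X)" if "X \<in> S" for X
    unfolding orthogonal_matrix_orthonormal_rows
  proof (intro conjI allI impI)
    show "norm (row i (Q X)) = 1" for i
      using that gs_norm[of X "idx i"] idx_lt[of i] by (auto simp: S_def Q_def row_def vec_lambda_eta)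
    show "orthogonal (row i (Q X)) (row j (Q X))" if "i \<noteq> j" for i j
      using gs_orthogonal[of "idx i" "idx j" X] gs_orthogonal[of "idx j" "idx i" X] that idx_inj[of i j]
      by (cases "idx i < idx j") (auto simp: Q_def row_def vec_lambda_eta orthogonal_def inner_commute)
  qed
  have rotR: "rotation_matrix (R X)" if "X \<in> S" for X
  proof -
    have d: "det (Q X) = 1 \<or> det (Q X) = -1" using det_orthogonal_matrix[OF orthQ[OF that]] .
    let ?P = "\<chi> i. if i = i0 then det (Q X) *\<^sub>R gs X (idx i) else gs X (idx i)"
    have "det ?P = det (\<chi> i. if i = i0 then det (Q X) *s gs X (idx i) else gs X (idx i))"
      by (intro arg_cong[where f=det]) (simp add: vec_eq_iff)
    also have "\<dots> = det (Q X) * det (\<chi> i. if i = i0 then gs X (idx i) else gs X (idx i))"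
      by (rule det_row_mul)
    also have "\<dots> = det (Q X) * det (Q X)" by (simp add: Q_def)
    finally have "det ?P = 1" using d by auto
    moreover have "orthogonal_matrix ?P"
      unfolding orthogonal_matrix_orthonormal_rows
    proof (intro conjI allI impI)
      have row: "row i ?P = (if i = i0 then det (Q X) *\<^sub>R row i (Q X) else row i (Q X))" for i
        by (simp add: row_def Q_def vec_eq_iff)
      show "norm (row i ?P) = 1" for i
        using orthQ[OF that] d unfolding orthogonal_matrix_orthonormal_rows row by auto
      show "orthogonal (row i ?P) (row j ?P)" if "i \<noteq> j" for i j
        using orthQ[OF \<open>X \<in> S\<close>] that unfolding orthogonal_matrix_orthonormal_rows row by (auto simp: orthogonal_clauses)
    qed
    ultimately show ?thesis by (simp add: rotation_matrix_def R_def)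
  qed
  have "AE X in L. gs X j \<noteq> 0" if "j < n" for j
    unfolding L_def by (rule AE_gs_nonzero[OF _ that]) (simp add: n_def)
  then have "AE X in L. \<forall>j<n. gs X j \<noteq> 0"
    by (simp add: AE_all_countable)
  then have "AE X in L. X \<in> S \<longleftrightarrow> X \<in> Pi\<^sub>E {..<n} (\<lambda>_. ball 0 1)"
    using AE_space by eventually_elim (auto simp: S_def L_def space_PiM PiE_iff)
  then have "emeasure L S = emeasure L (Pi\<^sub>E {..<n} (\<lambda>_. ball 0 1))"
    by (rule emeasure_eq_AE) (auto simp: L_def intro!: sets_PiM_I_finite Sm[unfolded L_def])
  also have "\<dots> = (\<Prod>i<n. emeasure lborel (ball (0::real^'n) 1))"
  proof -
    interpret product_sigma_finite "\<lambda>_::nat. lborel :: (real^'n) measure"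
      by (simp add: product_sigma_finite_def sigma_finite_lborel)
    show ?thesis unfolding L_def by (subst emeasure_PiM) auto
  qed
  finally have LS: "emeasure L S \<noteq> 0" "emeasure L S \<noteq> \<infinity>"
    by (simp_all add: emeasure_ball ennreal_power)
  \<comment> \<open>The value \<open>mat 1\<close> on the remaining samples keeps the map inside the
    rotation group; these samples carry no mass in \<open>U\<close>.\<close>
  define \<rho> where "\<rho> = (\<lambda>X. if X \<in> S then R X else mat 1)"
  define U where "U = uniform_measure L S"
  define M where "M = distr U (restrict_space borel {A. rotation_matrix A}) \<rho>"
  have \<rho>[measurable]: "\<rho> \<in> measurable U (restrict_space borel {A. rotation_matrix A})"
  proof (rule measurable_restrict_space2)
    show "\<rho> \<in> space U \<rightarrow> {A. rotation_matrix A}"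
    proof -
      have "rotation_matrix (mat 1 :: real^'n^'n)" by (simp add: rotation_matrix_def orthogonal_matrix_id)
      then show ?thesis by (auto simp: \<rho>_def rotR)
    qed
    show "\<rho> \<in> borel_measurable U"
      unfolding \<rho>_def U_def by measurable
  qed
  have emM: "emeasure M E = emeasure L {X\<in>S. R X \<in> E} / emeasure L S" if "E \<in> sets M" for E
  proof -
    have E: "E \<in> sets (restrict_space borel {A. rotation_matrix A})" using that by (simp add: M_def)
    have "emeasure M E = emeasure U (\<rho> -` E \<inter> space U)"
      unfolding M_def using E by (intro emeasure_distr) auto
    also have "\<dots> = emeasure L (S \<inter> (\<rho> -` E \<inter> space U)) / emeasure L S"
      using measurable_sets[OF \<rho> E] unfolding U_def by (intro emeasure_uniform_measure) auto
    also have "S \<inter> (\<rho> -` E \<inter> space U) = {X\<in>S. R X \<in> E}"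
      using sets.sets_into_space[OF Sm] by (auto simp: \<rho>_def U_def)
    finally show ?thesis .
  qed
  have setsM: "sets M = sets (restrict_space borel {A. rotation_matrix A})" by (simp add: M_def)
  have spaceM: "space M = {A. rotation_matrix A}" by (simp add: M_def space_restrict_space)
  show ?thesis
  proof (intro exI[of _ M] conjI allI impI)
    have "{X \<in> S. R X \<in> space M} = S" by (auto simp: spaceM rotR)
    then show "emeasure M (space M) = 1"
      using LS by (subst emM) (auto simp: ennreal_divide_self less_top)
    show "sets M = sets (restrict_space borel {A. rotation_matrix A})" by (rule setsM)
    fix A :: "real^'n^'n" assume A: "rotation_matrix A"
    have T: "orthogonal_transformation (\<lambda>v. A *v v)" by (rule rotation_matrix_orthogonal_transformation[OF A])
    have mM[measurable]: "(\<lambda>B. A ** B) \<in> measurable M M"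
      unfolding measurable_cong_sets[OF setsM setsM]
      by (rule measurable_restrict_space2)
        (auto simp: space_restrict_space A rotation_matrix_mult intro!: measurable_restrict_space1)
    define t where "t = (\<lambda>X. \<lambda>j\<in>{..<n}. A *v (X j :: real^'n))"
    have tL: "distr L L t = L"
      unfolding L_def t_def
    proof (rule PiM_shift)
      show "distr lborel lborel ((*v) A) = lborel"
        using lborel_distr_orthogonal_transformation[OF T] by (simp cong: distr_cong)
    qed (auto simp: sigma_finite_lborel)
    have tm[measurable]: "t \<in> measurable L L"
      unfolding L_def t_def by (rule measurable_restrict) (use cm in \<open>auto simp: L_def\<close>)
    have gst: "gs (t X) j = A *v gs X j" if "j < n" for X j
    proof -
      have "gs (t X) j = gs (\<lambda>i. A *v X i) j" using that by (intro gs_cong) (auto simp: t_def)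
      then show ?thesis using gs_orthogonal_transformation[OF T] by simp
    qed
    have nrm: "norm (A *v v) = norm v" for v using T by (rule orthogonal_transformation_norm)
    have tS: "t X \<in> S \<longleftrightarrow> X \<in> S" if "X \<in> space L" for X
    proof -
      have "t X \<in> space L" using tm that by (rule measurable_space)
      moreover have "gs (t X) j \<noteq> 0 \<longleftrightarrow> gs X j \<noteq> 0" "norm (t X j) = norm (X j)" if "j < n" for j
      proof -
        show "gs (t X) j \<noteq> 0 \<longleftrightarrow> gs X j \<noteq> 0"
          unfolding gst[OF that] using nrm[of "gs X j"] by (metis norm_eq_zero)
        show "norm (t X j) = norm (X j)" using that by (simp add: t_def nrm)
      qed
      ultimately show ?thesis using that by (auto simp: S_def)
    qed
    have Qt: "Q (t X) = Q X ** transpose A" for X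
      unfolding Q_def by (simp add: gst idx_lt rows_matrix_mult)
    \<comment> \<open>As \<open>det A = 1\<close>, the orientation correction is the same before and
      after the rotation.\<close>
    have dQt: "det (Q (t X)) = det (Q X)" for X
      using A by (simp add: Qt det_mul rotation_matrix_def)
    have Rt: "R (t X) = A ** R X" for X
    proof -
      have "(\<chi> i. if i = i0 then det (Q (t X)) *\<^sub>R gs (t X) (idx i) else gs (t X) (idx i)) =
         (\<chi> i. A *v (if i = i0 then det (Q X) *\<^sub>R gs X (idx i) else gs X (idx i)))"
        by (auto simp: vec_eq_iff dQt gst idx_lt matrix_vector_mult_scaleR)
      then show ?thesis unfolding R_def rows_matrix_mult by (simp add: matrix_transpose_mul)
    qed
    show "distr M M (\<lambda>B. A ** B) = M"
    proof (rule measure_eqI)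
      fix E assume "E \<in> sets (distr M M (\<lambda>B. A ** B))"
      then have E: "E \<in> sets M" by simp
      have RE: "{X\<in>S. R X \<in> E} \<in> sets L"
      proof -
        have "{X\<in>S. R X \<in> E} = S \<inter> (\<rho> -` E \<inter> space U)"
          using sets.sets_into_space[OF Sm] by (auto simp: \<rho>_def U_def)
        then show ?thesis using measurable_sets[OF \<rho>, of E] E Sm by (auto simp: setsM U_def)
      qed
      have "emeasure (distr M M (\<lambda>B. A ** B)) E = emeasure M ((\<lambda>B. A ** B) -` E \<inter> space M)"
        using E by (intro emeasure_distr) auto
      also have "\<dots> = emeasure L {X\<in>S. R X \<in> (\<lambda>B. A ** B) -` E \<inter> space M} / emeasure L S"
        using E by (intro emM) auto
      also have "{X\<in>S. R X \<in> (\<lambda>B. A ** B) -` E \<inter> space M} = t -` {X\<in>S. R X \<in> E} \<inter> space L"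
        using tS rotR sets.sets_into_space[OF Sm] by (auto simp: Rt spaceM)
      also have "emeasure L \<dots> = emeasure (distr L L t) {X\<in>S. R X \<in> E}"
        using RE by (intro emeasure_distr[symmetric]) auto
      also have "\<dots> = emeasure L {X\<in>S. R X \<in> E}" by (simp add: tL)
      finally show "emeasure (distr M M (\<lambda>B. A ** B)) E = emeasure M E"
        using emM[OF E] by simp
    qed simp
  qed
qed

section \<open>Invariance of the Haar measure\<close>

lemma haar_SO:
  shows emeasure_haar_SO_space: "emeasure (haar_SO :: (real^'n^'n) measure) (space haar_SO) = 1"
    and sets_haar_SO: "sets (haar_SO :: (real^'n^'n) measure) = sets (restrict_space borel {A. rotation_matrix A})"
    and haar_SO_left: "\<And>A::real^'n^'n. rotation_matrix A \<Longrightarrow> distr haar_SO haar_SO (\<lambda>B. A ** B) = haar_SO"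
  using someI_ex[OF haar_SO_exists] unfolding haar_SO_def[symmetric] by blast+

lemma space_haar_SO: "space (haar_SO :: (real^'n^'n) measure) = {A. rotation_matrix A}"
  using sets_eq_imp_space_eq[OF sets_haar_SO] by (simp add: space_restrict_space)

lemma prob_space_haar_SO: "prob_space (haar_SO :: (real^'n^'n) measure)"
  by (rule prob_spaceI) (rule emeasure_haar_SO_space)

lemma measurable_haar_SO_id[measurable]: "(\<lambda>A. A) \<in> borel_measurable (haar_SO :: (real^'n^'n) measure)"
  unfolding measurable_cong_sets[OF sets_haar_SO refl] by (rule measurable_restrict_space1) simp

lemma measurable_into_haar_SO:
  fixes f :: "'a \<Rightarrow> real^'n^'n"
  assumes "f \<in> borel_measurable M" "\<And>x. x \<in> space M \<Longrightarrow> rotation_matrix (f x)"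
  shows "f \<in> measurable M haar_SO"
  unfolding measurable_cong_sets[OF refl sets_haar_SO] using assms by (intro measurable_restrict_space2) auto

lemma measurable_haar_SO_borel:
  "g \<in> borel_measurable borel \<Longrightarrow> g \<in> borel_measurable (haar_SO :: (real^'n^'n) measure)"
  using measurable_compose[OF measurable_haar_SO_id] by blast

lemma nn_integral_haar_SO_left:
  fixes B :: "real^'n^'n"
  assumes "rotation_matrix B" and [measurable]: "g \<in> borel_measurable borel"
  shows "(\<integral>\<^sup>+A. g (B ** A) \<partial>haar_SO) = (\<integral>\<^sup>+A. g A \<partial>haar_SO)"
proof -
  have [measurable]: "(\<lambda>A. B ** A) \<in> measurable haar_SO haar_SO"
    using assms(1) by (intro measurable_into_haar_SO) (auto simp: space_haar_SO rotation_matrix_mult)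
  have "(\<integral>\<^sup>+A. g A \<partial>haar_SO) = (\<integral>\<^sup>+A. g A \<partial>distr haar_SO haar_SO (\<lambda>A. B ** A))"
    using haar_SO_left[OF assms(1)] by simp
  then show ?thesis by (simp add: nn_integral_distr measurable_haar_SO_borel)
qed

text \<open>A left invariant probability measure agrees with its image under inversion, by exchanging
  the order of integration in the double integral of \<open>g (transpose B ** A)\<close>.\<close>

lemma nn_integral_haar_SO_transpose:
  assumes [measurable]: "g \<in> borel_measurable borel"
  shows "(\<integral>\<^sup>+A. g (transpose A) \<partial>(haar_SO :: (real^'n^'n) measure)) = (\<integral>\<^sup>+A. g A \<partial>haar_SO)"
proof -
  interpret prob_space "haar_SO :: (real^'n^'n) measure" by (rule prob_space_haar_SO)
  interpret P: pair_sigma_finite "haar_SO :: (real^'n^'n) measure" "haar_SO :: (real^'n^'n) measure" ..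
  have "(\<integral>\<^sup>+A. g A \<partial>haar_SO) = (\<integral>\<^sup>+B. (\<integral>\<^sup>+A. g (transpose B ** A) \<partial>(haar_SO :: (real^'n^'n) measure)) \<partial>haar_SO)"
  proof -
    have "(\<integral>\<^sup>+B. (\<integral>\<^sup>+A. g (transpose B ** A) \<partial>(haar_SO :: (real^'n^'n) measure)) \<partial>haar_SO) =
        (\<integral>\<^sup>+B. (\<integral>\<^sup>+A. g A \<partial>haar_SO) \<partial>(haar_SO :: (real^'n^'n) measure))"
      by (intro nn_integral_cong nn_integral_haar_SO_left rotation_matrix_transpose) (auto simp: space_haar_SO)
    then show ?thesis by (simp add: emeasure_space_1)
  qed
  also have "\<dots> = (\<integral>\<^sup>+A. (\<integral>\<^sup>+B. g (transpose B ** A) \<partial>(haar_SO :: (real^'n^'n) measure)) \<partial>haar_SO)"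
    by (rule P.Fubini') measurable
  also have "\<dots> = (\<integral>\<^sup>+A. (\<integral>\<^sup>+B. g (transpose B) \<partial>(haar_SO :: (real^'n^'n) measure)) \<partial>(haar_SO :: (real^'n^'n) measure))"
  proof (rule nn_integral_cong)
    fix A :: "real^'n^'n" assume "A \<in> space haar_SO"
    then have A: "rotation_matrix (transpose A)" by (simp add: space_haar_SO rotation_matrix_transpose)
    show "(\<integral>\<^sup>+B. g (transpose B ** A) \<partial>haar_SO) = (\<integral>\<^sup>+B. g (transpose B) \<partial>haar_SO)"
      using nn_integral_haar_SO_left[OF A, of "\<lambda>B. g (transpose B)"] by (simp add: matrix_transpose_mul)
  qed
  also have "\<dots> = (\<integral>\<^sup>+B. g (transpose B) \<partial>(haar_SO :: (real^'n^'n) measure))"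
    by (simp add: emeasure_space_1)
  finally show ?thesis by simp
qed

text \<open>Right invariance is left invariance conjugated by inversion, which is transposition
  here.\<close>

lemma nn_integral_haar_SO_right:
  fixes B :: "real^'n^'n"
  assumes B: "rotation_matrix B" and [measurable]: "g \<in> borel_measurable borel"
  shows "(\<integral>\<^sup>+A. g (A ** B) \<partial>haar_SO) = (\<integral>\<^sup>+A. g A \<partial>haar_SO)"
proof -
  have "(\<integral>\<^sup>+A. g (A ** B) \<partial>haar_SO) = (\<integral>\<^sup>+A. g (transpose A ** B) \<partial>haar_SO)"
    by (rule nn_integral_haar_SO_transpose[symmetric]) measurable
  also have "\<dots> = (\<integral>\<^sup>+A. g (transpose A) \<partial>haar_SO)"
    using nn_integral_haar_SO_left[OF rotation_matrix_transpose[OF B], of "\<lambda>A. g (transpose A)"]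
    by (simp add: matrix_transpose_mul)
  finally show ?thesis by (simp add: nn_integral_haar_SO_transpose)
qed

lemma rotation_matrix_exists:
  fixes x y :: "real^'n"
  assumes "CARD('n) \<ge> 2" "norm x = norm y"
  obtains B where "rotation_matrix B" "B *v x = y"
proof -
  obtain f where f: "orthogonal_transformation f" "det (matrix f) = 1" "f x = y"
    using rotation_exists[OF assms] by blast
  have "linear f" using f(1) by (rule orthogonal_transformation_linear)
  show ?thesis
  proof
    show "rotation_matrix (matrix f)"
      using f by (simp add: rotation_matrix_def orthogonal_transformation_matrix)
    show "matrix f *v x = y" using f(3) matrix_works[OF \<open>linear f\<close>[folded linear_matrix_vector_mul_eq]] matrix_vector_mul(2)[OF \<open>linear f\<close>] by metis
  qed
qed

text \<open>A rotation B with B x = y is absorbed by right invariance, so the average over the orbit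
  depends on the norm alone. The hypothesis n \<ge> 2 provides transitivity on spheres: SO(1) is
  trivial.\<close>

lemma nn_integral_haar_SO_norm:
  fixes x y :: "real^'n"
  assumes "CARD('n) \<ge> 2" "norm x = norm y" and [measurable]: "g \<in> borel_measurable borel"
  shows "(\<integral>\<^sup>+A. g (A *v x) \<partial>haar_SO) = (\<integral>\<^sup>+A. g (A *v y) \<partial>haar_SO)"
proof -
  obtain B where B: "rotation_matrix B" "B *v x = y"
    using rotation_matrix_exists[OF assms(1,2)] .
  have "(\<integral>\<^sup>+A. g (A *v x) \<partial>haar_SO) = (\<integral>\<^sup>+A. g ((A ** B) *v x) \<partial>haar_SO)"
    by (rule nn_integral_haar_SO_right[OF B(1), symmetric]) measurable
  then show ?thesis by (simp add: B(2) matrix_vector_mul_assoc[symmetric])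
qed

section \<open>Spherical means and integrals over rotated planes\<close>

lemma distr_eq_densityI:
  fixes N :: "'a \<Rightarrow> real"
  assumes [measurable]: "N \<in> borel_measurable M" "w \<in> borel_measurable borel"
    and eq: "\<And>s::real. emeasure M {x \<in> space M. N x \<le> s} = (\<integral>\<^sup>+t. w t * indicator {..s} t \<partial>lborel)"
    and fin: "\<And>s::real. emeasure M {x \<in> space M. N x \<le> s} \<noteq> \<infinity>"
  shows "distr M borel N = density lborel w"
proof (rule measure_eqI_generator_eq[where E="range atMost" and \<Omega>=UNIV and A="\<lambda>i. {..real i}"])
  show "Int_stable (range atMost :: real set set)"
    by (auto simp: Int_stable_def)
  show "(\<Union>i. {..real i}) = UNIV" by (auto intro: real_arch_simple)
  have *: "emeasure (distr M borel N) {..s} = emeasure M {x \<in> space M. N x \<le> s}" for s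
    by (subst emeasure_distr) (auto intro!: arg_cong2[where f=emeasure])
  show "emeasure (distr M borel N) X = emeasure (density lborel w) X" if "X \<in> range atMost" for X
    using that by (auto simp: * eq emeasure_density)
  show "emeasure (distr M borel N) {..real i} \<noteq> \<infinity>" for i using fin by (simp add: *)
qed (auto simp: borel_eq_atMost)

text \<open>The density of the pushforward of \<open>k\<close>-dimensional Lebesgue measure under \<open>sqrt (r\<^sup>2 + |v|\<^sup>2)\<close>.\<close>

definition radial_weight :: "nat \<Rightarrow> real \<Rightarrow> real \<Rightarrow> real" where
  "radial_weight k r s = indicator {r<..} s * (real k * unit_ball_vol (real k) * (s\<^sup>2 - r\<^sup>2) powr (real k / 2 - 1) * s)"

lemma radial_weight_nonneg: "0 \<le> r \<Longrightarrow> 0 \<le> radial_weight k r s"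
  by (auto simp: radial_weight_def indicator_def)

lemma radial_weight_measurable[measurable]:
  "(\<lambda>s. radial_weight k r s) \<in> borel_measurable borel"
  unfolding radial_weight_def by measurable

lemma nn_integral_radial_weight:
  assumes "k \<ge> 1" "r \<ge> 0"
  shows "(\<integral>\<^sup>+t. ennreal (radial_weight k r t) * indicator {..s} t \<partial>lborel) =
     (if s \<le> r then 0 else ennreal (unit_ball_vol (real k) * (s\<^sup>2 - r\<^sup>2) powr (real k / 2)))"
proof (cases "s \<le> r")
  case True
  then have "(\<integral>\<^sup>+t. ennreal (radial_weight k r t) * indicator {..s} t \<partial>lborel) = (\<integral>\<^sup>+t. 0 \<partial>(lborel::real measure))"
    by (intro nn_integral_cong) (auto simp: radial_weight_def indicator_def)
  with True show ?thesis by simp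
next
  case False
  define h where "h = (\<lambda>t. real k * unit_ball_vol (real k) * (t\<^sup>2 - r\<^sup>2) powr (real k / 2 - 1) * t)"
  have "(h has_integral
      (unit_ball_vol (real k) * (s\<^sup>2 - r\<^sup>2) powr (real k / 2) - unit_ball_vol (real k) * (r\<^sup>2 - r\<^sup>2) powr (real k / 2))) {r..s}"
  \<comment> \<open>For k = 1 and r > 0 the integrand is unbounded at r while its primitive stays
    continuous there, so the derivative is asked for in the open interval only.\<close>
  proof (rule fundamental_theorem_of_calculus_interior)
    show "r \<le> s" using False by simp
    have "t\<^sup>2 - r\<^sup>2 \<ge> 0" if "t \<in> {r..s}" for t
      using that assms by (simp add: power_mono)
    then show "continuous_on {r..s} (\<lambda>t. unit_ball_vol (real k) * (t\<^sup>2 - r\<^sup>2) powr (real k / 2))"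
      using assms by (intro continuous_intros continuous_on_powr') auto
    fix t assume t: "t \<in> {r<..<s}"
    then have "t\<^sup>2 - r\<^sup>2 > 0" using assms by (simp add: power_strict_mono)
    then show "((\<lambda>t. unit_ball_vol (real k) * (t\<^sup>2 - r\<^sup>2) powr (real k / 2)) has_vector_derivative h t) (at t)"
      unfolding has_real_derivative_iff_has_vector_derivative[symmetric] h_def
      by (auto intro!: derivative_eq_intros simp: field_simps)
  qed
  then have hi: "(h has_integral unit_ball_vol (real k) * (s\<^sup>2 - r\<^sup>2) powr (real k / 2)) {r..s}" by simp
  have "(radial_weight k r has_integral unit_ball_vol (real k) * (s\<^sup>2 - r\<^sup>2) powr (real k / 2)) {r..s}"
    by (rule has_integral_spike_finite[OF _ _ hi, of "{r}"]) (simp_all add: radial_weight_def h_def)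
  then have "((\<lambda>t. if t \<in> {r..s} then radial_weight k r t else 0) has_integral unit_ball_vol (real k) * (s\<^sup>2 - r\<^sup>2) powr (real k / 2)) UNIV"
    by (simp only: has_integral_restrict_UNIV)
  then have "(\<integral>\<^sup>+t. ennreal (if t \<in> {r..s} then radial_weight k r t else 0) \<partial>lborel) =
     ennreal (unit_ball_vol (real k) * (s\<^sup>2 - r\<^sup>2) powr (real k / 2))"
    using assms by (intro nn_integral_has_integral_lborel) (auto simp: radial_weight_nonneg)
  also have "(\<integral>\<^sup>+t. ennreal (if t \<in> {r..s} then radial_weight k r t else 0) \<partial>lborel) =
      (\<integral>\<^sup>+t. ennreal (radial_weight k r t) * indicator {..s} t \<partial>lborel)"
    by (intro nn_integral_cong) (auto simp: radial_weight_def indicator_def)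
  finally show ?thesis using False by simp
qed

text \<open>For s > r the sublevel set is a ball of radius
  \<open>sqrt (s\<^sup>2 - r\<^sup>2)\<close>, whose volume as a function of s has
  \<open>radial_weight\<close> as its density.\<close>

lemma distr_subspace_lborel_radial:
  fixes B :: "'a::euclidean_space set"
  assumes B: "orthonormal B" "B \<noteq> {}" and r: "r \<ge> 0"
  shows "distr (subspace_lborel B) borel (\<lambda>v. sqrt (r\<^sup>2 + (norm v)\<^sup>2)) = density lborel (radial_weight (card B) r)"
proof -
  have k: "card B \<ge> 1" using B orthonormal_finite[OF B(1)] by (simp add: Suc_le_eq card_gt_0_iff)
  have em: "emeasure (subspace_lborel B) {v \<in> space (subspace_lborel B). sqrt (r\<^sup>2 + (norm v)\<^sup>2) \<le> s} =
      (if s \<le> r then 0 else ennreal (unit_ball_vol (real (card B)) * (s\<^sup>2 - r\<^sup>2) powr (real (card B) / 2)))" for s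
  proof (cases "s \<le> r")
    case True
    \<comment> \<open>Here the sublevel set contains at most the origin; its measure is squeezed to
      0 by small balls, as \<open>card B \<ge> 1\<close>.\<close>
    have "{v::'a. sqrt (r\<^sup>2 + (norm v)\<^sup>2) \<le> s} \<subseteq> cball 0 d" if "d > 0" for d
    proof
      fix v assume "v \<in> {v::'a. sqrt (r\<^sup>2 + (norm v)\<^sup>2) \<le> s}"
      then have "sqrt (r\<^sup>2 + (norm v)\<^sup>2) \<le> sqrt (r\<^sup>2)" using True r by simp
      then have "norm v = 0" by (simp only: real_sqrt_le_iff) simp
      then show "v \<in> cball 0 d" using that by simp
    qed
    then have "emeasure (subspace_lborel B) {v. sqrt (r\<^sup>2 + (norm v)\<^sup>2) \<le> s} \<le> ennreal (unit_ball_vol (real (card B)) * d ^ card B)" if "d > 0" for d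
      using emeasure_subspace_lborel_cball[OF B(1) that] that by (metis emeasure_mono sets_subspace_lborel borel_closed closed_cball)
    moreover have "((\<lambda>d. ennreal (unit_ball_vol (real (card B)) * d ^ card B)) \<longlongrightarrow> ennreal (unit_ball_vol (real (card B)) * 0 ^ card B)) (at_right 0)"
      by (intro tendsto_intros)
    ultimately have "emeasure (subspace_lborel B) {v. sqrt (r\<^sup>2 + (norm v)\<^sup>2) \<le> s} \<le> ennreal (unit_ball_vol (real (card B)) * 0 ^ card B)"
      by (intro tendsto_lowerbound[of _ _ "at_right 0"]) (auto simp: eventually_at_right_less intro!: eventually_mono[OF eventually_at_right_less[of 0]])
    then show ?thesis using True k by (simp add: power_0_left)
  next
    case False
    define d where "d = sqrt (s\<^sup>2 - r\<^sup>2)"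
    have sr: "s\<^sup>2 - r\<^sup>2 > 0" using False r by (simp add: power_strict_mono)
    then have d: "d > 0" by (simp add: d_def)
    have iff: "sqrt (r\<^sup>2 + (norm v)\<^sup>2) \<le> s \<longleftrightarrow> norm v \<le> d" for v :: 'a
    proof -
      have "sqrt (r\<^sup>2 + (norm v)\<^sup>2) \<le> s \<longleftrightarrow> sqrt (r\<^sup>2 + (norm v)\<^sup>2) \<le> sqrt (s\<^sup>2)" using False r by simp
      also have "\<dots> \<longleftrightarrow> sqrt ((norm v)\<^sup>2) \<le> d" unfolding d_def real_sqrt_le_iff by auto
      finally show ?thesis by simp
    qed
    have "{v \<in> space (subspace_lborel B). sqrt (r\<^sup>2 + (norm v)\<^sup>2) \<le> s} = cball 0 d"
      by (simp only: iff space_subspace_lborel) auto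
    moreover have "d ^ card B = (s\<^sup>2 - r\<^sup>2) powr (real (card B) / 2)"
      using sr by (simp add: d_def powr_half_sqrt[symmetric] powr_powr powr_realpow[symmetric])
    ultimately show ?thesis
      using emeasure_subspace_lborel_cball[OF B(1) d] False by simp
  qed
  show ?thesis
    by (rule distr_eq_densityI) (auto simp: em[unfolded space_subspace_lborel, simplified] nn_integral_radial_weight[OF k r] split: if_splits)
qed

lemma orthonormal_Basis: "orthonormal (Basis :: 'a::euclidean_space set)"
  by (auto simp: orthonormal_def pairwise_def orthogonal_def inner_not_same_Basis)

lemma distr_lborel_norm:
  "distr lborel borel (norm :: 'a::euclidean_space \<Rightarrow> real) = density lborel (radial_weight DIM('a) 0)"
proof -
  have "(lborel :: 'a measure) = subspace_lborel Basis"
    by (rule lborel_eq_subspace_lborel[OF orthonormal_Basis]) (simp add: span_Basis)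
  then show ?thesis
    using distr_subspace_lborel_radial[OF orthonormal_Basis, of 0, where 'a='a] by simp
qed

lemma radial_weight_0:
  assumes "k \<ge> 1"
  shows "radial_weight k 0 s = indicator {0<..} s * (real k * unit_ball_vol (real k) * s ^ (k - 1))"
proof (cases "s > 0")
  case True
  have "(s\<^sup>2) powr (real k / 2 - 1) * s = s powr (real k - 2) * s powr 1"
    using True by (simp add: powr_power[symmetric] powr_powr algebra_simps flip: powr_numeral)
  also have "\<dots> = s powr (real k - 1)"
    using powr_add[of s "real k - 2" 1] by simp
  also have "\<dots> = s ^ (k - 1)"
    using True assms by (simp add: of_nat_diff flip: powr_realpow)
  finally show ?thesis using True by (simp add: radial_weight_def)
qed (simp add: radial_weight_def)

lemma distr_haar_SO_norm:
  fixes x y :: "real^'n"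
  assumes "CARD('n) \<ge> 2" "norm x = norm y"
  shows "distr haar_SO borel (\<lambda>A. A *v x) = distr haar_SO borel (\<lambda>A. A *v y)"
proof (rule measure_eqI)
  fix E assume "E \<in> sets (distr haar_SO borel (\<lambda>A. A *v x))"
  then have [measurable]: "E \<in> sets borel" by simp
  have *: "emeasure (distr haar_SO borel (\<lambda>A. A *v z)) E = (\<integral>\<^sup>+A. indicator E (A *v z) \<partial>haar_SO)" for z :: "real^'n"
  proof -
    have "emeasure (distr haar_SO borel (\<lambda>A. A *v z)) E = (\<integral>\<^sup>+y. indicator E y \<partial>distr haar_SO borel (\<lambda>A. A *v z))"
      by simp
    also have "\<dots> = (\<integral>\<^sup>+A. indicator E (A *v z) \<partial>haar_SO)"
      by (rule nn_integral_distr) measurable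
    finally show ?thesis .
  qed
  show "emeasure (distr haar_SO borel (\<lambda>A. A *v x)) E = emeasure (distr haar_SO borel (\<lambda>A. A *v y)) E"
    unfolding * by (rule nn_integral_haar_SO_norm[OF assms]) simp
qed simp

text \<open>Mean over the sphere of radius s around x when \<xi> is a unit vector, written over the
  rotation group so that joint measurability in x and s follows from the theory of product measures.
  The nonnegative version controls where the signed \<open>sph_mean\<close> converges.\<close>

definition sph_nn :: "real^'n \<Rightarrow> (real^'n \<Rightarrow> ennreal) \<Rightarrow> real^'n \<Rightarrow> real \<Rightarrow> ennreal" where
  "sph_nn \<xi> g x s = (\<integral>\<^sup>+A. g (x + s *\<^sub>R (A *v \<xi>)) \<partial>haar_SO)"

definition sph_mean :: "real^'n \<Rightarrow> (real^'n \<Rightarrow> real) \<Rightarrow> real^'n \<Rightarrow> real \<Rightarrow> real" where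
  "sph_mean \<xi> f x s = (LINT A|haar_SO. f (x + s *\<^sub>R (A *v \<xi>)))"

lemma sph_nn_measurable[measurable (raw)]:
  fixes X :: "'a \<Rightarrow> real^'n"
  assumes [measurable]: "g \<in> borel_measurable borel" "X \<in> borel_measurable M" "S \<in> borel_measurable M"
  shows "(\<lambda>a. sph_nn \<xi> g (X a) (S a)) \<in> borel_measurable M"
proof -
  interpret prob_space "haar_SO :: (real^'n^'n) measure" by (rule prob_space_haar_SO)
  show ?thesis unfolding sph_nn_def by measurable
qed

lemma sph_mean_measurable[measurable (raw)]:
  fixes X :: "'a \<Rightarrow> real^'n"
  assumes [measurable]: "f \<in> borel_measurable borel" "X \<in> borel_measurable M" "S \<in> borel_measurable M"
  shows "(\<lambda>a. sph_mean \<xi> f (X a) (S a)) \<in> borel_measurable M"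
proof -
  interpret prob_space "haar_SO :: (real^'n^'n) measure" by (rule prob_space_haar_SO)
  show ?thesis unfolding sph_mean_def by measurable
qed

lemma nn_integral_haar_SO_eq_sph_nn:
  fixes z :: "real^'n"
  assumes "CARD('n) \<ge> 2" "norm \<xi> = 1" and [measurable]: "g \<in> borel_measurable borel"
  shows "(\<integral>\<^sup>+A. g (x + A *v z) \<partial>haar_SO) = sph_nn \<xi> g x (norm z)"
proof -
  have "(\<integral>\<^sup>+A. g (x + A *v z) \<partial>haar_SO) = (\<integral>\<^sup>+A. g (x + A *v (norm z *\<^sub>R \<xi>)) \<partial>haar_SO)"
    by (rule nn_integral_haar_SO_norm[of z "norm z *\<^sub>R \<xi>" "\<lambda>y. g (x + y)"]) (use assms in auto)
  then show ?thesis by (simp add: sph_nn_def matrix_vector_mult_scaleR)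
qed

lemma integral_haar_SO_eq_sph_mean:
  fixes z :: "real^'n"
  assumes n: "CARD('n) \<ge> 2" and \<xi>: "norm \<xi> = 1" and [measurable]: "f \<in> borel_measurable borel"
  shows "(LINT A|haar_SO. f (x + A *v z)) = sph_mean \<xi> f x (norm z)"
proof -
  have "(LINT A|haar_SO. f (x + A *v z)) = (LINT y|distr haar_SO borel (\<lambda>A. A *v z). f (x + y))"
    by (subst integral_distr) auto
  also have "distr haar_SO borel (\<lambda>A. A *v z) = distr haar_SO borel (\<lambda>A. A *v (norm z *\<^sub>R \<xi>))"
    using n \<xi> by (intro distr_haar_SO_norm) auto
  also have "(LINT y|\<dots>. f (x + y)) = (LINT A|haar_SO. f (x + A *v (norm z *\<^sub>R \<xi>)))"
    by (subst integral_distr) auto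
  finally show ?thesis by (simp add: sph_mean_def matrix_vector_mult_scaleR)
qed

section \<open>Polar coordinates\<close>

lemma nn_integral_lborel_matrix:
  fixes A :: "real^'n^'n"
  assumes "rotation_matrix A" and [measurable]: "g \<in> borel_measurable borel"
  shows "(\<integral>\<^sup>+y. g (A *v y) \<partial>lborel) = (\<integral>\<^sup>+y. g y \<partial>lborel)"
proof -
  have "(\<integral>\<^sup>+y. g (A *v y) \<partial>lborel) = (\<integral>\<^sup>+y. g y \<partial>distr lborel borel (\<lambda>y. A *v y))"
    by (subst nn_integral_distr) auto
  also have "distr lborel borel (\<lambda>y. A *v y) = lborel"
    by (rule lborel_distr_orthogonal_transformation[OF rotation_matrix_orthogonal_transformation[OF assms(1)]])
  finally show ?thesis .
qed

lemma nn_integral_lborel_rotations: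
  fixes g :: "real^'n \<Rightarrow> ennreal"
  assumes [measurable]: "g \<in> borel_measurable borel"
  shows "(\<integral>\<^sup>+y. g y \<partial>lborel) = (\<integral>\<^sup>+y. (\<integral>\<^sup>+A. g (A *v y) \<partial>haar_SO) \<partial>lborel)"
proof -
  interpret prob_space "haar_SO :: (real^'n^'n) measure" by (rule prob_space_haar_SO)
  interpret P: pair_sigma_finite "haar_SO :: (real^'n^'n) measure" "lborel :: (real^'n) measure" ..
  have "(\<integral>\<^sup>+y. (\<integral>\<^sup>+A. g (A *v y) \<partial>haar_SO) \<partial>lborel) = (\<integral>\<^sup>+A. (\<integral>\<^sup>+y. g (A *v y) \<partial>lborel) \<partial>haar_SO)"
    by (rule P.Fubini') measurable
  also have "\<dots> = (\<integral>\<^sup>+A. (\<integral>\<^sup>+y. g y \<partial>lborel) \<partial>(haar_SO :: (real^'n^'n) measure))"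
    by (rule nn_integral_cong, rule nn_integral_lborel_matrix) (auto simp: space_haar_SO)
  finally show ?thesis by (simp add: emeasure_space_1)
qed

lemma nn_integral_lborel_translation:
  fixes g :: "'a::euclidean_space \<Rightarrow> ennreal"
  assumes [measurable]: "g \<in> borel_measurable borel"
  shows "(\<integral>\<^sup>+y. g (x + y) \<partial>lborel) = (\<integral>\<^sup>+y. g y \<partial>lborel)"
  using nn_integral_distr[of "\<lambda>y. x + y" lborel borel g] by (simp add: lborel_translation)

text \<open>Polar coordinates without surface measure: averaging the integrand over rotations leaves
  the integral unchanged, the average at y depends on |y| only, and the norm has the density
  \<open>radial_weight CARD('n) 0\<close>.\<close>

lemma nn_integral_polar:
  fixes x :: "real^'n"
  assumes n: "CARD('n) \<ge> 2" and \<xi>: "norm \<xi> = 1" and [measurable]: "g \<in> borel_measurable borel"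
  shows "(\<integral>\<^sup>+y. g y \<partial>lborel) = (\<integral>\<^sup>+s. ennreal (radial_weight CARD('n) 0 s) * sph_nn \<xi> g x s \<partial>lborel)"
proof -
  have "(\<integral>\<^sup>+y. g y \<partial>lborel) = (\<integral>\<^sup>+y. g (x + y) \<partial>lborel)"
    by (simp add: nn_integral_lborel_translation)
  also have "\<dots> = (\<integral>\<^sup>+y. (\<integral>\<^sup>+A. g (x + A *v y) \<partial>haar_SO) \<partial>lborel)"
    by (rule nn_integral_lborel_rotations) measurable
  also have "\<dots> = (\<integral>\<^sup>+(y::real^'n). sph_nn \<xi> g x (norm y) \<partial>lborel)"
    using nn_integral_haar_SO_eq_sph_nn[OF n \<xi>, of g x] by simp
  also have "\<dots> = (\<integral>\<^sup>+s. sph_nn \<xi> g x s \<partial>distr lborel borel (norm :: real^'n \<Rightarrow> real))"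
    by (subst nn_integral_distr) auto
  also have "\<dots> = (\<integral>\<^sup>+s. ennreal (radial_weight CARD('n) 0 s) * sph_nn \<xi> g x s \<partial>lborel)"
    unfolding distr_lborel_norm by (subst nn_integral_density) auto
  finally show ?thesis .
qed

section \<open>Averages of plane integrals over rotations\<close>

context
  fixes B :: "(real^'n) set" and \<xi> x :: "real^'n" and r :: real
  assumes n: "CARD('n) \<ge> 2" and B: "orthonormal B" "B \<noteq> {}" and \<xi>: "norm \<xi> = 1" "\<And>b. b \<in> B \<Longrightarrow> b \<bullet> \<xi> = 0"
    and r: "r \<ge> 0"
begin

lemma norm_plane_point:
  assumes "v \<in> span B"
  shows "norm (r *\<^sub>R \<xi> + v) = sqrt (r\<^sup>2 + (norm v)\<^sup>2)"
proof -
  have "orthogonal \<xi> v"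
    by (rule orthogonal_to_span[OF assms]) (simp add: orthogonal_def \<xi>(2) inner_commute)
  then have "norm (r *\<^sub>R \<xi> + v) ^ 2 = norm (r *\<^sub>R \<xi>) ^ 2 + norm v ^ 2"
    by (intro norm_add_Pythagorean) (simp add: orthogonal_def)
  then show ?thesis using \<xi>(1) by (metis norm_ge_zero norm_scaleR mult.right_neutral power2_abs real_sqrt_unique)
qed

text \<open>After exchanging the integrals, the rotation average at v is the spherical mean with
  radius |r \<xi> + v|. As B is orthogonal to \<xi>, Pythagoras expresses this radius by |v|, and
  its law is \<open>radial_weight\<close>.\<close>

lemma nn_integral_rotated_planes:
  assumes [measurable]: "g \<in> borel_measurable borel"
  shows "(\<integral>\<^sup>+A. (\<integral>\<^sup>+v. g (x + A *v (r *\<^sub>R \<xi> + v)) \<partial>subspace_lborel B) \<partial>haar_SO) =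
    (\<integral>\<^sup>+s. ennreal (radial_weight (card B) r s) * sph_nn \<xi> g x s \<partial>lborel)"
proof -
  interpret prob_space "haar_SO :: (real^'n^'n) measure" by (rule prob_space_haar_SO)
  interpret S: sigma_finite_measure "subspace_lborel B" by (rule sigma_finite_subspace_lborel[OF B(1)])
  interpret P: pair_sigma_finite "haar_SO :: (real^'n^'n) measure" "subspace_lborel B" ..
  have "(\<integral>\<^sup>+A. (\<integral>\<^sup>+v. g (x + A *v (r *\<^sub>R \<xi> + v)) \<partial>subspace_lborel B) \<partial>haar_SO) =
     (\<integral>\<^sup>+v. (\<integral>\<^sup>+A. g (x + A *v (r *\<^sub>R \<xi> + v)) \<partial>haar_SO) \<partial>subspace_lborel B)"
    by (rule P.Fubini'[symmetric]) measurable
  also have "\<dots> = (\<integral>\<^sup>+v. sph_nn \<xi> g x (sqrt (r\<^sup>2 + (norm v)\<^sup>2)) \<partial>subspace_lborel B)"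
    using AE_subspace_lborel[of B]
    by (intro nn_integral_cong_AE, eventually_elim)
       (simp add: nn_integral_haar_SO_eq_sph_nn[OF n \<xi>(1)] norm_plane_point)
  also have "\<dots> = (\<integral>\<^sup>+s. sph_nn \<xi> g x s \<partial>distr (subspace_lborel B) borel (\<lambda>v. sqrt (r\<^sup>2 + (norm v)\<^sup>2)))"
    by (subst nn_integral_distr) auto
  also have "\<dots> = (\<integral>\<^sup>+s. ennreal (radial_weight (card B) r s) * sph_nn \<xi> g x s \<partial>lborel)"
    unfolding distr_subspace_lborel_radial[OF B r] by (subst nn_integral_density) auto
  finally show ?thesis .
qed

lemma integral_rotated_planes:
  assumes [measurable]: "f \<in> borel_measurable borel"
    and fin: "(\<integral>\<^sup>+s. ennreal (radial_weight (card B) r s) * sph_nn \<xi> (\<lambda>y. ennreal \<bar>f y\<bar>) x s \<partial>lborel) < \<infinity>"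
  shows "AE A in haar_SO. integrable (subspace_lborel B) (\<lambda>v. f (x + A *v (r *\<^sub>R \<xi> + v)))"
    and "(LINT A|haar_SO. LINT v|subspace_lborel B. f (x + A *v (r *\<^sub>R \<xi> + v))) =
      (LINT s|lborel. radial_weight (card B) r s * sph_mean \<xi> f x s)"
proof -
  interpret prob_space "haar_SO :: (real^'n^'n) measure" by (rule prob_space_haar_SO)
  interpret S: sigma_finite_measure "subspace_lborel B" by (rule sigma_finite_subspace_lborel[OF B(1)])
  interpret P: pair_sigma_finite "haar_SO :: (real^'n^'n) measure" "subspace_lborel B" ..
  have int: "integrable (haar_SO \<Otimes>\<^sub>M subspace_lborel B) (\<lambda>(A, v). f (x + A *v (r *\<^sub>R \<xi> + v)))"
  proof (rule integrableI_bounded)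
    have "(\<integral>\<^sup>+ p. ennreal (norm (case p of (A, v) \<Rightarrow> f (x + A *v (r *\<^sub>R \<xi> + v)))) \<partial>(haar_SO \<Otimes>\<^sub>M subspace_lborel B)) =
      (\<integral>\<^sup>+A. (\<integral>\<^sup>+v. ennreal \<bar>f (x + A *v (r *\<^sub>R \<xi> + v))\<bar> \<partial>subspace_lborel B) \<partial>haar_SO)"
      by (subst S.nn_integral_fst[symmetric]) (auto simp: case_prod_beta)
    also have "\<dots> < \<infinity>" using fin by (subst nn_integral_rotated_planes) auto
    finally show "(\<integral>\<^sup>+ p. ennreal (norm (case p of (A, v) \<Rightarrow> f (x + A *v (r *\<^sub>R \<xi> + v)))) \<partial>(haar_SO \<Otimes>\<^sub>M subspace_lborel B)) < \<infinity>" .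
  qed measurable
  show "AE A in haar_SO. integrable (subspace_lborel B) (\<lambda>v. f (x + A *v (r *\<^sub>R \<xi> + v)))"
    using P.AE_integrable_fst[OF int] .
  have "(LINT A|haar_SO. LINT v|subspace_lborel B. f (x + A *v (r *\<^sub>R \<xi> + v))) =
     (LINT v|subspace_lborel B. LINT A|haar_SO. f (x + A *v (r *\<^sub>R \<xi> + v)))"
    using P.Fubini_integral[OF int] by simp
  also have "\<dots> = (LINT v|subspace_lborel B. sph_mean \<xi> f x (sqrt (r\<^sup>2 + (norm v)\<^sup>2)))"
  proof (rule integral_cong_AE)
    show "AE v in subspace_lborel B. (LINT A|haar_SO. f (x + A *v (r *\<^sub>R \<xi> + v))) = sph_mean \<xi> f x (sqrt (r\<^sup>2 + (norm v)\<^sup>2))"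
      using AE_subspace_lborel[of B]
      by eventually_elim (simp add: integral_haar_SO_eq_sph_mean[OF n \<xi>(1)] norm_plane_point)
  qed measurable
  also have "\<dots> = (LINT s|distr (subspace_lborel B) borel (\<lambda>v. sqrt (r\<^sup>2 + (norm v)\<^sup>2)). sph_mean \<xi> f x s)"
    by (subst integral_distr) auto
  also have "\<dots> = (LINT s|lborel. radial_weight (card B) r s * sph_mean \<xi> f x s)"
    unfolding distr_subspace_lborel_radial[OF B r]
    by (subst integral_density) (auto simp: radial_weight_nonneg[OF r])
  finally show "(LINT A|haar_SO. LINT v|subspace_lborel B. f (x + A *v (r *\<^sub>R \<xi> + v))) =
      (LINT s|lborel. radial_weight (card B) r s * sph_mean \<xi> f x s)" .
qed

end

section \<open>Differentiation at Lebesgue points\<close>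

text \<open>The mean of |g - g(r)| over [r - h, r + h] tends to 0, with the value g(r) itself
  prescribed. Being an extended nonnegative integral, the condition presupposes no integrability of
  g.\<close>

definition lebesgue_point :: "(real \<Rightarrow> real) \<Rightarrow> real \<Rightarrow> bool" where
  "lebesgue_point g r \<longleftrightarrow> (\<forall>\<epsilon>>0. \<forall>\<^sub>F h in at_right 0.
     (\<integral>\<^sup>+s. indicator {r - h..r + h} s * ennreal \<bar>g s - g r\<bar> \<partial>lborel) \<le> ennreal (\<epsilon> * h))"

lemma lebesgue_point_mult:
  assumes [measurable]: "g \<in> borel_measurable borel" and a: "isCont a r" and g: "lebesgue_point g r"
  shows "lebesgue_point (\<lambda>s. a s * g s) r"
  unfolding lebesgue_point_def
proof (intro allI impI)
  fix \<epsilon> :: real assume \<epsilon>: "\<epsilon> > 0"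
  \<comment> \<open>Split a(s) g(s) - a(r) g(r) = a(s) (g(s) - g(r)) + (a(s) - a(r)) g(r). The first
    part costs \<epsilon> h / 2, the second \<epsilon> / 4 on an interval of length 2 h; the 1 in
    \<eta> bounds |a(s)| by |a(r)| + 1.\<close>
  define \<epsilon>1 where "\<epsilon>1 = \<epsilon> / (2 * (\<bar>a r\<bar> + 1))"
  define \<eta> where "\<eta> = min 1 (\<epsilon> / (4 * (\<bar>g r\<bar> + 1)))"
  have pos: "\<epsilon>1 > 0" "\<eta> > 0" using \<epsilon> by (auto simp: \<epsilon>1_def \<eta>_def)
  obtain d where d: "d > 0" "\<And>s. \<bar>s - r\<bar> < d \<Longrightarrow> \<bar>a s - a r\<bar> < \<eta>"
    using a pos(2) unfolding continuous_at_eps_delta dist_real_def by blast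
  have "\<forall>\<^sub>F h in at_right 0. (\<integral>\<^sup>+s. indicator {r - h..r + h} s * ennreal \<bar>g s - g r\<bar> \<partial>lborel) \<le> ennreal (\<epsilon>1 * h)"
    using g pos by (auto simp: lebesgue_point_def)
  moreover have "\<forall>\<^sub>F h in at_right (0::real). h > 0 \<and> h < d"
    using d(1) by (auto simp: eventually_at_right_field)
  ultimately show "\<forall>\<^sub>F h in at_right 0. (\<integral>\<^sup>+s. indicator {r - h..r + h} s * ennreal \<bar>a s * g s - a r * g r\<bar> \<partial>lborel) \<le> ennreal (\<epsilon> * h)"
  proof eventually_elim
    fix h assume h: "(\<integral>\<^sup>+s. indicator {r - h..r + h} s * ennreal \<bar>g s - g r\<bar> \<partial>lborel) \<le> ennreal (\<epsilon>1 * h)" "0 < h \<and> h < d"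
    have "(\<integral>\<^sup>+s. indicator {r - h..r + h} s * ennreal \<bar>a s * g s - a r * g r\<bar> \<partial>lborel) \<le>
      (\<integral>\<^sup>+s. ennreal (\<bar>a r\<bar> + 1) * (indicator {r - h..r + h} s * ennreal \<bar>g s - g r\<bar>) +
          ennreal (\<epsilon> / 4) * indicator {r - h..r + h} s \<partial>lborel)"
    proof (rule nn_integral_mono)
      fix s
      show "indicator {r - h..r + h} s * ennreal \<bar>a s * g s - a r * g r\<bar> \<le>
         ennreal (\<bar>a r\<bar> + 1) * (indicator {r - h..r + h} s * ennreal \<bar>g s - g r\<bar>) +
          ennreal (\<epsilon> / 4) * indicator {r - h..r + h} s"
      proof (cases "s \<in> {r - h..r + h}")
        case True
        then have as: "\<bar>a s - a r\<bar> < \<eta>" using h by (intro d(2)) auto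
        have "a s * g s - a r * g r = a s * (g s - g r) + (a s - a r) * g r" by (simp add: algebra_simps)
        then have "\<bar>a s * g s - a r * g r\<bar> \<le> \<bar>a s\<bar> * \<bar>g s - g r\<bar> + \<bar>a s - a r\<bar> * \<bar>g r\<bar>"
          by (metis abs_mult abs_triangle_ineq)
        also have "\<dots> \<le> (\<bar>a r\<bar> + 1) * \<bar>g s - g r\<bar> + (\<epsilon> / (4 * (\<bar>g r\<bar> + 1))) * \<bar>g r\<bar>"
          using as by (intro add_mono mult_right_mono) (auto simp: \<eta>_def)
        also have "(\<epsilon> / (4 * (\<bar>g r\<bar> + 1))) * \<bar>g r\<bar> \<le> \<epsilon> / 4"
          using \<epsilon> by (simp add: field_simps)
        finally have "\<bar>a s * g s - a r * g r\<bar> \<le> (\<bar>a r\<bar> + 1) * \<bar>g s - g r\<bar> + \<epsilon> / 4" by simp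
        then show ?thesis
          using True \<epsilon> by (simp add: ennreal_plus[symmetric] ennreal_mult[symmetric] del: ennreal_plus)
      qed simp
    qed
    also have "\<dots> = ennreal (\<bar>a r\<bar> + 1) * (\<integral>\<^sup>+s. indicator {r - h..r + h} s * ennreal \<bar>g s - g r\<bar> \<partial>lborel) + ennreal (\<epsilon> / 4) * ennreal (2 * h)"
      using h by (subst nn_integral_add) (auto simp: nn_integral_cmult)
    also have "\<dots> \<le> ennreal (\<bar>a r\<bar> + 1) * ennreal (\<epsilon>1 * h) + ennreal (\<epsilon> / 4) * ennreal (2 * h)"
      using h by (intro add_mono mult_left_mono) auto
    also have "\<dots> = ennreal ((\<bar>a r\<bar> + 1) * (\<epsilon>1 * h) + \<epsilon> / 4 * (2 * h))"
    proof -
      have "0 \<le> (\<bar>a r\<bar> + 1) * (\<epsilon>1 * h)" "0 \<le> \<epsilon> / 4 * (2 * h)" "0 \<le> \<epsilon>1 * h" "0 \<le> \<epsilon> / 4"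
        using \<epsilon> pos h by auto
      then have "ennreal ((\<bar>a r\<bar> + 1) * (\<epsilon>1 * h) + \<epsilon> / 4 * (2 * h)) = ennreal ((\<bar>a r\<bar> + 1) * (\<epsilon>1 * h)) + ennreal (\<epsilon> / 4 * (2 * h))"
        by (intro ennreal_plus)
      also have "ennreal ((\<bar>a r\<bar> + 1) * (\<epsilon>1 * h)) = ennreal (\<bar>a r\<bar> + 1) * ennreal (\<epsilon>1 * h)"
        using \<open>0 \<le> \<epsilon>1 * h\<close> by (intro ennreal_mult) auto
      also have "ennreal (\<epsilon> / 4 * (2 * h)) = ennreal (\<epsilon> / 4) * ennreal (2 * h)"
        using \<open>0 \<le> \<epsilon> / 4\<close> h by (intro ennreal_mult) auto
      finally show ?thesis by simp
    qed
    also have "(\<bar>a r\<bar> + 1) * (\<epsilon>1 * h) + \<epsilon> / 4 * (2 * h) = \<epsilon> * h"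
    proof -
      have "(\<bar>a r\<bar> + 1) * \<epsilon>1 = \<epsilon> / 2" by (simp add: \<epsilon>1_def field_simps)
      then have "(\<bar>a r\<bar> + 1) * (\<epsilon>1 * h) = \<epsilon> / 2 * h" by (simp add: mult.assoc[symmetric])
      then show ?thesis by (simp add: field_simps)
    qed
    finally show "(\<integral>\<^sup>+s. indicator {r - h..r + h} s * ennreal \<bar>a s * g s - a r * g r\<bar> \<partial>lborel) \<le> ennreal (\<epsilon> * h)" .
  qed
qed

lemma lebesgue_point_isCont:
  assumes "isCont g r"
  shows "lebesgue_point g r"
proof -
  have "lebesgue_point (\<lambda>_. 1) r" by (simp add: lebesgue_point_def)
  then have "lebesgue_point (\<lambda>s. g s * 1) r" using assms by (intro lebesgue_point_mult) auto
  then show ?thesis by simp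
qed

text \<open>Differentiation at one given Lebesgue point: the error of the linear approximation is,
  up to sign, the integral of h(s) - h(r) over the interval between r and y, which lies in
  [r - \<delta>, r + \<delta>] with \<delta> = |y - r|.\<close>

lemma tail_integral_has_derivative:
  fixes h :: "real \<Rightarrow> real"
  assumes [measurable]: "h \<in> borel_measurable borel"
    and int: "\<And>r. r > 0 \<Longrightarrow> integrable lborel (\<lambda>s. indicator {r<..} s * h s)"
    and r: "r > 0" and leb: "lebesgue_point h r"
  shows "((\<lambda>r. LINT s|lborel. indicator {r<..} s * h s) has_real_derivative - h r) (at r)"
  unfolding has_field_derivative_def has_derivative_within_alt2
proof (intro conjI allI impI)
  show "bounded_linear ((*) (- h r))" by (rule bounded_linear_mult_right)
  fix e :: real assume e: "e > 0"
  let ?T = "\<lambda>r. LINT s|lborel. indicator {r<..} s * h s"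
  obtain b where b: "b > 0" "\<And>\<delta>. 0 < \<delta> \<Longrightarrow> \<delta> < b \<Longrightarrow>
     (\<integral>\<^sup>+s. indicator {r - \<delta>..r + \<delta>} s * ennreal \<bar>h s - h r\<bar> \<partial>lborel) \<le> ennreal (e * \<delta>)"
    using leb e unfolding lebesgue_point_def eventually_at_right_field by auto
  have "norm (?T y - ?T r - - h r * (y - r)) \<le> e * norm (y - r)" if y: "y \<noteq> r" "dist y r < min b r" for y
  proof -
    define \<delta> where "\<delta> = \<bar>y - r\<bar>"
    have \<delta>: "0 < \<delta>" "\<delta> < b" "y > 0" using y by (auto simp: \<delta>_def dist_real_def)
    \<comment> \<open>A signed indicator of the interval between y and r, which treats y < r and y >
      r together.\<close>
    define I :: "real \<Rightarrow> real" where "I = (\<lambda>s. indicator {y<..} s - indicator {r<..} s)"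
    have [measurable]: "I \<in> borel_measurable borel" unfolding I_def by measurable
    have Iint: "integrable lborel I" "integral\<^sup>L lborel I = r - y"
    proof -
      have "I = (\<lambda>s. if y < r then indicator {y<..r} s else - indicator {r<..y} s)"
        using y by (auto simp: I_def fun_eq_iff indicator_def)
      then show "integrable lborel I" "integral\<^sup>L lborel I = r - y"
        by (cases "y < r"; simp)+
    qed
    have Ih: "integrable lborel (\<lambda>s. I s * h s)" "(LINT s|lborel. I s * h s) = ?T y - ?T r"
      using int[OF \<delta>(3)] int[OF r] by (auto simp: I_def left_diff_distrib)
    have "(LINT s|lborel. I s * h r) = (r - y) * h r"
      using Iint(2) by simp
    then have "?T y - ?T r - - h r * (y - r) = (LINT s|lborel. I s * h s) - (LINT s|lborel. I s * h r)"
      unfolding Ih(2) by (simp only:) (simp add: algebra_simps)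
    also have "\<dots> = (LINT s|lborel. I s * (h s - h r))"
      using Ih Iint by (subst Bochner_Integration.integral_diff[symmetric]) (auto simp: algebra_simps)
    finally have eq: "?T y - ?T r - - h r * (y - r) = (LINT s|lborel. I s * (h s - h r))" .
    have "integrable lborel (\<lambda>s. I s * (h s - h r))"
      using Ih Iint by (simp add: right_diff_distrib)
    then have "ennreal (norm (LINT s|lborel. I s * (h s - h r))) \<le> (\<integral>\<^sup>+s. ennreal (norm (I s * (h s - h r))) \<partial>lborel)"
      by (rule integral_norm_bound_ennreal)
    also have "\<dots> \<le> (\<integral>\<^sup>+s. indicator {r - \<delta>..r + \<delta>} s * ennreal \<bar>h s - h r\<bar> \<partial>lborel)"
      by (intro nn_integral_mono) (auto simp: I_def \<delta>_def indicator_def)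
    also have "\<dots> \<le> ennreal (e * \<delta>)" by (rule b(2)[OF \<delta>(1,2)])
    finally show ?thesis unfolding eq \<delta>_def using e by simp
  qed
  then show "\<forall>\<^sub>F y in at r. norm (?T y - ?T r - - h r * (y - r)) \<le> e * norm (y - r)"
    unfolding eventually_at using b(1) r by (intro exI[of _ "min b r"]) auto
qed

section \<open>Integrals of integer order and their derivatives\<close>

lemma abs_power_diff_le:
  fixes a b c :: real
  assumes "0 \<le> a" "a \<le> c" "0 \<le> b" "b \<le> c"
  shows "\<bar>a ^ j - b ^ j\<bar> \<le> real j * c ^ (j - 1) * \<bar>a - b\<bar>"
proof (induction j)
  case (Suc j)
  have "a ^ Suc j - b ^ Suc j = a * (a ^ j - b ^ j) + (a - b) * b ^ j" by (simp add: algebra_simps)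
  then have "\<bar>a ^ Suc j - b ^ Suc j\<bar> \<le> a * \<bar>a ^ j - b ^ j\<bar> + \<bar>a - b\<bar> * b ^ j"
    using assms abs_triangle_ineq[of "a * (a ^ j - b ^ j)" "(a - b) * b ^ j"] by (simp add: abs_mult)
  also have "\<dots> \<le> c * (real j * c ^ (j - 1) * \<bar>a - b\<bar>) + \<bar>a - b\<bar> * c ^ j"
    using assms Suc by (intro add_mono mult_mono power_mono) auto
  also have "\<dots> = real (Suc j) * c ^ (Suc j - 1) * \<bar>a - b\<bar>"
    by (cases j) (simp_all add: algebra_simps)
  finally show ?case .
qed simp

text \<open>Multiplied by 2 / j! this is the Erdelyi--Kober integral of order j + 1 of the function
  h(s) / s. The operator \<open>minus_D\<close> lowers j by one, and at j = 0 it returns h(r) / (2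
  r) where r is a Lebesgue point.\<close>

definition tail_power :: "nat \<Rightarrow> (real \<Rightarrow> real) \<Rightarrow> real \<Rightarrow> real" where
  "tail_power j h r = (LINT s|lborel. indicator {r<..} s * ((s\<^sup>2 - r\<^sup>2) ^ j * h s))"

lemma tail_power_integrable:
  fixes h :: "real \<Rightarrow> real"
  assumes [measurable]: "h \<in> borel_measurable borel"
    and int: "\<And>r. r > 0 \<Longrightarrow> integrable lborel (\<lambda>s. indicator {r<..} s * (s ^ (2 * j) * h s))"
    and r: "r > 0"
  shows "integrable lborel (\<lambda>s. indicator {r<..} s * ((s\<^sup>2 - r\<^sup>2) ^ j * h s))"
proof (rule Bochner_Integration.integrable_bound[OF int[OF r]])
  show "AE s in lborel. norm (indicator {r<..} s * ((s\<^sup>2 - r\<^sup>2) ^ j * h s)) \<le> norm (indicator {r<..} s * (s ^ (2 * j) * h s))"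
  proof (rule AE_I2)
    fix s
    have "(s\<^sup>2 - r\<^sup>2) ^ j \<le> s ^ (2 * j)" "0 \<le> s\<^sup>2 - r\<^sup>2" if "s > r"
      using that r by (auto simp: power_mult intro!: power_mono)
    then show "norm (indicator {r<..} s * ((s\<^sup>2 - r\<^sup>2) ^ j * h s)) \<le> norm (indicator {r<..} s * (s ^ (2 * j) * h s))"
      using r by (cases "s > r") (auto simp: abs_mult intro!: mult_right_mono)
  qed
qed measurable

text \<open>The factor (s / r)^(2 (j - i)) \<ge> 1 on s > r lets the top moment dominate the lower
  ones.\<close>

lemma tail_moment_mono:
  fixes h :: "real \<Rightarrow> real"
  assumes [measurable]: "h \<in> borel_measurable borel"
    and int: "\<And>r. r > 0 \<Longrightarrow> integrable lborel (\<lambda>s. indicator {r<..} s * (s ^ (2 * j) * h s))"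
    and r: "r > 0" and i: "i \<le> j"
  shows "integrable lborel (\<lambda>s. indicator {r<..} s * (s ^ (2 * i) * h s))"
proof (rule Bochner_Integration.integrable_bound)
  show "integrable lborel (\<lambda>s. (1 / r) ^ (2 * (j - i)) * (indicator {r<..} s * (s ^ (2 * j) * h s)))"
    using int[OF r] by simp
  show "AE s in lborel. norm (indicator {r<..} s * (s ^ (2 * i) * h s)) \<le>
      norm ((1 / r) ^ (2 * (j - i)) * (indicator {r<..} s * (s ^ (2 * j) * h s)))"
  proof (rule AE_I2)
    fix s
    show "norm (indicator {r<..} s * (s ^ (2 * i) * h s)) \<le>
      norm ((1 / r) ^ (2 * (j - i)) * (indicator {r<..} s * (s ^ (2 * j) * h s)))"
    proof (cases "s > r")
      case True
      have "s ^ (2 * i) * 1 \<le> s ^ (2 * i) * (s / r) ^ (2 * (j - i))"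
        using True r by (intro mult_left_mono one_le_power) auto
      also have "\<dots> = (1 / r) ^ (2 * (j - i)) * (s ^ (2 * i) * s ^ (2 * (j - i)))"
        by (simp add: power_divide)
      also have "s ^ (2 * i) * s ^ (2 * (j - i)) = s ^ (2 * j)"
      proof -
        have "2 * i + 2 * (j - i) = 2 * j" using i by simp
        then show ?thesis by (simp only: power_add[symmetric])
      qed
      finally have "s ^ (2 * i) * \<bar>h s\<bar> \<le> (1 / r) ^ (2 * (j - i)) * s ^ (2 * j) * \<bar>h s\<bar>"
        by (intro mult_right_mono) auto
      then show ?thesis using True r by (simp add: abs_mult mult.assoc)
    qed simp
  qed
qed measurable

text \<open>For j \<ge> 1 the kernel vanishes at s = r, so there is no boundary term and dominated
  convergence suffices for a merely measurable h. The difference quotients are bounded through a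
  Lipschitz estimate for the j-th power.\<close>

lemma tail_power_has_derivative:
  fixes h :: "real \<Rightarrow> real"
  assumes hm[measurable]: "h \<in> borel_measurable borel"
    and int: "\<And>r. r > 0 \<Longrightarrow> integrable lborel (\<lambda>s. indicator {r<..} s * (s ^ (2 * j) * h s))"
    and r: "r > 0" and j: "j \<ge> 1"
  shows "(tail_power j h has_real_derivative - 2 * real j * r * tail_power (j - 1) h r) (at r)"
  unfolding has_field_derivative_iff tendsto_at_iff_sequentially
proof (intro allI impI)
  fix X :: "nat \<Rightarrow> real" assume X: "\<forall>i. X i \<in> UNIV - {r}" "X \<longlonglongrightarrow> r"
  define F where "F = (\<lambda>u s. indicator {u<..} s * ((s\<^sup>2 - u\<^sup>2) ^ j * h s))"
  have Fint: "integrable lborel (F u)" if "u > 0" for u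
    unfolding F_def by (rule tail_power_integrable[OF hm int that])
  have [measurable]: "F u \<in> borel_measurable borel" for u unfolding F_def by measurable
  \<comment> \<open>Writing the cut-off as a positive part makes the integrand Lipschitz in u across
    u = s; this uses 0^j = 0.\<close>
  have Fmax: "F u s = (max 0 (s\<^sup>2 - u\<^sup>2)) ^ j * h s" if "u > 0" "s > 0" for u s
  proof (cases "s > u")
    case True
    then have "s\<^sup>2 - u\<^sup>2 \<ge> 0" using that by (simp add: power_mono)
    then show ?thesis using True by (simp add: F_def max_def)
  next
    case False
    then have "s\<^sup>2 - u\<^sup>2 \<le> 0" using that by (simp add: power_mono)
    then show ?thesis using False j by (simp add: F_def max_def)
  qed
  obtain N where N: "\<And>i. i \<ge> N \<Longrightarrow> \<bar>X i - r\<bar> < r / 2"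
    using X(2) r unfolding LIMSEQ_def dist_real_def by (metis half_gt_zero)
  define Y where "Y = (\<lambda>i. X (i + N))"
  have Y: "Y i \<noteq> r" "\<bar>Y i - r\<bar> < r / 2" for i using X N by (auto simp: Y_def)
  then have Ypos: "Y i > r / 2" "Y i < 3 / 2 * r" "Y i > 0" for i
    using r by (auto simp: abs_less_iff field_simps) (smt (verit, best) field_sum_of_halves)+
  have Ylim: "filterlim Y (at r) sequentially"
    using Y LIMSEQ_ignore_initial_segment[OF X(2), of N] by (simp add: filterlim_at Y_def)
  define q where "q = (\<lambda>i s. (F (Y i) s - F r s) / (Y i - r))"
  define d where "d = (\<lambda>s. - 2 * real j * r * (indicator {r<..} s * ((s\<^sup>2 - r\<^sup>2) ^ (j - 1) * h s)))"
  have "(\<lambda>i. LINT s|lborel. q i s) \<longlonglongrightarrow> (LINT s|lborel. d s)"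
  proof (rule integral_dominated_convergence)
    show "d \<in> borel_measurable lborel" "\<And>i. q i \<in> borel_measurable lborel"
      unfolding d_def q_def by measurable
    \<comment> \<open>For |Y i - r| < r / 2 the factor 3 r bounds Y i + r, and on s > r / 2 the
      factor (2 s / r)^2 \<ge> 1 raises s^(2 j - 2) to the integrable moment s^(2 j).\<close>
    define w where "w = (\<lambda>s. (3 * r * real j * (2 / r)\<^sup>2) * \<bar>indicator {r / 2<..} s * (s ^ (2 * j) * h s)\<bar>)"
    show "integrable lborel w"
      unfolding w_def using int[of "r / 2"] r by (intro integrable_mult_right integrable_abs) auto
    show "AE s in lborel. norm (q i s) \<le> w s" for i
    proof (rule AE_I2)
      fix s
      show "norm (q i s) \<le> w s"
      proof (cases "s > r / 2")
        case False
        then have "F (Y i) s = 0" "F r s = 0" using Ypos[of i] r by (auto simp: F_def)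
        then show ?thesis using r by (simp add: q_def w_def)
      next
        case True
        then have s: "s > 0" using r by simp
        have "\<bar>F (Y i) s - F r s\<bar> = \<bar>(max 0 (s\<^sup>2 - (Y i)\<^sup>2)) ^ j - (max 0 (s\<^sup>2 - r\<^sup>2)) ^ j\<bar> * \<bar>h s\<bar>"
          using Fmax[OF Ypos(3) s] Fmax[OF r s] by (simp add: left_diff_distrib[symmetric] abs_mult)
        also have "\<dots> \<le> (real j * (s\<^sup>2) ^ (j - 1) * \<bar>max 0 (s\<^sup>2 - (Y i)\<^sup>2) - max 0 (s\<^sup>2 - r\<^sup>2)\<bar>) * \<bar>h s\<bar>"
          by (intro mult_right_mono abs_power_diff_le) auto
        also have "\<bar>max 0 (s\<^sup>2 - (Y i)\<^sup>2) - max 0 (s\<^sup>2 - r\<^sup>2)\<bar> \<le> \<bar>(Y i)\<^sup>2 - r\<^sup>2\<bar>"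
          by (auto simp: max_def)
        also have "\<bar>(Y i)\<^sup>2 - r\<^sup>2\<bar> = \<bar>Y i - r\<bar> * (Y i + r)"
          using Ypos(3)[of i] r by (simp add: power2_eq_square square_diff_square_factored abs_mult)
        also have "\<dots> \<le> \<bar>Y i - r\<bar> * (3 * r)"
          using Ypos[of i] r by (intro mult_left_mono) auto
        finally have 1: "\<bar>F (Y i) s - F r s\<bar> \<le> (real j * (s\<^sup>2) ^ (j - 1) * (\<bar>Y i - r\<bar> * (3 * r))) * \<bar>h s\<bar>"
          by (simp add: mult_left_mono mult_right_mono)
        have "(s\<^sup>2) ^ (j - 1) * 1 \<le> (s\<^sup>2) ^ (j - 1) * (s * (2 / r))\<^sup>2"
          using True r by (intro mult_left_mono one_le_power) (auto simp: field_simps)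
        also have "\<dots> = (2 / r)\<^sup>2 * ((s\<^sup>2) ^ (j - 1) * s\<^sup>2)" by (simp only: power_mult_distrib mult_ac)
        also have "(s\<^sup>2) ^ (j - 1) * s\<^sup>2 = s ^ (2 * j)"
          using j power_minus_mult[of j "s\<^sup>2"] by (simp only: power_mult)
        finally have 2: "(s\<^sup>2) ^ (j - 1) \<le> (2 / r)\<^sup>2 * s ^ (2 * j)" by simp
        have "\<bar>F (Y i) s - F r s\<bar> / \<bar>Y i - r\<bar> \<le> (real j * (s\<^sup>2) ^ (j - 1) * (3 * r)) * \<bar>h s\<bar>"
          using 1 Y(1)[of i] by (simp add: divide_le_eq mult_ac)
        also have "\<dots> \<le> (real j * ((2 / r)\<^sup>2 * s ^ (2 * j)) * (3 * r)) * \<bar>h s\<bar>"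
          using 2 r by (intro mult_right_mono mult_left_mono) auto
        also have "\<dots> = w s" using True s by (simp add: w_def abs_mult mult_ac)
        finally show ?thesis by (simp add: q_def abs_divide)
      qed
    qed
    show "AE s in lborel. (\<lambda>i. q i s) \<longlonglongrightarrow> d s"
      using AE_lborel_singleton[of r]
    proof eventually_elim
      fix s assume s: "s \<noteq> r"
      have "((\<lambda>u. F u s) has_real_derivative d s) (at r)"
      proof (cases "s > r")
        case True
        have "((\<lambda>u. (s\<^sup>2 - u\<^sup>2) ^ j * h s) has_real_derivative d s) (at r)"
          using True by (auto intro!: derivative_eq_intros simp: d_def)
        moreover have "\<forall>\<^sub>F u in nhds r. F u s = (s\<^sup>2 - u\<^sup>2) ^ j * h s"
          using eventually_nhds_in_open[of "{..<s}" r] True by (auto elim!: eventually_mono simp: F_def)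
        ultimately show ?thesis by (subst DERIV_cong_ev) auto
      next
        case False
        have "\<forall>\<^sub>F u in nhds r. F u s = 0"
          using eventually_nhds_in_open[of "{s<..}" r] False s by (auto elim!: eventually_mono simp: F_def)
        moreover have "d s = 0" using False by (simp add: d_def)
        ultimately show ?thesis by (subst DERIV_cong_ev[of r r "\<lambda>u. F u s" "\<lambda>_. 0"]) auto
      qed
      then have "((\<lambda>y. (F y s - F r s) / (y - r)) \<longlongrightarrow> d s) (at r)"
        by (simp add: has_field_derivative_iff)
      from filterlim_compose[OF this Ylim] show "(\<lambda>i. q i s) \<longlonglongrightarrow> d s"
        by (simp add: q_def)
    qed
  qed
  also have "(LINT s|lborel. d s) = - 2 * real j * r * tail_power (j - 1) h r"
    unfolding d_def tail_power_def by (rule integral_mult_right_zero)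
  also have "(\<lambda>i. LINT s|lborel. q i s) = (\<lambda>i. (tail_power j h (Y i) - tail_power j h r) / (Y i - r))"
  proof -
    have "tail_power j h u = integral\<^sup>L lborel (F u)" for u
      by (simp add: tail_power_def F_def)
    then show ?thesis using Fint[OF Ypos(3)] Fint[OF r] by (simp add: q_def fun_eq_iff)
  qed
  finally show "((\<lambda>y. (tail_power j h y - tail_power j h r) / (y - r)) \<circ> X) \<longlonglongrightarrow> - 2 * real j * r * tail_power (j - 1) h r"
    unfolding Y_def comp_def by (rule LIMSEQ_offset)
qed

lemma minus_D_cong:
  assumes "\<And>u. u > 0 \<Longrightarrow> F u = F' u" "r > 0"
  shows "minus_D F r = minus_D F' r"
proof -
  have "\<forall>\<^sub>F u in nhds r. F u = F' u"
    using eventually_nhds_in_open[of "{0<..}" r] assms by (auto elim!: eventually_mono)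
  then show ?thesis unfolding minus_D_def by (simp add: deriv_cong_ev)
qed

lemma minus_D_DERIV: "(F has_real_derivative D) (at r) \<Longrightarrow> minus_D F r = - (1 / (2 * r) * D)"
  by (simp add: minus_D_def DERIV_imp_deriv)

lemma minus_D_funpow_tail_power:
  fixes h :: "real \<Rightarrow> real"
  assumes hm: "h \<in> borel_measurable borel"
    and int: "\<And>r. r > 0 \<Longrightarrow> integrable lborel (\<lambda>s. indicator {r<..} s * (s ^ (2 * j) * h s))"
    and F: "\<And>u. u > 0 \<Longrightarrow> F u = c * tail_power j h u"
  shows "i \<le> j \<Longrightarrow> r > 0 \<Longrightarrow> (minus_D ^^ i) F r = c * (fact j / fact (j - i)) * tail_power (j - i) h r"
proof (induction i arbitrary: r)
  case 0
  then show ?case using F by simp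
next
  case (Suc i)
  define C where "C = c * (fact j / fact (j - i))"
  have d: "(tail_power (j - i) h has_real_derivative - 2 * real (j - i) * r * tail_power (j - i - 1) h r) (at r)"
    by (rule tail_power_has_derivative[OF hm])
       (use Suc.prems tail_moment_mono[OF hm int, of _ "j - i"] in auto)
  have "(minus_D ^^ Suc i) F r = minus_D ((minus_D ^^ i) F) r" by simp
  also have "\<dots> = minus_D (\<lambda>u. C * tail_power (j - i) h u) r"
    using Suc by (intro minus_D_cong) (auto simp: C_def)
  also have "\<dots> = - (1 / (2 * r) * (C * (- 2 * real (j - i) * r * tail_power (j - i - 1) h r)))"
    by (intro minus_D_DERIV DERIV_cmult d)
  also have "\<dots> = C * real (j - i) * tail_power (j - Suc i) h r"
    using Suc.prems by (simp add: field_simps)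
  also have "C * real (j - i) = c * (fact j / fact (j - Suc i))"
  proof -
    have "j - i = Suc (j - Suc i)" using Suc.prems by simp
    then have "(fact (j - i) :: real) = real (j - i) * fact (j - Suc i)" by (metis fact_Suc of_nat_fact of_nat_mult)
    then show ?thesis using Suc.prems by (simp add: C_def)
  qed
  finally show ?case .
qed

text \<open>The first j derivatives act on the kernel and exist at every radius, as they must, since
  a derivative needs its function on a neighbourhood; only the last one falls on h and asks for a
  Lebesgue point.\<close>

lemma minus_D_funpow_lebesgue_point:
  fixes h :: "real \<Rightarrow> real"
  assumes hm: "h \<in> borel_measurable borel"
    and int: "\<And>r. r > 0 \<Longrightarrow> integrable lborel (\<lambda>s. indicator {r<..} s * (s ^ (2 * j) * h s))"
    and F: "\<And>u. u > 0 \<Longrightarrow> F u = c * tail_power j h u"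
    and r: "r > 0" and leb: "lebesgue_point h r"
  shows "(minus_D ^^ Suc j) F r = c * fact j * h r / (2 * r)"
proof -
  have "(minus_D ^^ Suc j) F r = minus_D ((minus_D ^^ j) F) r" by simp
  also have "\<dots> = minus_D (\<lambda>u. c * fact j * (LINT s|lborel. indicator {u<..} s * h s)) r"
    using minus_D_funpow_tail_power[OF hm int F, of j] r
    by (intro minus_D_cong) (auto simp: tail_power_def)
  also have "\<dots> = - (1 / (2 * r) * (c * fact j * - h r))"
    using tail_moment_mono[OF hm int, of _ 0]
    by (intro minus_D_DERIV DERIV_cmult tail_integral_has_derivative[OF hm _ r leb]) auto
  finally show ?thesis by simp
qed

section \<open>Inversion by the Erdelyi--Kober derivative\<close>

lemma AE_null_superset:
  assumes "AE x in M. P x"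
  shows "\<exists>N. N \<in> null_sets M \<and> (\<forall>x\<in>space M. x \<notin> N \<longrightarrow> P x)"
proof -
  obtain N where "{x \<in> space M. \<not> P x} \<subseteq> N" "emeasure M N = 0" "N \<in> sets M" by (rule AE_E[OF assms])
  then show ?thesis by (intro exI[of _ N]) (auto simp: null_sets_def)
qed

lemma borel_measurable_completion_AE:
  assumes g: "g \<in> measurable M N" and eq: "AE x in M. f x = g x" and sp: "\<And>x. x \<in> space M \<Longrightarrow> f x \<in> space N"
  shows "f \<in> measurable (completion M) N"
proof (rule measurableI)
  show "f x \<in> space N" if "x \<in> space (completion M)" for x using that sp by simp
  fix A assume A: "A \<in> sets N"
  obtain Z where Z: "Z \<in> null_sets M" "\<forall>x\<in>space M. x \<notin> Z \<longrightarrow> f x = g x"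
    using AE_null_superset[OF eq] by blast
  have "f -` A \<inter> space (completion M) = ((g -` A \<inter> space M) - Z) \<union> (f -` A \<inter> space M \<inter> Z)"
    using Z by auto
  moreover have "(g -` A \<inter> space M) - Z \<in> sets (completion M)"
    using measurable_sets[OF g A] Z by auto
  moreover have "f -` A \<inter> space M \<inter> Z \<in> sets (completion M)"
    by (rule completion.complete[of _ Z]) (use Z in \<open>auto intro: null_sets_completionI\<close>)
  ultimately show "f -` A \<inter> space (completion M) \<in> sets (completion M)" by (simp only: sets.Un)
qed

text \<open>The definitions integrate over completed measures, while Fubini's theorem and image
  measures are applied to Borel representatives; this passes between the two.\<close>

lemma integral_completion_AE:
  fixes f g :: "'a \<Rightarrow> real"
  assumes g: "g \<in> borel_measurable M" and eq: "AE x in M. f x = g x"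
  shows "(LINT x|completion M. f x) = (LINT x|M. g x)"
    and "integrable (completion M) f \<longleftrightarrow> integrable M g"
proof -
  have f: "f \<in> borel_measurable (completion M)"
    by (rule borel_measurable_completion_AE[OF g eq]) simp
  have eq': "AE x in completion M. f x = g x" using eq by (rule AE_completion)
  have "(LINT x|completion M. f x) = (LINT x|completion M. g x)"
    by (rule integral_cong_AE[OF f measurable_completion[OF g] eq'])
  then show "(LINT x|completion M. f x) = (LINT x|M. g x)" by (simp add: integral_completion g)
  have "integrable (completion M) f \<longleftrightarrow> integrable (completion M) g"
    by (rule integrable_cong_AE[OF f measurable_completion[OF g] eq'])
  then show "integrable (completion M) f \<longleftrightarrow> integrable M g" by (simp add: integrable_completion g)
qed

text \<open>For k = n - 2 and g the spherical means of f around x, this is the mean value of the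
  plane integrals of f at distance r from x.\<close>

definition EK_mean :: "nat \<Rightarrow> (real \<Rightarrow> real) \<Rightarrow> real \<Rightarrow> real" where
  "EK_mean k g r = (LINT s|lborel. radial_weight k r s * g s)"

text \<open>The exponent k - 1 is the growth of \<open>radial_weight k r s\<close> as s tends to
  infinity.\<close>

definition tail_integrable :: "nat \<Rightarrow> (real \<Rightarrow> real) \<Rightarrow> bool" where
  "tail_integrable k g \<longleftrightarrow> g \<in> borel_measurable borel \<and>
     (\<forall>r>0. integrable lborel (\<lambda>s. indicator {r<..} s * (s ^ (k - 1) * g s)))"

section \<open>Even dimension\<close>

lemma EK_mean_even:
  assumes "N \<ge> 1" "r > 0"
  shows "EK_mean (2 * N) g r = real (2 * N) * unit_ball_vol (real (2 * N)) * tail_power (N - 1) (\<lambda>s. s * g s) r"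
proof -
  have "radial_weight (2 * N) r s * g s = real (2 * N) * unit_ball_vol (real (2 * N)) *
      (indicator {r<..} s * ((s\<^sup>2 - r\<^sup>2) ^ (N - 1) * (s * g s)))" for s
  proof (cases "s > r")
    case True
    then have "s\<^sup>2 - r\<^sup>2 > 0" using assms by (simp add: power_strict_mono)
    moreover have "real (2 * N) / 2 - 1 = real (N - 1)" using assms by (simp add: of_nat_diff)
    ultimately have "(s\<^sup>2 - r\<^sup>2) powr (real (2 * N) / 2 - 1) = (s\<^sup>2 - r\<^sup>2) ^ (N - 1)"
      by (simp only: powr_realpow)
    then show ?thesis by (simp add: radial_weight_def)
  qed (simp add: radial_weight_def)
  then show ?thesis unfolding EK_mean_def tail_power_def by (simp only: integral_mult_right_zero)
qed

lemma tail_integrable_even: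
  assumes g: "tail_integrable (2 * N) g" and N: "N \<ge> 1"
  shows "(\<lambda>s. s * g s) \<in> borel_measurable borel"
    and "r > 0 \<Longrightarrow> integrable lborel (\<lambda>s. indicator {r<..} s * (s ^ (2 * (N - 1)) * (s * g s)))"
proof -
  have [measurable]: "g \<in> borel_measurable borel" using g by (simp add: tail_integrable_def)
  show "(\<lambda>s. s * g s) \<in> borel_measurable borel" by measurable
  have "2 * N - 1 = Suc (2 * (N - 1))" using N by simp
  then have eq: "s ^ (2 * N - 1) * g s = s ^ (2 * (N - 1)) * (s * g s)" for s :: real by (simp only: power_Suc2 mult.assoc)
  show "r > 0 \<Longrightarrow> integrable lborel (\<lambda>s. indicator {r<..} s * (s ^ (2 * (N - 1)) * (s * g s)))"
    unfolding eq[symmetric] using g unfolding tail_integrable_def by blast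
qed

text \<open>Continuity serves uniqueness: two such means that agree for almost every radius agree
  for every radius. Differentiability gives it for N \<ge> 2; N = 1 is a plain tail integral,
  continuous by dominated convergence.\<close>

lemma isCont_EK_mean_even:
  assumes g: "tail_integrable (2 * N) g" and N: "N \<ge> 1" and r: "r > 0"
  shows "isCont (EK_mean (2 * N) g) r"
proof -
  let ?h = "\<lambda>s. s * g s"
  have hm[measurable]: "?h \<in> borel_measurable borel" and
     int: "\<And>r. r > 0 \<Longrightarrow> integrable lborel (\<lambda>s. indicator {r<..} s * (s ^ (2 * (N - 1)) * ?h s))"
    using tail_integrable_even[OF g N] by auto
  have "isCont (tail_power (N - 1) ?h) r"
  proof (cases "N - 1 \<ge> 1")
    case True
    show ?thesis by (rule DERIV_isCont[OF tail_power_has_derivative[OF hm int r True]])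
  next
    case False
    then have N1: "N - 1 = 0" by simp
    have int0: "integrable lborel (\<lambda>s. indicator {u<..} s * ?h s)" if "u > 0" for u using int[OF that] N1 by simp
    show ?thesis
      unfolding isCont_def tendsto_at_iff_sequentially
    proof (intro allI impI)
      fix X :: "nat \<Rightarrow> real" assume X: "\<forall>i. X i \<in> UNIV - {r}" "X \<longlonglongrightarrow> r"
      obtain M where M: "\<And>i. i \<ge> M \<Longrightarrow> \<bar>X i - r\<bar> < r / 2"
        using X(2) r unfolding LIMSEQ_def dist_real_def by (metis half_gt_zero)
      have "(\<lambda>i. LINT s|lborel. indicator {X (i + M)<..} s * ?h s) \<longlonglongrightarrow> (LINT s|lborel. indicator {r<..} s * ?h s)"
      proof (rule integral_dominated_convergence)
        show "integrable lborel (\<lambda>s. \<bar>indicator {r/2<..} s * ?h s\<bar>)" using int0[of "r/2"] r by simp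
        show "AE s in lborel. norm (indicator {X (i + M)<..} s * ?h s) \<le> \<bar>indicator {r/2<..} s * ?h s\<bar>" for i
        proof (rule AE_I2)
          fix s
          have "X (i + M) > r / 2" using M[of "i + M", OF le_add2] by linarith
          then show "norm (indicator {X (i + M)<..} s * ?h s) \<le> \<bar>indicator {r/2<..} s * ?h s\<bar>"
            by (auto simp: indicator_def)
        qed
        show "AE s in lborel. (\<lambda>i. indicator {X (i + M)<..} s * ?h s) \<longlonglongrightarrow> indicator {r<..} s * ?h s"
          using AE_lborel_singleton[of r]
        proof eventually_elim
          fix s assume "s \<noteq> r"
          have Xl: "(\<lambda>i. X (i + M)) \<longlonglongrightarrow> r" using X(2) by (rule LIMSEQ_ignore_initial_segment)
          have "\<forall>\<^sub>F i in sequentially. indicator {X (i + M)<..} s * ?h s = indicator {r<..} s * ?h s"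
          proof (cases "s > r")
            case True
            then have "\<forall>\<^sub>F i in sequentially. X (i + M) < s" by (rule order_tendstoD(2)[OF Xl])
            then show ?thesis by eventually_elim (use True in simp)
          next
            case False
            then have "\<forall>\<^sub>F i in sequentially. X (i + M) > s" using \<open>s \<noteq> r\<close> by (intro order_tendstoD(1)[OF Xl]) simp
            then show ?thesis by eventually_elim (use False in simp)
          qed
          then show "(\<lambda>i. indicator {X (i + M)<..} s * ?h s) \<longlonglongrightarrow> indicator {r<..} s * ?h s"
            by (rule tendsto_eventually)
        qed
      qed measurable
      then show "(tail_power (N - 1) ?h \<circ> X) \<longlonglongrightarrow> tail_power (N - 1) ?h r"
        unfolding comp_def N1 tail_power_def power_0 mult_1 by (rule LIMSEQ_offset[where k=M])
    qed
  qed
  then have "isCont (\<lambda>u. real (2 * N) * unit_ball_vol (real (2 * N)) * tail_power (N - 1) ?h u) r"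
    by (intro continuous_intros)
  moreover have "\<forall>\<^sub>F u in nhds r. EK_mean (2 * N) g u = real (2 * N) * unit_ball_vol (real (2 * N)) * tail_power (N - 1) ?h u"
  proof -
    have "\<forall>\<^sub>F u in nhds r. u \<in> {0<..}" by (rule eventually_nhds_in_open) (use r in auto)
    then show ?thesis by eventually_elim (rule EK_mean_even[OF N], simp)
  qed
  ultimately show ?thesis by (simp only: isCont_cong)
qed

lemma EK_deriv_even:
  assumes k: "even k" "k \<ge> 1" and g: "tail_integrable k g"
    and mv: "\<And>q. q > 0 \<Longrightarrow> mv q = EK_mean k g q" and r: "r > 0" and leb: "lebesgue_point g r"
  shows "pi powr (1 - real (k + 2) / 2) * EK_deriv (k + 2) mv r = g r"
proof -
  obtain N where N: "k = 2 * N" "N \<ge> 1" using k by (auto elim!: evenE)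
  let ?h = "\<lambda>s. s * g s"
  have gm: "g \<in> borel_measurable borel" using g by (simp add: tail_integrable_def)
  have "lebesgue_point ?h r" by (rule lebesgue_point_mult[OF gm _ leb]) simp
  then have "(minus_D ^^ Suc (N - 1)) mv r = real (2 * N) * unit_ball_vol (real (2 * N)) * fact (N - 1) * ?h r / (2 * r)"
    using tail_integrable_even[OF g[unfolded N(1)] N(2)] mv N r
    by (intro minus_D_funpow_lebesgue_point) (auto simp: EK_mean_even)
  moreover have "EK_deriv (k + 2) mv r = (minus_D ^^ Suc (N - 1)) mv r"
    using N by (simp add: EK_deriv_def)
  \<comment> \<open>The constants collapse: 2 N times \<pi>^N / N! times (N - 1)! / 2 is \<pi>^N,
    which the prefactor cancels.\<close>
  moreover have "unit_ball_vol (real (2 * N)) = pi ^ N / fact N" by (rule unit_ball_vol_even)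
  moreover have "(fact N :: real) = real N * fact (N - 1)" using N by (simp add: fact_reduce)
  moreover have "pi powr (1 - real (k + 2) / 2) = 1 / pi ^ N"
  proof -
    have "1 - real (k + 2) / 2 = - real N" using N by (simp add: field_simps)
    then show ?thesis by (simp only: powr_minus_divide powr_realpow[OF pi_gt_zero])
  qed
  ultimately have "pi powr (1 - real (k + 2) / 2) * EK_deriv (k + 2) mv r =
      1 / pi ^ N * (real (2 * N) * (pi ^ N / (real N * fact (N - 1))) * fact (N - 1) * (r * g r) / (2 * r))"
    by (simp only:)
  also have "\<dots> = g r" using r N by simp
  finally show ?thesis .
qed

section \<open>Odd dimension: a half-order integral makes the order an integer\<close>

definition beta_kernel :: "nat \<Rightarrow> real \<Rightarrow> real \<Rightarrow> real" where
  "beta_kernel k t q = (if t < q then (q\<^sup>2 - t\<^sup>2) powr (1 / 2 - 1) * q powr (- real k) else 0)"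

lemma beta_kernel_measurable[measurable]: "beta_kernel k t \<in> borel_measurable borel"
  unfolding beta_kernel_def[abs_def] by measurable

lemma beta_kernel_nonneg: "0 \<le> beta_kernel k t q"
  by (simp add: beta_kernel_def)

lemma radial_weight_measurable2[measurable (raw)]:
  assumes [measurable]: "R \<in> borel_measurable M" "S \<in> borel_measurable M"
  shows "(\<lambda>x. radial_weight k (R x) (S x)) \<in> borel_measurable M"
proof -
  have "radial_weight k r s = (if r < s then real k * unit_ball_vol (real k) * (s\<^sup>2 - r\<^sup>2) powr (real k / 2 - 1) * s else 0)" for r s
    by (simp add: radial_weight_def)
  then show ?thesis by simp
qed

text \<open>The algebra of \<open>beta_substitution\<close> with every positive quantity written as
  an exponential, so that an identity of powers becomes a linear identity of exponents.\<close>

lemma beta_substitution_exp: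
  fixes p u \<rho> \<sigma> \<tau> \<kappa> a :: real
  shows "(exp p * (exp \<sigma>)\<^sup>2 / (exp \<rho> * (exp \<kappa>)\<^sup>2)) powr (1 / 2 - 1) * ((exp \<tau>)\<^sup>2 * exp u / (exp \<rho> * (exp \<kappa>)\<^sup>2)) powr (a - 1)
      * (2 * (exp \<sigma>)\<^sup>2 * (exp \<tau>)\<^sup>2 / (exp \<rho> * (exp \<kappa>) ^ 3)) =
    2 * exp \<sigma> * exp \<tau> powr (2 * a) * exp \<rho> powr (1 / 2 - a) * (exp p powr (1 / 2 - 1) * exp u powr (a - 1) * exp \<kappa> powr (- (2 * a)))"
proof -
  have e: "(exp x)\<^sup>2 = exp (2 * x)" "exp x ^ 3 = exp (3 * x)" for x :: real
    using exp_of_nat_mult[of 2 x] exp_of_nat_mult[of 3 x] by simp_all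
  have 1: "exp p * (exp \<sigma>)\<^sup>2 / (exp \<rho> * (exp \<kappa>)\<^sup>2) = exp (p + 2 * \<sigma> - \<rho> - 2 * \<kappa>)"
    "(exp \<tau>)\<^sup>2 * exp u / (exp \<rho> * (exp \<kappa>)\<^sup>2) = exp (2 * \<tau> + u - \<rho> - 2 * \<kappa>)"
    "2 * (exp \<sigma>)\<^sup>2 * (exp \<tau>)\<^sup>2 / (exp \<rho> * (exp \<kappa>) ^ 3) = 2 * exp (2 * \<sigma> + 2 * \<tau> - \<rho> - 3 * \<kappa>)"
    unfolding e by (simp_all add: exp_diff exp_add)
  show ?thesis
    unfolding 1 exp_powr_real
    by (simp add: exp_add[symmetric] mult.assoc mult.left_commute[of _ 2]) (simp add: algebra_simps add_divide_distrib diff_divide_distrib)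
qed

lemma beta_substitution:
  fixes q s t a :: real
  assumes "0 < t" "t < q" "q < s"
  shows "((q\<^sup>2 - t\<^sup>2) * s\<^sup>2 / ((s\<^sup>2 - t\<^sup>2) * q\<^sup>2)) powr (1 / 2 - 1) * (1 - (q\<^sup>2 - t\<^sup>2) * s\<^sup>2 / ((s\<^sup>2 - t\<^sup>2) * q\<^sup>2)) powr (a - 1)
      * (2 * s\<^sup>2 * t\<^sup>2 / ((s\<^sup>2 - t\<^sup>2) * q ^ 3)) =
    2 * s * t powr (2 * a) * (s\<^sup>2 - t\<^sup>2) powr (1 / 2 - a) * ((q\<^sup>2 - t\<^sup>2) powr (1 / 2 - 1) * (s\<^sup>2 - q\<^sup>2) powr (a - 1) * q powr (- (2 * a)))"
proof -
  have pos: "q\<^sup>2 - t\<^sup>2 > 0" "s\<^sup>2 - q\<^sup>2 > 0" "s\<^sup>2 - t\<^sup>2 > 0" "q > 0" "s > 0"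
    using assms by (auto simp: power_strict_mono)
  have "1 - (q\<^sup>2 - t\<^sup>2) * s\<^sup>2 / ((s\<^sup>2 - t\<^sup>2) * q\<^sup>2) = t\<^sup>2 * (s\<^sup>2 - q\<^sup>2) / ((s\<^sup>2 - t\<^sup>2) * q\<^sup>2)"
    using pos by (simp add: field_simps)
  then show ?thesis
    using beta_substitution_exp[of "ln (q\<^sup>2 - t\<^sup>2)" "ln s" "ln (s\<^sup>2 - t\<^sup>2)" "ln q" "ln t" "ln (s\<^sup>2 - q\<^sup>2)" a] pos assms
    by simp
qed

text \<open>\<open>beta_kernel\<close> is the factor (q^2 - t^2)^(-1/2) q of the half-order integral
  divided by q^(n-1), where n - 1 = k + 1. Composed with \<open>radial_weight\<close> it is a Beta
  integral in the variable \<open>w\<close>.\<close>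

lemma nn_integral_beta_kernel:
  assumes k: "k \<ge> 1" and t: "t > 0"
  shows "(\<integral>\<^sup>+q. ennreal (beta_kernel k t q * radial_weight k q s) \<partial>lborel) =
     ennreal (indicator {t<..} s * (real k * unit_ball_vol (real k) * Beta (1 / 2) (real k / 2) / 2 * (s\<^sup>2 - t\<^sup>2) powr ((real k - 1) / 2) / t ^ k))"
proof (cases "s > t")
  case False
  then have "beta_kernel k t q * radial_weight k q s = 0" for q
    by (simp add: beta_kernel_def radial_weight_def)
  then show ?thesis using False by (simp only:) simp
next
  case True
  define a where "a = real k / 2"
  \<comment> \<open>Increases from 0 at q = t to 1 at q = s, and 1 - w = t^2 (s^2 - q^2) / ((s^2 -
    t^2) q^2), so both singular factors of the kernel become powers of w and 1 - w.\<close>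
  define w where "w = (\<lambda>q. (q\<^sup>2 - t\<^sup>2) * s\<^sup>2 / ((s\<^sup>2 - t\<^sup>2) * q\<^sup>2))"
  define w' where "w' = (\<lambda>q. 2 * s\<^sup>2 * t\<^sup>2 / ((s\<^sup>2 - t\<^sup>2) * q ^ 3))"
  define f where "f = (\<lambda>x::real. x powr (1 / 2 - 1) * (1 - x) powr (a - 1))"
  define K where "K = real k * unit_ball_vol (real k) / 2 * (s\<^sup>2 - t\<^sup>2) powr ((real k - 1) / 2) / t ^ k"
  have R: "s\<^sup>2 - t\<^sup>2 > 0" using True t by (simp add: power_strict_mono)
  have K: "K \<ge> 0" using R t by (simp add: K_def)
  have [measurable]: "f \<in> borel_measurable borel" unfolding f_def by measurable
  have [measurable]: "w \<in> borel_measurable borel" "w' \<in> borel_measurable borel" unfolding w_def w'_def by measurable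
  have wts: "w t = 0" "w s = 1" using R True t by (auto simp: w_def)
  have "(\<integral>\<^sup>+x. ennreal (f x * indicator {w t..w s} x) \<partial>lborel) = (\<integral>\<^sup>+x. ennreal (f (w x) * w' x * indicator {t..s} x) \<partial>lborel)"
  proof (rule nn_integral_substitution)
    show "set_borel_measurable borel {w t..w s} f" unfolding set_borel_measurable_def by measurable
    show "(w has_real_derivative w' q) (at q)" if "q \<in> {t..s}" for q
    proof -
      have *: "((\<lambda>q. (q\<^sup>2 - t\<^sup>2) * s\<^sup>2 / (D * q\<^sup>2)) has_real_derivative 2 * s\<^sup>2 * t\<^sup>2 / (D * q ^ 3)) (at q)"
        if "D \<noteq> 0" "q \<noteq> 0" for D q :: real
        using that by (auto intro!: derivative_eq_intros simp: field_simps power2_eq_square power3_eq_cube)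
      show ?thesis unfolding w_def w'_def using *[of "s\<^sup>2 - t\<^sup>2" q] that t R by auto
    qed
    show "continuous_on {t..s} w'" unfolding w'_def using t R by (intro continuous_intros) auto
    show "0 \<le> w' q" if "q \<in> {t..s}" for q using that t R by (simp add: w'_def)
  qed (use True in simp)
  moreover have "(\<integral>\<^sup>+x. ennreal (f x * indicator {w t..w s} x) \<partial>lborel) = ennreal (Beta (1 / 2) a)"
  proof -
    have "((\<lambda>x. f x * indicator {0..1} x) has_integral Beta (1 / 2) a) UNIV"
    proof -
      have "(f has_integral Beta (1 / 2) a) {0..1}"
        unfolding f_def using k by (intro has_integral_Beta_real) (auto simp: a_def)
      then have "((\<lambda>x. if x \<in> {0..1} then f x else 0) has_integral Beta (1 / 2) a) UNIV"
        by (simp only: has_integral_restrict_UNIV)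
      then show ?thesis by (rule has_integral_eq[rotated]) (simp add: indicator_def)
    qed
    then show ?thesis
      unfolding wts by (intro nn_integral_has_integral_lborel) (auto simp: f_def)
  qed
  ultimately have B: "(\<integral>\<^sup>+x. ennreal (f (w x) * w' x * indicator {t..s} x) \<partial>lborel) = ennreal (Beta (1 / 2) a)" by simp
  have "(\<integral>\<^sup>+q. ennreal (beta_kernel k t q * radial_weight k q s) \<partial>lborel) =
      (\<integral>\<^sup>+q. ennreal K * ennreal (f (w q) * w' q * indicator {t..s} q) \<partial>lborel)"
  proof (rule nn_integral_cong_AE)
    show "AE q in lborel. ennreal (beta_kernel k t q * radial_weight k q s) = ennreal K * ennreal (f (w q) * w' q * indicator {t..s} q)"
      using AE_lborel_singleton[of s] AE_lborel_singleton[of t]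
    proof eventually_elim
      fix q assume q: "q \<noteq> s" "q \<noteq> t"
      show "ennreal (beta_kernel k t q * radial_weight k q s) = ennreal K * ennreal (f (w q) * w' q * indicator {t..s} q)"
      proof (cases "t < q \<and> q < s")
        case True
        have "f (w q) * w' q = 2 * s * t powr (2 * a) * (s\<^sup>2 - t\<^sup>2) powr (1 / 2 - a) *
            ((q\<^sup>2 - t\<^sup>2) powr (1 / 2 - 1) * (s\<^sup>2 - q\<^sup>2) powr (a - 1) * q powr (- (2 * a)))"
          unfolding f_def w_def w'_def using True t by (intro beta_substitution) auto
        moreover have "(s\<^sup>2 - t\<^sup>2) powr ((real k - 1) / 2) * (s\<^sup>2 - t\<^sup>2) powr (1 / 2 - a) = 1"
          using R by (simp add: powr_add[symmetric] a_def field_simps)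
        moreover have "t powr (2 * a) = t ^ k" using t by (simp add: a_def powr_realpow)
        ultimately have "K * (f (w q) * w' q) = real k * unit_ball_vol (real k) * s * ((q\<^sup>2 - t\<^sup>2) powr (1 / 2 - 1) * (s\<^sup>2 - q\<^sup>2) powr (a - 1) * q powr (- (2 * a)))"
          using t by (simp add: K_def)
        also have "\<dots> = beta_kernel k t q * radial_weight k q s"
          using True by (simp add: beta_kernel_def radial_weight_def a_def)
        finally show ?thesis using True K by (simp add: ennreal_mult'[symmetric])
      next
        case False
        then have "beta_kernel k t q * radial_weight k q s = 0" "indicator {t..s} q = (0::real)"
          using q by (auto simp: beta_kernel_def radial_weight_def)
        then show ?thesis by (simp only:) simp
      qed
    qed
  qed
  also have "\<dots> = ennreal K * ennreal (Beta (1 / 2) a)"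
    by (subst nn_integral_cmult) (simp_all add: B)
  also have "\<dots> = ennreal (K * Beta (1 / 2) a)" using K by (simp add: ennreal_mult')
  finally show ?thesis using True by (simp add: K_def a_def mult_ac)
qed

lemma beta_kernel_double_integral_finite:
  assumes k: "k \<ge> 1" and g: "tail_integrable k g" and t: "t > 0"
  shows "(\<integral>\<^sup>+q. (\<integral>\<^sup>+s. ennreal (beta_kernel k t q * radial_weight k q s * \<bar>g s\<bar>) \<partial>lborel) \<partial>lborel) < \<infinity>"
proof -
  have [measurable]: "g \<in> borel_measurable borel" using g by (simp add: tail_integrable_def)
  define C where "C = real k * unit_ball_vol (real k) * Beta (1 / 2) (real k / 2) / 2 / t ^ k"
  have C: "C \<ge> 0" using k t by (auto simp: C_def Beta_def intro!: divide_nonneg_nonneg mult_nonneg_nonneg Gamma_real_nonneg)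
  have nn: "0 \<le> beta_kernel k t q * radial_weight k q s" for q s
    using t by (cases "t < q") (auto simp: beta_kernel_nonneg radial_weight_nonneg beta_kernel_def)
  have "(\<integral>\<^sup>+q. (\<integral>\<^sup>+s. ennreal (beta_kernel k t q * radial_weight k q s * \<bar>g s\<bar>) \<partial>lborel) \<partial>lborel) =
     (\<integral>\<^sup>+s. (\<integral>\<^sup>+q. ennreal (beta_kernel k t q * radial_weight k q s) * ennreal \<bar>g s\<bar> \<partial>lborel) \<partial>lborel)"
    using nn by (subst lborel_pair.Fubini') (auto simp: ennreal_mult')
  also have "\<dots> = (\<integral>\<^sup>+s. ennreal (indicator {t<..} s * (real k * unit_ball_vol (real k) * Beta (1 / 2) (real k / 2) / 2 * (s\<^sup>2 - t\<^sup>2) powr ((real k - 1) / 2) / t ^ k)) * ennreal \<bar>g s\<bar> \<partial>lborel)"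
    by (subst nn_integral_multc) (simp_all add: nn_integral_beta_kernel[OF k t])
  also have "\<dots> \<le> (\<integral>\<^sup>+s. ennreal C * ennreal (norm (indicator {t<..} s * (s ^ (k - 1) * g s))) \<partial>lborel)"
  proof (rule nn_integral_mono)
    fix s
    show "ennreal (indicator {t<..} s * (real k * unit_ball_vol (real k) * Beta (1 / 2) (real k / 2) / 2 * (s\<^sup>2 - t\<^sup>2) powr ((real k - 1) / 2) / t ^ k)) * ennreal \<bar>g s\<bar>
       \<le> ennreal C * ennreal (norm (indicator {t<..} s * (s ^ (k - 1) * g s)))"
    proof (cases "s > t")
      case True
      then have s: "s > 0" "0 \<le> s\<^sup>2 - t\<^sup>2" using t by (auto simp: power_mono)
      have "(s\<^sup>2 - t\<^sup>2) powr ((real k - 1) / 2) \<le> (s\<^sup>2) powr ((real k - 1) / 2)"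
        using s k by (intro powr_mono2) auto
      also have "(s\<^sup>2) powr ((real k - 1) / 2) = s powr (2 * ((real k - 1) / 2))"
        using s powr_powr[of s 2 "(real k - 1) / 2"] by simp
      also have "2 * ((real k - 1) / 2) = real (k - 1)" using k by (simp add: of_nat_diff)
      also have "s powr real (k - 1) = s ^ (k - 1)" using s by (simp add: powr_realpow)
      finally have "C * (s\<^sup>2 - t\<^sup>2) powr ((real k - 1) / 2) * \<bar>g s\<bar> \<le> C * s ^ (k - 1) * \<bar>g s\<bar>"
        using C by (intro mult_right_mono mult_left_mono) auto
      moreover have "real k * unit_ball_vol (real k) * Beta (1 / 2) (real k / 2) / 2 * (s\<^sup>2 - t\<^sup>2) powr ((real k - 1) / 2) / t ^ k = C * (s\<^sup>2 - t\<^sup>2) powr ((real k - 1) / 2)"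
        by (simp add: C_def)
      ultimately show ?thesis
        using True C s by (simp add: ennreal_mult''[symmetric] abs_mult mult.assoc)
    qed simp
  qed
  also have "\<dots> < \<infinity>"
    using g t by (subst nn_integral_cmult) (auto simp: tail_integrable_def integrable_iff_bounded ennreal_mult_less_top)
  finally show ?thesis .
qed

text \<open>Finiteness of the double integral gives finiteness of the inner one for almost every q >
  t, where the factor \<open>beta_kernel k t q\<close> is positive; t runs through the numbers 1 /
  (m + 1).\<close>

lemma AE_EK_mean_finite:
  assumes k: "k \<ge> 1" and g: "tail_integrable k g"
  shows "AE q in lborel. q > 0 \<longrightarrow> (\<integral>\<^sup>+s. ennreal (radial_weight k q s) * ennreal \<bar>g s\<bar> \<partial>lborel) < \<infinity>"
proof -
  have [measurable]: "g \<in> borel_measurable borel" using g by (simp add: tail_integrable_def)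
  have "AE q in lborel. (\<integral>\<^sup>+s. ennreal (beta_kernel k (1 / real (Suc m)) q * radial_weight k q s * \<bar>g s\<bar>) \<partial>lborel) \<noteq> \<infinity>" for m
    using beta_kernel_double_integral_finite[OF k g, of "1 / real (Suc m)"]
    by (intro nn_integral_PInf_AE) auto
  then have "AE q in lborel. \<forall>m. (\<integral>\<^sup>+s. ennreal (beta_kernel k (1 / real (Suc m)) q * radial_weight k q s * \<bar>g s\<bar>) \<partial>lborel) \<noteq> \<infinity>"
    by (simp add: AE_all_countable)
  then show ?thesis
  proof (eventually_elim, safe)
    fix q :: real
    assume fin: "\<forall>m. (\<integral>\<^sup>+s. ennreal (beta_kernel k (1 / real (Suc m)) q * radial_weight k q s * \<bar>g s\<bar>) \<partial>lborel) \<noteq> \<infinity>" and q: "q > 0"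
    obtain m where m: "1 / real (Suc m) < q" using q reals_Archimedean by (auto simp: inverse_eq_divide)
    then have b: "beta_kernel k (1 / real (Suc m)) q > 0"
    proof -
      have "(1 / real (Suc m))\<^sup>2 < q\<^sup>2" using m q by (intro power_strict_mono) auto
      then show ?thesis using m q by (simp add: beta_kernel_def)
    qed
    have "(\<integral>\<^sup>+s. ennreal (beta_kernel k (1 / real (Suc m)) q * radial_weight k q s * \<bar>g s\<bar>) \<partial>lborel) =
       ennreal (beta_kernel k (1 / real (Suc m)) q) * (\<integral>\<^sup>+s. ennreal (radial_weight k q s) * ennreal \<bar>g s\<bar> \<partial>lborel)"
      using b q by (subst nn_integral_cmult[symmetric]) (auto intro!: nn_integral_cong simp: ennreal_mult' mult.assoc radial_weight_nonneg)
    with fin have "ennreal (beta_kernel k (1 / real (Suc m)) q) * (\<integral>\<^sup>+s. ennreal (radial_weight k q s) * ennreal \<bar>g s\<bar> \<partial>lborel) \<noteq> \<infinity>"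
      by metis
    with b show "(\<integral>\<^sup>+s. ennreal (radial_weight k q s) * ennreal \<bar>g s\<bar> \<partial>lborel) < \<infinity>"
      by (auto simp: less_top ennreal_mult_eq_top_iff)
  qed
qed

text \<open>The mean has order k / 2; half an order more gives (k + 1) / 2 = m + 1, an integer, and
  the exponent (k - 1) / 2 left by the Beta integral is m. The means may differ on a null set of
  radii, since an integration comes first.\<close>

lemma EK_integral_EK_mean:
  assumes k: "k = 2 * m + 1" and g: "tail_integrable k g"
    and mv: "AE q in lborel. q > 0 \<longrightarrow> mv q = EK_mean k g q" and t: "t > 0"
  shows "t ^ k * EK_integral (1 / 2) (\<lambda>q. mv q / q ^ (k + 1)) t =
    2 / Gamma (1 / 2) * (real k * unit_ball_vol (real k) * Beta (1 / 2) (real k / 2) / 2) * tail_power m g t"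
proof -
  have k1: "k \<ge> 1" using k by simp
  have [measurable]: "g \<in> borel_measurable borel" using g by (simp add: tail_integrable_def)
  have [measurable]: "EK_mean k g \<in> borel_measurable borel" unfolding EK_mean_def[abs_def] by measurable
  let ?G = "\<lambda>q. beta_kernel k t q * EK_mean k g q"
  have nn: "0 \<le> beta_kernel k t q * radial_weight k q s" for q s
    using t by (cases "t < q") (auto simp: beta_kernel_nonneg radial_weight_nonneg beta_kernel_def)
  have "(LINT q:{t<..}|lebesgue. (q\<^sup>2 - t\<^sup>2) powr (1 / 2 - 1) * (mv q / q ^ (k + 1)) * q) = (LINT q|lborel. ?G q)"
    unfolding set_lebesgue_integral_def
  proof (rule integral_completion_AE(1))
    show "AE q in lborel. indicator {t<..} q *\<^sub>R ((q\<^sup>2 - t\<^sup>2) powr (1 / 2 - 1) * (mv q / q ^ (k + 1)) * q) = ?G q"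
      using mv
    proof eventually_elim
      fix q assume mvq: "q > 0 \<longrightarrow> mv q = EK_mean k g q"
      show "indicator {t<..} q *\<^sub>R ((q\<^sup>2 - t\<^sup>2) powr (1 / 2 - 1) * (mv q / q ^ (k + 1)) * q) = ?G q"
      proof (cases "q > t")
        case True
        then have q: "q > 0" using t by simp
        then have "q powr (- real k) = q / q ^ (k + 1)"
          by (simp add: powr_minus powr_realpow field_simps)
        then show ?thesis using True mvq q by (simp add: beta_kernel_def)
      qed (simp add: beta_kernel_def)
    qed
  qed measurable
  also have "\<dots> = (LINT q|lborel. LINT s|lborel. beta_kernel k t q * radial_weight k q s * g s)"
    by (simp add: EK_mean_def mult.assoc)
  also have "\<dots> = (LINT s|lborel. LINT q|lborel. beta_kernel k t q * radial_weight k q s * g s)"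
  proof (rule lborel_pair.Fubini_integral[symmetric])
    have "(\<integral>\<^sup>+x. ennreal (norm (case x of (q, s) \<Rightarrow> beta_kernel k t q * radial_weight k q s * g s)) \<partial>(lborel \<Otimes>\<^sub>M lborel)) =
      (\<integral>\<^sup>+q. (\<integral>\<^sup>+s. ennreal (beta_kernel k t q * radial_weight k q s * \<bar>g s\<bar>) \<partial>lborel) \<partial>lborel)"
      using nn by (subst lborel.nn_integral_fst[symmetric]) (auto simp: abs_mult[of "_ * _" "g _"] abs_of_nonneg[OF nn])
    also have "\<dots> < \<infinity>" by (rule beta_kernel_double_integral_finite[OF k1 g t])
    finally show "integrable (lborel \<Otimes>\<^sub>M lborel) (\<lambda>(q, s). beta_kernel k t q * radial_weight k q s * g s)"
      by (intro integrableI_bounded) auto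
  qed
  also have "\<dots> = (LINT s|lborel. (real k * unit_ball_vol (real k) * Beta (1 / 2) (real k / 2) / 2 / t ^ k) * (indicator {t<..} s * ((s\<^sup>2 - t\<^sup>2) ^ m * g s)))"
  proof (rule Bochner_Integration.integral_cong[OF refl])
    fix s
    have "(LINT q|lborel. beta_kernel k t q * radial_weight k q s) =
      enn2real (ennreal (indicator {t<..} s * (real k * unit_ball_vol (real k) * Beta (1 / 2) (real k / 2) / 2 * (s\<^sup>2 - t\<^sup>2) powr ((real k - 1) / 2) / t ^ k)))"
      by (subst integral_eq_nn_integral) (use nn in \<open>auto simp: nn_integral_beta_kernel[OF k1 t]\<close>)
    also have "\<dots> = indicator {t<..} s * (real k * unit_ball_vol (real k) * Beta (1 / 2) (real k / 2) / 2 * (s\<^sup>2 - t\<^sup>2) powr ((real k - 1) / 2) / t ^ k)"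
      using k1 t by (intro enn2real_ennreal) (auto simp: Beta_def intro!: divide_nonneg_nonneg mult_nonneg_nonneg Gamma_real_nonneg)
    also have "\<dots> = (real k * unit_ball_vol (real k) * Beta (1 / 2) (real k / 2) / 2 / t ^ k) * (indicator {t<..} s * (s\<^sup>2 - t\<^sup>2) ^ m)"
    proof (cases "s > t")
      case True
      then have "s\<^sup>2 - t\<^sup>2 > 0" using t by (simp add: power_strict_mono)
      then show ?thesis using k by (simp add: powr_realpow)
    qed simp
    finally have "(LINT q|lborel. beta_kernel k t q * radial_weight k q s) = \<dots>" .
    moreover have "(LINT q|lborel. beta_kernel k t q * radial_weight k q s * g s) = (LINT q|lborel. beta_kernel k t q * radial_weight k q s) * g s"
      by (rule integral_mult_left_zero)
    ultimately show "(LINT q|lborel. beta_kernel k t q * radial_weight k q s * g s) = (real k * unit_ball_vol (real k) * Beta (1 / 2) (real k / 2) / 2 / t ^ k) * (indicator {t<..} s * ((s\<^sup>2 - t\<^sup>2) ^ m * g s))"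
      by (simp only: mult.assoc)
  qed
  also have "\<dots> = (real k * unit_ball_vol (real k) * Beta (1 / 2) (real k / 2) / 2 / t ^ k) * tail_power m g t"
    unfolding tail_power_def by (rule integral_mult_right_zero)
  finally show ?thesis using t by (simp add: EK_integral_def)
qed

lemma EK_deriv_odd:
  assumes k: "odd k" and g: "tail_integrable k g"
    and mv: "AE q in lborel. q > 0 \<longrightarrow> mv q = EK_mean k g q" and r: "r > 0" and leb: "lebesgue_point g r"
  shows "pi powr (1 - real (k + 2) / 2) * EK_deriv (k + 2) mv r = g r"
proof -
  obtain m where m: "k = 2 * m + 1" using k by (auto elim!: oddE)
  have gm: "g \<in> borel_measurable borel" using g by (simp add: tail_integrable_def)
  define c where "c = 2 / Gamma (1 / 2) * (real k * unit_ball_vol (real k) * Beta (1 / 2) (real k / 2) / 2)"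
  let ?F = "\<lambda>s. s ^ (k + 2 - 2) * EK_integral (1 / 2) (\<lambda>q. mv q / q ^ (k + 2 - 1)) s"
  have "(minus_D ^^ Suc m) ?F r = c * fact m * g r / (2 * r)"
  proof (rule minus_D_funpow_lebesgue_point[OF gm _ _ r leb])
    show "integrable lborel (\<lambda>s. indicator {r<..} s * (s ^ (2 * m) * g s))" if "r > 0" for r
      using g that m by (simp add: tail_integrable_def)
    show "?F u = c * tail_power m g u" if "u > 0" for u
      using EK_integral_EK_mean[OF m g mv that] by (simp add: c_def)
  qed
  moreover have "EK_deriv (k + 2) mv r = r * (minus_D ^^ Suc m) ?F r"
    using m by (simp add: EK_deriv_def)
  \<comment> \<open>The values of \<Gamma> at 1/2 and k/2 in the Beta function cancel against the
    half-order integral and the ball volume; \<Gamma>((k + 1)/2) = m! cancels the factorial from the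
    differentiations.\<close>
  moreover have c2: "pi powr (1 - real (k + 2) / 2) * c * fact m = 2"
  proof -
    have u: "unit_ball_vol (real k) = pi powr (real k / 2) / (real k / 2 * Gamma (real k / 2))"
    proof -
      have "Gamma (real k / 2 + 1) = real k / 2 * Gamma (real k / 2)"
        using m by (intro Gamma_plus1) (auto elim!: nonpos_Ints_cases)
      then show ?thesis by (simp only: unit_ball_vol_def)
    qed
    have b: "Beta (1 / 2) (real k / 2) = Gamma (1 / 2) * Gamma (real k / 2) / fact m"
      using Gamma_fact[of m, where 'a=real] m by (simp add: Beta_def add_divide_distrib)
    have g0: "Gamma (real k / 2) > 0" "Gamma (1 / 2 :: real) > 0" using m by (auto intro!: Gamma_real_pos)
    have *: "pi powr (1 - real (k + 2) / 2) * pi powr (real k / 2) = 1"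
      by (simp add: powr_add[symmetric] add_divide_distrib)
    have alg: "2 / a * (x * (P / (x / 2 * G)) * (a * G / f) / 2) = 2 * P / f"
      if "a > 0" "x > 0" "G > 0" "f > 0" for a x P G f :: real
      using that by (simp add: field_simps)
    have "real k > 0" "fact m > (0 :: real)" using m by auto
    then have "c = 2 * pi powr (real k / 2) / fact m"
      unfolding c_def u b by (intro alg g0)
    then show ?thesis using * by (simp add: mult.left_commute)
  qed
  ultimately have "pi powr (1 - real (k + 2) / 2) * EK_deriv (k + 2) mv r =
      pi powr (1 - real (k + 2) / 2) * (r * (c * fact m * g r / (2 * r)))"
    by (simp only:)
  also have "\<dots> = (pi powr (1 - real (k + 2) / 2) * c * fact m) * g r / 2" using r by simp
  also have "\<dots> = g r" unfolding c2 by simp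
  finally show ?thesis .
qed

text \<open>For even dimension the mean values must agree for every radius, since only derivatives are
  taken; for odd dimension agreement for almost every radius suffices.\<close>

lemma EK_deriv_inversion:
  assumes n: "n \<ge> 3" and g: "tail_integrable (n - 2) g"
    and even: "\<And>q. even n \<Longrightarrow> q > 0 \<Longrightarrow> mv q = EK_mean (n - 2) g q"
    and ae: "AE q in lborel. q > 0 \<longrightarrow> mv q = EK_mean (n - 2) g q"
    and r: "r > 0" and leb: "lebesgue_point g r"
  shows "pi powr (1 - real n / 2) * EK_deriv n mv r = g r"
proof -
  have n2: "n - 2 + 2 = n" "n - 2 \<ge> 1" using n by auto
  show ?thesis
  proof (cases "even n")
    case True
    then show ?thesis
      using EK_deriv_even[of "n - 2" g mv r] n2 g even r leb by auto
  next
    case False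
    then show ?thesis
      using EK_deriv_odd[of "n - 2" g mv r] n2 g ae r leb by auto
  qed
qed

section \<open>Lebesgue points of spherical means\<close>

lemma abs_add_powr_le:
  fixes a b p :: real
  assumes "p \<ge> 0"
  shows "\<bar>a + b\<bar> powr p \<le> 2 powr p * (\<bar>a\<bar> powr p + \<bar>b\<bar> powr p)"
proof -
  have "\<bar>a + b\<bar> powr p \<le> (2 * max \<bar>a\<bar> \<bar>b\<bar>) powr p" using assms by (intro powr_mono2) auto
  also have "\<dots> = 2 powr p * max \<bar>a\<bar> \<bar>b\<bar> powr p" by (simp add: powr_mult)
  also have "max \<bar>a\<bar> \<bar>b\<bar> powr p \<le> \<bar>a\<bar> powr p + \<bar>b\<bar> powr p" by (simp add: max_def)
  finally show ?thesis by (simp add: mult_left_mono)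
qed

lemma nn_integral_abs_add_powr_le:
  assumes [measurable]: "a \<in> borel_measurable M" "b \<in> borel_measurable M" and p: "p \<ge> (0::real)"
  shows "(\<integral>\<^sup>+x. ennreal (\<bar>a x + b x\<bar> powr p) \<partial>M) \<le>
    ennreal (2 powr p) * ((\<integral>\<^sup>+x. ennreal (\<bar>a x\<bar> powr p) \<partial>M) + (\<integral>\<^sup>+x. ennreal (\<bar>b x\<bar> powr p) \<partial>M))"
proof -
  have "(\<integral>\<^sup>+x. ennreal (\<bar>a x + b x\<bar> powr p) \<partial>M) \<le> (\<integral>\<^sup>+x. ennreal (2 powr p) * (ennreal (\<bar>a x\<bar> powr p) + ennreal (\<bar>b x\<bar> powr p)) \<partial>M)"
    using abs_add_powr_le[OF p] by (intro nn_integral_mono) (simp add: ennreal_mult''[symmetric] flip: ennreal_plus)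
  then show ?thesis by (simp add: nn_integral_cmult nn_integral_add)
qed

text \<open>A measurable f is an almost everywhere limit of continuous functions, in general without
  a majorant. Cutting off with \<open>\<zeta>\<close> and clamping with \<open>cl\<close> provides
  one: f is first approximated by its truncations, and then, with m fixed, the truncation is applied
  to the continuous functions.\<close>

lemma Lp_approx_continuous:
  fixes f :: "'a::euclidean_space \<Rightarrow> real"
  assumes [measurable]: "f \<in> borel_measurable borel" and p: "p \<ge> 1"
    and fin: "(\<integral>\<^sup>+x. ennreal (\<bar>f x\<bar> powr p) \<partial>lborel) < \<infinity>" and \<epsilon>: "\<epsilon> > 0"
  obtains g R where "continuous_on UNIV g" "\<And>x. norm x \<ge> R \<Longrightarrow> g x = 0"
    "(\<integral>\<^sup>+x. ennreal (\<bar>f x - g x\<bar> powr p) \<partial>lborel) \<le> ennreal \<epsilon>"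
proof -
  define \<zeta> :: "nat \<Rightarrow> 'a \<Rightarrow> real" where "\<zeta> = (\<lambda>m x. max 0 (min 1 (real m + 1 - norm x)))"
  define cl :: "nat \<Rightarrow> real \<Rightarrow> real" where "cl = (\<lambda>m y. max (- real m) (min (real m) y))"
  have \<zeta>: "0 \<le> \<zeta> m x" "\<zeta> m x \<le> 1" for m x by (auto simp: \<zeta>_def)
  have [measurable]: "\<zeta> m \<in> borel_measurable borel" "cl m \<in> borel_measurable borel" for m unfolding \<zeta>_def cl_def by measurable
  have cl: "\<bar>cl m y\<bar> \<le> real m" for m y by (auto simp: cl_def)
  define \<epsilon>1 where "\<epsilon>1 = \<epsilon> / (2 * 2 powr p)"
  have \<epsilon>1: "\<epsilon>1 > 0" using \<epsilon> by (simp add: \<epsilon>1_def)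
  define fm where "fm = (\<lambda>m x. \<zeta> m x * cl m (f x))"
  have [measurable]: "fm m \<in> borel_measurable borel" for m unfolding fm_def by measurable
  have "(\<lambda>m. \<integral>\<^sup>+x. ennreal (\<bar>f x - fm m x\<bar> powr p) \<partial>lborel) \<longlonglongrightarrow> (\<integral>\<^sup>+x. 0 \<partial>(lborel::'a measure))"
  proof (rule nn_integral_dominated_convergence[where w="\<lambda>x. ennreal (\<bar>f x\<bar> powr p)"])
    show "AE x in lborel. ennreal (\<bar>f x - fm m x\<bar> powr p) \<le> ennreal (\<bar>f x\<bar> powr p)" for m
    proof (rule AE_I2)
      fix x
      have "\<bar>f x - \<zeta> m x * cl m (f x)\<bar> \<le> \<bar>f x\<bar>"
      proof (cases "f x \<ge> 0")
        case True
        then have "0 \<le> cl m (f x)" "cl m (f x) \<le> f x" by (auto simp: cl_def)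
        then have "0 \<le> \<zeta> m x * cl m (f x)" "\<zeta> m x * cl m (f x) \<le> 1 * cl m (f x)"
          using \<zeta>[of m x] mult_left_le_one_le[of "cl m (f x)" "\<zeta> m x"] by auto
        then show ?thesis using \<open>cl m (f x) \<le> f x\<close> by auto
      next
        case False
        then have "0 \<le> - cl m (f x)" "- cl m (f x) \<le> - f x" by (auto simp: cl_def)
        then have "0 \<le> \<zeta> m x * - cl m (f x)" "\<zeta> m x * - cl m (f x) \<le> 1 * - cl m (f x)"
          using \<zeta>[of m x] mult_left_le_one_le[of "- cl m (f x)" "\<zeta> m x"]
            mult_nonneg_nonpos[of "\<zeta> m x" "cl m (f x)"] by auto
        then show ?thesis using \<open>- cl m (f x) \<le> - f x\<close> by auto
      qed
      then show "ennreal (\<bar>f x - fm m x\<bar> powr p) \<le> ennreal (\<bar>f x\<bar> powr p)"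
        using p by (intro ennreal_leI powr_mono2) (auto simp: fm_def)
    qed
    show "AE x in lborel. (\<lambda>m. ennreal (\<bar>f x - fm m x\<bar> powr p)) \<longlonglongrightarrow> 0"
    proof (rule AE_I2)
      fix x
      obtain M :: nat where M: "norm x + \<bar>f x\<bar> \<le> real M" using real_arch_simple by blast
      have "fm m x = f x" if "m \<ge> M" for m
      proof -
        have "norm x + \<bar>f x\<bar> \<le> real m" using M that by (meson of_nat_mono order_trans)
        then have "\<zeta> m x = 1" "cl m (f x) = f x" by (auto simp: \<zeta>_def cl_def max_def min_def abs_if split: if_splits) (smt (verit) norm_ge_zero)+
        then show ?thesis by (simp add: fm_def)
      qed
      then have "\<forall>\<^sub>F m in sequentially. ennreal (\<bar>f x - fm m x\<bar> powr p) = 0"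
        by (intro eventually_mono[OF eventually_ge_at_top[of M]]) simp
      then show "(\<lambda>m. ennreal (\<bar>f x - fm m x\<bar> powr p)) \<longlonglongrightarrow> 0" by (rule tendsto_eventually)
    qed
  qed (use fin in auto)
  then have "(\<lambda>m. \<integral>\<^sup>+x. ennreal (\<bar>f x - fm m x\<bar> powr p) \<partial>lborel) \<longlonglongrightarrow> 0" by simp
  then have "\<forall>\<^sub>F m in sequentially. (\<integral>\<^sup>+x. ennreal (\<bar>f x - fm m x\<bar> powr p) \<partial>lborel) < ennreal \<epsilon>1"
    using \<epsilon>1 by (intro order_tendstoD) auto
  then obtain m where m: "(\<integral>\<^sup>+x. ennreal (\<bar>f x - fm m x\<bar> powr p) \<partial>lborel) < ennreal \<epsilon>1"
    by (auto simp: eventually_sequentially)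
  have "f \<in> borel_measurable lebesgue" by (rule measurable_completion) simp
  then have "f measurable_on UNIV" by (rule lebesgue_measurable_imp_measurable_on_real) simp
  then obtain N G where NG: "negligible N" "\<And>i. continuous_on UNIV (G i)" "\<And>x. x \<notin> N \<Longrightarrow> (\<lambda>i. G i x) \<longlonglongrightarrow> f x"
    unfolding measurable_on_def by auto
  have "AE x in lebesgue. x \<notin> N" using NG(1) by (simp add: negligible_iff_null_sets AE_not_in)
  then have AEN: "AE x in lborel. x \<notin> N" by (simp add: AE_completion_iff)
  define u where "u = (\<lambda>i x. \<zeta> m x * cl m (G i x))"
  have [measurable]: "G i \<in> borel_measurable borel" for i using NG(2) by (rule borel_measurable_continuous_onI)
  have [measurable]: "u i \<in> borel_measurable borel" for i unfolding u_def by measurable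
  have "(\<lambda>i. \<integral>\<^sup>+x. ennreal (\<bar>fm m x - u i x\<bar> powr p) \<partial>lborel) \<longlonglongrightarrow> (\<integral>\<^sup>+x. 0 \<partial>(lborel::'a measure))"
  proof (rule nn_integral_dominated_convergence[where w="\<lambda>x. ennreal ((2 * real m) powr p) * indicator (cball 0 (real m + 1)) x"])
    show "AE x in lborel. ennreal (\<bar>fm m x - u i x\<bar> powr p) \<le> ennreal ((2 * real m) powr p) * indicator (cball 0 (real m + 1)) x" for i
    proof (rule AE_I2)
      fix x
      show "ennreal (\<bar>fm m x - u i x\<bar> powr p) \<le> ennreal ((2 * real m) powr p) * indicator (cball 0 (real m + 1)) x"
      proof (cases "x \<in> cball 0 (real m + 1)")
        case True
        have "\<bar>fm m x - u i x\<bar> = \<zeta> m x * \<bar>cl m (f x) - cl m (G i x)\<bar>"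
          using \<zeta>[of m x] by (simp add: fm_def u_def right_diff_distrib[symmetric] abs_mult)
        also have "\<dots> \<le> 1 * (2 * real m)"
          using \<zeta>[of m x] cl[of m "f x"] cl[of m "G i x"] by (intro mult_mono) auto
        finally show ?thesis using True p by (simp add: ennreal_leI powr_mono2)
      next
        case False
        then have "\<zeta> m x = 0" by (auto simp: \<zeta>_def)
        then show ?thesis by (simp add: fm_def u_def)
      qed
    qed
    show "AE x in lborel. (\<lambda>i. ennreal (\<bar>fm m x - u i x\<bar> powr p)) \<longlonglongrightarrow> 0"
      using AEN
    proof eventually_elim
      fix x assume "x \<notin> N"
      then have "(\<lambda>i. u i x) \<longlonglongrightarrow> fm m x"
        unfolding u_def fm_def cl_def by (intro tendsto_intros NG(3))
      then have "(\<lambda>i. \<bar>fm m x - u i x\<bar>) \<longlonglongrightarrow> \<bar>fm m x - fm m x\<bar>" by (intro tendsto_intros)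
      then have "(\<lambda>i. \<bar>fm m x - u i x\<bar> powr p) \<longlonglongrightarrow> \<bar>fm m x - fm m x\<bar> powr p"
        using p by (intro tendsto_powr') auto
      then show "(\<lambda>i. ennreal (\<bar>fm m x - u i x\<bar> powr p)) \<longlonglongrightarrow> 0"
        using tendsto_ennrealI by fastforce
    qed
    show "(\<integral>\<^sup>+x. ennreal ((2 * real m) powr p) * indicator (cball 0 (real m + 1)) x \<partial>(lborel::'a measure)) < \<infinity>"
      by (subst nn_integral_cmult_indicator) (auto simp: ennreal_mult_less_top emeasure_cball)
    show "(\<lambda>x. ennreal (\<bar>fm m x - u i x\<bar> powr p)) \<in> borel_measurable lborel" for i by measurable
    show "(\<lambda>x. ennreal ((2 * real m) powr p) * indicator (cball (0::'a) (real m + 1)) x) \<in> borel_measurable lborel"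
      by (intro borel_measurable_times_ennreal borel_measurable_indicator) auto
  qed simp_all
  then have "(\<lambda>i. \<integral>\<^sup>+x. ennreal (\<bar>fm m x - u i x\<bar> powr p) \<partial>lborel) \<longlonglongrightarrow> 0" by simp
  then have "\<forall>\<^sub>F i in sequentially. (\<integral>\<^sup>+x. ennreal (\<bar>fm m x - u i x\<bar> powr p) \<partial>lborel) < ennreal \<epsilon>1"
    using \<epsilon>1 by (intro order_tendstoD) auto
  then obtain i where i: "(\<integral>\<^sup>+x. ennreal (\<bar>fm m x - u i x\<bar> powr p) \<partial>lborel) < ennreal \<epsilon>1"
    by (auto simp: eventually_sequentially)
  show thesis
  proof
    show "continuous_on UNIV (u i)"
      unfolding u_def \<zeta>_def cl_def by (intro continuous_intros NG(2))
    show "u i x = 0" if "norm x \<ge> real m + 1" for x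
      using that by (simp add: u_def \<zeta>_def)
    have "(\<integral>\<^sup>+x. ennreal (\<bar>f x - u i x\<bar> powr p) \<partial>lborel) = (\<integral>\<^sup>+x. ennreal (\<bar>(f x - fm m x) + (fm m x - u i x)\<bar> powr p) \<partial>lborel)"
      by simp
    also have "\<dots> \<le> ennreal (2 powr p) * ((\<integral>\<^sup>+x. ennreal (\<bar>f x - fm m x\<bar> powr p) \<partial>lborel) + (\<integral>\<^sup>+x. ennreal (\<bar>fm m x - u i x\<bar> powr p) \<partial>lborel))"
      using p by (intro nn_integral_abs_add_powr_le) auto
    also have "\<dots> \<le> ennreal (2 powr p) * (ennreal \<epsilon>1 + ennreal \<epsilon>1)"
      using m i by (intro mult_left_mono add_mono) auto
    also have "\<dots> = ennreal (2 powr p * (\<epsilon>1 + \<epsilon>1))"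
      using \<epsilon>1 by (simp add: ennreal_mult''[symmetric] ennreal_plus[symmetric] del: ennreal_plus)
    also have "2 powr p * (\<epsilon>1 + \<epsilon>1) = \<epsilon>" by (simp add: \<epsilon>1_def)
    finally show "(\<integral>\<^sup>+x. ennreal (\<bar>f x - u i x\<bar> powr p) \<partial>lborel) \<le> ennreal \<epsilon>" .
  qed
qed

text \<open>Covers compact support as well as decay: two points at distance below 1 lie both in the
  ball of radius R + 1, where g is uniformly continuous, or both outside radius R, where |g| <
  \<epsilon> / 2.\<close>

lemma uniform_modulus_vanishing_at_infinity:
  fixes g :: "'a::euclidean_space \<Rightarrow> real"
  assumes g: "continuous_on UNIV g" "\<And>x. norm x \<ge> R \<Longrightarrow> 2 * \<bar>g x\<bar> < \<epsilon>" and \<epsilon>: "\<epsilon> > 0"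
  obtains d where "d > 0" "d \<le> 1" "\<And>x y. dist x y < d \<Longrightarrow> \<bar>g x - g y\<bar> < \<epsilon>"
proof -
  have "uniformly_continuous_on (cball 0 (R + 1)) g"
    using g(1) by (intro compact_uniformly_continuous) (auto intro: continuous_on_subset)
  then obtain d where d: "d > 0" "\<And>x y. x \<in> cball 0 (R + 1) \<Longrightarrow> y \<in> cball 0 (R + 1) \<Longrightarrow> dist y x < d \<Longrightarrow> \<bar>g y - g x\<bar> < \<epsilon>"
    using \<epsilon> unfolding uniformly_continuous_on_def dist_real_def by meson
  show thesis
  proof
    show "min d 1 > 0" "min d 1 \<le> 1" using d by auto
    fix x y :: 'a assume xy: "dist x y < min d 1"
    show "\<bar>g x - g y\<bar> < \<epsilon>"
    proof (cases "x \<in> cball 0 (R + 1) \<and> y \<in> cball 0 (R + 1)")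
      case True
      then show ?thesis using d(2)[of y x] xy by auto
    next
      case False
      have "norm x \<le> norm y + dist x y" "norm y \<le> norm x + dist x y"
        using norm_triangle_ineq2[of x y] norm_triangle_ineq2[of y x] by (auto simp: dist_norm norm_minus_commute)
      then have "norm x \<ge> R" "norm y \<ge> R" using False xy by auto
      then have "2 * \<bar>g x\<bar> < \<epsilon>" "2 * \<bar>g y\<bar> < \<epsilon>" using g(2) by blast+
      then show ?thesis by linarith
    qed
  qed
qed

lemma compact_support_uniform:
  fixes g :: "'a::euclidean_space \<Rightarrow> real"
  assumes g: "continuous_on UNIV g" "\<And>x. norm x \<ge> R \<Longrightarrow> g x = 0" and \<epsilon>: "\<epsilon> > 0"
  obtains d where "d > 0" "d \<le> 1" "\<And>x y. dist x y < d \<Longrightarrow> \<bar>g x - g y\<bar> < \<epsilon>"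
  using uniform_modulus_vanishing_at_infinity[of g R \<epsilon>] g \<epsilon> by auto

section \<open>Shell averages and the maximal inequality\<close>

context
  fixes \<xi> :: "real^'n"
  assumes n: "CARD('n) \<ge> 2" and \<xi>: "norm \<xi> = 1"
begin

lemma nn_integral_sph_nn:
  assumes [measurable]: "g \<in> borel_measurable borel"
  shows "(\<integral>\<^sup>+x. sph_nn \<xi> g x s \<partial>lborel) = (\<integral>\<^sup>+x. g x \<partial>lborel)"
proof -
  interpret prob_space "haar_SO :: (real^'n^'n) measure" by (rule prob_space_haar_SO)
  interpret P: pair_sigma_finite "haar_SO :: (real^'n^'n) measure" "lborel :: (real^'n) measure" ..
  have "(\<integral>\<^sup>+x. sph_nn \<xi> g x s \<partial>lborel) = (\<integral>\<^sup>+A. (\<integral>\<^sup>+x. g (x + s *\<^sub>R (A *v \<xi>)) \<partial>lborel) \<partial>haar_SO)"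
    unfolding sph_nn_def by (rule P.Fubini') measurable
  also have "\<dots> = (\<integral>\<^sup>+A. (\<integral>\<^sup>+x. g x \<partial>lborel) \<partial>(haar_SO :: (real^'n^'n) measure))"
  proof (rule nn_integral_cong)
    fix A :: "real^'n^'n"
    show "(\<integral>\<^sup>+x. g (x + s *\<^sub>R (A *v \<xi>)) \<partial>lborel) = (\<integral>\<^sup>+x. g x \<partial>lborel)"
      using nn_integral_lborel_translation[of g "s *\<^sub>R (A *v \<xi>)"] by (simp add: add.commute)
  qed
  finally show ?thesis by (simp add: emeasure_space_1)
qed

lemma norm_rotation: "A \<in> space (haar_SO :: (real^'n^'n) measure) \<Longrightarrow> norm (A *v v) = norm v"
  using rotation_matrix_orthogonal_transformation[of A] by (simp add: space_haar_SO orthogonal_transformation_norm)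

text \<open>From the volume of a small ball around \<open>\<eta>\<close>, in polar coordinates.\<close>

lemma cap_measure_lower_bound:
  obtains c where "c > 0"
    "\<And>\<delta> \<eta>. 0 < \<delta> \<Longrightarrow> \<delta> \<le> 1 \<Longrightarrow> norm \<eta> = 1 \<Longrightarrow>
      ennreal (c * \<delta> ^ (CARD('n) - 1)) \<le> emeasure haar_SO {A \<in> space haar_SO. norm (\<eta> - A *v \<xi>) < \<delta>}"
proof
  let ?n = "CARD('n)"
  let ?\<omega> = "unit_ball_vol (real ?n)"
  \<comment> \<open>K bounds the radial weight for s \<le> 2, which contains all radii up to 1 +
    \<delta> / 4; c turns the comparison with the volume of the ball of radius \<delta> / 4 into a
    lower bound for the cap.\<close>
  define K where "K = real ?n * ?\<omega> * 2 ^ (?n - 1)"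
  define c where "c = ?\<omega> * (1 / 4) ^ ?n / K"
  have K: "K > 0" by (auto simp: K_def intro!: mult_pos_pos)
  show "c > 0" using K by (auto simp: c_def)
  fix \<delta> :: real and \<eta> :: "real^'n" assume \<delta>: "0 < \<delta>" "\<delta> \<le> 1" and \<eta>: "norm \<eta> = 1"
  let ?P = "emeasure haar_SO {A \<in> space haar_SO. norm (\<eta> - A *v \<xi>) < \<delta>}"
  have [measurable]: "ball \<eta> (\<delta> / 4) \<in> sets borel" by simp
  have "ennreal (?\<omega> * (\<delta> / 4) ^ ?n) = (\<integral>\<^sup>+y. indicator (ball \<eta> (\<delta> / 4)) y \<partial>lborel)"
    using \<delta> by (simp add: emeasure_ball)
  also have "\<dots> = (\<integral>\<^sup>+s. ennreal (radial_weight ?n 0 s) * sph_nn \<xi> (indicator (ball \<eta> (\<delta> / 4))) 0 s \<partial>lborel)"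
    by (rule nn_integral_polar[OF n \<xi>]) measurable
  also have "\<dots> \<le> (\<integral>\<^sup>+s. (ennreal K * ?P) * indicator {1 - \<delta> / 4..1 + \<delta> / 4} s \<partial>lborel)"
  proof (rule nn_integral_mono)
    fix s :: real
    show "ennreal (radial_weight ?n 0 s) * sph_nn \<xi> (indicator (ball \<eta> (\<delta> / 4))) 0 s \<le> (ennreal K * ?P) * indicator {1 - \<delta> / 4..1 + \<delta> / 4} s"
    proof (cases "s > 0")
      case False
      then show ?thesis by (simp add: radial_weight_def)
    next
      case s: True
      have in_ball: "\<bar>s - 1\<bar> < \<delta> / 4 \<and> norm (\<eta> - A *v \<xi>) < \<delta>"
        if "A \<in> space haar_SO" "s *\<^sub>R (A *v \<xi>) \<in> ball \<eta> (\<delta> / 4)" for A :: "real^'n^'n"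
      proof -
        have nA: "norm (A *v \<xi>) = 1" using norm_rotation[OF that(1)] \<xi> by simp
        have d: "norm (\<eta> - s *\<^sub>R (A *v \<xi>)) < \<delta> / 4" using that(2) by (simp add: dist_norm)
        have "\<bar>norm \<eta> - norm (s *\<^sub>R (A *v \<xi>))\<bar> \<le> norm (\<eta> - s *\<^sub>R (A *v \<xi>))" by (rule norm_triangle_ineq3)
        then have 1: "\<bar>s - 1\<bar> < \<delta> / 4" using d s \<eta> nA by (simp add: abs_minus_commute)
        have "norm (\<eta> - A *v \<xi>) \<le> norm (\<eta> - s *\<^sub>R (A *v \<xi>)) + norm (s *\<^sub>R (A *v \<xi>) - A *v \<xi>)"
          by (rule order_trans[OF _ norm_triangle_ineq]) simp
        also have "s *\<^sub>R (A *v \<xi>) - A *v \<xi> = (s - 1) *\<^sub>R (A *v \<xi>)" by (simp add: algebra_simps)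
        finally have "norm (\<eta> - A *v \<xi>) < \<delta>" using d 1 nA \<delta> by simp
        with 1 show ?thesis by simp
      qed
      show ?thesis
      proof (cases "\<bar>s - 1\<bar> < \<delta> / 4")
        case False
        then have "sph_nn \<xi> (indicator (ball \<eta> (\<delta> / 4))) 0 s = (\<integral>\<^sup>+A. 0 \<partial>(haar_SO :: (real^'n^'n) measure))"
          unfolding sph_nn_def using in_ball by (intro nn_integral_cong) (auto simp: indicator_def)
        then show ?thesis by simp
      next
        case True
        have "sph_nn \<xi> (indicator (ball \<eta> (\<delta> / 4))) 0 s \<le> (\<integral>\<^sup>+A. indicator {A \<in> space haar_SO. norm (\<eta> - A *v \<xi>) < \<delta>} A \<partial>haar_SO)"
          unfolding sph_nn_def using in_ball by (intro nn_integral_mono) (auto simp: indicator_def)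
        also have "\<dots> = ?P" by (rule nn_integral_indicator) measurable
        finally have 1: "sph_nn \<xi> (indicator (ball \<eta> (\<delta> / 4))) 0 s \<le> ?P" .
        have "s \<le> 2" using abs_ge_self[of "s - 1"] True \<delta> by linarith
        then have "s ^ (?n - 1) \<le> 2 ^ (?n - 1)" using s by (intro power_mono) auto
        then have "radial_weight ?n 0 s \<le> K"
          using s n by (subst radial_weight_0) (auto simp: K_def mult.assoc intro!: mult_left_mono)
        then have "ennreal (radial_weight ?n 0 s) * sph_nn \<xi> (indicator (ball \<eta> (\<delta> / 4))) 0 s \<le> ennreal K * ?P"
          using 1 by (intro mult_mono ennreal_leI) auto
        moreover have "s \<in> {1 - \<delta> / 4..1 + \<delta> / 4}" using True unfolding abs_less_iff by auto
        ultimately show ?thesis by simp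
      qed
    qed
  qed
  also have "\<dots> = (ennreal K * ?P) * ennreal (\<delta> / 2)"
    using \<delta> by (subst nn_integral_cmult_indicator) (auto simp: field_simps)
  also have "\<dots> \<le> ennreal K * ?P * ennreal \<delta>"
    using \<delta> by (intro mult_left_mono ennreal_leI) auto
  finally have main: "ennreal (?\<omega> * (\<delta> / 4) ^ ?n) \<le> ennreal (K * \<delta>) * ?P"
    using K \<delta> by (simp add: ennreal_mult mult_ac)
  have "ennreal (c * \<delta> ^ (?n - 1)) = ennreal (1 / (K * \<delta>)) * ennreal (?\<omega> * (\<delta> / 4) ^ ?n)"
  proof -
    have "\<delta> ^ ?n = \<delta> * \<delta> ^ (?n - 1)" using n by (simp flip: power_Suc)
    then have "c * \<delta> ^ (?n - 1) = 1 / (K * \<delta>) * (?\<omega> * (\<delta> / 4) ^ ?n)"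
      using K \<delta> by (simp add: c_def power_divide field_simps)
    then have "ennreal (c * \<delta> ^ (?n - 1)) = ennreal (1 / (K * \<delta>) * (?\<omega> * (\<delta> / 4) ^ ?n))" by (rule arg_cong)
    also have "\<dots> = ennreal (1 / (K * \<delta>)) * ennreal (?\<omega> * (\<delta> / 4) ^ ?n)"
      using K \<delta> by (intro ennreal_mult) auto
    finally show ?thesis .
  qed
  also have "\<dots> \<le> ennreal (1 / (K * \<delta>)) * (ennreal (K * \<delta>) * ?P)"
    using main by (rule mult_left_mono) simp
  also have "\<dots> = ?P"
    using K \<delta> by (simp add: mult.assoc[symmetric] ennreal_mult''[symmetric])
  finally show "ennreal (c * \<delta> ^ (?n - 1)) \<le> ?P" .
qed

text \<open>A cap of radius \<delta> = h / (2 r) around y / |y| works: the points r A \<xi> over it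
  differ from y by less than |y| \<delta> + h, and |y| \<le> 2 r makes this at most 2 h.\<close>

lemma shell_measure_lower_bound:
  assumes r: "r > 0"
  obtains c where "c > 0"
    "\<And>h y. 0 < h \<Longrightarrow> h \<le> r / 2 \<Longrightarrow> \<bar>norm y - r\<bar> \<le> h \<Longrightarrow>
      ennreal (c * h ^ (CARD('n) - 1)) \<le> emeasure haar_SO {A \<in> space haar_SO. norm (y - r *\<^sub>R (A *v \<xi>)) < 2 * h}"
proof -
  obtain c where c: "c > 0" "\<And>\<delta> \<eta>. 0 < \<delta> \<Longrightarrow> \<delta> \<le> 1 \<Longrightarrow> norm \<eta> = 1 \<Longrightarrow>
      ennreal (c * \<delta> ^ (CARD('n) - 1)) \<le> emeasure haar_SO {A \<in> space haar_SO. norm (\<eta> - A *v \<xi>) < \<delta>}"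
    using cap_measure_lower_bound by blast
  show thesis
  proof
    show "c * (1 / (2 * r)) ^ (CARD('n) - 1) > 0" using c r by simp
    fix h :: real and y :: "real^'n" assume h: "0 < h" "h \<le> r / 2" "\<bar>norm y - r\<bar> \<le> h"
    define \<delta> where "\<delta> = h / (2 * r)"
    have \<delta>: "0 < \<delta>" "\<delta> \<le> 1" using h r by (auto simp: \<delta>_def field_simps)
    have y: "norm y > 0" "norm y \<le> 2 * r" using h r by auto
    have "ennreal (c * (1 / (2 * r)) ^ (CARD('n) - 1) * h ^ (CARD('n) - 1)) = ennreal (c * \<delta> ^ (CARD('n) - 1))"
      by (simp add: \<delta>_def power_divide)
    also have "\<dots> \<le> emeasure haar_SO {A \<in> space haar_SO. norm (y /\<^sub>R norm y - A *v \<xi>) < \<delta>}"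
      using \<delta> y by (intro c(2)) auto
    also have "\<dots> \<le> emeasure haar_SO {A \<in> space haar_SO. norm (y - r *\<^sub>R (A *v \<xi>)) < 2 * h}"
    proof (rule emeasure_mono)
      show "{A \<in> space haar_SO. norm (y /\<^sub>R norm y - A *v \<xi>) < \<delta>} \<subseteq> {A \<in> space haar_SO. norm (y - r *\<^sub>R (A *v \<xi>)) < 2 * h}"
      proof safe
        fix A :: "real^'n^'n" assume A: "A \<in> space haar_SO" "norm (y /\<^sub>R norm y - A *v \<xi>) < \<delta>"
        have nA: "norm (A *v \<xi>) = 1" using norm_rotation[OF A(1)] \<xi> by simp
        have "y - r *\<^sub>R (A *v \<xi>) = norm y *\<^sub>R (y /\<^sub>R norm y - A *v \<xi>) + (norm y - r) *\<^sub>R (A *v \<xi>)"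
          using y by (simp add: algebra_simps)
        then have "norm (y - r *\<^sub>R (A *v \<xi>)) \<le> norm y * norm (y /\<^sub>R norm y - A *v \<xi>) + \<bar>norm y - r\<bar> * norm (A *v \<xi>)"
          using norm_triangle_ineq[of "norm y *\<^sub>R (y /\<^sub>R norm y - A *v \<xi>)" "(norm y - r) *\<^sub>R (A *v \<xi>)"] by simp
        also have "\<dots> < norm y * \<delta> + h"
          using A(2) y nA h by (intro add_less_le_mono mult_strict_left_mono) auto
        also have "norm y * \<delta> \<le> 2 * r * \<delta>" using y \<delta> by (intro mult_right_mono) auto
        also have "2 * r * \<delta> = h" using r by (simp add: \<delta>_def)
        finally show "norm (y - r *\<^sub>R (A *v \<xi>)) < 2 * h" by simp
      qed
    qed measurable
    finally show "ennreal (c * (1 / (2 * r)) ^ (CARD('n) - 1) * h ^ (CARD('n) - 1)) \<le> emeasure haar_SO {A \<in> space haar_SO. norm (y - r *\<^sub>R (A *v \<xi>)) < 2 * h}" .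
  qed
qed

text \<open>Each y in the shell with radii between r - h and r + h around x is of the form z + r A
  \<xi> with z in the ball of radius 2 h around x, for a set of rotations A of measure at least c
  h^(n-1). Integrating over y and substituting z compares the shell integral with spherical means
  centred in that ball.\<close>

lemma shell_average_le:
  assumes r: "r > 0"
  obtains C where "C > 0"
    "\<And>g x h. g \<in> borel_measurable borel \<Longrightarrow> 0 < h \<Longrightarrow> h \<le> r / 2 \<Longrightarrow>
      (\<integral>\<^sup>+s. indicator {r - h..r + h} s * sph_nn \<xi> g x s \<partial>lborel) * ennreal (h ^ (CARD('n) - 1)) \<le>
      ennreal C * (\<integral>\<^sup>+z. indicator (ball x (2 * h)) z * sph_nn \<xi> g z r \<partial>lborel)"
proof -
  let ?n = "CARD('n)"
  interpret prob_space "haar_SO :: (real^'n^'n) measure" by (rule prob_space_haar_SO)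
  interpret P: pair_sigma_finite "haar_SO :: (real^'n^'n) measure" "lborel :: (real^'n) measure" ..
  obtain c where c: "c > 0" "\<And>h y. 0 < h \<Longrightarrow> h \<le> r / 2 \<Longrightarrow> \<bar>norm y - r\<bar> \<le> h \<Longrightarrow>
      ennreal (c * h ^ (?n - 1)) \<le> emeasure haar_SO {A \<in> space haar_SO. norm (y - r *\<^sub>R (A *v \<xi>)) < 2 * h}"
    using shell_measure_lower_bound[OF r] by blast
  define K where "K = real ?n * unit_ball_vol (real ?n) * (r / 2) ^ (?n - 1)"
  have K: "K > 0" using r by (auto simp: K_def intro!: mult_pos_pos)
  show thesis
  proof
    show "1 / (c * K) > 0" using c K by simp
    fix g :: "real^'n \<Rightarrow> ennreal" and x h assume [measurable]: "g \<in> borel_measurable borel" and h: "0 < h" "h \<le> r / 2"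
    let ?T = "\<integral>\<^sup>+s. indicator {r - h..r + h} s * sph_nn \<xi> g x s \<partial>lborel"
    have [measurable]: "ball x (2 * h) \<in> sets borel" by simp
    define G where "G = (\<lambda>y. indicator {y. \<bar>norm (y - x) - r\<bar> \<le> h} y * g y)"
    have [measurable]: "G \<in> borel_measurable borel" unfolding G_def by measurable
    have "ennreal (c * h ^ (?n - 1)) * (ennreal K * ?T) = ennreal (c * h ^ (?n - 1)) * (\<integral>\<^sup>+s. ennreal K * (indicator {r - h..r + h} s * sph_nn \<xi> g x s) \<partial>lborel)"
      by (subst nn_integral_cmult) auto
    also have "\<dots> \<le> ennreal (c * h ^ (?n - 1)) * (\<integral>\<^sup>+s. ennreal (radial_weight ?n 0 s) * sph_nn \<xi> G x s \<partial>lborel)"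
    proof (intro mult_left_mono nn_integral_mono)
      fix s
      show "ennreal K * (indicator {r - h..r + h} s * sph_nn \<xi> g x s) \<le> ennreal (radial_weight ?n 0 s) * sph_nn \<xi> G x s"
      proof (cases "s \<in> {r - h..r + h}")
        case True
        then have s: "s > 0" "s \<ge> r / 2" using h r by auto
        have "G (x + s *\<^sub>R (A *v \<xi>)) = g (x + s *\<^sub>R (A *v \<xi>))" if "A \<in> space haar_SO" for A :: "real^'n^'n"
          using True s norm_rotation[OF that, of \<xi>] \<xi> by (auto simp: G_def abs_le_iff)
        then have "sph_nn \<xi> G x s = sph_nn \<xi> g x s" unfolding sph_nn_def by (intro nn_integral_cong) auto
        moreover have "K \<le> radial_weight ?n 0 s"
          using s n r by (subst radial_weight_0) (auto simp: K_def intro!: mult_left_mono power_mono)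
        ultimately show ?thesis using True by (auto intro!: mult_right_mono ennreal_leI)
      qed simp
    qed simp
    also have "\<dots> = ennreal (c * h ^ (?n - 1)) * (\<integral>\<^sup>+y. G y \<partial>lborel)"
      by (subst nn_integral_polar[OF n \<xi>, of G x]) auto
    also have "\<dots> = (\<integral>\<^sup>+y. ennreal (c * h ^ (?n - 1)) * G y \<partial>lborel)"
      by (subst nn_integral_cmult) auto
    also have "\<dots> \<le> (\<integral>\<^sup>+y. (\<integral>\<^sup>+A. indicator {A \<in> space haar_SO. norm (y - x - r *\<^sub>R (A *v \<xi>)) < 2 * h} A * g y \<partial>haar_SO) \<partial>lborel)"
    proof (rule nn_integral_mono)
      fix y
      have "(\<integral>\<^sup>+A. indicator {A \<in> space haar_SO. norm (y - x - r *\<^sub>R (A *v \<xi>)) < 2 * h} A * g y \<partial>haar_SO) =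
         emeasure haar_SO {A \<in> space haar_SO. norm (y - x - r *\<^sub>R (A *v \<xi>)) < 2 * h} * g y"
        by (subst nn_integral_multc) auto
      then show "ennreal (c * h ^ (?n - 1)) * G y \<le> (\<integral>\<^sup>+A. indicator {A \<in> space haar_SO. norm (y - x - r *\<^sub>R (A *v \<xi>)) < 2 * h} A * g y \<partial>haar_SO)"
        using c(2)[OF h, of "y - x"] by (cases "\<bar>norm (y - x) - r\<bar> \<le> h") (auto simp: G_def intro!: mult_right_mono)
    qed
    also have "\<dots> = (\<integral>\<^sup>+y. (\<integral>\<^sup>+A. indicator {v. norm v < 2 * h} (y - x - r *\<^sub>R (A *v \<xi>)) * g y \<partial>haar_SO) \<partial>lborel)"
      by (intro nn_integral_cong) (auto simp: indicator_def)
    also have "\<dots> = (\<integral>\<^sup>+A. (\<integral>\<^sup>+y. indicator {v. norm v < 2 * h} (y - x - r *\<^sub>R (A *v \<xi>)) * g y \<partial>lborel) \<partial>haar_SO)"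
      by (rule P.Fubini') measurable
    also have "\<dots> = (\<integral>\<^sup>+A. (\<integral>\<^sup>+z. indicator (ball x (2 * h)) z * g (z + r *\<^sub>R (A *v \<xi>)) \<partial>lborel) \<partial>haar_SO)"
    proof (rule nn_integral_cong)
      fix A :: "real^'n^'n"
      have "(\<integral>\<^sup>+y. indicator {v. norm v < 2 * h} (y - x - r *\<^sub>R (A *v \<xi>)) * g y \<partial>lborel) =
        (\<integral>\<^sup>+z. indicator {v. norm v < 2 * h} ((r *\<^sub>R (A *v \<xi>) + z) - x - r *\<^sub>R (A *v \<xi>)) * g (r *\<^sub>R (A *v \<xi>) + z) \<partial>lborel)"
        by (rule nn_integral_lborel_translation[symmetric]) measurable
      also have "\<dots> = (\<integral>\<^sup>+z. indicator (ball x (2 * h)) z * g (z + r *\<^sub>R (A *v \<xi>)) \<partial>lborel)"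
        by (intro nn_integral_cong) (auto simp: indicator_def dist_norm norm_minus_commute algebra_simps)
      finally show "(\<integral>\<^sup>+y. indicator {v. norm v < 2 * h} (y - x - r *\<^sub>R (A *v \<xi>)) * g y \<partial>lborel) =
         (\<integral>\<^sup>+z. indicator (ball x (2 * h)) z * g (z + r *\<^sub>R (A *v \<xi>)) \<partial>lborel)" .
    qed
    also have "\<dots> = (\<integral>\<^sup>+z. (\<integral>\<^sup>+A. indicator (ball x (2 * h)) z * g (z + r *\<^sub>R (A *v \<xi>)) \<partial>haar_SO) \<partial>lborel)"
      by (rule P.Fubini'[symmetric]) measurable
    also have "\<dots> = (\<integral>\<^sup>+z. indicator (ball x (2 * h)) z * sph_nn \<xi> g z r \<partial>lborel)"
      unfolding sph_nn_def by (intro nn_integral_cong nn_integral_cmult) measurable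
    finally have main: "ennreal (c * h ^ (?n - 1)) * (ennreal K * ?T) \<le> (\<integral>\<^sup>+z. indicator (ball x (2 * h)) z * sph_nn \<xi> g z r \<partial>lborel)" .
    have "?T * ennreal (h ^ (?n - 1)) = ennreal (1 / (c * K)) * (ennreal (c * h ^ (?n - 1)) * (ennreal K * ?T))"
    proof -
      have "ennreal (1 / (c * K)) * (ennreal (c * h ^ (?n - 1)) * (ennreal K * ?T)) =
        ennreal (1 / (c * K) * (c * h ^ (?n - 1)) * K) * ?T"
      proof -
        have "ennreal (1 / (c * K) * (c * h ^ (?n - 1)) * K) = ennreal (1 / (c * K) * (c * h ^ (?n - 1))) * ennreal K"
          using c K h by (intro ennreal_mult) auto
        also have "ennreal (1 / (c * K) * (c * h ^ (?n - 1))) = ennreal (1 / (c * K)) * ennreal (c * h ^ (?n - 1))"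
          using c K h by (intro ennreal_mult) auto
        finally show ?thesis by (simp only: mult.assoc)
      qed
      also have "1 / (c * K) * (c * h ^ (?n - 1)) * K = h ^ (?n - 1)" using c K by simp
      finally show ?thesis by (simp add: mult.commute)
    qed
    also have "\<dots> \<le> ennreal (1 / (c * K)) * (\<integral>\<^sup>+z. indicator (ball x (2 * h)) z * sph_nn \<xi> g z r \<partial>lborel)"
      using main by (rule mult_left_mono) simp
    finally show "?T * ennreal (h ^ (?n - 1)) \<le> \<dots>" .
  qed
qed

end

context
  fixes \<xi> :: "real^'n"
  assumes n: "CARD('n) \<ge> 2" and \<xi>: "norm \<xi> = 1"
begin

text \<open>A shell average around \<open>x\<close> is controlled by the average of \<open>sph_nn \<xi> g z r\<close> over a ball around
  \<open>x\<close>, so the Hardy--Littlewood argument with Vitali's covering lemma applies.\<close>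

lemma shell_maximal_inequality:
  assumes r: "r > 0"
  obtains C where "C > 0"
    "\<And>g \<kappa>. g \<in> borel_measurable borel \<Longrightarrow> \<kappa> > 0 \<Longrightarrow>
      \<exists>S\<in>sets borel. emeasure lborel S \<le> ennreal (C / \<kappa>) * (\<integral>\<^sup>+x. g x \<partial>lborel) \<and>
        (\<forall>x h. x \<notin> S \<longrightarrow> 0 < h \<longrightarrow> h \<le> r / 2 \<longrightarrow>
          (\<integral>\<^sup>+s. indicator {r - h..r + h} s * sph_nn \<xi> g x s \<partial>lborel) \<le> ennreal (\<kappa> * h))"
proof -
  let ?n = "CARD('n)"
  let ?\<omega> = "unit_ball_vol (real ?n)"
  obtain C where C: "C > 0"
    "\<And>g x h. g \<in> borel_measurable borel \<Longrightarrow> 0 < h \<Longrightarrow> h \<le> r / 2 \<Longrightarrow>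
      (\<integral>\<^sup>+s. indicator {r - h..r + h} s * sph_nn \<xi> g x s \<partial>lborel) * ennreal (h ^ (?n - 1)) \<le>
      ennreal C * (\<integral>\<^sup>+z. indicator (ball x (2 * h)) z * sph_nn \<xi> g z r \<partial>lborel)"
    using shell_average_le[OF n \<xi> r] by blast
  have \<omega>: "?\<omega> > 0" by simp
  show thesis
  proof
    show "?\<omega> * 10 ^ ?n * C > 0" using C by simp
    fix g :: "real^'n \<Rightarrow> ennreal" and \<kappa> :: real assume g[measurable]: "g \<in> borel_measurable borel" and \<kappa>: "\<kappa> > 0"
    let ?T = "\<lambda>x h. \<integral>\<^sup>+s. indicator {r - h..r + h} s * sph_nn \<xi> g x s \<partial>lborel"
    \<comment> \<open>The bad set is covered rather than measured: the covering lemma takes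
      arbitrary sets, and the set S below is open.\<close>
    define E where "E = {x. \<exists>h. 0 < h \<and> h \<le> r / 2 \<and> ennreal (\<kappa> * h) < ?T x h}"
    have "\<forall>x\<in>E. \<exists>h. 0 < h \<and> h \<le> r / 2 \<and> ennreal (\<kappa> * h) < ?T x h" unfolding E_def by blast
    then obtain h where h: "\<And>x. x \<in> E \<Longrightarrow> 0 < h x \<and> h x \<le> r / 2 \<and> ennreal (\<kappa> * h x) < ?T x (h x)" by metis
    have cov: "E \<subseteq> (\<Union>x\<in>E. ball x (2 * h x))" using h by force
    have hr: "0 < 2 * h x \<and> 2 * h x \<le> r" if "x \<in> E" for x using h[OF that] by auto
    obtain K where K: "countable K" "K \<subseteq> E" "pairwise (\<lambda>i j. disjnt (ball i (2 * h i)) (ball j (2 * h j))) K"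
      "E \<subseteq> (\<Union>i\<in>K. ball i (5 * (2 * h i)))"
      using Vitali_covering_lemma_balls[OF cov hr] by auto
    \<comment> \<open>Radius 10 h is five times the radius 2 h of the selected disjoint balls, the
      factor of Vitali's lemma.\<close>
    define S where "S = (\<Union>i\<in>K. ball i (10 * h i))"
    have S[measurable]: "S \<in> sets borel" unfolding S_def by (intro borel_open open_UN) auto
    have "emeasure lborel S = (\<integral>\<^sup>+x. indicator S x \<partial>lborel)" by simp
    also have "\<dots> \<le> (\<integral>\<^sup>+x. (\<integral>\<^sup>+i. indicator (ball i (10 * h i)) x \<partial>count_space K) \<partial>lborel)"
    proof (rule nn_integral_mono)
      fix x
      show "indicator S x \<le> (\<integral>\<^sup>+i. indicator (ball i (10 * h i)) x \<partial>count_space K)"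
      proof (cases "x \<in> S")
        case True
        then obtain i where i: "i \<in> K" "x \<in> ball i (10 * h i)" by (auto simp: S_def)
        have "(\<integral>\<^sup>+j. indicator {i} j \<partial>count_space K) \<le> (\<integral>\<^sup>+j. indicator (ball j (10 * h j)) x \<partial>count_space K)"
          using i by (intro nn_integral_mono) (auto simp: indicator_def)
        moreover have "(\<integral>\<^sup>+j. indicator {i} j \<partial>count_space K) = 1"
          using i by (subst nn_integral_indicator) auto
        ultimately show ?thesis using True by simp
      qed simp
    qed
    also have "\<dots> = (\<integral>\<^sup>+i. (\<integral>\<^sup>+x. indicator (ball i (10 * h i)) x \<partial>lborel) \<partial>count_space K)"
      using K(1) by (intro nn_integral_count_space_nn_integral borel_measurable_indicator) auto
    also have "\<dots> \<le> (\<integral>\<^sup>+i. ennreal (?\<omega> * 10 ^ ?n * C / \<kappa>) * (\<integral>\<^sup>+z. indicator (ball i (2 * h i)) z * sph_nn \<xi> g z r \<partial>lborel) \<partial>count_space K)"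
    proof (rule nn_integral_mono)
      fix i assume "i \<in> space (count_space K)"
      then have hi: "0 < h i" "h i \<le> r / 2" "ennreal (\<kappa> * h i) < ?T i (h i)" using K(2) h[of i] by auto
      let ?J = "\<integral>\<^sup>+z. indicator (ball i (2 * h i)) z * sph_nn \<xi> g z r \<partial>lborel"
      have "(\<integral>\<^sup>+x. indicator (ball i (10 * h i)) x \<partial>lborel) = ennreal (?\<omega> * (10 * h i) ^ ?n)"
        using hi by (simp add: emeasure_ball)
      also have "\<dots> = ennreal (?\<omega> * 10 ^ ?n / \<kappa>) * (ennreal (\<kappa> * h i) * ennreal (h i ^ (?n - 1)))"
      proof -
        have "h i ^ ?n = h i * h i ^ (?n - 1)" using n by (simp flip: power_Suc)
        then have "?\<omega> * (10 * h i) ^ ?n = (?\<omega> * 10 ^ ?n / \<kappa>) * ((\<kappa> * h i) * h i ^ (?n - 1))"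
          using \<kappa> by (simp add: power_mult_distrib)
        then have "ennreal (?\<omega> * (10 * h i) ^ ?n) = ennreal ((?\<omega> * 10 ^ ?n / \<kappa>) * ((\<kappa> * h i) * h i ^ (?n - 1)))" by (rule arg_cong)
        also have "\<dots> = ennreal (?\<omega> * 10 ^ ?n / \<kappa>) * ennreal ((\<kappa> * h i) * h i ^ (?n - 1))"
          using \<kappa> hi by (intro ennreal_mult) auto
        also have "ennreal ((\<kappa> * h i) * h i ^ (?n - 1)) = ennreal (\<kappa> * h i) * ennreal (h i ^ (?n - 1))"
          using \<kappa> hi by (intro ennreal_mult) auto
        finally show ?thesis .
      qed
      also have "\<dots> \<le> ennreal (?\<omega> * 10 ^ ?n / \<kappa>) * (?T i (h i) * ennreal (h i ^ (?n - 1)))"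
        using hi by (intro mult_left_mono mult_right_mono) auto
      also have "\<dots> \<le> ennreal (?\<omega> * 10 ^ ?n / \<kappa>) * (ennreal C * ?J)"
        using hi by (intro mult_left_mono C(2)) auto
      also have "\<dots> = ennreal (?\<omega> * 10 ^ ?n * C / \<kappa>) * ?J"
        using \<kappa> C(1) by (simp add: mult.assoc[symmetric] ennreal_mult''[symmetric])
      finally show "(\<integral>\<^sup>+x. indicator (ball i (10 * h i)) x \<partial>lborel) \<le> ennreal (?\<omega> * 10 ^ ?n * C / \<kappa>) * ?J" .
    qed
    also have "\<dots> = ennreal (?\<omega> * 10 ^ ?n * C / \<kappa>) * (\<integral>\<^sup>+i. (\<integral>\<^sup>+z. indicator (ball i (2 * h i)) z * sph_nn \<xi> g z r \<partial>lborel) \<partial>count_space K)"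
      by (rule nn_integral_cmult) simp
    also have "(\<integral>\<^sup>+i. (\<integral>\<^sup>+z. indicator (ball i (2 * h i)) z * sph_nn \<xi> g z r \<partial>lborel) \<partial>count_space K) =
        (\<integral>\<^sup>+z. (\<integral>\<^sup>+i. indicator (ball i (2 * h i)) z * sph_nn \<xi> g z r \<partial>count_space K) \<partial>lborel)"
      using K(1) by (intro nn_integral_count_space_nn_integral[symmetric]) (auto intro!: borel_measurable_times_ennreal borel_measurable_indicator)
    also have "\<dots> \<le> (\<integral>\<^sup>+z. sph_nn \<xi> g z r \<partial>lborel)"
    proof (rule nn_integral_mono)
      fix z
      have "(\<integral>\<^sup>+i. indicator (ball i (2 * h i)) z * sph_nn \<xi> g z r \<partial>count_space K) =
         (\<integral>\<^sup>+i. indicator {i\<in>K. z \<in> ball i (2 * h i)} i * sph_nn \<xi> g z r \<partial>count_space K)"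
        by (intro nn_integral_cong) (auto simp: indicator_def)
      also have "\<dots> = emeasure (count_space K) {i\<in>K. z \<in> ball i (2 * h i)} * sph_nn \<xi> g z r"
        by (subst nn_integral_multc) auto
      also have "\<dots> \<le> 1 * sph_nn \<xi> g z r"
      proof (rule mult_right_mono)
        \<comment> \<open>Disjointness of the selected balls: each z is counted at most
          once.\<close>
        have "i = j" if "i \<in> K" "z \<in> ball i (2 * h i)" "j \<in> K" "z \<in> ball j (2 * h j)" for i j
        proof (rule ccontr)
          assume "i \<noteq> j"
          then have "ball i (2 * h i) \<inter> ball j (2 * h j) = {}" using K(3) that by (simp add: pairwise_def disjnt_def)
          then show False using that by blast
        qed
        then have "{i\<in>K. z \<in> ball i (2 * h i)} = {} \<or> (\<exists>i. {i\<in>K. z \<in> ball i (2 * h i)} = {i} \<and> i \<in> K)" by blast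
        then show "emeasure (count_space K) {i\<in>K. z \<in> ball i (2 * h i)} \<le> 1"
        proof (elim disjE exE conjE)
          assume *: "{i\<in>K. z \<in> ball i (2 * h i)} = {}"
          show ?thesis unfolding * by simp
        next
          fix i assume *: "{i\<in>K. z \<in> ball i (2 * h i)} = {i}" "i \<in> K"
          show ?thesis unfolding *(1) using *(2) by simp
        qed
      qed simp
      finally show "(\<integral>\<^sup>+i. indicator (ball i (2 * h i)) z * sph_nn \<xi> g z r \<partial>count_space K) \<le> sph_nn \<xi> g z r" by simp
    qed
    also have "(\<integral>\<^sup>+z. sph_nn \<xi> g z r \<partial>lborel) = (\<integral>\<^sup>+x. g x \<partial>lborel)" by (rule nn_integral_sph_nn[OF n \<xi> g])
    finally have "emeasure lborel S \<le> ennreal (?\<omega> * 10 ^ ?n * C / \<kappa>) * (\<integral>\<^sup>+x. g x \<partial>lborel)"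
      by (simp add: mult_left_mono)
    moreover have "?T x u \<le> ennreal (\<kappa> * u)" if "x \<notin> S" "0 < u" "u \<le> r / 2" for x u
    proof -
      have "x \<notin> E" using that(1) K(4) by (auto simp: S_def)
      then show ?thesis using that by (auto simp: E_def not_less)
    qed
    ultimately show "\<exists>S\<in>sets borel. emeasure lborel S \<le> ennreal (?\<omega> * 10 ^ ?n * C / \<kappa>) * (\<integral>\<^sup>+x. g x \<partial>lborel) \<and>
        (\<forall>x h. x \<notin> S \<longrightarrow> 0 < h \<longrightarrow> h \<le> r / 2 \<longrightarrow> ?T x h \<le> ennreal (\<kappa> * h))"
      using S by blast
  qed
qed

section \<open>Lebesgue points for integrable functions\<close>

lemma integrable_sphere:
  assumes [measurable]: "f \<in> borel_measurable borel" and fin: "sph_nn \<xi> (\<lambda>y. ennreal \<bar>f y\<bar>) x s < \<infinity>"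
  shows "integrable haar_SO (\<lambda>A. f (x + s *\<^sub>R (A *v \<xi>)))"
proof (rule integrableI_bounded)
  show "(\<integral>\<^sup>+A. ennreal (norm (f (x + s *\<^sub>R (A *v \<xi>)))) \<partial>haar_SO) < \<infinity>"
    using fin by (simp add: sph_nn_def)
qed measurable

lemma sph_mean_diff:
  assumes "f \<in> borel_measurable borel" "g \<in> borel_measurable borel"
    "sph_nn \<xi> (\<lambda>y. ennreal \<bar>f y\<bar>) x s < \<infinity>" "sph_nn \<xi> (\<lambda>y. ennreal \<bar>g y\<bar>) x s < \<infinity>"
  shows "sph_mean \<xi> f x s - sph_mean \<xi> g x s = sph_mean \<xi> (\<lambda>y. f y - g y) x s"
  unfolding sph_mean_def using integrable_sphere[OF assms(1,3)] integrable_sphere[OF assms(2,4)] by simp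

lemma abs_sph_mean_le:
  assumes [measurable]: "f \<in> borel_measurable borel"
  shows "ennreal \<bar>sph_mean \<xi> f x s\<bar> \<le> sph_nn \<xi> (\<lambda>y. ennreal \<bar>f y\<bar>) x s"
proof (cases "integrable haar_SO (\<lambda>A. f (x + s *\<^sub>R (A *v \<xi>)))")
  case True
  then show ?thesis
    unfolding sph_mean_def sph_nn_def using integral_norm_bound_ennreal[OF True] by simp
next
  case False
  then show ?thesis by (simp add: sph_mean_def not_integrable_integral_eq)
qed

lemma sph_nn_le_const:
  assumes "\<And>y. g y \<le> c"
  shows "sph_nn \<xi> g x s \<le> c"
proof -
  interpret prob_space "haar_SO :: (real^'n^'n) measure" by (rule prob_space_haar_SO)
  have "sph_nn \<xi> g x s \<le> (\<integral>\<^sup>+A. c \<partial>(haar_SO :: (real^'n^'n) measure))"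
    unfolding sph_nn_def using assms by (intro nn_integral_mono)
  then show ?thesis by (simp add: emeasure_space_1)
qed

lemma AE_sph_nn_finite:
  assumes [measurable]: "g \<in> borel_measurable borel" and fin: "(\<integral>\<^sup>+y. g y \<partial>lborel) < \<infinity>"
  shows "AE s in lborel. s > 0 \<longrightarrow> sph_nn \<xi> g x s < \<infinity>"
proof -
  have "(\<integral>\<^sup>+s. ennreal (radial_weight CARD('n) 0 s) * sph_nn \<xi> g x s \<partial>lborel) \<noteq> \<infinity>"
    using fin nn_integral_polar[OF n \<xi> assms(1), of x] by simp
  then have "AE s in lborel. ennreal (radial_weight CARD('n) 0 s) * sph_nn \<xi> g x s \<noteq> \<infinity>"
    by (intro nn_integral_PInf_AE) auto
  then show ?thesis
  proof (eventually_elim, safe)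
    fix s :: real assume *: "ennreal (radial_weight CARD('n) 0 s) * sph_nn \<xi> g x s \<noteq> \<infinity>" and s: "s > 0"
    have "radial_weight CARD('n) 0 s > 0"
      using s n by (subst radial_weight_0) (auto intro!: mult_pos_pos)
    then show "sph_nn \<xi> g x s < \<infinity>" using * by (auto simp: less_top ennreal_mult_eq_top_iff)
  qed
qed

lemma sph_mean_uniform_modulus:
  assumes g: "g \<in> borel_measurable borel" "\<And>y. \<bar>g y\<bar> \<le> B" and d: "\<And>x y. dist x y < d \<Longrightarrow> \<bar>g x - g y\<bar> < \<epsilon>"
    and s: "\<bar>s - r\<bar> < d"
  shows "\<bar>sph_mean \<xi> g x s - sph_mean \<xi> g x r\<bar> \<le> \<epsilon>"
proof -
  interpret prob_space "haar_SO :: (real^'n^'n) measure" by (rule prob_space_haar_SO)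
  have fin: "sph_nn \<xi> (\<lambda>y. ennreal \<bar>g y\<bar>) x s < \<infinity>" for x s
    using sph_nn_le_const[of "\<lambda>y. ennreal \<bar>g y\<bar>" "ennreal B" x s] g(2) by (auto simp: ennreal_leI order_le_less_trans)
  have i: "integrable haar_SO (\<lambda>A. g (x + s *\<^sub>R (A *v \<xi>)))" for s by (rule integrable_sphere[OF g(1) fin])
  have "\<bar>sph_mean \<xi> g x s - sph_mean \<xi> g x r\<bar> = \<bar>LINT A|haar_SO. g (x + s *\<^sub>R (A *v \<xi>)) - g (x + r *\<^sub>R (A *v \<xi>))\<bar>"
    using i by (simp add: sph_mean_def)
  also have "\<dots> \<le> (LINT A|haar_SO. \<bar>g (x + s *\<^sub>R (A *v \<xi>)) - g (x + r *\<^sub>R (A *v \<xi>))\<bar>)"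
    by (rule integral_abs_bound)
  also have "\<dots> \<le> (LINT A|(haar_SO :: (real^'n^'n) measure). \<epsilon>)"
  proof (rule integral_mono)
    fix A :: "real^'n^'n" assume A: "A \<in> space haar_SO"
    have "(x + s *\<^sub>R (A *v \<xi>)) - (x + r *\<^sub>R (A *v \<xi>)) = (s - r) *\<^sub>R (A *v \<xi>)" by (simp add: algebra_simps)
    then have dst: "dist (x + s *\<^sub>R (A *v \<xi>)) (x + r *\<^sub>R (A *v \<xi>)) = \<bar>s - r\<bar>"
      using norm_rotation[OF n \<xi> A, of \<xi>] \<xi> by (simp add: dist_norm)
    then show "\<bar>g (x + s *\<^sub>R (A *v \<xi>)) - g (x + r *\<^sub>R (A *v \<xi>))\<bar> \<le> \<epsilon>" 
      by (intro less_imp_le d) (simp only: dst s)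
  qed (use i in auto)
  finally show ?thesis by (simp add: prob_space)
qed

lemma continuous_compact_support_bounded:
  fixes g :: "real^'n \<Rightarrow> real"
  assumes "continuous_on UNIV g" "\<And>x. norm x \<ge> R \<Longrightarrow> g x = 0"
  obtains B where "\<And>y. \<bar>g y\<bar> \<le> B"
proof -
  have "compact (g ` cball 0 R)" using assms(1) by (intro compact_continuous_image) (auto intro: continuous_on_subset)
  then obtain B where B: "\<And>y. y \<in> cball 0 R \<Longrightarrow> \<bar>g y\<bar> \<le> B" using compact_imp_bounded bounded_iff by (metis imageI real_norm_def)
  show thesis
  proof
    show "\<bar>g y\<bar> \<le> max B 0" for y using B[of y] assms(2)[of y] by (cases "norm y \<le> R") auto
  qed
qed

text \<open>Density argument: approximate f by a continuous g of compact support. For g the radii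
  near r are harmless; for f - g the shell averages are small outside S by the maximal inequality,
  and the mean at r itself is small outside U by Chebyshev's inequality. So the failure set is
  contained in sets of arbitrarily small measure.\<close>

lemma AE_lebesgue_point_L1:
  assumes f[measurable]: "f \<in> borel_measurable borel" and fin: "(\<integral>\<^sup>+y. ennreal \<bar>f y\<bar> \<partial>lborel) < \<infinity>" and r: "r > 0"
  shows "AE x in lborel. lebesgue_point (sph_mean \<xi> f x) r"
proof -
  let ?D = "\<lambda>f x h. \<integral>\<^sup>+s. indicator {r - h..r + h} s * ennreal \<bar>sph_mean \<xi> f x s - sph_mean \<xi> f x r\<bar> \<partial>lborel"
  define N0 where "N0 = {x. \<not> sph_nn \<xi> (\<lambda>y. ennreal \<bar>f y\<bar>) x r < \<infinity>}"
  have "AE x in lborel. sph_nn \<xi> (\<lambda>y. ennreal \<bar>f y\<bar>) x r \<noteq> \<infinity>"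
    using fin nn_integral_sph_nn[OF n \<xi>, of "\<lambda>y. ennreal \<bar>f y\<bar>" r] by (intro nn_integral_PInf_AE) auto
  then have N0: "emeasure lborel N0 = 0" "N0 \<in> sets lborel"
    by (auto simp: N0_def less_top AE_iff_measurable[OF _ refl] intro!: borel_measurable_eq)
  obtain C where C: "C > 0"
    "\<And>g \<kappa>. g \<in> borel_measurable borel \<Longrightarrow> \<kappa> > 0 \<Longrightarrow>
      \<exists>S\<in>sets borel. emeasure lborel S \<le> ennreal (C / \<kappa>) * (\<integral>\<^sup>+x. g x \<partial>lborel) \<and>
        (\<forall>x h. x \<notin> S \<longrightarrow> 0 < h \<longrightarrow> h \<le> r / 2 \<longrightarrow>
          (\<integral>\<^sup>+s. indicator {r - h..r + h} s * sph_nn \<xi> g x s \<partial>lborel) \<le> ennreal (\<kappa> * h))"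
    using shell_maximal_inequality[OF r] by blast
  have neg: "AE x in lborel. \<forall>\<^sub>F h in at_right 0. ?D f x h \<le> ennreal (\<epsilon> * h)" if \<epsilon>: "\<epsilon> > 0" for \<epsilon>
  proof -
    define E where "E = {x. \<not> (\<forall>\<^sub>F h in at_right 0. ?D f x h \<le> ennreal (\<epsilon> * h))}"
    have "\<exists>T. E \<subseteq> T \<and> T \<in> lmeasurable \<and> measure lebesgue T \<le> \<delta>" if \<delta>: "\<delta> > 0" for \<delta>
    proof -
      \<comment> \<open>Chosen so that the bounds C (4 / \<epsilon>) \<eta> and (8 / \<epsilon>)
        \<eta> for the measures of S and U add up to \<delta>.\<close>
      define \<eta> where "\<eta> = \<delta> / (C * (4 / \<epsilon>) + 8 / \<epsilon>)"
      have den: "C * (4 / \<epsilon>) + 8 / \<epsilon> > 0" using C \<epsilon> by (intro add_pos_pos) auto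
      have \<eta>: "\<eta> > 0" using \<delta> den by (simp add: \<eta>_def)
      obtain g R where g: "continuous_on UNIV g" "\<And>x. norm x \<ge> R \<Longrightarrow> g x = 0"
        and fg: "(\<integral>\<^sup>+x. ennreal (\<bar>f x - g x\<bar> powr 1) \<partial>lborel) \<le> ennreal \<eta>"
        using Lp_approx_continuous[OF f, of 1 \<eta>] fin \<eta> by auto
      have gm[measurable]: "g \<in> borel_measurable borel" using g(1) by (rule borel_measurable_continuous_onI)
      obtain B where B: "\<And>y. \<bar>g y\<bar> \<le> B" using continuous_compact_support_bounded[OF g] by blast
      have "\<epsilon> / 8 > 0" using \<epsilon> by simp
      then obtain d where d: "d > 0" "d \<le> 1" "\<And>x y. dist x y < d \<Longrightarrow> \<bar>g x - g y\<bar> < \<epsilon> / 8"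
        using compact_support_uniform[OF g] by blast
      define b where "b = (\<lambda>x. ennreal \<bar>f x - g x\<bar>)"
      have bm[measurable]: "b \<in> borel_measurable borel" unfolding b_def by measurable
      have b_int: "(\<integral>\<^sup>+x. b x \<partial>lborel) \<le> ennreal \<eta>" using fg by (simp add: b_def)
      have "\<exists>S\<in>sets borel. emeasure lborel S \<le> ennreal (C / (\<epsilon> / 4)) * (\<integral>\<^sup>+x. b x \<partial>lborel) \<and>
        (\<forall>x h. x \<notin> S \<longrightarrow> 0 < h \<longrightarrow> h \<le> r / 2 \<longrightarrow>
          (\<integral>\<^sup>+s. indicator {r - h..r + h} s * sph_nn \<xi> b x s \<partial>lborel) \<le> ennreal (\<epsilon> / 4 * h))"
        by (rule C(2)[OF bm]) (use \<epsilon> in simp)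
      then obtain S where S: "S \<in> sets borel" "emeasure lborel S \<le> ennreal (C / (\<epsilon> / 4)) * (\<integral>\<^sup>+x. b x \<partial>lborel)"
        "\<And>x h. x \<notin> S \<Longrightarrow> 0 < h \<Longrightarrow> h \<le> r / 2 \<Longrightarrow> (\<integral>\<^sup>+s. indicator {r - h..r + h} s * sph_nn \<xi> b x s \<partial>lborel) \<le> ennreal (\<epsilon> / 4 * h)"
        by blast
      \<comment> \<open>The maximal inequality does not see the single sphere of radius r, yet the
        Lebesgue condition compares with the value there.\<close>
      define U where "U = {x \<in> space lborel. ennreal (8 / \<epsilon>) * sph_nn \<xi> b x r \<ge> 1}"
      have Um[measurable]: "U \<in> sets borel" unfolding U_def by measurable
      have Ue: "emeasure lborel U \<le> ennreal (8 / \<epsilon>) * (\<integral>\<^sup>+x. b x \<partial>lborel)"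
      proof -
        have "emeasure lborel U = (\<integral>\<^sup>+x. indicator U x \<partial>lborel)" by simp
        also have "\<dots> \<le> (\<integral>\<^sup>+x. ennreal (8 / \<epsilon>) * sph_nn \<xi> b x r \<partial>lborel)"
          by (intro nn_integral_mono) (auto simp: U_def indicator_def)
        also have "\<dots> = ennreal (8 / \<epsilon>) * (\<integral>\<^sup>+x. b x \<partial>lborel)"
          by (subst nn_integral_cmult) (simp_all add: nn_integral_sph_nn[OF n \<xi> bm])
        finally show ?thesis .
      qed
      define T where "T = N0 \<union> S \<union> U"
      have Tm[measurable]: "T \<in> sets borel" using N0 S Um by (auto simp: T_def)
      have "emeasure lborel T \<le> emeasure lborel N0 + emeasure lborel S + emeasure lborel U"
        unfolding T_def using N0 S Um by (intro order_trans[OF emeasure_subadditive] add_mono emeasure_subadditive) auto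
      also have "\<dots> \<le> 0 + ennreal (C / (\<epsilon> / 4)) * ennreal \<eta> + ennreal (8 / \<epsilon>) * ennreal \<eta>"
        using N0 by (intro add_mono order_trans[OF S(2)] order_trans[OF Ue] mult_left_mono b_int) auto
      also have "\<dots> = ennreal (C / (\<epsilon> / 4) * \<eta> + 8 / \<epsilon> * \<eta>)"
        using \<epsilon> C(1) \<eta> by (simp add: ennreal_mult''[symmetric] ennreal_plus[symmetric] del: ennreal_plus)
      also have "C / (\<epsilon> / 4) * \<eta> + 8 / \<epsilon> * \<eta> = (C * (4 / \<epsilon>) + 8 / \<epsilon>) * \<eta>" by (simp add: algebra_simps)
      also have "\<dots> = \<delta>" using den by (simp add: \<eta>_def)
      finally have Te: "emeasure lborel T \<le> ennreal \<delta>" .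
      then have "T \<in> lmeasurable" using Tm by (intro fmeasurableI) (auto simp: less_top intro: order_le_less_trans)
      moreover have "measure lebesgue T \<le> \<delta>"
        using Te \<delta> Tm by (simp add: measure_def enn2real_leI)
      moreover have "E \<subseteq> T"
      proof
        fix x assume xE: "x \<in> E"
        show "x \<in> T"
        proof (rule ccontr)
          assume "x \<notin> T"
          then have xS: "x \<notin> S" and xU: "ennreal (8 / \<epsilon>) * sph_nn \<xi> b x r \<le> 1" and xN: "sph_nn \<xi> (\<lambda>y. ennreal \<bar>f y\<bar>) x r < \<infinity>"
            by (auto simp: T_def U_def N0_def)
          have ub: "sph_nn \<xi> b x r \<le> ennreal (\<epsilon> / 8)"
          proof -
            have "sph_nn \<xi> b x r = ennreal (\<epsilon> / 8) * (ennreal (8 / \<epsilon>) * sph_nn \<xi> b x r)"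
              using \<epsilon> by (simp add: mult.assoc[symmetric] ennreal_mult''[symmetric])
            also have "\<dots> \<le> ennreal (\<epsilon> / 8) * 1" using xU by (rule mult_left_mono) simp
            finally show ?thesis by simp
          qed
          have fing: "sph_nn \<xi> (\<lambda>y. ennreal \<bar>g y\<bar>) x s < \<infinity>" for s
            using sph_nn_le_const[of "\<lambda>y. ennreal \<bar>g y\<bar>" "ennreal B" x s] B by (auto simp: ennreal_leI order_le_less_trans)
          have le: "\<bar>sph_mean \<xi> f x s - sph_mean \<xi> g x s\<bar> \<le> enn2real (sph_nn \<xi> b x s) \<and> ennreal \<bar>sph_mean \<xi> f x s - sph_mean \<xi> g x s\<bar> \<le> sph_nn \<xi> b x s"
            if "sph_nn \<xi> (\<lambda>y. ennreal \<bar>f y\<bar>) x s < \<infinity>" for s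
          proof -
            have 1: "ennreal \<bar>sph_mean \<xi> f x s - sph_mean \<xi> g x s\<bar> \<le> sph_nn \<xi> b x s"
              unfolding sph_mean_diff[OF f gm that fing] b_def by (rule abs_sph_mean_le) measurable
            have "sph_nn \<xi> b x s \<le> sph_nn \<xi> (\<lambda>y. ennreal \<bar>f y\<bar>) x s + sph_nn \<xi> (\<lambda>y. ennreal \<bar>g y\<bar>) x s"
              unfolding sph_nn_def b_def by (subst nn_integral_add[symmetric]) (auto intro!: nn_integral_mono simp flip: ennreal_plus)
            then have "sph_nn \<xi> b x s < \<infinity>" using that fing[of s] by (auto simp: order_le_less_trans)
            then show ?thesis using 1 by (metis enn2real_ennreal enn2real_mono abs_ge_zero infinity_ennreal_def)
          qed
          have fin_s: "AE s in lborel. s > 0 \<longrightarrow> sph_nn \<xi> (\<lambda>y. ennreal \<bar>f y\<bar>) x s < \<infinity>"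
            by (rule AE_sph_nn_finite[OF _ fin]) measurable
          have bound: "?D f x h \<le> ennreal (\<epsilon> * h)" if h: "0 < h" "h \<le> r / 2" "h < d" for h
          proof -
            \<comment> \<open>Error budget: \<epsilon> h / 4 from the shell averages of |f - g|, and
              \<epsilon> / 8 each from the value at r and from the modulus of g, over a length 2
              h.\<close>
            have "?D f x h \<le> (\<integral>\<^sup>+s. indicator {r - h..r + h} s * sph_nn \<xi> b x s + ennreal (\<epsilon> / 4) * indicator {r - h..r + h} s \<partial>lborel)"
            proof (rule nn_integral_mono_AE)
              show "AE s in lborel. indicator {r - h..r + h} s * ennreal \<bar>sph_mean \<xi> f x s - sph_mean \<xi> f x r\<bar> \<le>
                 indicator {r - h..r + h} s * sph_nn \<xi> b x s + ennreal (\<epsilon> / 4) * indicator {r - h..r + h} s"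
                using fin_s
              proof eventually_elim
                fix s assume s: "s > 0 \<longrightarrow> sph_nn \<xi> (\<lambda>y. ennreal \<bar>f y\<bar>) x s < \<infinity>"
                show "indicator {r - h..r + h} s * ennreal \<bar>sph_mean \<xi> f x s - sph_mean \<xi> f x r\<bar> \<le>
                   indicator {r - h..r + h} s * sph_nn \<xi> b x s + ennreal (\<epsilon> / 4) * indicator {r - h..r + h} s"
                proof (cases "s \<in> {r - h..r + h}")
                  case True
                  then have s': "sph_nn \<xi> (\<lambda>y. ennreal \<bar>f y\<bar>) x s < \<infinity>" "\<bar>s - r\<bar> < d" using s h by auto
                  have "\<bar>sph_mean \<xi> f x r - sph_mean \<xi> g x r\<bar> \<le> enn2real (sph_nn \<xi> b x r)" using le[OF xN] by simp
                  also have "\<dots> \<le> \<epsilon> / 8" by (rule enn2real_leI) (use ub \<epsilon> in auto)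
                  finally have 1: "\<bar>sph_mean \<xi> f x r - sph_mean \<xi> g x r\<bar> \<le> \<epsilon> / 8" .
                  have 2: "\<bar>sph_mean \<xi> g x s - sph_mean \<xi> g x r\<bar> \<le> \<epsilon> / 8"
                    by (rule sph_mean_uniform_modulus[OF gm B d(3) s'(2)])
                  have "ennreal \<bar>sph_mean \<xi> f x s - sph_mean \<xi> f x r\<bar> \<le> ennreal (\<bar>sph_mean \<xi> f x s - sph_mean \<xi> g x s\<bar> + \<epsilon> / 4)"
                    using 1 2 by (intro ennreal_leI) linarith
                  also have "\<dots> = ennreal \<bar>sph_mean \<xi> f x s - sph_mean \<xi> g x s\<bar> + ennreal (\<epsilon> / 4)"
                    using \<epsilon> by simp
                  also have "\<dots> \<le> sph_nn \<xi> b x s + ennreal (\<epsilon> / 4)" using le[OF s'(1)] by (intro add_right_mono) simp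
                  finally show ?thesis using True by simp
                qed simp
              qed
            qed
            also have "\<dots> = (\<integral>\<^sup>+s. indicator {r - h..r + h} s * sph_nn \<xi> b x s \<partial>lborel) + ennreal (\<epsilon> / 4) * ennreal (2 * h)"
              using h by (subst nn_integral_add) (auto simp: nn_integral_cmult_indicator)
            also have "\<dots> \<le> ennreal (\<epsilon> / 4 * h) + ennreal (\<epsilon> / 4) * ennreal (2 * h)"
              using h by (intro add_right_mono S(3) xS)
            also have "\<dots> = ennreal (\<epsilon> / 4 * h + \<epsilon> / 4 * (2 * h))"
              using h \<epsilon> by (simp only: ennreal_mult''[symmetric]) (subst ennreal_plus, auto)
            also have "\<dots> \<le> ennreal (\<epsilon> * h)" using h \<epsilon> by (intro ennreal_leI) (simp add: field_simps)
            finally show ?thesis .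
          qed
          have "\<forall>\<^sub>F h in at_right 0. ?D f x h \<le> ennreal (\<epsilon> * h)"
            unfolding eventually_at_right_field using r d bound by (intro exI[of _ "min (r / 2) d"]) auto
          then show False using xE by (simp add: E_def)
        qed
      qed
      ultimately show ?thesis by blast
    qed
    then have "negligible E" by (simp add: negligible_outer_le)
    then have "AE x in lebesgue. x \<notin> E" by (simp add: negligible_iff_null_sets AE_not_in)
    then show ?thesis by (simp add: AE_completion_iff E_def)
  qed
  have "AE x in lborel. \<forall>m::nat. \<forall>\<^sub>F h in at_right 0. ?D f x h \<le> ennreal (1 / real (Suc m) * h)"
    unfolding AE_all_countable by (intro allI neg) simp
  then show ?thesis
  proof eventually_elim
    fix x assume *: "\<forall>m::nat. \<forall>\<^sub>F h in at_right 0. ?D f x h \<le> ennreal (1 / real (Suc m) * h)"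
    show "lebesgue_point (sph_mean \<xi> f x) r"
      unfolding lebesgue_point_def
    proof (intro allI impI)
      fix \<epsilon> :: real assume "\<epsilon> > 0"
      then obtain m where m: "1 / real (Suc m) < \<epsilon>" using reals_Archimedean by (auto simp: inverse_eq_divide)
      have "\<forall>\<^sub>F h in at_right (0::real). h > 0" by (simp add: eventually_at_right_less)
      with *[rule_format, of m] show "\<forall>\<^sub>F h in at_right 0. ?D f x h \<le> ennreal (\<epsilon> * h)"
      proof eventually_elim
        fix h :: real assume h: "?D f x h \<le> ennreal (1 / real (Suc m) * h)" "h > 0"
        have "ennreal (1 / real (Suc m) * h) \<le> ennreal (\<epsilon> * h)"
          using m h(2) by (intro ennreal_leI mult_right_mono) auto
        with h(1) show "?D f x h \<le> ennreal (\<epsilon> * h)" by (rule order_trans)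
      qed
    qed
  qed
qed

end

section \<open>Convergence of spherical means\<close>

text \<open>Tangent line of the convex function t^p at m. The endpoint t = 0 is separate, since
  convexity is used on the open half-line.\<close>

lemma powr_tangent_le:
  fixes t m p :: real
  assumes "p \<ge> 1" "t \<ge> 0" "m > 0"
  shows "m powr p + p * m powr (p - 1) * (t - m) \<le> t powr p"
proof (cases "t = 0")
  case True
  have "m powr (p - 1) * m = m powr p" using assms by (simp add: powr_diff)
  then have "p * m powr (p - 1) * (0 - m) = - (p * m powr p)" by simp
  also have "\<dots> \<le> - (m powr p)" using assms by simp
  finally show ?thesis using True by simp
next
  case False
  have "p * m powr (p - 1) * (t - m) \<le> t powr p - m powr p"
    using False assms
    by (intro convex_on_imp_above_tangent[where A="{0<..}" and f="\<lambda>x. x powr p"] powr_convex)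
       (auto intro!: derivative_eq_intros simp: interior_open)
  then show ?thesis by simp
qed

text \<open>Jensen's inequality, by integrating the tangent at the mean m of |X|; for m = 0 the
  bound is immediate.\<close>

lemma (in prob_space) abs_expectation_powr_le:
  fixes X :: "'a \<Rightarrow> real"
  assumes X: "integrable M X" and p: "p \<ge> 1"
  shows "ennreal (\<bar>expectation X\<bar> powr p) \<le> (\<integral>\<^sup>+x. ennreal (\<bar>X x\<bar> powr p) \<partial>M)"
proof (cases "(\<integral>\<^sup>+x. ennreal (\<bar>X x\<bar> powr p) \<partial>M) = \<infinity>")
  case False
  have [measurable]: "X \<in> borel_measurable M" using X by simp
  have Xp: "integrable M (\<lambda>x. \<bar>X x\<bar> powr p)"
    using False by (intro integrableI_bounded) (auto simp: less_top)
  define m where "m = expectation (\<lambda>x. \<bar>X x\<bar>)"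
  have Xm: "\<bar>expectation X\<bar> \<le> m" unfolding m_def by (rule integral_abs_bound)
  have "m powr p \<le> expectation (\<lambda>x. \<bar>X x\<bar> powr p)"
  proof (cases "m > 0")
    case True
    have "m powr p = expectation (\<lambda>x. m powr p + p * m powr (p - 1) * (\<bar>X x\<bar> - m))"
      using X by (simp add: prob_space m_def)
    also have "\<dots> \<le> expectation (\<lambda>x. \<bar>X x\<bar> powr p)"
      using X Xp powr_tangent_le[OF p _ True] by (intro integral_mono) auto
    finally show ?thesis .
  next
    case False
    then have "m = 0" using Xm by simp
    then show ?thesis using Xp by (simp add: integral_nonneg_AE)
  qed
  moreover have "\<bar>expectation X\<bar> powr p \<le> m powr p" using Xm p by (intro powr_mono2) auto
  ultimately show ?thesis
    using Xp by (subst nn_integral_eq_integral) (auto intro!: ennreal_leI)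
qed simp

lemma lebesgue_point_cong:
  assumes eq: "\<And>s. a < s \<Longrightarrow> s < b \<Longrightarrow> g s = g' s" and r: "a < r" "r < b" and leb: "lebesgue_point g r"
  shows "lebesgue_point g' r"
  unfolding lebesgue_point_def
proof (intro allI impI)
  fix \<epsilon> :: real assume "\<epsilon> > 0"
  then have 1: "\<forall>\<^sub>F h in at_right 0. (\<integral>\<^sup>+s. indicator {r - h..r + h} s * ennreal \<bar>g s - g r\<bar> \<partial>lborel) \<le> ennreal (\<epsilon> * h)"
    using leb by (simp add: lebesgue_point_def)
  have 2: "\<forall>\<^sub>F h in at_right (0::real). h < min (r - a) (b - r)"
    using r unfolding eventually_at_right_field by (intro exI[of _ "min (r - a) (b - r)"]) auto
  show "\<forall>\<^sub>F h in at_right 0. (\<integral>\<^sup>+s. indicator {r - h..r + h} s * ennreal \<bar>g' s - g' r\<bar> \<partial>lborel) \<le> ennreal (\<epsilon> * h)"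
    using 1 2
  proof eventually_elim
    fix h assume h: "(\<integral>\<^sup>+s. indicator {r - h..r + h} s * ennreal \<bar>g s - g r\<bar> \<partial>lborel) \<le> ennreal (\<epsilon> * h)" "h < min (r - a) (b - r)"
    have "(\<integral>\<^sup>+s. indicator {r - h..r + h} s * ennreal \<bar>g' s - g' r\<bar> \<partial>lborel) = (\<integral>\<^sup>+s. indicator {r - h..r + h} s * ennreal \<bar>g s - g r\<bar> \<partial>lborel)"
      using h(2) r eq by (intro nn_integral_cong) (auto simp: indicator_def)
    then show "(\<integral>\<^sup>+s. indicator {r - h..r + h} s * ennreal \<bar>g' s - g' r\<bar> \<partial>lborel) \<le> ennreal (\<epsilon> * h)" using h(1) by simp
  qed
qed

section \<open>Decay at infinity and convergence over planes\<close>

lemma nn_integral_subspace_powr_outside_ball: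
  fixes B :: "'a::euclidean_space set"
  assumes B: "orthonormal B" "B \<noteq> {}" and r: "r > 0" and a: "a > real (card B)"
  shows "(\<integral>\<^sup>+v. indicator {r..} (norm v) * ennreal (norm v powr - a) \<partial>subspace_lborel B) < \<infinity>"
proof -
  let ?k = "card B"
  let ?K = "real ?k * unit_ball_vol (real ?k)" and ?e = "real ?k - 1 - a"
  have k: "?k \<ge> 1" using B orthonormal_finite[OF B(1)] by (simp add: Suc_le_eq card_gt_0_iff)
  have "(\<integral>\<^sup>+v. indicator {r..} (norm v) * ennreal (norm v powr - a) \<partial>subspace_lborel B) =
    (\<integral>\<^sup>+s. indicator {r..} s * ennreal (s powr - a) \<partial>distr (subspace_lborel B) borel (\<lambda>v. sqrt (0\<^sup>2 + (norm v)\<^sup>2)))"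
    by (subst nn_integral_distr) auto
  also have "\<dots> = (\<integral>\<^sup>+s. ennreal (radial_weight ?k 0 s) * (indicator {r..} s * ennreal (s powr - a)) \<partial>lborel)"
    unfolding distr_subspace_lborel_radial[OF B order_refl] by (subst nn_integral_density) auto
  also have "\<dots> \<le> (\<integral>\<^sup>+s. ennreal ?K * (ennreal (s powr ?e) * indicator {r..} s) \<partial>lborel)"
  proof (rule nn_integral_mono)
    fix s :: real
    show "ennreal (radial_weight ?k 0 s) * (indicator {r..} s * ennreal (s powr - a)) \<le> ennreal ?K * (ennreal (s powr ?e) * indicator {r..} s)"
    proof (cases "s \<ge> r")
      case True
      then have s: "s > 0" using r by simp
      have "s ^ (?k - 1) = s powr (real ?k - 1)" using s k by (simp add: of_nat_diff flip: powr_realpow)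
      then have "s ^ (?k - 1) * s powr - a = s powr ?e" by (simp add: powr_add[symmetric])
      then have "radial_weight ?k 0 s * s powr - a = ?K * s powr ?e"
        using s k by (simp add: radial_weight_0 mult.assoc)
      then have "ennreal (radial_weight ?k 0 s) * ennreal (s powr - a) = ennreal ?K * ennreal (s powr ?e)"
        by (metis ennreal_mult'' powr_ge_zero)
      then show ?thesis using True by simp
    qed simp
  qed
  also have "\<dots> = ennreal ?K * (\<integral>\<^sup>+s. ennreal (s powr ?e) * indicator {r..} s \<partial>lborel)"
    by (rule nn_integral_cmult) measurable
  also have "(\<integral>\<^sup>+s. ennreal (s powr ?e) * indicator {r..} s \<partial>lborel) = ennreal (- (r powr (?e + 1)) / (?e + 1))"
    using a r by (intro nn_integral_has_integral_lebesgue' has_integral_powr_to_inf) auto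
  also have "ennreal ?K * \<dots> < \<infinity>" by (simp add: ennreal_mult_less_top)
  finally show ?thesis .
qed

lemma nn_integral_powr_outside_ball:
  assumes r: "r > 0" and a: "a > real CARD('n)"
  shows "(\<integral>\<^sup>+y. indicator {y. norm (y - x) > r} y * ennreal (norm (y - x) powr - a) \<partial>(lborel :: (real^'n) measure)) < \<infinity>"
proof -
  define G where "G = (\<lambda>v :: real^'n. indicator {r..} (norm v) * ennreal (norm v powr - a))"
  have [measurable]: "G \<in> borel_measurable borel" unfolding G_def by measurable
  have "(\<integral>\<^sup>+y. indicator {y. norm (y - x) > r} y * ennreal (norm (y - x) powr - a) \<partial>lborel) \<le> (\<integral>\<^sup>+y. G (- x + y) \<partial>lborel)"
    by (intro nn_integral_mono) (auto simp: G_def indicator_def)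
  also have "\<dots> = (\<integral>\<^sup>+v. G v \<partial>subspace_lborel Basis)"
    unfolding lborel_eq_subspace_lborel[OF orthonormal_Basis span_Basis, symmetric] by (rule nn_integral_lborel_translation) measurable
  also have "\<dots> < \<infinity>"
    unfolding G_def using a by (intro nn_integral_subspace_powr_outside_ball orthonormal_Basis r) auto
  finally show ?thesis .
qed

text \<open>Decay just strong enough for the convergence of the integrals over almost all
  \<open>(n - 2)\<close>-planes, whose average is an integral against a kernel of order \<open>|y - x|\<^sup>-\<^sup>2\<close>.\<close>

definition tame :: "(real^'n \<Rightarrow> real) \<Rightarrow> bool" where
  "tame f \<longleftrightarrow> f \<in> borel_measurable borel \<and>
     (\<forall>x r. r > 0 \<longrightarrow> (\<integral>\<^sup>+y. indicator {y. norm (y - x) > r} y * ennreal (\<bar>f y\<bar> / (norm (y - x))\<^sup>2) \<partial>lborel) < \<infinity>)"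

context
  fixes \<xi> :: "real^'n"
  assumes n: "CARD('n) \<ge> 2" and \<xi>: "norm \<xi> = 1"
begin

lemma tame_if_powr_integrable:
  assumes n3: "CARD('n) \<ge> 3" and [measurable]: "f \<in> borel_measurable borel"
    and p: "1 \<le> p" "p < real CARD('n) / (real CARD('n) - 2)"
    and fin: "(\<integral>\<^sup>+y. ennreal (\<bar>f y\<bar> powr p) \<partial>(lborel :: (real^'n) measure)) < \<infinity>"
  shows "tame f"
  unfolding tame_def
proof (intro conjI allI impI)
  fix x :: "real^'n" and r :: real assume r: "r > 0"
  have pn: "(p - 1) * (real CARD('n) - 2) < 2" using p n3 by (simp add: field_simps)
  \<comment> \<open>The threshold |f(y)| = |y - x|^(-a) separates two bounds. Below it, |f(y)| / |y
    - x|^2 is at most |y - x|^(-a-2), integrable far out since a > n - 2; above it, a multiple of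
    |f(y)|^p suffices since a (p - 1) \<le> 2. The range of p is exactly what makes 2 / (p - 1) > n
    - 2.\<close>
  define a where "a = (if p = 1 then real CARD('n) else 2 / (p - 1))"
  have a: "a > real CARD('n) - 2" "a * (p - 1) = 0 \<or> a * (p - 1) = 2" using p pn by (auto simp: a_def field_simps)
  have "(\<integral>\<^sup>+y. indicator {y. norm (y - x) > r} y * ennreal (\<bar>f y\<bar> / (norm (y - x))\<^sup>2) \<partial>lborel) \<le>
    (\<integral>\<^sup>+y. ennreal (1 + 1 / r\<^sup>2) * ennreal (\<bar>f y\<bar> powr p) + indicator {y. norm (y - x) > r} y * ennreal (norm (y - x) powr - (a + 2)) \<partial>lborel)"
  proof (rule nn_integral_mono)
    fix y
    show "indicator {y. norm (y - x) > r} y * ennreal (\<bar>f y\<bar> / (norm (y - x))\<^sup>2) \<le>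
      ennreal (1 + 1 / r\<^sup>2) * ennreal (\<bar>f y\<bar> powr p) + indicator {y. norm (y - x) > r} y * ennreal (norm (y - x) powr - (a + 2))"
    proof (cases "norm (y - x) > r")
      case True
      define d where "d = norm (y - x)"
      have d: "d > r" "d > 0" using True r by (auto simp: d_def)
      have d2: "d\<^sup>2 = d powr 2" using d by simp
      have "\<bar>f y\<bar> / d\<^sup>2 \<le> (1 + 1 / r\<^sup>2) * \<bar>f y\<bar> powr p + d powr - (a + 2)"
      proof (cases "\<bar>f y\<bar> < d powr - a")
        case True
        then have "\<bar>f y\<bar> / d\<^sup>2 \<le> d powr - a / d\<^sup>2" by (intro divide_right_mono) auto
        also have "\<dots> = d powr - (a + 2)" unfolding d2 by (simp add: powr_diff[symmetric])
        also have "\<dots> \<le> (1 + 1 / r\<^sup>2) * \<bar>f y\<bar> powr p + d powr - (a + 2)" by simp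
        finally show ?thesis .
      next
        case False
        then have f: "\<bar>f y\<bar> \<ge> d powr - a" "\<bar>f y\<bar> > 0" using d by (auto intro: less_le_trans[of 0 "d powr - a"])
        have "\<bar>f y\<bar> powr (1 - p) \<le> (d powr - a) powr (1 - p)"
          using f d p by (intro powr_mono2') auto
        also have "\<dots> = d powr (a * (p - 1))" by (simp add: powr_powr algebra_simps)
        finally have "\<bar>f y\<bar> powr (1 - p) / d\<^sup>2 \<le> d powr (a * (p - 1)) / d\<^sup>2" by (intro divide_right_mono) auto
        also have "\<dots> \<le> 1 + 1 / r\<^sup>2"
        proof -
          have "1 / d\<^sup>2 \<le> 1 / r\<^sup>2" using d r by (intro divide_left_mono power_mono) auto
          moreover have "0 \<le> 1 / r\<^sup>2" by simp
          ultimately show ?thesis using a(2) d by auto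
        qed
        finally have "\<bar>f y\<bar> powr p * (\<bar>f y\<bar> powr (1 - p) / d\<^sup>2) \<le> \<bar>f y\<bar> powr p * (1 + 1 / r\<^sup>2)"
          by (intro mult_left_mono) auto
        also have "\<bar>f y\<bar> powr p * (\<bar>f y\<bar> powr (1 - p) / d\<^sup>2) = \<bar>f y\<bar> / d\<^sup>2"
          using f by (simp add: powr_add[symmetric])
        finally show ?thesis by (simp add: mult.commute add_increasing2)
      qed
      then have "ennreal (\<bar>f y\<bar> / d\<^sup>2) \<le> ennreal ((1 + 1 / r\<^sup>2) * \<bar>f y\<bar> powr p + d powr - (a + 2))" by (rule ennreal_leI)
      also have "\<dots> = ennreal (1 + 1 / r\<^sup>2) * ennreal (\<bar>f y\<bar> powr p) + ennreal (d powr - (a + 2))"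
      proof -
        have "ennreal ((1 + 1 / r\<^sup>2) * \<bar>f y\<bar> powr p + d powr - (a + 2)) = ennreal ((1 + 1 / r\<^sup>2) * \<bar>f y\<bar> powr p) + ennreal (d powr - (a + 2))"
          by (intro ennreal_plus) auto
        also have "ennreal ((1 + 1 / r\<^sup>2) * \<bar>f y\<bar> powr p) = ennreal (1 + 1 / r\<^sup>2) * ennreal (\<bar>f y\<bar> powr p)"
          by (intro ennreal_mult) auto
        finally show ?thesis .
      qed
      finally show ?thesis using True by (simp add: d_def)
    qed simp
  qed
  also have "\<dots> = ennreal (1 + 1 / r\<^sup>2) * (\<integral>\<^sup>+y. ennreal (\<bar>f y\<bar> powr p) \<partial>lborel) +
     (\<integral>\<^sup>+y. indicator {y. norm (y - x) > r} y * ennreal (norm (y - x) powr - (a + 2)) \<partial>lborel)"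
    by (subst nn_integral_add) (auto simp: nn_integral_cmult)
  also have "\<dots> < \<infinity>"
    using fin nn_integral_powr_outside_ball[OF r, of "a + 2" x] a(1) by (simp add: ennreal_mult_less_top)
  finally show "(\<integral>\<^sup>+y. indicator {y. norm (y - x) > r} y * ennreal (\<bar>f y\<bar> / (norm (y - x))\<^sup>2) \<partial>lborel) < \<infinity>" .
qed measurable

lemma tame_if_decay:
  fixes f :: "real^'n \<Rightarrow> real"
  assumes [measurable]: "f \<in> borel_measurable borel" and \<mu>: "\<mu> > real CARD('n) - 2" "\<mu> > 0"
    and B: "\<And>y. \<bar>f y\<bar> \<le> B" and C: "\<And>y. norm y \<ge> R \<Longrightarrow> \<bar>f y\<bar> \<le> C * norm y powr - \<mu>"
  shows "tame f"
  unfolding tame_def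
proof (intro conjI allI impI)
  fix x :: "real^'n" and r :: real assume r: "r > 0"
  \<comment> \<open>Beyond distance D from x one has |y| \<ge> R and |y - x| \<le> 3/2 |y|, so decay
    in |y| turns into decay in |y - x|; within distance D the bound B does.\<close>
  define D where "D = max 1 (max (\<bar>R\<bar> + norm x) (3 * norm x))"
  define K where "K = max (\<bar>B\<bar> * D powr \<mu>) (\<bar>C\<bar> * (3 / 2) powr \<mu>)"
  have K: "\<bar>f y\<bar> \<le> K * norm (y - x) powr - \<mu>" if yx: "norm (y - x) > r" for y
  proof (cases "norm (y - x) \<le> D")
    case True
    have "norm (y - x) > 0" using yx r by linarith
    then have "1 \<le> D / norm (y - x)" using True by simp
    then have "1 \<le> (D / norm (y - x)) powr \<mu>" using \<mu> by (intro ge_one_powr_ge_zero) auto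
    also have "\<dots> = D powr \<mu> * norm (y - x) powr - \<mu>"
      using yx r by (simp add: powr_divide powr_minus_divide D_def)
    finally have "\<bar>B\<bar> * 1 \<le> \<bar>B\<bar> * (D powr \<mu> * norm (y - x) powr - \<mu>)" by (rule mult_left_mono) simp
    also have "\<dots> \<le> K * norm (y - x) powr - \<mu>" unfolding mult.assoc[symmetric] by (rule mult_right_mono) (auto simp: K_def)
    finally show ?thesis using B[of y] by linarith
  next
    case False
    have t: "norm (y - x) \<le> norm y + norm x" by (rule norm_triangle_ineq4)
    then have y: "norm y \<ge> R" "norm (y - x) \<le> 3 / 2 * norm y" "norm y > 0" using False by (auto simp: D_def)
    have "\<bar>f y\<bar> \<le> C * norm y powr - \<mu>" using y by (intro C)
    also have "\<dots> \<le> \<bar>C\<bar> * norm y powr - \<mu>" by (intro mult_right_mono) auto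
    also have "norm y powr - \<mu> \<le> (2 / 3 * norm (y - x)) powr - \<mu>"
      using y yx r \<mu> by (intro powr_mono2') auto
    also have "(2 / 3 * norm (y - x)) powr - \<mu> = (3 / 2) powr \<mu> * norm (y - x) powr - \<mu>"
      by (simp add: powr_mult powr_minus powr_divide field_simps)
    finally have "\<bar>f y\<bar> \<le> \<bar>C\<bar> * ((3 / 2) powr \<mu> * norm (y - x) powr - \<mu>)" by (simp add: mult_left_mono)
    also have "\<dots> \<le> K * norm (y - x) powr - \<mu>" unfolding mult.assoc[symmetric] by (rule mult_right_mono) (auto simp: K_def)
    finally show ?thesis .
  qed
  have K0: "K \<ge> 0" by (auto simp: K_def le_max_iff_disj)
  have "(\<integral>\<^sup>+y. indicator {y. norm (y - x) > r} y * ennreal (\<bar>f y\<bar> / (norm (y - x))\<^sup>2) \<partial>lborel) \<le>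
    (\<integral>\<^sup>+y. ennreal K * (indicator {y. norm (y - x) > r} y * ennreal (norm (y - x) powr - (\<mu> + 2))) \<partial>lborel)"
  proof (rule nn_integral_mono)
    fix y
    show "indicator {y. norm (y - x) > r} y * ennreal (\<bar>f y\<bar> / (norm (y - x))\<^sup>2) \<le>
       ennreal K * (indicator {y. norm (y - x) > r} y * ennreal (norm (y - x) powr - (\<mu> + 2)))"
    proof (cases "norm (y - x) > r")
      case True
      then have d: "norm (y - x) > 0" using r by linarith
      have "\<bar>f y\<bar> / (norm (y - x))\<^sup>2 \<le> K * norm (y - x) powr - \<mu> / (norm (y - x))\<^sup>2"
        using K[OF True] by (rule divide_right_mono) simp
      also have "\<dots> = K * norm (y - x) powr - (\<mu> + 2)"
        using d powr_diff[of "norm (y - x)" "- \<mu>" 2] by simp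
      finally show ?thesis using True K0 by (simp add: ennreal_mult''[symmetric] ennreal_leI)
    qed simp
  qed
  also have "\<dots> = ennreal K * (\<integral>\<^sup>+y. indicator {y. norm (y - x) > r} y * ennreal (norm (y - x) powr - (\<mu> + 2)) \<partial>lborel)"
    by (rule nn_integral_cmult) measurable
  also have "\<dots> < \<infinity>"
    using nn_integral_powr_outside_ball[OF r, of "\<mu> + 2" x] \<mu> by (simp add: ennreal_mult_less_top)
  finally show "(\<integral>\<^sup>+y. indicator {y. norm (y - x) > r} y * ennreal (\<bar>f y\<bar> / (norm (y - x))\<^sup>2) \<partial>lborel) < \<infinity>" .
qed measurable

lemma tame_borel: "tame f \<Longrightarrow> f \<in> borel_measurable borel"
  by (simp add: tame_def)

text \<open>Tameness in polar coordinates around x: dividing by s^2 lowers the weight s^(n-1) to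
  s^(n-3), the moment in \<open>tail_integrable\<close> for k = n - 2.\<close>

lemma tame_radial:
  assumes n3: "CARD('n) \<ge> 3" and f: "tame f" and r: "r > 0"
  shows "(\<integral>\<^sup>+s. indicator {r<..} s * (ennreal (s ^ (CARD('n) - 3)) * sph_nn \<xi> (\<lambda>y. ennreal \<bar>f y\<bar>) x s) \<partial>lborel) < \<infinity>"
proof -
  let ?K = "real CARD('n) * unit_ball_vol (real CARD('n))"
  have [measurable]: "f \<in> borel_measurable borel" using f by (rule tame_borel)
  have K: "?K > 0" using n by (intro mult_pos_pos) auto
  define G where "G = (\<lambda>y. indicator {y. norm (y - x) > r} y * ennreal (\<bar>f y\<bar> / (norm (y - x))\<^sup>2))"
  have [measurable]: "G \<in> borel_measurable borel" unfolding G_def by measurable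
  have "(\<integral>\<^sup>+s. indicator {r<..} s * (ennreal (s ^ (CARD('n) - 3)) * sph_nn \<xi> (\<lambda>y. ennreal \<bar>f y\<bar>) x s) \<partial>lborel) =
     (\<integral>\<^sup>+s. ennreal (1 / ?K) * (ennreal (radial_weight CARD('n) 0 s) * sph_nn \<xi> G x s) \<partial>lborel)"
  proof (rule nn_integral_cong)
    fix s :: real
    show "indicator {r<..} s * (ennreal (s ^ (CARD('n) - 3)) * sph_nn \<xi> (\<lambda>y. ennreal \<bar>f y\<bar>) x s) =
       ennreal (1 / ?K) * (ennreal (radial_weight CARD('n) 0 s) * sph_nn \<xi> G x s)"
    proof (cases "s > 0")
      case s: True
      have "G (x + s *\<^sub>R (A *v \<xi>)) = (indicator {r<..} s * ennreal (1 / s\<^sup>2)) * ennreal \<bar>f (x + s *\<^sub>R (A *v \<xi>))\<bar>"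
        if "A \<in> space haar_SO" for A :: "real^'n^'n"
        using norm_rotation[OF n \<xi> that, of \<xi>] s \<xi> by (simp add: G_def indicator_def ennreal_mult''[symmetric])
      then have "sph_nn \<xi> G x s = (\<integral>\<^sup>+A. (indicator {r<..} s * ennreal (1 / s\<^sup>2)) * ennreal \<bar>f (x + s *\<^sub>R (A *v \<xi>))\<bar> \<partial>haar_SO)"
        unfolding sph_nn_def by (intro nn_integral_cong) auto
      also have "\<dots> = (indicator {r<..} s * ennreal (1 / s\<^sup>2)) * sph_nn \<xi> (\<lambda>y. ennreal \<bar>f y\<bar>) x s"
        unfolding sph_nn_def by (rule nn_integral_cmult) measurable
      finally have 1: "ennreal (1 / ?K) * (ennreal (radial_weight CARD('n) 0 s) * sph_nn \<xi> G x s) =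
          indicator {r<..} s * (ennreal (1 / ?K) * ennreal (radial_weight CARD('n) 0 s) * ennreal (1 / s\<^sup>2) * sph_nn \<xi> (\<lambda>y. ennreal \<bar>f y\<bar>) x s)"
        by (simp add: mult_ac)
      have "CARD('n) - 1 = CARD('n) - 3 + 2" using n3 by simp
      then have "s ^ (CARD('n) - 1) = s ^ (CARD('n) - 3) * s\<^sup>2" by (simp only: power_add)
      then have "1 / ?K * radial_weight CARD('n) 0 s * (1 / s\<^sup>2) = s ^ (CARD('n) - 3)"
        using K s n by (simp add: radial_weight_0)
      moreover have "ennreal (1 / ?K * radial_weight CARD('n) 0 s * (1 / s\<^sup>2)) = ennreal (1 / ?K) * ennreal (radial_weight CARD('n) 0 s) * ennreal (1 / s\<^sup>2)"
      proof -
        have "0 \<le> 1 / ?K" "0 \<le> radial_weight CARD('n) 0 s" "0 \<le> 1 / s\<^sup>2"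
          using K by (auto simp: radial_weight_nonneg)
        then show ?thesis by (simp only: ennreal_mult mult_nonneg_nonneg)
      qed
      ultimately show ?thesis by (simp only: 1)
    qed (use r in \<open>simp add: radial_weight_def\<close>)
  qed
  also have "\<dots> = ennreal (1 / ?K) * (\<integral>\<^sup>+s. ennreal (radial_weight CARD('n) 0 s) * sph_nn \<xi> G x s \<partial>lborel)"
    by (rule nn_integral_cmult) measurable
  also have "\<dots> = ennreal (1 / ?K) * (\<integral>\<^sup>+y. G y \<partial>lborel)"
    by (subst nn_integral_polar[OF n \<xi>, of G x]) auto
  also have "\<dots> < \<infinity>" using f r unfolding G_def by (simp add: tame_def ennreal_mult_less_top)
  finally show ?thesis .
qed

lemma tame_tail_integrable:
  assumes n3: "CARD('n) \<ge> 3" and f: "tame f" and [measurable]: "h \<in> borel_measurable borel"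
    and h: "\<And>s. ennreal \<bar>h s\<bar> \<le> sph_nn \<xi> (\<lambda>y. ennreal \<bar>f y\<bar>) x s"
  shows "tail_integrable (CARD('n) - 2) h"
  unfolding tail_integrable_def
proof (intro conjI allI impI)
  fix r :: real assume r: "r > 0"
  show "integrable lborel (\<lambda>s. indicator {r<..} s * (s ^ (CARD('n) - 2 - 1) * h s))"
  proof (rule integrableI_bounded)
    have "(\<integral>\<^sup>+s. ennreal (norm (indicator {r<..} s * (s ^ (CARD('n) - 2 - 1) * h s))) \<partial>lborel) \<le>
      (\<integral>\<^sup>+s. indicator {r<..} s * (ennreal (s ^ (CARD('n) - 3)) * sph_nn \<xi> (\<lambda>y. ennreal \<bar>f y\<bar>) x s) \<partial>lborel)"
    proof (rule nn_integral_mono)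
      fix s
      show "ennreal (norm (indicator {r<..} s * (s ^ (CARD('n) - 2 - 1) * h s))) \<le>
         indicator {r<..} s * (ennreal (s ^ (CARD('n) - 3)) * sph_nn \<xi> (\<lambda>y. ennreal \<bar>f y\<bar>) x s)"
      proof (cases "s > r")
        case True
        have "CARD('n) - 2 - 1 = CARD('n) - 3" by simp
        then have "norm (indicator {r<..} s * (s ^ (CARD('n) - 2 - 1) * h s)) = s ^ (CARD('n) - 3) * \<bar>h s\<bar>"
          using True r by (simp add: abs_mult)
        also have "ennreal \<dots> = ennreal (s ^ (CARD('n) - 3)) * ennreal \<bar>h s\<bar>" by (rule ennreal_mult'') simp
        also have "\<dots> \<le> ennreal (s ^ (CARD('n) - 3)) * sph_nn \<xi> (\<lambda>y. ennreal \<bar>f y\<bar>) x s"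
          by (rule mult_left_mono[OF h]) simp
        finally show ?thesis using True by simp
      qed simp
    qed
    also have "\<dots> < \<infinity>" by (rule tame_radial[OF n3 f r])
    finally show "(\<integral>\<^sup>+s. ennreal (norm (indicator {r<..} s * (s ^ (CARD('n) - 2 - 1) * h s))) \<partial>lborel) < \<infinity>" .
  qed measurable
qed measurable

lemma tame_sph_mean_tail_integrable:
  assumes n3: "CARD('n) \<ge> 3" and f: "tame f"
  shows "tail_integrable (CARD('n) - 2) (sph_mean \<xi> f x)"
proof -
  have [measurable]: "f \<in> borel_measurable borel" using f by (rule tame_borel)
  show ?thesis
    by (rule tame_tail_integrable[OF n3 f]) (measurable, rule abs_sph_mean_le[OF n \<xi>], measurable)
qed

lemma tame_AE_sph_nn_finite:
  assumes n3: "CARD('n) \<ge> 3" and f: "tame f"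
  shows "AE s in lborel. s > 0 \<longrightarrow> sph_nn \<xi> (\<lambda>y. ennreal \<bar>f y\<bar>) x s < \<infinity>"
proof -
  have [measurable]: "f \<in> borel_measurable borel" using f by (rule tame_borel)
  let ?I = "\<lambda>r s. indicator {r<..} s * (ennreal (s ^ (CARD('n) - 3)) * sph_nn \<xi> (\<lambda>y. ennreal \<bar>f y\<bar>) x s)"
  have "AE s in lborel. \<forall>m. ?I (1 / real (Suc m)) s \<noteq> \<infinity>"
    unfolding AE_all_countable
  proof
    fix m
    have "(\<integral>\<^sup>+s. ?I (1 / real (Suc m)) s \<partial>lborel) < \<infinity>" by (rule tame_radial[OF n3 f]) simp
    then show "AE s in lborel. ?I (1 / real (Suc m)) s \<noteq> \<infinity>" by (intro nn_integral_PInf_AE) auto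
  qed
  then show ?thesis
  proof (eventually_elim, safe)
    fix s :: real assume *: "\<forall>m. ?I (1 / real (Suc m)) s \<noteq> \<infinity>" and s: "s > 0"
    obtain m where "1 / real (Suc m) < s" using s reals_Archimedean by (auto simp: inverse_eq_divide)
    then have "ennreal (s ^ (CARD('n) - 3)) * sph_nn \<xi> (\<lambda>y. ennreal \<bar>f y\<bar>) x s \<noteq> \<infinity>" using *[rule_format, of m] by simp
    moreover have "s ^ (CARD('n) - 3) > 0" using s by simp
    ultimately show "sph_nn \<xi> (\<lambda>y. ennreal \<bar>f y\<bar>) x s < \<infinity>"
      using s by (auto simp: less_top ennreal_mult_eq_top_iff)
  qed
qed

lemma tame_AE_radial_weight_finite:
  assumes n3: "CARD('n) \<ge> 3" and f: "tame f"
  shows "AE q in lborel. q > 0 \<longrightarrow> (\<integral>\<^sup>+s. ennreal (radial_weight (CARD('n) - 2) q s) * sph_nn \<xi> (\<lambda>y. ennreal \<bar>f y\<bar>) x s \<partial>lborel) < \<infinity>"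
proof -
  have [measurable]: "f \<in> borel_measurable borel" using f by (rule tame_borel)
  \<comment> \<open>The spherical means of |f| may be infinite for a null set of radii; the
    real-valued g agrees with them elsewhere.\<close>
  define g where "g = (\<lambda>s. enn2real (sph_nn \<xi> (\<lambda>y. ennreal \<bar>f y\<bar>) x s))"
  have [measurable]: "g \<in> borel_measurable borel" unfolding g_def by measurable
  have "tail_integrable (CARD('n) - 2) g"
    by (rule tame_tail_integrable[OF n3 f, where x=x]) (auto simp: g_def ennreal_enn2real_if)
  then have "AE q in lborel. q > 0 \<longrightarrow> (\<integral>\<^sup>+s. ennreal (radial_weight (CARD('n) - 2) q s) * ennreal \<bar>g s\<bar> \<partial>lborel) < \<infinity>"
    using n3 by (intro AE_EK_mean_finite) auto
  then show ?thesis
  proof (eventually_elim, safe)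
    fix q :: real assume q: "q > 0" "(\<integral>\<^sup>+s. ennreal (radial_weight (CARD('n) - 2) q s) * ennreal \<bar>g s\<bar> \<partial>lborel) < \<infinity>"
    have "(\<integral>\<^sup>+s. ennreal (radial_weight (CARD('n) - 2) q s) * sph_nn \<xi> (\<lambda>y. ennreal \<bar>f y\<bar>) x s \<partial>lborel) =
      (\<integral>\<^sup>+s. ennreal (radial_weight (CARD('n) - 2) q s) * ennreal \<bar>g s\<bar> \<partial>lborel)"
    proof (rule nn_integral_cong_AE)
      show "AE s in lborel. ennreal (radial_weight (CARD('n) - 2) q s) * sph_nn \<xi> (\<lambda>y. ennreal \<bar>f y\<bar>) x s =
         ennreal (radial_weight (CARD('n) - 2) q s) * ennreal \<bar>g s\<bar>"
        using tame_AE_sph_nn_finite[OF n3 f, of x]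
      proof eventually_elim
        fix s assume s: "s > 0 \<longrightarrow> sph_nn \<xi> (\<lambda>y. ennreal \<bar>f y\<bar>) x s < \<infinity>"
        show "ennreal (radial_weight (CARD('n) - 2) q s) * sph_nn \<xi> (\<lambda>y. ennreal \<bar>f y\<bar>) x s =
         ennreal (radial_weight (CARD('n) - 2) q s) * ennreal \<bar>g s\<bar>"
          using s q(1) by (cases "s > q") (auto simp: g_def ennreal_enn2real radial_weight_def)
      qed
    qed
    then show "(\<integral>\<^sup>+s. ennreal (radial_weight (CARD('n) - 2) q s) * sph_nn \<xi> (\<lambda>y. ennreal \<bar>f y\<bar>) x s \<partial>lborel) < \<infinity>" using q(2) by simp
  qed
qed

text \<open>For \<open>n > 3\<close> the weight is bounded on compact sets, so no radius is exceptional.\<close>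

lemma tame_radial_weight_finite:
  assumes n3: "CARD('n) > 3" and f: "tame f" and q: "q > 0"
  shows "(\<integral>\<^sup>+s. ennreal (radial_weight (CARD('n) - 2) q s) * sph_nn \<xi> (\<lambda>y. ennreal \<bar>f y\<bar>) x s \<partial>lborel) < \<infinity>"
proof -
  have [measurable]: "f \<in> borel_measurable borel" using f by (rule tame_borel)
  let ?k = "CARD('n) - 2"
  let ?K = "real ?k * unit_ball_vol (real ?k)"
  have "(\<integral>\<^sup>+s. ennreal (radial_weight ?k q s) * sph_nn \<xi> (\<lambda>y. ennreal \<bar>f y\<bar>) x s \<partial>lborel) \<le>
    (\<integral>\<^sup>+s. ennreal ?K * (indicator {q<..} s * (ennreal (s ^ (CARD('n) - 3)) * sph_nn \<xi> (\<lambda>y. ennreal \<bar>f y\<bar>) x s)) \<partial>lborel)"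
  proof (rule nn_integral_mono)
    fix s
    show "ennreal (radial_weight ?k q s) * sph_nn \<xi> (\<lambda>y. ennreal \<bar>f y\<bar>) x s \<le>
      ennreal ?K * (indicator {q<..} s * (ennreal (s ^ (CARD('n) - 3)) * sph_nn \<xi> (\<lambda>y. ennreal \<bar>f y\<bar>) x s))"
    proof (cases "s > q")
      case True
      then have s: "s > 0" "0 \<le> s\<^sup>2 - q\<^sup>2" using q by (auto simp: power_mono)
      have k: "real ?k \<ge> 2" using n3 by linarith
      have "(s\<^sup>2 - q\<^sup>2) powr (real ?k / 2 - 1) \<le> (s\<^sup>2) powr (real ?k / 2 - 1)"
        using s k by (intro powr_mono2) auto
      also have "\<dots> = s powr (2 * (real ?k / 2 - 1))" using s powr_powr[of s 2 "real ?k / 2 - 1"] by simp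
      also have "2 * (real ?k / 2 - 1) = real ?k - 2" by simp
      finally have "(s\<^sup>2 - q\<^sup>2) powr (real ?k / 2 - 1) * s \<le> s powr (real ?k - 2) * s"
        using s by (intro mult_right_mono) auto
      also have "\<dots> = s powr (real ?k - 1)" using s powr_add[of s "real ?k - 2" 1] by simp
      also have "real ?k - 1 = real (CARD('n) - 3)" using n3 by simp
      also have "s powr real (CARD('n) - 3) = s ^ (CARD('n) - 3)" using s by (simp add: powr_realpow)
      finally have "?K * ((s\<^sup>2 - q\<^sup>2) powr (real ?k / 2 - 1) * s) \<le> ?K * s ^ (CARD('n) - 3)"
        by (intro mult_left_mono) auto
      then have "ennreal (radial_weight ?k q s) \<le> ennreal (?K * s ^ (CARD('n) - 3))"
        using True by (intro ennreal_leI) (simp add: radial_weight_def mult.assoc)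
      also have "\<dots> = ennreal ?K * ennreal (s ^ (CARD('n) - 3))" using s by (intro ennreal_mult) auto
      finally show ?thesis using True by (simp add: mult.assoc[symmetric] mult_right_mono)
    qed (simp add: radial_weight_def)
  qed
  also have "\<dots> = ennreal ?K * (\<integral>\<^sup>+s. indicator {q<..} s * (ennreal (s ^ (CARD('n) - 3)) * sph_nn \<xi> (\<lambda>y. ennreal \<bar>f y\<bar>) x s) \<partial>lborel)"
    by (rule nn_integral_cmult) measurable
  also have "\<dots> < \<infinity>" using tame_radial[OF _ f q, of x] n3 by (simp add: ennreal_mult_less_top)
  finally show ?thesis .
qed

text \<open>Being a Lebesgue point is local in the radius: for |x| < R and radii below 2 r only the
  values of f on the ball of radius R + 2 r matter, and there f is integrable.\<close>

lemma tame_AE_lebesgue_point: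
  assumes f: "tame f" and r: "r > 0"
  shows "AE x in lborel. lebesgue_point (sph_mean \<xi> f x) r"
proof -
  have [measurable]: "f \<in> borel_measurable borel" using f by (rule tame_borel)
  have "AE x in lborel. \<forall>R::nat. norm x < real R \<longrightarrow> lebesgue_point (sph_mean \<xi> f x) r"
    unfolding AE_all_countable
  proof
    fix R :: nat
    define R' where "R' = real R + 2 * r"
    define fR where "fR = (\<lambda>y. indicator (ball 0 R') y * f y)"
    have [measurable]: "ball (0::real^'n) R' \<in> sets borel" by simp
    have fRm[measurable]: "fR \<in> borel_measurable borel" unfolding fR_def by measurable
    \<comment> \<open>Tameness bounds integrals away from its centre, so integrability on the ball
      is read off from a centre at distance 1 outside it.\<close>
    define x0 where "x0 = (R' + 1) *\<^sub>R \<xi>"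
    have x0: "norm x0 = R' + 1" using r \<xi> by (simp add: x0_def R'_def)
    have "(\<integral>\<^sup>+y. ennreal \<bar>fR y\<bar> \<partial>lborel) \<le> (\<integral>\<^sup>+y. ennreal ((2 * R' + 1)\<^sup>2) * (indicator {y. norm (y - x0) > 1 / 2} y * ennreal (\<bar>f y\<bar> / (norm (y - x0))\<^sup>2)) \<partial>lborel)"
    proof (rule nn_integral_mono)
      fix y
      show "ennreal \<bar>fR y\<bar> \<le> ennreal ((2 * R' + 1)\<^sup>2) * (indicator {y. norm (y - x0) > 1 / 2} y * ennreal (\<bar>f y\<bar> / (norm (y - x0))\<^sup>2))"
      proof (cases "y \<in> ball 0 R'")
        case True
        then have "norm (y - x0) > 1 / 2" "norm (y - x0) \<le> 2 * R' + 1"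
          using norm_triangle_ineq2[of x0 y] norm_triangle_ineq4[of y x0] x0 by (auto simp: norm_minus_commute)
        then have "1 * \<bar>f y\<bar> \<le> ((2 * R' + 1)\<^sup>2 / (norm (y - x0))\<^sup>2) * \<bar>f y\<bar>"
          by (intro mult_right_mono) (auto simp: divide_simps intro!: power_mono)
        then show ?thesis using True \<open>norm (y - x0) > 1 / 2\<close>
          by (auto simp: fR_def ennreal_mult''[symmetric] intro!: ennreal_leI)
      qed (simp add: fR_def)
    qed
    also have "\<dots> = ennreal ((2 * R' + 1)\<^sup>2) * (\<integral>\<^sup>+y. indicator {y. norm (y - x0) > 1 / 2} y * ennreal (\<bar>f y\<bar> / (norm (y - x0))\<^sup>2) \<partial>lborel)"
      by (rule nn_integral_cmult) measurable
    also have "\<dots> < \<infinity>"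
      using f[unfolded tame_def, THEN conjunct2, rule_format, of "1 / 2" x0] by (auto simp: ennreal_mult_less_top)
    finally have "AE x in lborel. lebesgue_point (sph_mean \<xi> fR x) r"
      by (intro AE_lebesgue_point_L1[OF n \<xi> fRm _ r])
    then show "AE x in lborel. norm x < real R \<longrightarrow> lebesgue_point (sph_mean \<xi> f x) r"
    proof (eventually_elim, safe)
      fix x assume leb: "lebesgue_point (sph_mean \<xi> fR x) r" and x: "norm x < real R"
      show "lebesgue_point (sph_mean \<xi> f x) r"
      proof (rule lebesgue_point_cong[OF _ _ _ leb])
        fix s assume s: "0 < s" "s < 2 * r"
        show "sph_mean \<xi> fR x s = sph_mean \<xi> f x s"
          unfolding sph_mean_def
        proof (rule Bochner_Integration.integral_cong[OF refl])
          fix A :: "real^'n^'n" assume A: "A \<in> space haar_SO"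
          have "norm (x + s *\<^sub>R (A *v \<xi>)) \<le> norm x + s"
            using norm_triangle_ineq[of x "s *\<^sub>R (A *v \<xi>)"] norm_rotation[OF n \<xi> A, of \<xi>] s \<xi> by simp
          then show "fR (x + s *\<^sub>R (A *v \<xi>)) = f (x + s *\<^sub>R (A *v \<xi>))"
            using s x by (simp add: fR_def R'_def)
        qed
      qed (use r in auto)
    qed
  qed
  then show ?thesis
  proof eventually_elim
    fix x :: "real^'n" assume *: "\<forall>R::nat. norm x < real R \<longrightarrow> lebesgue_point (sph_mean \<xi> f x) r"
    obtain R :: nat where "norm x < real R" using reals_Archimedean2 by blast
    then show "lebesgue_point (sph_mean \<xi> f x) r" using * by blast
  qed
qed

section \<open>Convergence of spherical means in L^p\<close>

lemma nn_integral_translation_continuous: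
  fixes f :: "real^'n \<Rightarrow> real"
  assumes fm[measurable]: "f \<in> borel_measurable borel" and p: "p \<ge> 1"
    and fin: "(\<integral>\<^sup>+y. ennreal (\<bar>f y\<bar> powr p) \<partial>lborel) < \<infinity>" and \<epsilon>: "\<epsilon> > 0"
  obtains \<delta> where "\<delta> > 0" "\<And>z. norm z < \<delta> \<Longrightarrow> (\<integral>\<^sup>+y. ennreal (\<bar>f (y + z) - f y\<bar> powr p) \<partial>lborel) \<le> ennreal \<epsilon>"
proof -
  \<comment> \<open>Three terms, and two applications of the inequality with factor 2^p in place of
    the triangle inequality.\<close>
  define \<epsilon>1 where "\<epsilon>1 = \<epsilon> / (3 * (2 powr p * 2 powr p))"
  have \<epsilon>1: "\<epsilon>1 > 0" using \<epsilon> by (simp add: \<epsilon>1_def)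
  obtain g R where g: "continuous_on UNIV g" "\<And>x. norm x \<ge> R \<Longrightarrow> g x = 0"
    and fg: "(\<integral>\<^sup>+x. ennreal (\<bar>f x - g x\<bar> powr p) \<partial>lborel) \<le> ennreal \<epsilon>1"
    using Lp_approx_continuous[OF fm p fin \<epsilon>1] by blast
  have [measurable]: "g \<in> borel_measurable borel" using g(1) by (rule borel_measurable_continuous_onI)
  define V where "V = measure lborel (cball (0::real^'n) (\<bar>R\<bar> + 1))"
  have V: "emeasure lborel (cball (0::real^'n) (\<bar>R\<bar> + 1)) = ennreal V" "V \<ge> 0"
    unfolding V_def by (auto simp: emeasure_eq_ennreal_measure emeasure_cball)
  define \<eta> where "\<eta> = (\<epsilon>1 / (V + 1)) powr (1 / p)"
  have \<eta>: "\<eta> > 0" "\<eta> powr p = \<epsilon>1 / (V + 1)" using \<epsilon>1 V p by (auto simp: \<eta>_def powr_powr)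
  obtain d where d: "d > 0" "d \<le> 1" "\<And>x y. dist x y < d \<Longrightarrow> \<bar>g x - g y\<bar> < \<eta>"
    using compact_support_uniform[OF g \<eta>(1)] by blast
  show thesis
  proof
    show "d > 0" by fact
    fix z :: "real^'n" assume z: "norm z < d"
    let ?b = "\<lambda>y. f y - g y"
    let ?I = "\<lambda>h. \<integral>\<^sup>+y. ennreal (\<bar>h y\<bar> powr p) \<partial>(lborel :: (real^'n) measure)"
    have p0: "p \<ge> 0" using p by simp
    have b1: "?I (\<lambda>y. ?b (y + z)) \<le> ennreal \<epsilon>1"
      using nn_integral_lborel_translation[of "\<lambda>y. ennreal (\<bar>?b y\<bar> powr p)" z] fg by (simp add: add.commute)
    have b2: "?I (\<lambda>y. - ?b y) \<le> ennreal \<epsilon>1" using fg by (simp add: abs_minus_commute)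
    have "?I (\<lambda>y. g (y + z) - g y) \<le> (\<integral>\<^sup>+y. ennreal (\<eta> powr p) * indicator (cball 0 (\<bar>R\<bar> + 1)) y \<partial>(lborel :: (real^'n) measure))"
    proof (rule nn_integral_mono)
      fix y :: "real^'n"
      show "ennreal (\<bar>g (y + z) - g y\<bar> powr p) \<le> ennreal (\<eta> powr p) * indicator (cball 0 (\<bar>R\<bar> + 1)) y"
      proof (cases "y \<in> cball 0 (\<bar>R\<bar> + 1)")
        case True
        have "\<bar>g (y + z) - g y\<bar> < \<eta>" using z by (intro d) (simp add: dist_norm)
        then show ?thesis using True p by (auto intro!: ennreal_leI powr_mono2)
      next
        case False
        then have "norm y \<ge> R" "norm (y + z) \<ge> R" using norm_diff_ineq[of y z] z d by auto
        then show ?thesis using g(2) by simp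
      qed
    qed
    also have "\<dots> = ennreal (\<eta> powr p) * ennreal V"
      by (subst nn_integral_cmult_indicator) (auto simp: V)
    also have "\<dots> = ennreal (\<epsilon>1 / (V + 1) * V)" unfolding \<eta>(2) using V(2) by (rule ennreal_mult''[symmetric])
    also have "\<dots> \<le> ennreal \<epsilon>1" using V \<epsilon>1 by (intro ennreal_leI) (simp add: field_simps)
    finally have g1: "?I (\<lambda>y. g (y + z) - g y) \<le> ennreal \<epsilon>1" .
    have "?I (\<lambda>y. f (y + z) - f y) = ?I (\<lambda>y. ?b (y + z) + ((g (y + z) - g y) + - ?b y))" by simp
    also have "\<dots> \<le> ennreal (2 powr p) * (?I (\<lambda>y. ?b (y + z)) + ?I (\<lambda>y. (g (y + z) - g y) + - ?b y))"
      by (rule nn_integral_abs_add_powr_le[OF _ _ p0]) measurable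
    also have "\<dots> \<le> ennreal (2 powr p) * (ennreal \<epsilon>1 + ennreal (2 powr p) * (?I (\<lambda>y. g (y + z) - g y) + ?I (\<lambda>y. - ?b y)))"
      by (intro mult_left_mono add_mono b1 nn_integral_abs_add_powr_le[OF _ _ p0]) measurable
    also have "\<dots> \<le> ennreal (2 powr p) * (ennreal \<epsilon>1 + ennreal (2 powr p) * (ennreal \<epsilon>1 + ennreal \<epsilon>1))"
      by (intro mult_left_mono add_mono g1 b2 order_refl) auto
    also have "\<dots> = ennreal (2 powr p * (\<epsilon>1 + 2 powr p * (\<epsilon>1 + \<epsilon>1)))"
      using \<epsilon>1 by (simp add: ennreal_mult''[symmetric] ennreal_plus[symmetric] del: ennreal_plus)
    also have "\<dots> \<le> ennreal (2 powr p * (2 powr p * \<epsilon>1 + 2 powr p * (\<epsilon>1 + \<epsilon>1)))"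
      using \<epsilon>1 p by (intro ennreal_leI mult_left_mono add_right_mono) (auto intro!: ge_one_powr_ge_zero)
    also have "2 powr p * (2 powr p * \<epsilon>1 + 2 powr p * (\<epsilon>1 + \<epsilon>1)) = \<epsilon>" by (simp add: \<epsilon>1_def field_simps)
    finally show "?I (\<lambda>y. f (y + z) - f y) \<le> ennreal \<epsilon>" .
  qed
qed

lemma AE_sph_nn_abs_finite:
  assumes [measurable]: "f \<in> borel_measurable borel" and p: "p \<ge> 1"
    and fin: "(\<integral>\<^sup>+y. ennreal (\<bar>f y\<bar> powr p) \<partial>(lborel :: (real^'n) measure)) < \<infinity>"
  shows "AE x in lborel. sph_nn \<xi> (\<lambda>y. ennreal \<bar>f y\<bar>) x r < \<infinity>"
proof -
  have "AE x in lborel. sph_nn \<xi> (\<lambda>y. ennreal (\<bar>f y\<bar> powr p)) x r \<noteq> \<infinity>"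
    using fin nn_integral_sph_nn[OF n \<xi>, of "\<lambda>y. ennreal (\<bar>f y\<bar> powr p)" r] by (intro nn_integral_PInf_AE) auto
  then show ?thesis
  proof eventually_elim
    fix x assume x: "sph_nn \<xi> (\<lambda>y. ennreal (\<bar>f y\<bar> powr p)) x r \<noteq> \<infinity>"
    have "ennreal \<bar>t\<bar> \<le> 1 + ennreal (\<bar>t\<bar> powr p)" for t
    proof (cases "\<bar>t\<bar> \<le> 1")
      case True
      then have "ennreal \<bar>t\<bar> \<le> 1" by (simp add: ennreal_le_1)
      then show ?thesis by (rule order_trans) simp
    next
      case False
      then have "\<bar>t\<bar> powr 1 \<le> \<bar>t\<bar> powr p" using p by (intro powr_mono) auto
      then have "ennreal \<bar>t\<bar> \<le> ennreal (\<bar>t\<bar> powr p)" by (intro ennreal_leI) simp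
      then show ?thesis by (rule order_trans) simp
    qed
    then have "sph_nn \<xi> (\<lambda>y. ennreal \<bar>f y\<bar>) x r \<le> (\<integral>\<^sup>+A. 1 + ennreal (\<bar>f (x + r *\<^sub>R (A *v \<xi>))\<bar> powr p) \<partial>haar_SO)"
      unfolding sph_nn_def by (intro nn_integral_mono) auto
    also have "\<dots> = 1 + sph_nn \<xi> (\<lambda>y. ennreal (\<bar>f y\<bar> powr p)) x r"
      unfolding sph_nn_def by (subst nn_integral_add) (auto simp: emeasure_haar_SO_space)
    also have "\<dots> < \<infinity>" using x by (simp add: less_top)
    finally show "sph_nn \<xi> (\<lambda>y. ennreal \<bar>f y\<bar>) x r < \<infinity>" .
  qed
qed

text \<open>Jensen's inequality moves the p-th power inside the rotation average, Fubini's theorem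
  leaves translates of f by vectors of length r, and translation is continuous in L^p.\<close>

lemma sph_mean_Lp_tendsto:
  assumes fm[measurable]: "f \<in> borel_measurable borel" and p: "p \<ge> 1"
    and fin: "(\<integral>\<^sup>+y. ennreal (\<bar>f y\<bar> powr p) \<partial>(lborel :: (real^'n) measure)) < \<infinity>"
  shows "((\<lambda>r. \<integral>\<^sup>+x. ennreal (\<bar>sph_mean \<xi> f x r - f x\<bar> powr p) \<partial>lborel) \<longlongrightarrow> 0) (at_right 0)"
proof (rule order_tendstoI)
  fix a :: ennreal assume a: "0 < a"
  interpret prob_space "haar_SO :: (real^'n^'n) measure" by (rule prob_space_haar_SO)
  interpret P: pair_sigma_finite "haar_SO :: (real^'n^'n) measure" "lborel :: (real^'n) measure" ..
  obtain b where b: "0 < b" "b < a" using a dense by blast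
  then have bt: "b < top" by (auto intro: less_le_trans)
  then have "enn2real b > 0" using b by (simp add: enn2real_positive_iff)
  then obtain \<delta> where \<delta>: "\<delta> > 0" "\<And>z. norm z < \<delta> \<Longrightarrow> (\<integral>\<^sup>+y. ennreal (\<bar>f (y + z) - f y\<bar> powr p) \<partial>lborel) \<le> ennreal (enn2real b)"
    using nn_integral_translation_continuous[OF fm p fin] by blast
  have "(\<integral>\<^sup>+x. ennreal (\<bar>sph_mean \<xi> f x r - f x\<bar> powr p) \<partial>lborel) < a" if r: "0 < r" "r < \<delta>" for r
  proof -
    have "(\<integral>\<^sup>+x. ennreal (\<bar>sph_mean \<xi> f x r - f x\<bar> powr p) \<partial>lborel) \<le>
      (\<integral>\<^sup>+x. (\<integral>\<^sup>+A. ennreal (\<bar>f (x + r *\<^sub>R (A *v \<xi>)) - f x\<bar> powr p) \<partial>haar_SO) \<partial>lborel)"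
    proof (rule nn_integral_mono_AE)
      show "AE x in lborel. ennreal (\<bar>sph_mean \<xi> f x r - f x\<bar> powr p) \<le> (\<integral>\<^sup>+A. ennreal (\<bar>f (x + r *\<^sub>R (A *v \<xi>)) - f x\<bar> powr p) \<partial>haar_SO)"
        using AE_sph_nn_abs_finite[OF fm p fin, of r]
      proof eventually_elim
        fix x assume "sph_nn \<xi> (\<lambda>y. ennreal \<bar>f y\<bar>) x r < \<infinity>"
        then have i: "integrable haar_SO (\<lambda>A. f (x + r *\<^sub>R (A *v \<xi>)))" by (rule integrable_sphere[OF n \<xi> fm])
        then have "sph_mean \<xi> f x r - f x = expectation (\<lambda>A. f (x + r *\<^sub>R (A *v \<xi>)) - f x)"
          by (simp add: sph_mean_def prob_space)
        then show "ennreal (\<bar>sph_mean \<xi> f x r - f x\<bar> powr p) \<le> (\<integral>\<^sup>+A. ennreal (\<bar>f (x + r *\<^sub>R (A *v \<xi>)) - f x\<bar> powr p) \<partial>haar_SO)"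
          using abs_expectation_powr_le[of "\<lambda>A. f (x + r *\<^sub>R (A *v \<xi>)) - f x" p] i p by simp
      qed
    qed
    also have "\<dots> = (\<integral>\<^sup>+A. (\<integral>\<^sup>+x. ennreal (\<bar>f (x + r *\<^sub>R (A *v \<xi>)) - f x\<bar> powr p) \<partial>lborel) \<partial>haar_SO)"
      by (rule P.Fubini') measurable
    also have "\<dots> \<le> (\<integral>\<^sup>+A. ennreal (enn2real b) \<partial>(haar_SO :: (real^'n^'n) measure))"
    proof (rule nn_integral_mono)
      fix A :: "real^'n^'n" assume A: "A \<in> space haar_SO"
      show "(\<integral>\<^sup>+x. ennreal (\<bar>f (x + r *\<^sub>R (A *v \<xi>)) - f x\<bar> powr p) \<partial>lborel) \<le> ennreal (enn2real b)"
        using norm_rotation[OF n \<xi> A, of \<xi>] r \<xi> by (intro \<delta>) simp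
    qed
    also have "\<dots> = b" using bt by (simp add: emeasure_space_1)
    finally show ?thesis using b by simp
  qed
  then show "\<forall>\<^sub>F r in at_right 0. (\<integral>\<^sup>+x. ennreal (\<bar>sph_mean \<xi> f x r - f x\<bar> powr p) \<partial>lborel) < a"
    unfolding eventually_at_right_field using \<delta>(1) by blast
qed simp

end

section \<open>The dual Radon transform as a plane integral\<close>

lemma sigma_finite_measure_borelI:
  fixes \<mu> :: "'a::euclidean_space measure"
  assumes s: "sets \<mu> = sets borel" and fin: "\<And>r. r > 0 \<Longrightarrow> emeasure \<mu> (cball 0 r) \<noteq> \<infinity>"
  shows "sigma_finite_measure \<mu>"
proof
  have sp: "space \<mu> = UNIV" using sets_eq_imp_space_eq[OF s] by simp
  show "\<exists>A. countable A \<and> A \<subseteq> sets \<mu> \<and> \<Union> A = space \<mu> \<and> (\<forall>a\<in>A. emeasure \<mu> a \<noteq> \<infinity>)"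
  proof (intro exI[of _ "range (\<lambda>n::nat. cball 0 (real (Suc n)))"] conjI ballI)
    have "\<exists>n::nat. x \<in> cball 0 (real (Suc n))" for x :: 'a
    proof -
      obtain n :: nat where "norm x \<le> real n" using real_arch_simple by blast
      then show ?thesis by (intro exI[of _ n]) simp
    qed
    then show "\<Union> (range (\<lambda>n. cball 0 (real (Suc n)))) = space \<mu>" unfolding sp by blast
    fix a assume "a \<in> range (\<lambda>n. cball (0::'a) (real (Suc n)))"
    then obtain n where a: "a = cball 0 (real (Suc n))" by blast
    show "emeasure \<mu> a \<noteq> \<infinity>" unfolding a by (rule fin) simp
  qed (auto simp: s)
qed

lemma subspace_lborel_isometry:
  assumes B: "orthonormal B" and T: "orthogonal_transformation T"
  shows "orthonormal (T ` B)" "distr (subspace_lborel B) borel T = subspace_lborel (T ` B)"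
proof -
  have lin: "linear T" using T by (rule orthogonal_transformation_linear)
  have nT: "norm (T x) = norm x" for x using T by (rule orthogonal_transformation_norm)
  have [measurable]: "T \<in> borel_measurable borel"
    using lin by (intro borel_measurable_continuous_onI linear_continuous_on) (simp add: linear_linear)
  show oTB: "orthonormal (T ` B)"
    using B T by (auto simp: orthonormal_def pairwise_def nT orthogonal_def orthogonal_transformation_def)
  have inj: "inj T" using T by (rule orthogonal_transformation_inj)
  have card: "card (T ` B) = card B" using inj by (simp add: card_image inj_on_subset)
  have em: "emeasure (distr (subspace_lborel B) borel T) (cball 0 r) = ennreal (unit_ball_vol (real (card B)) * r ^ card B)" if "r > 0" for r
  proof -
    have "T -` cball 0 r = cball 0 r" by (auto simp: nT)
    then show ?thesis using emeasure_subspace_lborel_cball[OF B that] by (simp add: emeasure_distr)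
  qed
  show "distr (subspace_lborel B) borel T = subspace_lborel (T ` B)"
  proof (rule subspace_lborel_unique[OF oTB])
    show "sigma_finite_measure (distr (subspace_lborel B) borel T)"
      by (rule sigma_finite_measure_borelI) (auto simp: em)
    show "AE x in distr (subspace_lborel B) borel T. x \<in> span (T ` B)"
    proof (subst AE_distr_iff)
      show "{x \<in> space borel. x \<in> span (T ` B)} \<in> sets borel"
        using closed_subspace[OF subspace_span[of "T ` B"]] by simp
      show "AE x in subspace_lborel B. T x \<in> span (T ` B)"
        using AE_subspace_lborel[of B] by eventually_elim (simp add: linear_span_image[OF lin])
    qed simp
    show "emeasure (distr (subspace_lborel B) borel T) (cball 0 1) = ennreal (unit_ball_vol (real (card (T ` B))))"
      using em[of 1] card by simp
    fix a assume "a \<in> span (T ` B)"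
    then obtain b where b: "b \<in> span B" "a = T b" by (auto simp: linear_span_image[OF lin])
    have "distr (distr (subspace_lborel B) borel T) borel (\<lambda>x. a + x) = distr (subspace_lborel B) borel (\<lambda>x. T (b + x))"
      by (subst distr_distr) (auto simp: comp_def b linear_add[OF lin])
    also have "\<dots> = distr (distr (subspace_lborel B) borel (\<lambda>x. b + x)) borel T"
      by (subst distr_distr) (auto simp: comp_def)
    finally show "distr (distr (subspace_lborel B) borel T) borel (\<lambda>x. a + x) = distr (subspace_lborel B) borel T"
      by (simp add: subspace_lborel_translation[OF B b(1)])
  qed simp
qed

text \<open>The scaled measure with its constant density is again invariant along the subspace and
  has the right ball volumes, so uniqueness applies. Negative s occurs in the cone
  coordinates.\<close>

lemma nn_integral_subspace_lborel_scaleR: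
  fixes B :: "'a::euclidean_space set"
  assumes B: "orthonormal B" and s: "s \<noteq> 0" and [measurable]: "h \<in> borel_measurable borel"
  shows "(\<integral>\<^sup>+v. h v \<partial>subspace_lborel B) = ennreal (\<bar>s\<bar> ^ card B) * (\<integral>\<^sup>+v. h (s *\<^sub>R v) \<partial>subspace_lborel B)"
proof -
  define \<mu> where "\<mu> = density (distr (subspace_lborel B) borel (\<lambda>v. s *\<^sub>R v)) (\<lambda>_. ennreal (\<bar>s\<bar> ^ card B))"
  have em: "emeasure \<mu> (cball 0 r) = ennreal (unit_ball_vol (real (card B)) * r ^ card B)" if r: "r > 0" for r
  proof -
    have "(\<lambda>v. s *\<^sub>R v) -` cball 0 r = cball (0::'a) (r / \<bar>s\<bar>)" using s by (auto simp: field_simps)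
    then have "emeasure (distr (subspace_lborel B) borel (\<lambda>v. s *\<^sub>R v)) (cball 0 r) = ennreal (unit_ball_vol (real (card B)) * (r / \<bar>s\<bar>) ^ card B)"
      using emeasure_subspace_lborel_cball[OF B, of "r / \<bar>s\<bar>"] r s by (simp add: emeasure_distr)
    moreover have "emeasure \<mu> (cball 0 r) = ennreal (\<bar>s\<bar> ^ card B) * emeasure (distr (subspace_lborel B) borel (\<lambda>v. s *\<^sub>R v)) (cball 0 r)"
      unfolding \<mu>_def by (subst emeasure_density) (auto simp: nn_integral_cmult_indicator)
    moreover have "\<bar>s\<bar> ^ card B * (unit_ball_vol (real (card B)) * (r / \<bar>s\<bar>) ^ card B) = unit_ball_vol (real (card B)) * r ^ card B"
      using s by (simp add: power_divide)
    ultimately show ?thesis using r by (simp add: ennreal_mult''[symmetric])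
  qed
  have "\<mu> = subspace_lborel B"
  proof (rule subspace_lborel_unique[OF B])
    show "sigma_finite_measure \<mu>"
    proof (rule sigma_finite_measure_borelI)
      show "sets \<mu> = sets borel" by (simp add: \<mu>_def)
      show "emeasure \<mu> (cball 0 r) \<noteq> \<infinity>" if "r > 0" for r using em[OF that] by simp
    qed
    have V: "{x \<in> space borel. x \<in> span B} \<in> sets borel"
      using closed_subspace[OF subspace_span[of B]] by simp
    have "AE x in distr (subspace_lborel B) borel (\<lambda>v. s *\<^sub>R v). x \<in> span B"
    proof (subst AE_distr_iff[OF _ V])
      show "AE x in subspace_lborel B. s *\<^sub>R x \<in> span B"
        using AE_subspace_lborel[of B] by eventually_elim (rule span_scale)
    qed simp
    then show "AE x in \<mu>. x \<in> span B" unfolding \<mu>_def by (subst AE_density) auto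
    show "emeasure \<mu> (cball 0 1) = ennreal (unit_ball_vol (real (card B)))" using em[of 1] by simp
    fix a assume a: "a \<in> span B"
    then have a': "(1 / s) *\<^sub>R a \<in> span B" by (rule span_scale)
    have "distr (distr (subspace_lborel B) borel (\<lambda>v. s *\<^sub>R v)) borel (\<lambda>x. a + x) = distr (subspace_lborel B) borel (\<lambda>x. s *\<^sub>R ((1 / s) *\<^sub>R a + x))"
      using s by (subst distr_distr) (auto simp: comp_def scaleR_add_right)
    also have "\<dots> = distr (distr (subspace_lborel B) borel (\<lambda>x. (1 / s) *\<^sub>R a + x)) borel (\<lambda>v. s *\<^sub>R v)"
      by (subst distr_distr) (auto simp: comp_def)
    also have "\<dots> = distr (subspace_lborel B) borel (\<lambda>v. s *\<^sub>R v)"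
      by (simp only: subspace_lborel_translation[OF B a'])
    finally have eq: "distr (distr (subspace_lborel B) borel (\<lambda>v. s *\<^sub>R v)) borel (\<lambda>x. a + x) = distr (subspace_lborel B) borel (\<lambda>v. s *\<^sub>R v)" .
    have "distr \<mu> borel (\<lambda>x. a + x) = density (distr (distr (subspace_lborel B) borel (\<lambda>v. s *\<^sub>R v)) borel (\<lambda>x. a + x)) (\<lambda>_. ennreal (\<bar>s\<bar> ^ card B))"
      unfolding \<mu>_def by (subst density_distr) auto
    then show "distr \<mu> borel (\<lambda>x. a + x) = \<mu>" unfolding eq by (simp add: \<mu>_def)
  qed (simp add: \<mu>_def)
  then have "(\<integral>\<^sup>+v. h v \<partial>subspace_lborel B) = (\<integral>\<^sup>+v. h v \<partial>\<mu>)" by simp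
  also have "\<dots> = ennreal (\<bar>s\<bar> ^ card B) * (\<integral>\<^sup>+v. h (s *\<^sub>R v) \<partial>subspace_lborel B)"
    unfolding \<mu>_def by (subst nn_integral_density) (auto simp: nn_integral_distr nn_integral_cmult)
  finally show ?thesis .
qed

lemma nn_integral_subspace_lborel_insert:
  fixes B :: "'a::euclidean_space set"
  assumes B: "orthonormal (insert b B)" "b \<notin> B" and [measurable]: "h \<in> borel_measurable borel"
  shows "(\<integral>\<^sup>+v. h v \<partial>subspace_lborel (insert b B)) = (\<integral>\<^sup>+v. (\<integral>\<^sup>+t. h (t *\<^sub>R b + v) \<partial>lborel) \<partial>subspace_lborel B)"
proof -
  have fin: "finite B" using orthonormal_finite[OF B(1)] by simp
  interpret product_sigma_finite "\<lambda>_::'a. lborel :: real measure"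
    by (simp add: product_sigma_finite_def sigma_finite_lborel)
  have "(\<integral>\<^sup>+v. h v \<partial>subspace_lborel (insert b B)) = (\<integral>\<^sup>+c. h (\<Sum>i\<in>insert b B. c i *\<^sub>R i) \<partial>(\<Pi>\<^sub>M i\<in>insert b B. lborel))"
    unfolding subspace_lborel_def by (subst nn_integral_distr) auto
  also have "\<dots> = (\<integral>\<^sup>+x. (\<integral>\<^sup>+y. h (\<Sum>i\<in>insert b B. (x(b := y)) i *\<^sub>R i) \<partial>lborel) \<partial>(\<Pi>\<^sub>M i\<in>B. lborel))"
    using fin B(2) by (intro product_nn_integral_insert) auto
  also have "\<dots> = (\<integral>\<^sup>+x. (\<integral>\<^sup>+y. h (y *\<^sub>R b + (\<Sum>i\<in>B. x i *\<^sub>R i)) \<partial>lborel) \<partial>(\<Pi>\<^sub>M i\<in>B. lborel))"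
  proof -
    have "(\<Sum>i\<in>insert b B. (x(b := y)) i *\<^sub>R i) = y *\<^sub>R b + (\<Sum>i\<in>B. x i *\<^sub>R i)" for x and y :: real
    proof -
      have "(\<Sum>i\<in>B. (x(b := y)) i *\<^sub>R i) = (\<Sum>i\<in>B. x i *\<^sub>R i)" using B(2) by (intro sum.cong) auto
      then show ?thesis using fin B(2) by simp
    qed
    then show ?thesis by simp
  qed
  also have "\<dots> = (\<integral>\<^sup>+v. (\<integral>\<^sup>+t. h (t *\<^sub>R b + v) \<partial>lborel) \<partial>subspace_lborel B)"
    unfolding subspace_lborel_def by (subst nn_integral_distr) auto
  finally show ?thesis .
qed

text \<open>Read as a radial integral on the real line, whose weight is 2; up to a constant s^(m-1)
  is the radial weight of dimension m, integrated before.\<close>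

lemma nn_integral_abs_power_below:
  assumes "\<rho> > 0" "m \<ge> 1"
  shows "(\<integral>\<^sup>+s. indicator {s. \<bar>s\<bar> < \<rho>} s * ennreal (\<bar>s\<bar> ^ (m - 1)) \<partial>(lborel :: real measure)) = ennreal (2 * \<rho> ^ m / real m)"
proof -
  let ?K = "real m * unit_ball_vol (real m)"
  have K: "?K > 0" using assms by simp
  have "(\<integral>\<^sup>+s. indicator {s. \<bar>s\<bar> < \<rho>} s * ennreal (\<bar>s\<bar> ^ (m - 1)) \<partial>(lborel :: real measure)) =
     (\<integral>\<^sup>+s. indicator {..<\<rho>} (norm s) * ennreal (norm s ^ (m - 1)) \<partial>(lborel :: real measure))"
    by (intro nn_integral_cong) (auto simp: indicator_def)
  also have "\<dots> = (\<integral>\<^sup>+s. indicator {..<\<rho>} s * ennreal (s ^ (m - 1)) \<partial>distr (lborel :: real measure) borel norm)"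
    by (subst nn_integral_distr) auto
  also have "\<dots> = (\<integral>\<^sup>+s. ennreal (radial_weight 1 0 s) * (indicator {..<\<rho>} s * ennreal (s ^ (m - 1))) \<partial>lborel)"
    unfolding distr_lborel_norm by (subst nn_integral_density) auto
  also have "\<dots> = (\<integral>\<^sup>+s. ennreal (2 / ?K) * (ennreal (radial_weight m 0 s) * indicator {..\<rho>} s) \<partial>lborel)"
  proof (rule nn_integral_cong_AE)
    show "AE s in lborel. ennreal (radial_weight 1 0 s) * (indicator {..<\<rho>} s * ennreal (s ^ (m - 1))) =
        ennreal (2 / ?K) * (ennreal (radial_weight m 0 s) * indicator {..\<rho>} s)"
      using AE_lborel_singleton[of \<rho>]
    proof eventually_elim
      fix s assume "s \<noteq> \<rho>"
      then have ind: "indicator {..<\<rho>} s = (indicator {..\<rho>} s :: ennreal)" by (auto simp: indicator_def)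
      show "ennreal (radial_weight 1 0 s) * (indicator {..<\<rho>} s * ennreal (s ^ (m - 1))) =
        ennreal (2 / ?K) * (ennreal (radial_weight m 0 s) * indicator {..\<rho>} s)"
      proof (cases "s > 0")
        case True
        have "2 * s ^ (m - 1) = 2 / ?K * radial_weight m 0 s" using True assms K by (simp add: radial_weight_0)
        then have "ennreal 2 * ennreal (s ^ (m - 1)) = ennreal (2 / ?K) * ennreal (radial_weight m 0 s)"
          using K True by (simp only: ennreal_mult''[symmetric] radial_weight_nonneg order_refl zero_le_power less_imp_le)
        moreover have "radial_weight 1 0 s = 2" using True by (subst radial_weight_0) simp_all
        ultimately have "ennreal (radial_weight 1 0 s) * ennreal (s ^ (m - 1)) = ennreal (2 / ?K) * ennreal (radial_weight m 0 s)" by (simp only:)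
        then show ?thesis unfolding ind by (metis (no_types) mult.assoc mult.commute)
      qed (simp add: radial_weight_def)
    qed
  qed
  also have "\<dots> = ennreal (2 / ?K) * ennreal (unit_ball_vol (real m) * (\<rho>\<^sup>2) powr (real m / 2))"
    using assms by (subst nn_integral_cmult) (auto simp: nn_integral_radial_weight)
  also have "(\<rho>\<^sup>2) powr (real m / 2) = \<rho> ^ m"
    using assms powr_powr[of \<rho> 2 "real m / 2"] by (simp add: powr_realpow)
  also have "ennreal (2 / ?K) * ennreal (unit_ball_vol (real m) * \<rho> ^ m) = ennreal (2 / ?K * (unit_ball_vol (real m) * \<rho> ^ m))"
    using K assms by (intro ennreal_mult[symmetric]) auto
  also have "2 / ?K * (unit_ball_vol (real m) * \<rho> ^ m) = 2 * \<rho> ^ m / real m" using K by simp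
  finally show ?thesis .
qed

lemma sphere_area_eq: "sphere_area k = real (k + 1) * unit_ball_vol (real (k + 1))"
proof -
  define a where "a = (real k + 1) / 2"
  have a: "real (k + 1) = 2 * a" "a > 0" by (auto simp: a_def)
  have "Gamma (a + 1) = a * Gamma a"
    using a by (intro Gamma_plus1) (auto elim!: nonpos_Ints_cases)
  moreover have "Gamma a > 0" using a by (intro Gamma_real_pos)
  moreover have "sphere_area k = 2 * pi powr a / Gamma a" by (simp add: sphere_area_def a_def)
  ultimately show ?thesis using a unfolding a(1) by (simp add: unit_ball_vol_def)
qed

text \<open>The points of the \<open>(n - 2)\<close>-plane \<open>P\<close> parametrise the hyperplanes through the line, up to a null
  set; in the cone coordinates \<open>x = s (v - u / |u|\<^sup>2)\<close> of \<open>\<omega>\<^sup>\<bottom>\<close> the sphere measure becomes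
  \<open>|x|\<^sup>1\<^sup>-\<^sup>n dx\<close> on \<open>P\<close>.\<close>

context
  fixes \<omega> u :: "real^'n"
  assumes n3: "CARD('n) \<ge> 3" and \<omega>: "norm \<omega> = 1" and \<omega>u: "\<omega> \<bullet> u = 0" and u: "u \<noteq> 0"
begin

definition dual_plane :: "(real^'n) set" where
  "dual_plane = (\<lambda>v. v - u /\<^sub>R (norm u)\<^sup>2) ` {v. v \<bullet> \<omega> = 0 \<and> v \<bullet> u = 0}"

text \<open>In geometric terms: the hyperplane of all y with y \<bullet> x = -1 contains the
  line.\<close>

lemma dual_plane_iff: "x \<in> dual_plane \<longleftrightarrow> x \<bullet> \<omega> = 0 \<and> x \<bullet> u = -1"
proof
  have uu: "u \<bullet> u = (norm u)\<^sup>2" by (simp add: dot_square_norm)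
  show "x \<bullet> \<omega> = 0 \<and> x \<bullet> u = -1" if "x \<in> dual_plane"
    using that u \<omega>u by (auto simp: dual_plane_def inner_diff_left inner_commute[of u \<omega>] uu)
  show "x \<in> dual_plane" if "x \<bullet> \<omega> = 0 \<and> x \<bullet> u = -1"
    unfolding dual_plane_def
    by (rule image_eqI[of _ _ "x + u /\<^sub>R (norm u)\<^sup>2"])
       (use that u \<omega>u in \<open>auto simp: inner_add_left inner_commute[of u \<omega>] uu\<close>)
qed

lemma orthonormal_cone_basis:
  obtains B where "orthonormal B" "span B = {v. v \<bullet> \<omega> = 0 \<and> v \<bullet> u = 0}"
    "orthonormal (insert (u /\<^sub>R norm u) B)" "u /\<^sub>R norm u \<notin> B"
    "span (insert (u /\<^sub>R norm u) B) = {v. v \<bullet> \<omega> = 0}" "card B = CARD('n) - 2"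
proof -
  let ?W = "{v. v \<bullet> \<omega> = 0 \<and> v \<bullet> u = 0}" and ?b = "u /\<^sub>R norm u"
  have sub: "subspace ?W" by (auto simp: subspace_def inner_add_left)
  have "\<exists>B. B \<subseteq> ?W \<and> pairwise orthogonal B \<and> (\<forall>x\<in>B. norm x = 1) \<and> span B = ?W"
  proof (rule orthonormal_basis_subspace[OF sub])
    fix B assume "B \<subseteq> ?W" "pairwise orthogonal B" "\<And>x. x \<in> B \<Longrightarrow> norm x = 1" "span B = ?W"
    then show ?thesis by (intro exI[of _ B] conjI ballI)
  qed
  then obtain B where B: "B \<subseteq> ?W" "pairwise orthogonal B" "\<And>x. x \<in> B \<Longrightarrow> norm x = 1" "span B = ?W"
    by (elim exE conjE) (rule that, assumption, assumption, erule bspec, assumption)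
  have b: "norm ?b = 1" using u by simp
  have bb: "?b \<bullet> ?b = 1" using b by (simp add: dot_square_norm)
  have oB: "orthonormal B" using B by (simp add: orthonormal_def)
  have "?b \<notin> ?W" using bb u by auto
  then have bB: "?b \<notin> B" using B(1) by blast
  have oBb: "orthonormal (insert ?b B)"
    unfolding orthonormal_def
  proof (intro conjI ballI)
    have "orthogonal ?b v" "orthogonal v ?b" if "v \<in> B" for v
      using B(1) that by (auto simp: orthogonal_def inner_commute)
    then show "pairwise orthogonal (insert ?b B)" using B(2) by (auto simp: pairwise_insert)
  qed (use b B(3) in auto)
  have sp: "span (insert ?b B) = {v. v \<bullet> \<omega> = 0}"
  proof
    have "insert ?b B \<subseteq> {v. v \<bullet> \<omega> = 0}" using B(1) \<omega>u by (auto simp: inner_commute)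
    moreover have "subspace {v. v \<bullet> \<omega> = 0}" by (auto simp: subspace_def inner_add_left)
    ultimately show "span (insert ?b B) \<subseteq> {v. v \<bullet> \<omega> = 0}" by (rule span_minimal)
    show "{v. v \<bullet> \<omega> = 0} \<subseteq> span (insert ?b B)"
    proof
      fix v assume v: "v \<in> {v. v \<bullet> \<omega> = 0}"
      have "(v - (v \<bullet> ?b) *\<^sub>R ?b) \<bullet> \<omega> = 0" using v \<omega>u by (simp add: inner_diff_left inner_commute[of u \<omega>])
      moreover have "(v - (v \<bullet> c) *\<^sub>R c) \<bullet> c = 0" if "c \<bullet> c = 1" for c using that by (simp add: inner_diff_left)
      then have "(v - (v \<bullet> ?b) *\<^sub>R ?b) \<bullet> ?b = 0" using bb by blast
      then have "(v - (v \<bullet> ?b) *\<^sub>R ?b) \<bullet> u = 0" using u by (simp only: inner_scaleR_right) simp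
      ultimately have "v - (v \<bullet> ?b) *\<^sub>R ?b \<in> span B" unfolding B(4) by simp
      then have "v - (v \<bullet> ?b) *\<^sub>R ?b \<in> span (insert ?b B)" by (metis in_span_insert span_mono subset_insertI subsetD)
      moreover have "(v \<bullet> ?b) *\<^sub>R ?b \<in> span (insert ?b B)" by (intro span_scale span_base) simp
      ultimately have "(v - (v \<bullet> ?b) *\<^sub>R ?b) + (v \<bullet> ?b) *\<^sub>R ?b \<in> span (insert ?b B)" by (rule span_add)
      then show "v \<in> span (insert ?b B)" by simp
    qed
  qed
  have "\<omega> \<noteq> 0" using \<omega> by auto
  have "card (insert ?b B) = dim {v. v \<bullet> \<omega> = 0}"
    using orthonormal_indep[OF oBb] sp by (metis dim_eq_card_independent dim_span)
  also have "{v. v \<bullet> \<omega> = 0} = {v. \<omega> \<bullet> v = 0}" by (simp add: inner_commute)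
  also have "dim {v. \<omega> \<bullet> v = 0} = CARD('n) - 1" using dim_hyperplane[OF \<open>\<omega> \<noteq> 0\<close>] by simp
  finally have "card B = CARD('n) - 2" using bB orthonormal_finite[OF oB] n3 by simp
  with oB B(4) oBb bB sp show thesis by (rule that)
qed

text \<open>Central projection of a direction onto the dual plane, and the point that \<nu> assigns
  to the hyperplane with normal \<theta> through the line. Directions orthogonal to u are sent to 0,
  which is not in the plane.\<close>

definition to_plane :: "real^'n \<Rightarrow> real^'n" where
  "to_plane \<theta> = - (\<theta> /\<^sub>R (\<theta> \<bullet> u))"

lemma to_plane_measurable[measurable]: "to_plane \<in> borel_measurable borel"
  unfolding to_plane_def[abs_def] by measurable

lemma to_plane_scale: "s \<noteq> 0 \<Longrightarrow> to_plane (s *\<^sub>R x) = to_plane x"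
  by (simp add: to_plane_def)

lemma to_plane_eq: "x \<in> dual_plane \<Longrightarrow> to_plane x = x"
  by (simp add: to_plane_def dual_plane_iff)

text \<open>Integrate over the unit ball of the orthogonal complement of \<omega> in cone
  coordinates: the integral of |t|^(n-2) over |t| < 1 / |x| is 2 |x|^(1-n) / (n - 1), where the 2
  reflects that \<theta> and -\<theta> have the same projection.\<close>

lemma distr_to_plane:
  "distr (sphere_prob {\<theta>. \<theta> \<bullet> \<omega> = 0}) borel to_plane =
    density (plane_lborel dual_plane) (\<lambda>x. ennreal (2 / (norm u * sphere_area (CARD('n) - 2)) * norm x powr (1 - real CARD('n))))"
proof -
  let ?n = "CARD('n)"
  let ?b = "u /\<^sub>R norm u" and ?d = "1 / norm u"
  have nu: "norm u > 0" using u by simp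
  obtain B where B: "orthonormal B" "span B = {v. v \<bullet> \<omega> = 0 \<and> v \<bullet> u = 0}"
    and Bb: "orthonormal (insert ?b B)" "?b \<notin> B" "span (insert ?b B) = {v. v \<bullet> \<omega> = 0}" and card: "card B = ?n - 2"
    by (rule orthonormal_cone_basis)
  let ?\<omega> = "unit_ball_vol (real (?n - 1))"
  have \<omega>: "?\<omega> > 0" by simp
  have card': "card (insert ?b B) = ?n - 1" using card Bb(2) orthonormal_finite[OF B(1)] n3 by simp
  have pV: "plane_lborel {\<theta>. \<theta> \<bullet> \<omega> = 0} = subspace_lborel (insert ?b B)"
  proof -
    have "plane_lborel ((\<lambda>v. 0 + v) ` span (insert ?b B)) = distr (subspace_lborel (insert ?b B)) borel (\<lambda>v. 0 + v)"
      by (rule plane_lborel_eq[OF Bb(1)])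
    then show ?thesis unfolding Bb(3) by (simp add: distr_id2)
  qed
  have Pu: "dual_plane = (\<lambda>v. - (?d *\<^sub>R ?b) + v) ` span B"
    unfolding dual_plane_def B(2) using u by (intro image_cong) (auto simp: power2_eq_square divide_inverse)
  have pP: "plane_lborel dual_plane = distr (subspace_lborel B) borel (\<lambda>v. - (?d *\<^sub>R ?b) + v)"
    unfolding Pu by (rule plane_lborel_eq[OF B(1)])
  interpret S: sigma_finite_measure "subspace_lborel B" by (rule sigma_finite_subspace_lborel[OF B(1)])
  interpret SL: pair_sigma_finite "subspace_lborel B" "lborel :: real measure" ..
  have ball: "emeasure (subspace_lborel (insert ?b B)) (ball 0 1) = ennreal ?\<omega>"
  proof -
    have ne: "insert ?b B \<noteq> {}" by simp
    have rad: "distr (subspace_lborel (insert ?b B)) borel norm = density lborel (radial_weight (?n - 1) 0)"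
      using distr_subspace_lborel_radial[OF Bb(1) ne, of 0] card' by simp
    have "emeasure (subspace_lborel (insert ?b B)) (ball 0 1) = emeasure (distr (subspace_lborel (insert ?b B)) borel norm) {..<1}"
      by (subst emeasure_distr) (auto intro!: arg_cong2[where f=emeasure])
    also have "\<dots> = (\<integral>\<^sup>+t. ennreal (radial_weight (?n - 1) 0 t) * indicator {..<1} t \<partial>lborel)"
      unfolding rad by (subst emeasure_density) auto
    also have "\<dots> = (\<integral>\<^sup>+t. ennreal (radial_weight (?n - 1) 0 t) * indicator {..1} t \<partial>lborel)"
      using AE_lborel_singleton[of 1] by (intro nn_integral_cong_AE, eventually_elim) (auto simp: indicator_def)
    also have "\<dots> = ennreal ?\<omega>" using n3 by (subst nn_integral_radial_weight) auto
    finally show ?thesis .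
  qed
  show ?thesis
  proof (rule measure_eqI)
    fix E assume "E \<in> sets (distr (sphere_prob {\<theta>. \<theta> \<bullet> \<omega> = 0}) borel to_plane)"
    then have E[measurable]: "E \<in> sets borel" by simp
    have [measurable]: "ball (0::real^'n) 1 \<in> sets borel" by simp
    let ?x = "\<lambda>v. - (?d *\<^sub>R ?b) + v"
    have "emeasure (distr (sphere_prob {\<theta>. \<theta> \<bullet> \<omega> = 0}) borel to_plane) E =
       emeasure (uniform_measure (subspace_lborel (insert ?b B)) (ball 0 1)) {x. to_plane (sgn x) \<in> E}"
      unfolding sphere_prob_def pV
      by (subst distr_distr, simp, simp, subst emeasure_distr) (simp_all add: comp_def vimage_def del: emeasure_uniform_measure)
    also have "\<dots> = emeasure (subspace_lborel (insert ?b B)) (ball 0 1 \<inter> {x. to_plane (sgn x) \<in> E}) / ennreal ?\<omega>"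
      by (subst emeasure_uniform_measure) (auto simp: ball)
    also have "emeasure (subspace_lborel (insert ?b B)) (ball 0 1 \<inter> {x. to_plane (sgn x) \<in> E}) =
        (\<integral>\<^sup>+x. indicator (ball 0 1) x * indicator E (to_plane (sgn x)) \<partial>subspace_lborel (insert ?b B))"
    proof -
      have "(\<integral>\<^sup>+x. indicator (ball 0 1) x * indicator E (to_plane (sgn x)) \<partial>subspace_lborel (insert ?b B)) =
        (\<integral>\<^sup>+x. indicator (ball 0 1 \<inter> {x. to_plane (sgn x) \<in> E}) x \<partial>subspace_lborel (insert ?b B))"
        by (intro nn_integral_cong) (auto simp: indicator_def)
      then show ?thesis by (simp add: nn_integral_indicator)
    qed
    also have "\<dots> = (\<integral>\<^sup>+v. (\<integral>\<^sup>+t. indicator (ball 0 1) (t *\<^sub>R ?b + v) * indicator E (to_plane (sgn (t *\<^sub>R ?b + v))) \<partial>lborel) \<partial>subspace_lborel B)"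
      by (rule nn_integral_subspace_lborel_insert[OF Bb(1,2)]) measurable
    also have "\<dots> = (\<integral>\<^sup>+t. (\<integral>\<^sup>+v. indicator (ball 0 1) (t *\<^sub>R ?b + v) * indicator E (to_plane (sgn (t *\<^sub>R ?b + v))) \<partial>subspace_lborel B) \<partial>lborel)"
      by (rule SL.Fubini'[symmetric]) measurable
    also have "\<dots> = (\<integral>\<^sup>+t. ennreal \<bar>?d\<bar> * (\<integral>\<^sup>+v. indicator (ball 0 1) ((?d * t) *\<^sub>R ?b + v) * indicator E (to_plane (sgn ((?d * t) *\<^sub>R ?b + v))) \<partial>subspace_lborel B) \<partial>lborel)"
    proof -
      have aff: "(\<integral>\<^sup>+t. H t \<partial>lborel) = (\<integral>\<^sup>+t. ennreal \<bar>?d\<bar> * H (?d * t) \<partial>lborel)" if [measurable]: "H \<in> borel_measurable borel" for H :: "real \<Rightarrow> ennreal"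
        using nn_integral_real_affine[OF that, of ?d 0] nu by (simp add: nn_integral_cmult)
      show ?thesis by (rule aff) measurable
    qed
    also have "\<dots> = (\<integral>\<^sup>+t. ennreal ?d * (\<integral>\<^sup>+v. ennreal (\<bar>t\<bar> ^ (?n - 2)) * (indicator (ball 0 1) (t *\<^sub>R ?x v) * indicator E (?x v)) \<partial>subspace_lborel B) \<partial>lborel)"
    proof (rule nn_integral_cong_AE)
      show "AE t in lborel. ennreal \<bar>?d\<bar> * (\<integral>\<^sup>+v. indicator (ball 0 1) ((?d * t) *\<^sub>R ?b + v) * indicator E (to_plane (sgn ((?d * t) *\<^sub>R ?b + v))) \<partial>subspace_lborel B) =
         ennreal ?d * (\<integral>\<^sup>+v. ennreal (\<bar>t\<bar> ^ (?n - 2)) * (indicator (ball 0 1) (t *\<^sub>R ?x v) * indicator E (?x v)) \<partial>subspace_lborel B)"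
        using AE_lborel_singleton[of 0]
      proof eventually_elim
        fix t :: real assume t: "t \<noteq> 0"
        \<comment> \<open>Replacing v by -t v turns the point into a multiple of a point of the
          plane; the projection ignores the factor and the ball ignores its sign.\<close>
        have eq: "(?d * t) *\<^sub>R ?b + - t *\<^sub>R v = - t *\<^sub>R ?x v" for v
          by (simp add: algebra_simps)
        have "(\<integral>\<^sup>+v. indicator (ball 0 1) ((?d * t) *\<^sub>R ?b + v) * indicator E (to_plane (sgn ((?d * t) *\<^sub>R ?b + v))) \<partial>subspace_lborel B) =
          ennreal (\<bar>- t\<bar> ^ card B) * (\<integral>\<^sup>+v. indicator (ball 0 1) ((?d * t) *\<^sub>R ?b + - t *\<^sub>R v) * indicator E (to_plane (sgn ((?d * t) *\<^sub>R ?b + - t *\<^sub>R v))) \<partial>subspace_lborel B)"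
          using t by (intro nn_integral_subspace_lborel_scaleR[OF B(1)]) auto
        also have "\<dots> = (\<integral>\<^sup>+v. ennreal (\<bar>t\<bar> ^ (?n - 2)) * (indicator (ball 0 1) ((?d * t) *\<^sub>R ?b + - t *\<^sub>R v) * indicator E (to_plane (sgn ((?d * t) *\<^sub>R ?b + - t *\<^sub>R v)))) \<partial>subspace_lborel B)"
          unfolding card abs_minus_cancel by (rule nn_integral_cmult[symmetric]) measurable
        also have "\<dots> = (\<integral>\<^sup>+v. ennreal (\<bar>t\<bar> ^ (?n - 2)) * (indicator (ball 0 1) (t *\<^sub>R ?x v) * indicator E (?x v)) \<partial>subspace_lborel B)"
        proof (rule nn_integral_cong_AE)
          show "AE v in subspace_lborel B. ennreal (\<bar>t\<bar> ^ (?n - 2)) * (indicator (ball 0 1) ((?d * t) *\<^sub>R ?b + - t *\<^sub>R v) * indicator E (to_plane (sgn ((?d * t) *\<^sub>R ?b + - t *\<^sub>R v)))) =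
             ennreal (\<bar>t\<bar> ^ (?n - 2)) * (indicator (ball 0 1) (t *\<^sub>R ?x v) * indicator E (?x v))"
            using AE_subspace_lborel[of B]
          proof eventually_elim
            fix v assume "v \<in> span B"
            then have xP: "?x v \<in> dual_plane" unfolding Pu by blast
            then have "?x v \<noteq> 0" by (auto simp: dual_plane_iff)
            then have "to_plane (sgn (- t *\<^sub>R ?x v)) = to_plane (?x v)"
              using t by (simp only: sgn_div_norm scaleR_scaleR) (rule to_plane_scale, simp)
            then have tp: "to_plane (sgn ((?d * t) *\<^sub>R ?b + - t *\<^sub>R v)) = ?x v"
              unfolding eq using to_plane_eq[OF xP] by simp
            have "(- t *\<^sub>R ?x v \<in> ball 0 1) = (t *\<^sub>R ?x v \<in> ball 0 1)" by (simp only: mem_ball_0 norm_scaleR abs_minus_cancel)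
            then show "ennreal (\<bar>t\<bar> ^ (?n - 2)) * (indicator (ball 0 1) ((?d * t) *\<^sub>R ?b + - t *\<^sub>R v) * indicator E (to_plane (sgn ((?d * t) *\<^sub>R ?b + - t *\<^sub>R v)))) =
             ennreal (\<bar>t\<bar> ^ (?n - 2)) * (indicator (ball 0 1) (t *\<^sub>R ?x v) * indicator E (?x v))"
              unfolding tp unfolding eq indicator_def by simp
          qed
        qed
        finally show "ennreal \<bar>?d\<bar> * (\<integral>\<^sup>+v. indicator (ball 0 1) ((?d * t) *\<^sub>R ?b + v) * indicator E (to_plane (sgn ((?d * t) *\<^sub>R ?b + v))) \<partial>subspace_lborel B) =
           ennreal ?d * (\<integral>\<^sup>+v. ennreal (\<bar>t\<bar> ^ (?n - 2)) * (indicator (ball 0 1) (t *\<^sub>R ?x v) * indicator E (?x v)) \<partial>subspace_lborel B)"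
          using nu by simp
      qed
    qed
    also have "\<dots> = ennreal ?d * (\<integral>\<^sup>+t. (\<integral>\<^sup>+v. ennreal (\<bar>t\<bar> ^ (?n - 2)) * (indicator (ball 0 1) (t *\<^sub>R ?x v) * indicator E (?x v)) \<partial>subspace_lborel B) \<partial>lborel)"
      by (rule nn_integral_cmult) measurable
    also have "(\<integral>\<^sup>+t. (\<integral>\<^sup>+v. ennreal (\<bar>t\<bar> ^ (?n - 2)) * (indicator (ball 0 1) (t *\<^sub>R ?x v) * indicator E (?x v)) \<partial>subspace_lborel B) \<partial>lborel) =
       (\<integral>\<^sup>+v. (\<integral>\<^sup>+t. ennreal (\<bar>t\<bar> ^ (?n - 2)) * (indicator (ball 0 1) (t *\<^sub>R ?x v) * indicator E (?x v)) \<partial>lborel) \<partial>subspace_lborel B)"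
      by (rule SL.Fubini') measurable
    also have "\<dots> = (\<integral>\<^sup>+v. ennreal (2 / real (?n - 1)) * (ennreal (norm (?x v) powr (1 - real ?n)) * indicator E (?x v)) \<partial>subspace_lborel B)"
    proof (rule nn_integral_cong_AE)
      show "AE v in subspace_lborel B. (\<integral>\<^sup>+t. ennreal (\<bar>t\<bar> ^ (?n - 2)) * (indicator (ball 0 1) (t *\<^sub>R ?x v) * indicator E (?x v)) \<partial>lborel) =
         ennreal (2 / real (?n - 1)) * (ennreal (norm (?x v) powr (1 - real ?n)) * indicator E (?x v))"
        using AE_subspace_lborel[of B]
      proof eventually_elim
        fix v assume "v \<in> span B"
        then have xP: "?x v \<in> dual_plane" unfolding Pu by blast
        then have "?x v \<noteq> 0" by (auto simp: dual_plane_iff)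
        then have nx: "norm (?x v) > 0" by (simp only: zero_less_norm_iff) simp
        define N where "N = norm (?x v)"
        have N: "N > 0" using nx by (simp add: N_def)
        have "(\<integral>\<^sup>+t. ennreal (\<bar>t\<bar> ^ (?n - 2)) * (indicator (ball 0 1) (t *\<^sub>R ?x v) * indicator E (?x v)) \<partial>lborel) =
          (\<integral>\<^sup>+t. (indicator {t. \<bar>t\<bar> < 1 / N} t * ennreal (\<bar>t\<bar> ^ (?n - 1 - 1))) * indicator E (?x v) \<partial>lborel)"
        proof (rule nn_integral_cong)
          fix t :: real
          have "t *\<^sub>R ?x v \<in> ball 0 1 \<longleftrightarrow> \<bar>t\<bar> < 1 / N"
            unfolding mem_ball_0 norm_scaleR N_def[symmetric] using N by (simp add: field_simps)
          moreover have "?n - 2 = ?n - 1 - 1" by simp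
          ultimately show "ennreal (\<bar>t\<bar> ^ (?n - 2)) * (indicator (ball 0 1) (t *\<^sub>R ?x v) * indicator E (?x v)) =
             (indicator {t. \<bar>t\<bar> < 1 / N} t * ennreal (\<bar>t\<bar> ^ (?n - 1 - 1))) * indicator E (?x v)"
            unfolding indicator_def by (simp only: mem_Collect_eq mult_ac)
        qed
        also have "\<dots> = (\<integral>\<^sup>+t. indicator {t. \<bar>t\<bar> < 1 / N} t * ennreal (\<bar>t\<bar> ^ (?n - 1 - 1)) \<partial>lborel) * indicator E (?x v)"
          by (rule nn_integral_multc) measurable
        also have "(\<integral>\<^sup>+t. indicator {t. \<bar>t\<bar> < 1 / N} t * ennreal (\<bar>t\<bar> ^ (?n - 1 - 1)) \<partial>lborel) = ennreal (2 * (1 / N) ^ (?n - 1) / real (?n - 1))"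
          using N n3 by (intro nn_integral_abs_power_below) auto
        also have "2 * (1 / N) ^ (?n - 1) / real (?n - 1) = 2 / real (?n - 1) * N powr (1 - real ?n)"
        proof -
          have "N powr (1 - real ?n) = N powr (- real (?n - 1))" using n3 by (simp add: of_nat_diff)
          also have "\<dots> = (1 / N) ^ (?n - 1)" by (simp only: powr_minus_divide powr_realpow[OF N] power_one_over)
          finally show ?thesis by simp
        qed
        also have "ennreal \<dots> = ennreal (2 / real (?n - 1)) * ennreal (N powr (1 - real ?n))"
          by (rule ennreal_mult) auto
        finally show "(\<integral>\<^sup>+t. ennreal (\<bar>t\<bar> ^ (?n - 2)) * (indicator (ball 0 1) (t *\<^sub>R ?x v) * indicator E (?x v)) \<partial>lborel) =
         ennreal (2 / real (?n - 1)) * (ennreal (norm (?x v) powr (1 - real ?n)) * indicator E (?x v))"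
          unfolding N_def by (simp only: mult.assoc)
      qed
    qed
    also have "\<dots> = ennreal (2 / real (?n - 1)) * (\<integral>\<^sup>+v. ennreal (norm (?x v) powr (1 - real ?n)) * indicator E (?x v) \<partial>subspace_lborel B)"
      by (rule nn_integral_cmult) measurable
    also have "(\<integral>\<^sup>+v. ennreal (norm (?x v) powr (1 - real ?n)) * indicator E (?x v) \<partial>subspace_lborel B) =
       (\<integral>\<^sup>+x. ennreal (norm x powr (1 - real ?n)) * indicator E x \<partial>plane_lborel dual_plane)"
      unfolding pP by (subst nn_integral_distr) auto
    finally have lhs: "emeasure (distr (sphere_prob {\<theta>. \<theta> \<bullet> \<omega> = 0}) borel to_plane) E =
      ennreal ?d * (ennreal (2 / real (?n - 1)) * (\<integral>\<^sup>+x. ennreal (norm x powr (1 - real ?n)) * indicator E x \<partial>plane_lborel dual_plane)) / ennreal ?\<omega>" .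
    let ?c = "2 / (norm u * sphere_area (?n - 2))"
    have area: "sphere_area (?n - 2) = real (?n - 1) * ?\<omega>"
    proof -
      have "?n - 2 + 1 = ?n - 1" using n3 by simp
      then show ?thesis unfolding sphere_area_eq by simp
    qed
    have c0: "?c \<ge> 0" using nu by (simp add: area)
    have sP: "sets (plane_lborel dual_plane) = sets borel" unfolding pP by simp
    have "emeasure (density (plane_lborel dual_plane) (\<lambda>x. ennreal (?c * norm x powr (1 - real ?n)))) E =
      (\<integral>\<^sup>+x. ennreal ?c * (ennreal (norm x powr (1 - real ?n)) * indicator E x) \<partial>plane_lborel dual_plane)"
    proof -
      have "(\<lambda>x. ennreal (?c * norm x powr (1 - real ?n))) \<in> borel_measurable (plane_lborel dual_plane)"
        unfolding measurable_cong_sets[OF sP refl] by measurable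
      then show ?thesis using E sP
        by (subst emeasure_density) (simp_all only: ennreal_mult[OF c0 powr_ge_zero] mult.assoc sets_distr sets_lborel)
    qed
    also have "\<dots> = ennreal ?c * (\<integral>\<^sup>+x. ennreal (norm x powr (1 - real ?n)) * indicator E x \<partial>plane_lborel dual_plane)"
      using sP by (subst nn_integral_cmult) (auto cong: measurable_cong_sets)
    also have "ennreal ?c = ennreal ?d * ennreal (2 / real (?n - 1)) / ennreal ?\<omega>"
    proof -
      have "?c = ?d * (2 / real (?n - 1)) / ?\<omega>" by (simp add: area)
      also have "ennreal \<dots> = ennreal (?d * (2 / real (?n - 1))) / ennreal ?\<omega>"
        using nu \<omega> by (intro divide_ennreal[symmetric] mult_nonneg_nonneg divide_nonneg_nonneg) auto
      also have "ennreal (?d * (2 / real (?n - 1))) = ennreal ?d * ennreal (2 / real (?n - 1))"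
        using nu by (intro ennreal_mult divide_nonneg_nonneg) auto
      finally show ?thesis .
    qed
    finally show "emeasure (distr (sphere_prob {\<theta>. \<theta> \<bullet> \<omega> = 0}) borel to_plane) E =
       emeasure (density (plane_lborel dual_plane) (\<lambda>x. ennreal (?c * norm x powr (1 - real ?n)))) E"
      unfolding lhs by (simp add: divide_ennreal_def mult_ac)
  next
    have "sets (plane_lborel dual_plane) = sets borel" unfolding pP by simp
    then show "sets (distr (sphere_prob {\<theta>. \<theta> \<bullet> \<omega> = 0}) borel to_plane) =
      sets (density (plane_lborel dual_plane) (\<lambda>x. ennreal (2 / (norm u * sphere_area (CARD('n) - 2)) * norm x powr (1 - real CARD('n)))))" by simp
  qed
qed

end

section \<open>Plane integrals from the dual Radon transform\<close>

text \<open>Here \<open>\<nu>\<close> maps the hyperplane \<open>{y. y \<bullet> x = -1}\<close> to \<open>x\<close>.\<close>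

definition point_fun :: "((real^'n) set \<Rightarrow> real) \<Rightarrow> real^'n \<Rightarrow> real" where
  "point_fun \<phi> x = norm x powr (1 - real CARD('n)) * \<phi> {y. y \<bullet> x = -1}"

lemma AE_plane_lborel:
  fixes B :: "(real^'n) set"
  assumes B: "orthonormal B" and T: "T = (\<lambda>v. q + v) ` span B"
  shows "AE x in plane_lborel T. x \<in> T"
proof -
  have "closed T" unfolding T by (rule closed_translation) (rule closed_subspace[OF subspace_span])
  then have "{x \<in> space borel. x \<in> T} \<in> sets borel" by simp
  moreover have "AE v in subspace_lborel B. q + v \<in> T"
    using AE_subspace_lborel[of B] by eventually_elim (auto simp: T)
  moreover have "plane_lborel T = distr (subspace_lborel B) borel (\<lambda>v. q + v)" unfolding T by (rule plane_lborel_eq[OF B])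
  ultimately show ?thesis by (simp only:) (subst AE_distr_iff, auto)
qed

lemma sets_plane_lborel:
  fixes B :: "(real^'n) set"
  assumes B: "orthonormal B" and T: "T = (\<lambda>v. q + v) ` span B"
  shows "sets (plane_lborel T) = sets borel"
  unfolding T plane_lborel_eq[OF B] by simp

text \<open>The density |x|^(1-n) of the projected sphere measure is the power contained in
  \<open>point_fun\<close>. The Borel function \<open>f1\<close> has to agree with it almost
  everywhere on this very plane, since a null set of the whole space may contain the plane.\<close>

lemma dual_radon_eq_integral:
  fixes \<omega> u :: "real^'n"
  assumes n3: "CARD('n) \<ge> 3" and \<omega>: "norm \<omega> = 1" and \<omega>u: "\<omega> \<bullet> u = 0" and u: "u \<noteq> 0"
    and f1: "f1 \<in> borel_measurable borel"
    and ae: "AE x in plane_lborel (dual_plane \<omega> u). point_fun \<phi> x = f1 x"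
  shows "dual_radon \<phi> (line \<omega> u) = 2 / (norm u * sphere_area (CARD('n) - 2)) * (LINT x|plane_lborel (dual_plane \<omega> u). f1 x)"
proof -
  let ?n = "CARD('n)" and ?P = "dual_plane \<omega> u" and ?V = "{\<theta>. \<theta> \<bullet> \<omega> = 0}"
  let ?c = "2 / (norm u * sphere_area (?n - 2))"
  note [measurable] = f1
  obtain B where B: "orthonormal B" "span B = {v. v \<bullet> \<omega> = 0 \<and> v \<bullet> u = 0}"
    by (rule orthonormal_cone_basis[OF n3 \<omega> \<omega>u u])
  have P: "?P = (\<lambda>v. - (u /\<^sub>R (norm u)\<^sup>2) + v) ` span B"
    unfolding dual_plane_def[OF n3 \<omega> \<omega>u u] B(2) by (intro image_cong) auto
  have sP[measurable_cong]: "sets (plane_lborel ?P) = sets borel" by (rule sets_plane_lborel[OF B(1) P])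
  have aeP: "AE x in plane_lborel ?P. x \<in> ?P" by (rule AE_plane_lborel[OF B(1) P])
  have iff: "x \<in> ?P \<longleftrightarrow> x \<bullet> \<omega> = 0 \<and> x \<bullet> u = -1" for x by (rule dual_plane_iff[OF n3 \<omega> \<omega>u u])
  have dist: "distr (sphere_prob ?V) borel (to_plane u) = density (plane_lborel ?P) (\<lambda>x. ennreal (?c * norm x powr (1 - real ?n)))"
    by (rule distr_to_plane[OF n3 \<omega> \<omega>u u])
  have sS[measurable_cong]: "sets (sphere_prob ?V) = sets borel" by (simp add: sphere_prob_def)
  have tpm[measurable]: "to_plane u \<in> borel_measurable borel" by (rule to_plane_measurable[OF n3 \<omega> \<omega>u u])
  \<comment> \<open>The value of \<phi> at the hyperplane belonging to x, with the power in
    \<open>point_fun\<close> undone.\<close>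
  define H where "H = (\<lambda>x. norm x powr (real ?n - 1) * f1 x)"
  have [measurable]: "H \<in> borel_measurable borel" unfolding H_def by measurable
  have "AE x in density (plane_lborel ?P) (\<lambda>x. ennreal (?c * norm x powr (1 - real ?n))). x \<in> ?P \<and> point_fun \<phi> x = f1 x"
    using aeP ae by (subst AE_density) (measurable, auto)
  then have "AE \<theta> in sphere_prob ?V. to_plane u \<theta> \<in> ?P \<and> point_fun \<phi> (to_plane u \<theta>) = f1 (to_plane u \<theta>)"
    unfolding dist[symmetric] by (rule AE_distrD[rotated]) measurable
  then have F: "AE \<theta> in sphere_prob ?V. \<phi> (hyperplane \<theta> (\<theta> \<bullet> u)) = H (to_plane u \<theta>)"
  proof (eventually_elim, elim conjE)
    fix \<theta> assume tp: "to_plane u \<theta> \<in> ?P" "point_fun \<phi> (to_plane u \<theta>) = f1 (to_plane u \<theta>)"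
    define x where "x = to_plane u \<theta>"
    have x: "x \<bullet> u = -1" using tp(1) iff by (simp add: x_def)
    then have nx: "norm x > 0" by auto
    have tu: "\<theta> \<bullet> u \<noteq> 0" using nx by (auto simp: x_def to_plane_def[OF n3 \<omega> \<omega>u u])
    have "y \<bullet> x = -1 \<longleftrightarrow> y \<bullet> \<theta> = \<theta> \<bullet> u" for y
      using tu by (auto simp: x_def to_plane_def[OF n3 \<omega> \<omega>u u] field_simps)
    then have "{y. y \<bullet> x = -1} = hyperplane \<theta> (\<theta> \<bullet> u)" by (simp add: hyperplane_def)
    then have "norm x powr (1 - real ?n) * \<phi> (hyperplane \<theta> (\<theta> \<bullet> u)) = f1 x"
      using tp(2) by (simp add: point_fun_def x_def)
    then have "H x = (norm x powr (real ?n - 1) * norm x powr (1 - real ?n)) * \<phi> (hyperplane \<theta> (\<theta> \<bullet> u))"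
      by (simp add: H_def)
    also have "norm x powr (real ?n - 1) * norm x powr (1 - real ?n) = 1"
      using nx by (simp add: powr_add[symmetric])
    finally show "\<phi> (hyperplane \<theta> (\<theta> \<bullet> u)) = H (to_plane u \<theta>)" by (simp add: x_def)
  qed
  have c0: "0 \<le> ?c * norm x powr (1 - real ?n)" for x :: "real^'n"
    unfolding sphere_area_eq by (intro mult_nonneg_nonneg divide_nonneg_nonneg) auto
  have "dual_radon \<phi> (line \<omega> u) = (LINT \<theta>|completion (sphere_prob ?V). \<phi> (hyperplane \<theta> (\<theta> \<bullet> u)))"
    by (rule coordinates_immaterial(1)[OF \<omega> \<omega>u])
  also have "\<dots> = (LINT \<theta>|sphere_prob ?V. H (to_plane u \<theta>))"
    by (rule integral_completion_AE(1)[OF _ F]) measurable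
  also have "\<dots> = (LINT x|distr (sphere_prob ?V) borel (to_plane u). H x)"
    by (rule integral_distr[symmetric]) measurable
  also have "\<dots> = (LINT x|plane_lborel ?P. (?c * norm x powr (1 - real ?n)) *\<^sub>R H x)"
    unfolding dist
  proof (rule integral_density)
    show "(\<lambda>x. ?c * norm x powr (1 - real ?n)) \<in> borel_measurable (plane_lborel ?P)"
      unfolding measurable_cong_sets[OF sP refl] by measurable
    show "H \<in> borel_measurable (plane_lborel ?P)" unfolding measurable_cong_sets[OF sP refl] by fact
    show "AE x in plane_lborel ?P. 0 \<le> ?c * norm x powr (1 - real ?n)" using c0 by simp
  qed
  also have "\<dots> = (LINT x|plane_lborel ?P. ?c * f1 x)"
  proof (rule integral_cong_AE)
    show "AE x in plane_lborel ?P. (?c * norm x powr (1 - real ?n)) *\<^sub>R H x = ?c * f1 x"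
      using aeP
    proof eventually_elim
      fix x assume "x \<in> ?P"
      then have nx: "norm x > 0" using iff[of x] by auto
      have "norm x powr (1 - real ?n) * norm x powr (real ?n - 1) = 1" using nx by (simp add: powr_add[symmetric])
      moreover have "(?c * norm x powr (1 - real ?n)) *\<^sub>R H x = ?c * (norm x powr (1 - real ?n) * norm x powr (real ?n - 1)) * f1 x"
        by (simp add: H_def)
      ultimately show "(?c * norm x powr (1 - real ?n)) *\<^sub>R H x = ?c * f1 x" by (simp only: mult_1_right)
    qed
  qed measurable
  also have "\<dots> = ?c * (LINT x|plane_lborel ?P. f1 x)" by (rule integral_mult_right_zero)
  finally show ?thesis .
qed

lemma dist0_dual_plane:
  fixes \<omega> u :: "real^'n"
  assumes n3: "CARD('n) \<ge> 3" and \<omega>: "norm \<omega> = 1" and \<omega>u: "\<omega> \<bullet> u = 0" and u: "u \<noteq> 0"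
  shows "dist0 (dual_plane \<omega> u) = 1 / norm u"
proof (rule antisym)
  let ?P = "dual_plane \<omega> u"
  have iff: "x \<in> ?P \<longleftrightarrow> x \<bullet> \<omega> = 0 \<and> x \<bullet> u = -1" for x by (rule dual_plane_iff[OF n3 \<omega> \<omega>u u])
  have p: "- (u /\<^sub>R (norm u)\<^sup>2) \<in> ?P"
    unfolding iff using u \<omega>u by (simp add: inner_commute[of u \<omega>] dot_square_norm)
  have "dist0 ?P \<le> dist 0 (- (u /\<^sub>R (norm u)\<^sup>2))" using p by (rule infdist_le)
  also have "\<dots> = 1 / norm u" using u by (simp add: dist_norm power2_eq_square field_simps)
  finally show "dist0 ?P \<le> 1 / norm u" .
  have "1 / norm u \<le> dist 0 x" if "x \<in> ?P" for x
  proof -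
    have "1 = \<bar>x \<bullet> u\<bar>" using that iff by simp
    also have "\<dots> \<le> norm x * norm u" by (rule Cauchy_Schwarz_ineq2)
    finally show ?thesis using u by (simp add: field_simps dist_norm)
  qed
  then show "1 / norm u \<le> dist0 ?P"
    unfolding infdist_def using p by (auto intro!: cINF_greatest)
qed

text \<open>As |P| = 1 / |u|, the factor in \<open>Phi\<close> is the inverse of the constant in
  \<open>dual_radon_eq_integral\<close>. Membership in the range of \<nu> makes the chosen inverse a
  genuine preimage line.\<close>

lemma Phi_eq_integral_dual_plane:
  fixes P :: "(real^'n) set"
  assumes n3: "CARD('n) \<ge> 3" and P: "P \<in> nu_line ` {l \<in> lines. 0 \<notin> l}"
    and f1: "f1 \<in> borel_measurable borel" and ae: "AE x in plane_lborel P. point_fun \<phi> x = f1 x"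
  shows "Phi \<phi> P = (LINT x|plane_lborel P. f1 x)"
proof -
  define l where "l = nu_line_inv P"
  have l: "l \<in> {l \<in> lines. 0 \<notin> l}" "nu_line l = P"
    unfolding l_def nu_line_inv_def by (rule inv_into_into[OF P], rule f_inv_into_f[OF P])
  obtain \<omega> u where \<omega>: "norm \<omega> = 1" "\<omega> \<bullet> u = 0" and lu: "l = line \<omega> u"
    using l(1) by (auto simp: lines_def)
  have u: "u \<noteq> 0"
  proof
    assume "u = 0"
    then have "0 \<in> line \<omega> u" unfolding line_def by (intro image_eqI[of _ _ 0]) auto
    then show False using l(1) lu by simp
  qed
  have PP: "P = dual_plane \<omega> u"
    using l(2) coordinates_immaterial(2)[OF \<omega>] unfolding lu by (simp add: dual_plane_def[OF n3 \<omega> u])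
  have area: "sphere_area (CARD('n) - 2) > 0" unfolding sphere_area_eq by (intro mult_pos_pos) auto
  have "Phi \<phi> P = sphere_area (CARD('n) - 2) / (2 * (1 / norm u)) * (2 / (norm u * sphere_area (CARD('n) - 2)) * (LINT x|plane_lborel P. f1 x))"
    unfolding Phi_def l_def[symmetric] unfolding lu
    using dual_radon_eq_integral[OF n3 \<omega> u f1 ae[unfolded PP]] dist0_dual_plane[OF n3 \<omega> u] PP by (simp only:)
  also have "\<dots> = (LINT x|plane_lborel P. f1 x)" using u area by simp
  finally show ?thesis .
qed

lemma rotation_inner:
  fixes A :: "real^'n^'n"
  assumes "rotation_matrix A"
  shows "(A *v a) \<bullet> (A *v b) = a \<bullet> b"
  using rotation_matrix_orthogonal_transformation[OF assms] by (simp add: orthogonal_transformation_def)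

lemma rotation_transpose_mult:
  fixes A :: "real^'n^'n"
  assumes "rotation_matrix A"
  shows "A *v (transpose A *v x) = x"
  using assms unfolding matrix_vector_mul_assoc by (simp add: rotation_matrix_def orthogonal_matrix_def)

section \<open>The measure on the set of hyperplanes\<close>

text \<open>The substitution s = 1 / t on the intervals [1 / (m + 2), m + 2], which exhaust the
  half-line.\<close>

lemma nn_integral_inversion:
  assumes [measurable]: "z \<in> borel_measurable borel"
  shows "(\<integral>\<^sup>+t. indicator {0<..} t * (ennreal (1 / t\<^sup>2) * z (1 / t)) \<partial>lborel) = (\<integral>\<^sup>+s. indicator {0<..} s * z s \<partial>(lborel :: real measure))"
proof -
  define \<mu> \<nu> where "\<mu> = density lborel z" and "\<nu> = density lborel (\<lambda>t::real. ennreal (1 / t\<^sup>2) * z (1 / t))"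
  define K where "K = (\<lambda>m::nat. {1 / real (m + 2)..real (m + 2)})"
  have K: "emeasure \<nu> (K m) = emeasure \<mu> (K m)" for m
  proof -
    let ?a = "1 / real (m + 2)" and ?b = "real (m + 2)"
    have "emeasure \<mu> (K m) = (\<integral>\<^sup>+s. z s * indicator {?a..?b} s \<partial>lborel)"
      unfolding \<mu>_def K_def by (rule emeasure_density) auto
    \<comment> \<open>Reflection first: -1 / t is increasing, as the substitution rule
      requires.\<close>
    also have "\<dots> = (\<integral>\<^sup>+s. z (- s) * indicator {?a..?b} (- s) \<partial>lborel)"
      using nn_integral_real_affine[of "\<lambda>s. z s * indicator {?a..?b} s" "-1" 0] by simp
    also have "\<dots> = (\<integral>\<^sup>+s. z (- s) * indicator (atLeastAtMost (- (1 / ?a)) (- (1 / ?b))) s \<partial>lborel)"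
      by (intro nn_integral_cong arg_cong2[where f="(*)"]) (auto simp: indicator_def)
    also have "\<dots> = (\<integral>\<^sup>+t. z (- (- (1 / t))) * ennreal (1 / t\<^sup>2) * indicator {?a..?b} t \<partial>lborel)"
    proof (intro nn_integral_substitution_aux[where g="\<lambda>t. - (1 / t)"])
      show "?a < ?b" by (rule less_trans[of _ 1]) auto
    qed (auto intro!: derivative_eq_intros continuous_intros simp: power2_eq_square)
    also have "\<dots> = emeasure \<nu> (K m)"
      unfolding \<nu>_def K_def by (subst emeasure_density) (auto simp: mult_ac)
    finally show ?thesis by simp
  qed
  have inc: "incseq K"
  proof (rule incseq_SucI)
    fix m show "K m \<subseteq> K (Suc m)" unfolding K_def atLeastatMost_subset_iff by (intro disjI2 conjI) (auto simp: field_simps)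
  qed
  have UN: "(\<Union>m. K m) = {0<..}"
  proof
    show "(\<Union>m. K m) \<subseteq> {0<..}" by (auto simp: K_def intro: less_le_trans[of 0 "1 / real (_ + 2)"])
    show "{0<..} \<subseteq> (\<Union>m. K m)"
    proof
      fix s :: real assume "s \<in> {0<..}"
      then have s: "s > 0" by simp
      obtain m where m: "max s (1 / s) < real m" using reals_Archimedean2 by blast
      then have "s \<le> real (m + 2)" "1 / s \<le> real (m + 2)" by auto
      then have "s \<in> K m" using s by (simp add: K_def field_simps)
      then show "s \<in> (\<Union>m. K m)" by blast
    qed
  qed
  have "emeasure \<nu> {0<..} = (SUP m. emeasure \<nu> (K m))" "emeasure \<mu> {0<..} = (SUP m. emeasure \<mu> (K m))"
    unfolding UN[symmetric] using inc by (intro SUP_emeasure_incseq[symmetric]; auto simp: K_def \<nu>_def \<mu>_def)+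
  then have "emeasure \<nu> {0<..} = emeasure \<mu> {0<..}" by (simp add: K)
  then show ?thesis unfolding \<mu>_def \<nu>_def by (simp add: emeasure_density mult_ac)
qed

section \<open>Surface measure and the measure on hyperplanes\<close>

lemma plane_lborel_UNIV: "plane_lborel UNIV = (lborel :: (real^'n) measure)"
proof -
  have "plane_lborel ((\<lambda>v. 0 + v) ` span (Basis :: (real^'n) set)) = distr (subspace_lborel Basis) borel (\<lambda>v. 0 + v)"
    by (rule plane_lborel_eq[OF orthonormal_Basis])
  also have "\<dots> = lborel" unfolding lborel_eq_subspace_lborel[OF orthonormal_Basis span_Basis, symmetric] by (rule lborel_translation)
  finally show ?thesis by simp
qed

text \<open>In polar coordinates \<open>sgn\<close> forgets the radius, so the cone over E takes
  from the unit ball the fraction given by the Haar measure of the rotations A with A \<xi> in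
  E.\<close>

lemma sphere_prob_UNIV:
  fixes \<xi> :: "real^'n"
  assumes n: "CARD('n) \<ge> 2" and \<xi>: "norm \<xi> = 1"
  shows "sphere_prob UNIV = distr haar_SO borel (\<lambda>A. A *v \<xi>)"
proof (rule measure_eqI)
  show "sets (sphere_prob UNIV) = sets (distr haar_SO borel (\<lambda>A. A *v \<xi>))" by (simp add: sphere_prob_def)
  fix E :: "(real^'n) set" assume "E \<in> sets (sphere_prob UNIV)"
  then have [measurable]: "E \<in> sets borel" by (simp add: sphere_prob_def)
  have [measurable]: "ball (0::real^'n) 1 \<in> sets borel" by simp
  let ?w = "\<lambda>s. ennreal (radial_weight CARD('n) 0 s) * indicator {..<1} s"
  have polar: "(\<integral>\<^sup>+x. indicator (ball 0 1) x * g (sgn x) \<partial>lborel) = (\<integral>\<^sup>+s. ?w s \<partial>lborel) * (\<integral>\<^sup>+A. g (A *v \<xi>) \<partial>haar_SO)"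
    if [measurable]: "g \<in> borel_measurable borel" for g :: "real^'n \<Rightarrow> ennreal"
  proof -
    have sg: "sgn (s *\<^sub>R (A *v \<xi>)) = A *v \<xi>" "s *\<^sub>R (A *v \<xi>) \<in> ball 0 1 \<longleftrightarrow> s < 1"
      if "A \<in> space haar_SO" "s > 0" for A s
      using that norm_rotation[OF n \<xi> that(1), of \<xi>] by (simp_all add: sgn_div_norm \<xi>)
    have "(\<integral>\<^sup>+x. indicator (ball 0 1) x * g (sgn x) \<partial>lborel) =
      (\<integral>\<^sup>+s. ennreal (radial_weight CARD('n) 0 s) * sph_nn \<xi> (\<lambda>x. indicator (ball 0 1) x * g (sgn x)) 0 s \<partial>lborel)"
      by (rule nn_integral_polar[OF n \<xi>]) measurable
    also have "\<dots> = (\<integral>\<^sup>+s. ?w s * (\<integral>\<^sup>+A. g (A *v \<xi>) \<partial>haar_SO) \<partial>lborel)"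
    proof (rule nn_integral_cong)
      fix s :: real
      show "ennreal (radial_weight CARD('n) 0 s) * sph_nn \<xi> (\<lambda>x. indicator (ball 0 1) x * g (sgn x)) 0 s =
         ?w s * (\<integral>\<^sup>+A. g (A *v \<xi>) \<partial>haar_SO)"
      proof (cases "s > 0")
        case True
        have "sph_nn \<xi> (\<lambda>x. indicator (ball 0 1) x * g (sgn x)) 0 s = (\<integral>\<^sup>+A. indicator {..<1} s * g (A *v \<xi>) \<partial>haar_SO)"
          unfolding sph_nn_def add_0_left using sg[OF _ True] by (intro nn_integral_cong arg_cong2[where f="(*)"]) (auto simp: indicator_def)
        then show ?thesis by (simp add: nn_integral_cmult mult.assoc)
      qed (simp add: radial_weight_def)
    qed
    also have "\<dots> = (\<integral>\<^sup>+s. ?w s \<partial>lborel) * (\<integral>\<^sup>+A. g (A *v \<xi>) \<partial>haar_SO)"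
      by (rule nn_integral_multc) measurable
    finally show ?thesis .
  qed
  interpret prob_space "haar_SO :: (real^'n^'n) measure" by (rule prob_space_haar_SO)
  have b: "emeasure lborel (ball (0::real^'n) 1) = ennreal (unit_ball_vol (real CARD('n)))"
    using emeasure_ball[of 1 "0::real^'n"] by simp
  have w: "(\<integral>\<^sup>+s. ?w s \<partial>lborel) = emeasure lborel (ball (0::real^'n) 1)"
    using polar[of "\<lambda>_. 1"] by (simp add: emeasure_space_1)
  have "emeasure (sphere_prob UNIV) E = emeasure lborel (ball 0 1 \<inter> {x. sgn x \<in> E}) / emeasure lborel (ball (0::real^'n) 1)"
    unfolding sphere_prob_def plane_lborel_UNIV by (subst emeasure_distr) (auto simp: vimage_def)
  also have "emeasure lborel (ball 0 1 \<inter> {x. sgn x \<in> E}) = (\<integral>\<^sup>+x. indicator (ball 0 1) x * indicator E (sgn x) \<partial>lborel)"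
  proof -
    have "emeasure lborel (ball 0 1 \<inter> {x. sgn x \<in> E}) = (\<integral>\<^sup>+x. indicator (ball 0 1 \<inter> {x. sgn x \<in> E}) x \<partial>lborel)"
      by (rule nn_integral_indicator[symmetric]) measurable
    also have "\<dots> = (\<integral>\<^sup>+x. indicator (ball 0 1) x * indicator E (sgn x) \<partial>lborel)"
      by (intro nn_integral_cong) (simp add: indicator_def)
    finally show ?thesis .
  qed
  also have "\<dots> = emeasure lborel (ball (0::real^'n) 1) * (\<integral>\<^sup>+A. indicator E (A *v \<xi>) \<partial>haar_SO)"
    unfolding w[symmetric] by (rule polar) measurable
  also have "\<dots> / emeasure lborel (ball (0::real^'n) 1) = (\<integral>\<^sup>+A. indicator E (A *v \<xi>) \<partial>haar_SO)"
    unfolding b by (subst mult.commute, rule ennreal_mult_divide_eq) (auto simp: less_le)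
  also have "\<dots> = (\<integral>\<^sup>+x. indicator E x \<partial>distr haar_SO borel (\<lambda>A. A *v \<xi>))"
    by (subst nn_integral_distr) auto
  finally show "emeasure (sphere_prob UNIV) E = emeasure (distr haar_SO borel (\<lambda>A. A *v \<xi>)) E" by simp
qed

lemma hyperplane_sgn: "x \<noteq> 0 \<Longrightarrow> hyperplane (sgn x) (- (1 / norm x)) = {y. y \<bullet> (x :: real^'n) = -1}"
  by (auto simp: hyperplane_def sgn_div_norm field_simps)

lemma dist0_hyperplane:
  assumes \<theta>: "norm (\<theta> :: real^'n) = 1"
  shows "dist0 (hyperplane \<theta> t) = \<bar>t\<bar>"
proof (rule antisym)
  have m: "t *\<^sub>R \<theta> \<in> hyperplane \<theta> t" using \<theta> by (simp add: hyperplane_def dot_square_norm)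
  show "dist0 (hyperplane \<theta> t) \<le> \<bar>t\<bar>" using infdist_le[OF m, of 0] \<theta> by simp
  have "\<bar>t\<bar> \<le> dist 0 x" if "x \<in> hyperplane \<theta> t" for x
    using that Cauchy_Schwarz_ineq2[of x \<theta>] \<theta> by (simp add: hyperplane_def)
  then show "\<bar>t\<bar> \<le> dist0 (hyperplane \<theta> t)"
    unfolding infdist_def using m by (auto intro!: cINF_greatest)
qed

context
  fixes \<xi> :: "real^'n"
  assumes n: "CARD('n) \<ge> 2" and \<xi>: "norm \<xi> = 1"
begin

lemma prob_space_sphere_prob_UNIV: "prob_space (sphere_prob UNIV :: (real^'n) measure)"
  unfolding sphere_prob_UNIV[OF n \<xi>] by (rule prob_space.prob_space_distr[OF prob_space_haar_SO]) measurable

lemma sets_sphere_prob[measurable_cong]: "sets (sphere_prob UNIV :: (real^'n) measure) = sets borel"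
  by (simp add: sphere_prob_def)

lemma AE_sphere_prob_norm: "AE (\<theta>, t) in sphere_prob UNIV \<Otimes>\<^sub>M (lborel :: real measure). norm (\<theta> :: real^'n) = 1 \<and> t \<noteq> 0"
proof -
  interpret prob_space "sphere_prob UNIV :: (real^'n) measure" by (rule prob_space_sphere_prob_UNIV)
  interpret P: pair_sigma_finite "sphere_prob UNIV :: (real^'n) measure" "lborel :: real measure" ..
  have "AE A in haar_SO. norm (A *v \<xi>) = 1"
    using norm_rotation[OF n \<xi>, of _ \<xi>] \<xi> by (intro AE_I2) simp
  then have 1: "AE \<theta> in (sphere_prob UNIV :: (real^'n) measure). norm \<theta> = 1"
    unfolding sphere_prob_UNIV[OF n \<xi>] by (subst AE_distr_iff) auto
  show ?thesis unfolding case_prod_beta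
  proof (rule P.AE_pair_measure)
    show "AE \<theta> in (sphere_prob UNIV :: (real^'n) measure). AE t in lborel. norm (fst (\<theta>, t)) = 1 \<and> snd (\<theta>, t) \<noteq> (0::real)"
      using 1
    proof eventually_elim
      fix \<theta> :: "real^'n" assume "norm \<theta> = 1"
      then show "AE t in lborel. norm (fst (\<theta>, t)) = 1 \<and> snd (\<theta>, t) \<noteq> (0::real)"
        using AE_lborel_singleton[of "0::real"] by simp
    qed
  qed measurable
qed

text \<open>Since (\<theta>, t) and (-\<theta>, -t) describe the same hyperplane, either half t > 0
  or t < 0, selected by c, parametrises the nonzero points x = -\<theta> / t once. With s = |x| = 1
  / |t| the weight is the Jacobian: s^(n-1) |ds| = |t|^(-n-1) |dt|.\<close>

lemma nn_integral_hyperplanes: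
  assumes c: "c = 1 \<or> c = -1" and [measurable]: "h \<in> borel_measurable borel"
  shows "ennreal (real CARD('n) * unit_ball_vol (real CARD('n))) *
    (\<integral>\<^sup>+(\<theta>, t). indicator {0<..} (c * t) * (ennreal (\<bar>t\<bar> powr - (real CARD('n) + 1)) * h (- (\<theta> /\<^sub>R t))) \<partial>(sphere_prob UNIV \<Otimes>\<^sub>M lborel)) =
    (\<integral>\<^sup>+x. h (x :: real^'n) \<partial>lborel)"
proof -
  let ?n = "CARD('n)" and ?C = "ennreal (real CARD('n) * unit_ball_vol (real CARD('n)))"
  interpret prob_space "sphere_prob UNIV :: (real^'n) measure" by (rule prob_space_sphere_prob_UNIV)
  interpret P: pair_sigma_finite "sphere_prob UNIV :: (real^'n) measure" "lborel :: real measure" ..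
  define z where "z = (\<lambda>s. ennreal (s ^ (?n - 1)) * sph_nn \<xi> h 0 s)"
  have [measurable]: "z \<in> borel_measurable borel" unfolding z_def by measurable
  let ?W = "\<lambda>t. indicator {0<..} (c * t) * ennreal (\<bar>t\<bar> powr - (real ?n + 1))"
  let ?k = "\<lambda>t. ?W t * sph_nn \<xi> h 0 (1 / \<bar>t\<bar>)"
  have "(\<integral>\<^sup>+(\<theta>, t). indicator {0<..} (c * t) * (ennreal (\<bar>t\<bar> powr - (real ?n + 1)) * h (- (\<theta> /\<^sub>R t))) \<partial>(sphere_prob UNIV \<Otimes>\<^sub>M lborel)) =
     (\<integral>\<^sup>+t. (\<integral>\<^sup>+\<theta>. ?W t * h (- (\<theta> /\<^sub>R t)) \<partial>sphere_prob UNIV) \<partial>lborel)"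
    unfolding mult.assoc by (subst P.nn_integral_snd[symmetric]) auto
  also have "\<dots> = (\<integral>\<^sup>+t. ?k t \<partial>lborel)"
  proof (rule nn_integral_cong)
    fix t :: real
    have mv_neg: "A *v (- v) = - (A *v v)" for A :: "real^'n^'n" and v
      using matrix_vector_mult_scaleR[of A "-1" v] by simp
    have "(\<integral>\<^sup>+\<theta>. h (- (\<theta> /\<^sub>R t)) \<partial>sphere_prob UNIV) = (\<integral>\<^sup>+A. h (0 + A *v (- (\<xi> /\<^sub>R t))) \<partial>haar_SO)"
      unfolding sphere_prob_UNIV[OF n \<xi>] by (subst nn_integral_distr) (auto simp: matrix_vector_mult_scaleR mv_neg)
    also have "\<dots> = sph_nn \<xi> h 0 (norm (- (\<xi> /\<^sub>R t)))" by (rule nn_integral_haar_SO_eq_sph_nn[OF n \<xi>]) measurable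
    also have "norm (- (\<xi> /\<^sub>R t)) = 1 / \<bar>t\<bar>" by (simp add: \<xi> divide_inverse)
    finally show "(\<integral>\<^sup>+\<theta>. ?W t * h (- (\<theta> /\<^sub>R t)) \<partial>sphere_prob UNIV) = ?k t" by (subst nn_integral_cmult) auto
  qed
  also have "\<dots> = (\<integral>\<^sup>+t. ?k (c * t) \<partial>lborel)"
    using nn_integral_real_affine[of ?k c 0] c by auto
  also have "\<dots> = (\<integral>\<^sup>+t. indicator {0<..} t * (ennreal (1 / t\<^sup>2) * z (1 / t)) \<partial>lborel)"
  proof (rule nn_integral_cong)
    fix t :: real
    show "?k (c * t) = indicator {0<..} t * (ennreal (1 / t\<^sup>2) * z (1 / t))"
    proof (cases "t > 0")
      case True
      have "t powr - (real ?n + 1) = t powr (- real 2) * t powr (- real (?n - 1))"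
        unfolding powr_add[symmetric] using n by (simp add: of_nat_diff algebra_simps)
      also have "\<dots> = 1 / t\<^sup>2 * (1 / t) ^ (?n - 1)"
        by (simp only: powr_minus_divide powr_realpow[OF True] power_one_over)
      finally have "ennreal (t powr - (real ?n + 1)) = ennreal (1 / t\<^sup>2) * ennreal ((1 / t) ^ (?n - 1))"
        by (simp only:) (rule ennreal_mult, use True in auto)
      moreover have "c * (c * t) = t" "\<bar>c * t\<bar> = t" using c True by auto
      ultimately show ?thesis using True by (simp only: z_def mult.assoc)
    qed (use c in auto)
  qed
  also have "\<dots> = (\<integral>\<^sup>+s. indicator {0<..} s * z s \<partial>lborel)" by (rule nn_integral_inversion) measurable
  also have "?C * \<dots> = (\<integral>\<^sup>+s. ?C * (indicator {0<..} s * z s) \<partial>lborel)" by (rule nn_integral_cmult[symmetric]) measurable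
  also have "\<dots> = (\<integral>\<^sup>+s. ennreal (radial_weight ?n 0 s) * sph_nn \<xi> h 0 s \<partial>lborel)"
  proof (rule nn_integral_cong)
    fix s :: real
    show "?C * (indicator {0<..} s * z s) = ennreal (radial_weight ?n 0 s) * sph_nn \<xi> h 0 s"
    proof (cases "s > 0")
      case True
      then have "radial_weight ?n 0 s = real ?n * unit_ball_vol (real ?n) * s ^ (?n - 1)" using n by (simp add: radial_weight_0)
      then have "ennreal (radial_weight ?n 0 s) = ?C * ennreal (s ^ (?n - 1))"
        using True by (simp only:) (intro ennreal_mult mult_nonneg_nonneg, auto)
      then show ?thesis using True by (simp only: z_def) (simp add: mult.assoc)
    qed (simp add: radial_weight_def)
  qed
  also have "\<dots> = (\<integral>\<^sup>+x. h x \<partial>lborel)" by (rule nn_integral_polar[OF n \<xi>, symmetric]) measurable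
  finally show ?thesis .
qed

lemma AE_hyperplane_point:
  assumes N: "N \<in> null_sets lborel"
  shows "AE (\<theta>, t) in sphere_prob UNIV \<Otimes>\<^sub>M (lborel :: real measure). - (\<theta> /\<^sub>R t) \<notin> (N :: (real^'n) set)"
proof -
  have [measurable]: "N \<in> sets borel" using N by auto
  define I :: "real^'n \<Rightarrow> ennreal" where "I = indicator N"
  have [measurable]: "I \<in> borel_measurable borel" unfolding I_def by measurable
  have "integral\<^sup>N lborel I = emeasure lborel N" unfolding I_def by (rule nn_integral_indicator) simp
  then have I0: "integral\<^sup>N lborel I = 0" using null_setsD1[OF N] by simp
  have C: "ennreal (real CARD('n) * unit_ball_vol (real CARD('n))) \<noteq> 0"
    by (auto simp: ennreal_eq_0_iff not_le less_le)
  have ae: "AE (\<theta>, t) in sphere_prob UNIV \<Otimes>\<^sub>M (lborel :: real measure). indicator {0<..} (c * t) * (ennreal (\<bar>t\<bar> powr - (real CARD('n) + 1)) * I (- (\<theta> /\<^sub>R t))) = 0"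
    if c: "c = 1 \<or> c = -1" for c :: real
  proof -
    have "(\<integral>\<^sup>+(\<theta>, t). indicator {0<..} (c * t) * (ennreal (\<bar>t\<bar> powr - (real CARD('n) + 1)) * I (- (\<theta> /\<^sub>R t))) \<partial>(sphere_prob UNIV \<Otimes>\<^sub>M lborel)) = 0"
      using nn_integral_hyperplanes[OF c, of I] I0 C by simp
    then show ?thesis by (subst (asm) nn_integral_0_iff_AE) (auto simp: case_prod_beta)
  qed
  show ?thesis
    using ae[OF disjI1[OF refl]] ae[OF disjI2[OF refl]] AE_sphere_prob_norm unfolding case_prod_beta
  proof eventually_elim
    fix p :: "(real^'n) \<times> real"
    assume *: "indicator {0<..} (1 * snd p) * (ennreal (\<bar>snd p\<bar> powr - (real CARD('n) + 1)) * I (- (fst p /\<^sub>R snd p))) = 0"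
      "indicator {0<..} (- 1 * snd p) * (ennreal (\<bar>snd p\<bar> powr - (real CARD('n) + 1)) * I (- (fst p /\<^sub>R snd p))) = 0"
      "norm (fst p) = 1 \<and> snd p \<noteq> 0"
    have "ennreal (\<bar>snd p\<bar> powr - (real CARD('n) + 1)) \<noteq> 0" using *(3) by (simp add: ennreal_eq_0_iff not_le)
    moreover have "snd p > 0 \<or> - snd p > 0" using *(3) by auto
    ultimately have "I (- (fst p /\<^sub>R snd p)) = 0" using *(1,2) by (elim disjE) (simp_all only: mult_1_left mult_minus1 indicator_simps greaterThan_iff mult_eq_0_iff simp_thms zero_neq_one one_neq_zero)
    then show "- (fst p /\<^sub>R snd p) \<notin> N" by (simp add: I_def indicator_def split: if_splits)
  qed
qed

text \<open>The weight in the space of \<phi> is made for this: |t|^(-n-1) |t|^((n-1) p) =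
  |t|^((n-1)(p-1)-2), so the L^p integral of f is bounded by the weighted integral of \<phi>. A
  Borel representative is chosen in the coordinates (\<theta>, t) and carried to points.\<close>

lemma Lp_tilde_point_fun:
  assumes \<phi>: "\<phi> \<in> Lp_tilde p" and p: "p \<ge> 1"
  obtains f :: "real^'n \<Rightarrow> real" where "f \<in> borel_measurable borel" "AE x in lborel. point_fun \<phi> x = f x"
    "(\<integral>\<^sup>+x. ennreal (\<bar>f x\<bar> powr p) \<partial>lborel) < \<infinity>"
proof -
  let ?n = "CARD('n)" and ?M = "sphere_prob UNIV \<Otimes>\<^sub>M (lborel :: real measure) :: ((real^'n) \<times> real) measure"
  let ?C = "ennreal (real ?n * unit_ball_vol (real ?n))"
  define G where "G = (\<lambda>(\<theta>, t). \<phi> (hyperplane \<theta> t))"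
  have "G \<in> borel_measurable (completion ?M)" using \<phi> by (simp add: Lp_tilde_def G_def hyperplane_measure_def)
  then obtain G1 where G1[measurable]: "G1 \<in> borel_measurable ?M" and GG: "AE q in ?M. G q = G1 q"
    using completion_ex_borel_measurable_real by blast
  obtain Z where Z: "Z \<in> null_sets ?M" "\<forall>q\<in>space ?M. q \<notin> Z \<longrightarrow> G q = G1 q"
    using AE_null_superset[OF GG] by blast
  have Zm[measurable]: "Z \<in> sets ?M" using Z(1) by auto
  have spM: "space ?M = UNIV" by (simp add: space_pair_measure sphere_prob_def)
  \<comment> \<open>A section of the map from (\<theta>, t) to -\<theta> / t with values in t < 0;
    hence c = -1 below.\<close>
  define k :: "real^'n \<Rightarrow> (real^'n) \<times> real" where "k = (\<lambda>x. (sgn x, - (1 / norm x)))"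
  have [measurable]: "k \<in> measurable borel ?M" unfolding k_def by measurable
  define f where "f = (\<lambda>x. norm x powr (1 - real ?n) * G1 (k x))"
  have fm[measurable]: "f \<in> borel_measurable borel" unfolding f_def by measurable
  have k: "k (- (\<theta> /\<^sub>R t)) = (\<theta>, t)" if "norm \<theta> = 1" "t < 0" for \<theta> t
    using that by (simp add: k_def sgn_div_norm divide_inverse)
  define I :: "real^'n \<Rightarrow> ennreal" where "I = (\<lambda>x. indicator Z (k x))"
  have [measurable]: "I \<in> borel_measurable borel" unfolding I_def by measurable
  have "(\<integral>\<^sup>+(\<theta>, t). indicator {0<..} (- 1 * t) * (ennreal (\<bar>t\<bar> powr - (real ?n + 1)) * I (- (\<theta> /\<^sub>R t))) \<partial>?M) = (\<integral>\<^sup>+q. 0 \<partial>?M)"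
    using AE_sphere_prob_norm AE_not_in[OF Z(1)]
    by (intro nn_integral_cong_AE, eventually_elim) (auto simp: I_def indicator_def k)
  then have "(\<integral>\<^sup>+x. I x \<partial>lborel) = 0"
    using nn_integral_hyperplanes[of "-1" I] by simp
  then have "AE x in lborel. I x = 0" by (subst (asm) nn_integral_0_iff_AE) auto
  then have ff: "AE x in lborel. point_fun \<phi> x = f x"
    using AE_lborel_singleton[of "0::real^'n"]
  proof eventually_elim
    fix x :: "real^'n" assume x: "I x = 0" "x \<noteq> 0"
    have "G (k x) = G1 (k x)" using x(1) bspec[OF Z(2), of "k x"] unfolding spM by (auto simp: I_def indicator_def split: if_splits)
    then show "point_fun \<phi> x = f x" using hyperplane_sgn[OF x(2)] by (simp add: point_fun_def f_def G_def k_def)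
  qed
  have "(\<integral>\<^sup>+x. ennreal (\<bar>f x\<bar> powr p) \<partial>lborel) =
    ?C * (\<integral>\<^sup>+(\<theta>, t). indicator {0<..} (- 1 * t) * (ennreal (\<bar>t\<bar> powr - (real ?n + 1)) * ennreal (\<bar>f (- (\<theta> /\<^sub>R t))\<bar> powr p)) \<partial>?M)"
    using nn_integral_hyperplanes[of "-1" "\<lambda>x. ennreal (\<bar>f x\<bar> powr p)"] by simp
  also have "\<dots> \<le> ?C * (\<integral>\<^sup>+(\<theta>, t). ennreal (dist0 (hyperplane \<theta> t) powr ((real ?n - 1) * (p - 1) - 2) * \<bar>\<phi> (hyperplane \<theta> t)\<bar> powr p) \<partial>?M)"
  proof (intro mult_left_mono nn_integral_mono_AE)
    show "AE q in ?M. (case q of (\<theta>, t) \<Rightarrow> indicator {0<..} (- 1 * t) * (ennreal (\<bar>t\<bar> powr - (real ?n + 1)) * ennreal (\<bar>f (- (\<theta> /\<^sub>R t))\<bar> powr p)))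
      \<le> (case q of (\<theta>, t) \<Rightarrow> ennreal (dist0 (hyperplane \<theta> t) powr ((real ?n - 1) * (p - 1) - 2) * \<bar>\<phi> (hyperplane \<theta> t)\<bar> powr p))"
      using AE_sphere_prob_norm GG
    proof eventually_elim
      fix q :: "(real^'n) \<times> real" assume "case q of (\<theta>, t) \<Rightarrow> norm \<theta> = 1 \<and> t \<noteq> 0" "G q = G1 q"
      then obtain \<theta> t where q: "q = (\<theta>, t)" "norm \<theta> = 1" "\<phi> (hyperplane \<theta> t) = G1 (\<theta>, t)" by (cases q) (auto simp: G_def)
      show "(case q of (\<theta>, t) \<Rightarrow> indicator {0<..} (- 1 * t) * (ennreal (\<bar>t\<bar> powr - (real ?n + 1)) * ennreal (\<bar>f (- (\<theta> /\<^sub>R t))\<bar> powr p)))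
      \<le> (case q of (\<theta>, t) \<Rightarrow> ennreal (dist0 (hyperplane \<theta> t) powr ((real ?n - 1) * (p - 1) - 2) * \<bar>\<phi> (hyperplane \<theta> t)\<bar> powr p))"
      proof (cases "t < 0")
        case True
        have nt: "norm (- (\<theta> /\<^sub>R t)) = \<bar>t\<bar> powr - 1" using q(2) True by (simp add: powr_minus divide_inverse)
        have "\<bar>f (- (\<theta> /\<^sub>R t))\<bar> powr p = (\<bar>t\<bar> powr (real ?n - 1) * \<bar>G1 (\<theta>, t)\<bar>) powr p"
          unfolding f_def k[OF q(2) True] nt powr_powr by (simp add: abs_mult)
        also have "\<dots> = \<bar>t\<bar> powr ((real ?n - 1) * p) * \<bar>G1 (\<theta>, t)\<bar> powr p"
          by (simp add: powr_mult powr_powr)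
        finally have "\<bar>t\<bar> powr - (real ?n + 1) * \<bar>f (- (\<theta> /\<^sub>R t))\<bar> powr p =
           (\<bar>t\<bar> powr - (real ?n + 1) * \<bar>t\<bar> powr ((real ?n - 1) * p)) * \<bar>G1 (\<theta>, t)\<bar> powr p" by simp
        also have "\<bar>t\<bar> powr - (real ?n + 1) * \<bar>t\<bar> powr ((real ?n - 1) * p) = \<bar>t\<bar> powr ((real ?n - 1) * (p - 1) - 2)"
          unfolding powr_add[symmetric] by (simp add: algebra_simps)
        finally have "ennreal (\<bar>t\<bar> powr - (real ?n + 1)) * ennreal (\<bar>f (- (\<theta> /\<^sub>R t))\<bar> powr p) =
          ennreal (\<bar>t\<bar> powr ((real ?n - 1) * (p - 1) - 2) * \<bar>G1 (\<theta>, t)\<bar> powr p)"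
          by (subst ennreal_mult[symmetric]) auto
        then show ?thesis using True by (simp add: q dist0_hyperplane)
      qed (simp add: q)
    qed
  qed simp
  also have "\<dots> < \<infinity>"
    using \<phi> by (auto simp: Lp_tilde_def hyperplane_measure_def nn_integral_completion ennreal_mult_less_top)
  finally show thesis using that fm ff by blast
qed

end

lemma point_fun_nu_hyperplane:
  assumes \<theta>: "norm (\<theta> :: real^'n) = 1" and t: "t \<noteq> 0"
  shows "\<phi> (hyperplane \<theta> t) = dist0 (hyperplane \<theta> t) powr (1 - real CARD('n)) * point_fun \<phi> (nu_hyperplane (hyperplane \<theta> t))"
proof -
  have x: "nu_hyperplane (hyperplane \<theta> t) = - (\<theta> /\<^sub>R t)" by (rule coordinates_immaterial(3)[OF \<theta>])
  have "{y. y \<bullet> - (\<theta> /\<^sub>R t) = -1} = hyperplane \<theta> t"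
    using t by (auto simp: hyperplane_def field_simps)
  moreover have "\<bar>t\<bar> powr (1 - real CARD('n)) * norm (- (\<theta> /\<^sub>R t)) powr (1 - real CARD('n)) = 1"
    using t by (subst powr_mult[symmetric]) (auto simp: \<theta>)
  ultimately show ?thesis
    unfolding x dist0_hyperplane[OF \<theta>] point_fun_def by (simp only: mult.assoc[symmetric] mult_1_left)
qed

section \<open>Mean values over planes\<close>

context
  fixes e :: "nat \<Rightarrow> real^'n"
  assumes n3: "CARD('n) \<ge> 3" and e: "bij_betw e {1..CARD('n)} Basis"
begin

text \<open>\<open>\<xi>\<close> and \<open>\<eta>\<close> span the normal directions of the base
  plane, \<open>\<xi>\<close> being the direction in which the mean value displaces it.\<close>

abbreviation (input) "\<xi> \<equiv> e CARD('n)"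
abbreviation (input) "\<eta> \<equiv> e (CARD('n) - 1)"
abbreviation (input) "B0 \<equiv> e ` {1..CARD('n) - 2}"

lemma two_le_card: "CARD('n) \<ge> 2"
  using n3 by simp

lemma frame:
  shows frame_in: "i \<in> {1..CARD('n)} \<Longrightarrow> e i \<in> Basis"
    and frame_norm: "i \<in> {1..CARD('n)} \<Longrightarrow> norm (e i) = 1"
    and frame_orth: "i \<in> {1..CARD('n)} \<Longrightarrow> j \<in> {1..CARD('n)} \<Longrightarrow> i \<noteq> j \<Longrightarrow> e i \<bullet> e j = 0"
proof -
  show *: "e i \<in> Basis" if "i \<in> {1..CARD('n)}" for i using e that by (auto simp: bij_betw_def)
  then show "i \<in> {1..CARD('n)} \<Longrightarrow> norm (e i) = 1" by simp
  assume ij: "i \<in> {1..CARD('n)}" "j \<in> {1..CARD('n)}" "i \<noteq> j"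
  then have "e i \<noteq> e j" using inj_on_eq_iff[OF bij_betw_imp_inj_on[OF e] ij(1,2)] by simp
  then show "e i \<bullet> e j = 0" using *[OF ij(1)] *[OF ij(2)] by (simp add: inner_Basis)
qed

lemma xi_norm: "norm \<xi> = 1" and eta_norm: "norm \<eta> = 1" and xi_eta: "\<xi> \<bullet> \<eta> = 0"
  and B0_xi: "b \<in> B0 \<Longrightarrow> b \<bullet> \<xi> = 0" and B0_eta: "b \<in> B0 \<Longrightarrow> b \<bullet> \<eta> = 0"
  using n3 by (auto intro!: frame_norm frame_orth)

lemma B0: "orthonormal B0" and B0_ne: "B0 \<noteq> {}" and card_B0: "card B0 = CARD('n) - 2"
proof -
  have inj: "inj_on e {1..CARD('n) - 2}"
    by (rule inj_on_subset[OF bij_betw_imp_inj_on[OF e]]) auto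
  show "card B0 = CARD('n) - 2" using card_image[OF inj] by simp
  show "B0 \<noteq> {}" using n3 by auto
  show "orthonormal B0"
    unfolding orthonormal_def pairwise_def orthogonal_def
  proof (intro conjI ballI impI)
    show "norm b = 1" if "b \<in> B0" for b using that by (auto intro!: frame_norm)
    fix a b assume "a \<in> B0" "b \<in> B0" "a \<noteq> b"
    then obtain i j where "i \<in> {1..CARD('n) - 2}" "j \<in> {1..CARD('n) - 2}" "a = e i" "b = e j" "i \<noteq> j" by blast
    then show "a \<bullet> b = 0" by (auto intro!: frame_orth)
  qed
qed

lemma span_B0_iff: "w \<in> span B0 \<longleftrightarrow> w \<bullet> \<xi> = 0 \<and> w \<bullet> \<eta> = 0"
proof
  show "w \<bullet> \<xi> = 0 \<and> w \<bullet> \<eta> = 0" if "w \<in> span B0"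
    using orthogonal_to_span[OF that, of \<xi>] orthogonal_to_span[OF that, of \<eta>] B0_xi B0_eta
    by (auto simp: orthogonal_def inner_commute)
  assume w: "w \<bullet> \<xi> = 0 \<and> w \<bullet> \<eta> = 0"
  have "w = (\<Sum>b\<in>Basis. (w \<bullet> b) *\<^sub>R b)" by (rule euclidean_representation[symmetric])
  also have "\<dots> = (\<Sum>i\<in>{1..CARD('n)}. (w \<bullet> e i) *\<^sub>R e i)"
    by (rule sum.reindex_bij_betw[OF e, symmetric])
  also have "\<dots> \<in> span B0"
  proof (rule span_sum)
    fix i assume i: "i \<in> {1..CARD('n)}"
    show "(w \<bullet> e i) *\<^sub>R e i \<in> span B0"
    proof (cases "i \<le> CARD('n) - 2")
      case True
      then show ?thesis using i by (intro span_scale span_base) auto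
    next
      case False
      then have "i = CARD('n) \<or> i = CARD('n) - 1" using i by auto
      then show ?thesis using w by (auto simp: span_zero)
    qed
  qed
  finally show "w \<in> span B0" .
qed

lemma plane_eq: "plane e A y = (\<lambda>v. y + v) ` span ((\<lambda>v. A *v v) ` B0)"
proof -
  have "span ((\<lambda>v. A *v v) ` B0) = (\<lambda>v. A *v v) ` span B0"
    by (rule linear_span_image) (rule matrix_vector_mul_linear)
  then show ?thesis by (simp add: plane_def image_image add.commute)
qed

lemma orthonormal_rotated: "rotation_matrix A \<Longrightarrow> orthonormal ((\<lambda>v. A *v v) ` B0)"
  by (rule subspace_lborel_isometry(1)[OF B0 rotation_matrix_orthogonal_transformation])

lemma plane_lborel_plane:
  assumes A: "rotation_matrix A"
  shows "plane_lborel (plane e A y) = distr (subspace_lborel B0) borel (\<lambda>v. y + A *v v)"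
proof -
  have "plane_lborel (plane e A y) = distr (subspace_lborel ((\<lambda>v. A *v v) ` B0)) borel (\<lambda>v. y + v)"
    unfolding plane_eq by (rule plane_lborel_eq[OF orthonormal_rotated[OF A]])
  also have "\<dots> = distr (distr (subspace_lborel B0) borel (\<lambda>v. A *v v)) borel (\<lambda>v. y + v)"
    by (simp only: subspace_lborel_isometry(2)[OF B0 rotation_matrix_orthogonal_transformation[OF A]])
  also have "\<dots> = distr (subspace_lborel B0) borel (\<lambda>v. y + A *v v)"
    by (subst distr_distr) (auto simp: comp_def)
  finally show ?thesis .
qed

lemma mem_plane_iff:
  assumes A: "rotation_matrix A"
  shows "x \<in> plane e A y \<longleftrightarrow> (x - y) \<bullet> (A *v \<xi>) = 0 \<and> (x - y) \<bullet> (A *v \<eta>) = 0"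
proof -
  define w where "w = transpose A *v (x - y)"
  have Aw: "A *v w = x - y" unfolding w_def by (rule rotation_transpose_mult[OF A])
  have "x \<in> plane e A y \<longleftrightarrow> w \<in> span B0"
  proof
    assume "x \<in> plane e A y"
    then obtain v where v: "v \<in> span B0" "x = A *v v + y" by (auto simp: plane_def)
    then have "A *v v = A *v w" using Aw by simp
    then have "v = w" using orthogonal_transformation_inj[OF rotation_matrix_orthogonal_transformation[OF A]] by (auto simp: inj_def)
    then show "w \<in> span B0" using v by simp
  next
    assume "w \<in> span B0"
    then show "x \<in> plane e A y" unfolding plane_def by (rule image_eqI[rotated]) (simp add: Aw)
  qed
  also have "\<dots> \<longleftrightarrow> (x - y) \<bullet> (A *v \<xi>) = 0 \<and> (x - y) \<bullet> (A *v \<eta>) = 0"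
    unfolding span_B0_iff Aw[symmetric] rotation_inner[OF A] ..
  finally show ?thesis .
qed

text \<open>In the normal 2-plane spanned by X and Y, the foot of the perpendicular from the origin
  is a X + b Y, of squared length N; u is minus its inversion in the unit sphere, and \<omega> is
  its direction turned by a right angle.\<close>

lemma plane_in_range_nu_line:
  assumes A: "rotation_matrix A" and 0: "0 \<notin> plane e A y"
  shows "plane e A y \<in> nu_line ` {l \<in> lines. 0 \<notin> l}"
proof -
  define X Y where "X = A *v \<xi>" and "Y = A *v \<eta>"
  have XY: "X \<bullet> X = 1" "Y \<bullet> Y = 1" "X \<bullet> Y = 0" "Y \<bullet> X = 0"
    unfolding X_def Y_def rotation_inner[OF A] using xi_norm eta_norm xi_eta by (auto simp: dot_square_norm inner_commute)
  define a b where "a = y \<bullet> X" and "b = y \<bullet> Y"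
  define N where "N = a\<^sup>2 + b\<^sup>2"
  have "\<not> (a = 0 \<and> b = 0)" using 0 unfolding mem_plane_iff[OF A] by (auto simp: a_def b_def X_def Y_def)
  then have N: "N > 0" by (auto simp: N_def sum_power2_gt_zero_iff)
  define u where "u = - ((a *\<^sub>R X + b *\<^sub>R Y) /\<^sub>R N)"
  define \<omega> where "\<omega> = (b *\<^sub>R X - a *\<^sub>R Y) /\<^sub>R sqrt N"
  have "\<omega> \<bullet> \<omega> = N / (sqrt N * sqrt N)"
    by (simp only: \<omega>_def inner_scaleR_left inner_scaleR_right inner_diff_left inner_diff_right XY N_def power2_eq_square divide_inverse inverse_mult_distrib)
       (simp only: algebra_simps mult_zero_right mult_1_right diff_zero)
  then have "\<omega> \<bullet> \<omega> = 1" using N by simp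
  then have \<omega>: "norm \<omega> = 1" by (simp add: norm_eq_sqrt_inner)
  have \<omega>u: "\<omega> \<bullet> u = 0"
    by (simp add: \<omega>_def u_def inner_diff_left inner_add_right XY)
  have "u \<bullet> u = N / (N * N)"
    by (simp only: u_def inner_minus_left inner_minus_right inner_scaleR_left inner_scaleR_right inner_add_left inner_add_right XY N_def power2_eq_square divide_inverse inverse_mult_distrib)
       (simp add: algebra_simps)
  then have "u \<bullet> u = 1 / N" using N by simp
  then have u: "u \<noteq> 0" using N by auto
  have "plane e A y = dual_plane \<omega> u"
  proof (rule set_eqI)
    fix x
    have "x \<in> dual_plane \<omega> u \<longleftrightarrow> x \<bullet> \<omega> = 0 \<and> x \<bullet> u = -1" by (rule dual_plane_iff[OF n3 \<omega> \<omega>u u])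
    also have "x \<bullet> \<omega> = 0 \<longleftrightarrow> b * (x \<bullet> X) - a * (x \<bullet> Y) = 0"
      using N by (simp add: \<omega>_def inner_diff_right)
    also have "x \<bullet> u = -1 \<longleftrightarrow> a * (x \<bullet> X) + b * (x \<bullet> Y) = N"
    proof -
      have "x \<bullet> u = - ((a * (x \<bullet> X) + b * (x \<bullet> Y)) / N)" by (simp add: u_def inner_add_right inner_diff_right divide_inverse algebra_simps)
      then show ?thesis using N by (simp add: divide_eq_eq)
    qed
    also have "b * (x \<bullet> X) - a * (x \<bullet> Y) = 0 \<and> a * (x \<bullet> X) + b * (x \<bullet> Y) = N \<longleftrightarrow> x \<bullet> X = a \<and> x \<bullet> Y = b"
    proof
      assume *: "b * (x \<bullet> X) - a * (x \<bullet> Y) = 0 \<and> a * (x \<bullet> X) + b * (x \<bullet> Y) = N"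
      have "N * (x \<bullet> X) = b * (b * (x \<bullet> X) - a * (x \<bullet> Y)) + a * (a * (x \<bullet> X) + b * (x \<bullet> Y))"
        by (simp add: N_def power2_eq_square algebra_simps)
      also have "\<dots> = N * a" using * by simp
      finally have 1: "x \<bullet> X = a" using N by simp
      have "N * (x \<bullet> Y) = - a * (b * (x \<bullet> X) - a * (x \<bullet> Y)) + b * (a * (x \<bullet> X) + b * (x \<bullet> Y))"
        by (simp add: N_def power2_eq_square algebra_simps)
      also have "\<dots> = N * b" using * by simp
      finally show "x \<bullet> X = a \<and> x \<bullet> Y = b" using 1 N by simp
    qed (auto simp: N_def power2_eq_square)
    also have "\<dots> \<longleftrightarrow> x \<in> plane e A y"
      unfolding mem_plane_iff[OF A] by (auto simp: a_def b_def X_def Y_def inner_diff_left)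
    finally show "x \<in> plane e A y \<longleftrightarrow> x \<in> dual_plane \<omega> u" by blast
  qed
  also have "\<dots> = nu_line (line \<omega> u)"
    using coordinates_immaterial(2)[OF \<omega> \<omega>u] by (simp add: dual_plane_def[OF n3 \<omega> \<omega>u u])
  finally have eq: "plane e A y = nu_line (line \<omega> u)" .
  have "line \<omega> u \<in> lines" using \<omega> \<omega>u by (auto simp: lines_def)
  moreover have "0 \<notin> line \<omega> u"
  proof
    assume "0 \<in> line \<omega> u"
    then obtain s where s: "0 = s *\<^sub>R \<omega> + u" by (auto simp: line_def)
    then have "u \<bullet> u = - s * (\<omega> \<bullet> u)" by (metis add_eq_0_iff inner_minus_left inner_scaleR_left mult_minus_left)
    then show False using \<omega>u u by simp
  qed
  ultimately show ?thesis unfolding eq by blast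
qed

lemma Phi_eq_integral:
  assumes A: "rotation_matrix A" and 0: "0 \<notin> plane e A y"
    and f1: "f1 \<in> borel_measurable borel" and ae: "AE x in plane_lborel (plane e A y). point_fun \<phi> x = f1 x"
  shows "Phi \<phi> (plane e A y) = (LINT x|plane_lborel (plane e A y). f1 x)"
  by (rule Phi_eq_integral_dual_plane[OF n3 plane_in_range_nu_line[OF A 0] f1 ae])

text \<open>What both parts of the theorem supply to the inversion: \<Psi> is the integral of f on
  every plane off the origin that meets a fixed null set N in a null set; for continuous f the set N
  is empty. A condition on single planes, rather than on almost all of them, lets mean values be
  computed at every x and q.\<close>

definition recoverable :: "((real^'n) set \<Rightarrow> real) \<Rightarrow> (real^'n \<Rightarrow> real) \<Rightarrow> bool" where
  "recoverable \<Psi> f \<longleftrightarrow> (\<exists>N. N \<in> null_sets lborel \<and> (\<forall>A y. rotation_matrix A \<longrightarrow> 0 \<notin> plane e A y \<longrightarrow>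
     (AE v in subspace_lborel B0. y + A *v v \<notin> N) \<longrightarrow> \<Psi> (plane e A y) = (LINT v|subspace_lborel B0. f (y + A *v v))))"

text \<open>Holds for every x and q: almost every sphere around x meets N in a null set, and the
  planes at distance q see these spheres through the density \<open>radial_weight\<close>.\<close>

lemma AE_plane_avoids_null_set:
  assumes N: "N \<in> null_sets lborel" and q: "q \<ge> 0"
  shows "AE A in haar_SO. AE v in subspace_lborel B0. x + A *v (q *\<^sub>R \<xi> + v) \<notin> N"
proof -
  interpret S: sigma_finite_measure "subspace_lborel B0" by (rule sigma_finite_subspace_lborel[OF B0])
  note n2 = two_le_card
  have [measurable]: "N \<in> sets borel" using N by auto
  define I :: "real^'n \<Rightarrow> ennreal" where "I = indicator N"
  have [measurable]: "I \<in> borel_measurable borel" unfolding I_def by measurable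
  have "(\<integral>\<^sup>+s. ennreal (radial_weight CARD('n) 0 s) * sph_nn \<xi> I x s \<partial>lborel) = 0"
  proof -
    have "integral\<^sup>N lborel I = emeasure lborel N" unfolding I_def by (rule nn_integral_indicator) simp
    then show ?thesis using nn_integral_polar[OF n2 xi_norm, of I x] null_setsD1[OF N] by simp
  qed
  then have "AE s in lborel. ennreal (radial_weight CARD('n) 0 s) * sph_nn \<xi> I x s = 0"
    by (subst (asm) nn_integral_0_iff_AE) auto
  then have "AE s in lborel. ennreal (radial_weight (card B0) q s) * sph_nn \<xi> I x s = 0"
  proof eventually_elim
    fix s assume s: "ennreal (radial_weight CARD('n) 0 s) * sph_nn \<xi> I x s = 0"
    show "ennreal (radial_weight (card B0) q s) * sph_nn \<xi> I x s = 0"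
    proof (cases "s > q")
      case True
      then have "radial_weight CARD('n) 0 s > 0" using q n2 by (subst radial_weight_0) (auto intro!: mult_pos_pos)
      then show ?thesis using s by auto
    qed (simp add: radial_weight_def)
  qed
  then have "(\<integral>\<^sup>+s. ennreal (radial_weight (card B0) q s) * sph_nn \<xi> I x s \<partial>lborel) = 0"
    by (subst nn_integral_0_iff_AE) auto
  then have "(\<integral>\<^sup>+A. (\<integral>\<^sup>+v. I (x + A *v (q *\<^sub>R \<xi> + v)) \<partial>subspace_lborel B0) \<partial>haar_SO) = 0"
    by (subst nn_integral_rotated_planes[OF n2 B0 B0_ne xi_norm B0_xi q]) auto
  then have "AE A in haar_SO. (\<integral>\<^sup>+v. I (x + A *v (q *\<^sub>R \<xi> + v)) \<partial>subspace_lborel B0) = 0"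
  proof (subst (asm) nn_integral_0_iff_AE)
    show "(\<lambda>A. \<integral>\<^sup>+v. I (x + A *v (q *\<^sub>R \<xi> + v)) \<partial>subspace_lborel B0) \<in> borel_measurable haar_SO"
      by (rule S.borel_measurable_nn_integral) measurable
  qed
  then show ?thesis
  proof eventually_elim
    fix A :: "real^'n^'n" assume "(\<integral>\<^sup>+v. I (x + A *v (q *\<^sub>R \<xi> + v)) \<partial>subspace_lborel B0) = 0"
    then have "AE v in subspace_lborel B0. I (x + A *v (q *\<^sub>R \<xi> + v)) = (0::ennreal)"
      by (subst (asm) nn_integral_0_iff_AE) auto
    then show "AE v in subspace_lborel B0. x + A *v (q *\<^sub>R \<xi> + v) \<notin> N"
      by eventually_elim (auto simp: I_def indicator_def split: if_splits)
  qed
qed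

text \<open>A hyperplane through 0 is null, so almost every sphere around 0 meets it in a null set;
  being a cone, it is met for the same rotations at every radius, and one radius s suffices.\<close>

lemma AE_rotated_not_orthogonal:
  assumes x: "x \<noteq> 0"
  shows "AE A in haar_SO. x \<bullet> (A *v \<eta>) \<noteq> 0"
proof -
  note n2 = two_le_card
  let ?H = "{y. x \<bullet> y = 0}"
  have Hm[measurable]: "?H \<in> sets borel" by measurable
  have "?H \<in> null_sets lebesgue" using negligible_hyperplane[of x 0] x by (auto simp: negligible_iff_null_sets)
  then have "emeasure lborel ?H = 0" using Hm by (simp add: null_sets_completion_iff null_setsD1)
  then have "(\<integral>\<^sup>+s. ennreal (radial_weight CARD('n) 0 s) * sph_nn \<eta> (indicator ?H) 0 s \<partial>lborel) = 0"
    using nn_integral_polar[OF n2 eta_norm, of "indicator ?H" 0] by simp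
  then have ae: "AE s in lborel. ennreal (radial_weight CARD('n) 0 s) * sph_nn \<eta> (indicator ?H) 0 s = 0"
    by (subst (asm) nn_integral_0_iff_AE) auto
  have "\<exists>s>0. ennreal (radial_weight CARD('n) 0 s) * sph_nn \<eta> (indicator ?H) 0 s = 0"
  proof (rule ccontr)
    assume *: "\<not> ?thesis"
    have "AE s in lborel. s \<notin> {0<..<1::real}" using ae by eventually_elim (use * in auto)
    then have "{0<..<1::real} \<in> null_sets lborel" by (subst AE_iff_null_sets) auto
    then have "emeasure lborel {0<..<1::real} = 0" by (rule null_setsD1)
    then show False by simp
  qed
  then obtain s where s: "s > 0" "ennreal (radial_weight CARD('n) 0 s) * sph_nn \<eta> (indicator ?H) 0 s = 0" by blast
  have "radial_weight CARD('n) 0 s > 0" using s(1) n2 by (subst radial_weight_0) (auto intro!: mult_pos_pos)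
  then have "sph_nn \<eta> (indicator ?H) 0 s = 0" using s(2) by auto
  then have "AE A in haar_SO. indicator ?H (0 + s *\<^sub>R (A *v \<eta>)) = (0::ennreal)"
    unfolding sph_nn_def by (subst (asm) nn_integral_0_iff_AE) auto
  then show ?thesis
    by eventually_elim (use s(1) in \<open>auto simp: indicator_def split: if_splits\<close>)
qed

text \<open>A plane of this form through 0 forces x \<bullet> A \<eta> = 0, which is exceptional for
  x \<noteq> 0; for x = 0 the plane has distance q > 0 from the origin.\<close>

lemma AE_plane_avoids_origin:
  assumes q: "q > 0"
  shows "AE A in haar_SO. 0 \<notin> plane e A (x + q *\<^sub>R (A *v \<xi>))"
proof -
  have mem: "x \<bullet> (A *v \<xi>) = - q \<and> x \<bullet> (A *v \<eta>) = 0" if A: "A \<in> space haar_SO" and 0: "0 \<in> plane e A (x + q *\<^sub>R (A *v \<xi>))" for A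
  proof -
    have A: "rotation_matrix A" using A by (simp add: space_haar_SO)
    have "(A *v \<xi>) \<bullet> (A *v \<xi>) = 1" "(A *v \<xi>) \<bullet> (A *v \<eta>) = 0"
      unfolding rotation_inner[OF A] using xi_norm xi_eta by (auto simp: dot_square_norm)
    then show ?thesis using 0 unfolding mem_plane_iff[OF A] by (auto simp: inner_diff_left inner_add_left)
  qed
  show ?thesis
  proof (cases "x = 0")
    case True
    then show ?thesis using mem q by (intro AE_I2) auto
  next
    case False
    show ?thesis using AE_rotated_not_orthogonal[OF False] AE_space
      by eventually_elim (use mem in blast)
  qed
qed

text \<open>The rotations for which the plane passes through 0 or meets N too much form a null set
  for every x and q > 0, so only the finiteness of the weighted integral restricts the
  radius.\<close>

lemma mean_value_eq:
  assumes \<Psi>: "recoverable \<Psi> f" and [measurable]: "f \<in> borel_measurable borel" and q: "q > 0"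
    and fin: "(\<integral>\<^sup>+s. ennreal (radial_weight (CARD('n) - 2) q s) * sph_nn \<xi> (\<lambda>y. ennreal \<bar>f y\<bar>) x s \<partial>lborel) < \<infinity>"
  shows "mean_value e \<Psi> x q = EK_mean (CARD('n) - 2) (sph_mean \<xi> f x) q"
proof -
  note n2 = two_le_card
  interpret S: sigma_finite_measure "subspace_lborel B0" by (rule sigma_finite_subspace_lborel[OF B0])
  obtain N where N: "N \<in> null_sets lborel" and eq: "\<And>A y. rotation_matrix A \<Longrightarrow> 0 \<notin> plane e A y \<Longrightarrow>
     (AE v in subspace_lborel B0. y + A *v v \<notin> N) \<Longrightarrow> \<Psi> (plane e A y) = (LINT v|subspace_lborel B0. f (y + A *v v))"
    using \<Psi> unfolding recoverable_def by blast
  have split: "x + A *v (q *\<^sub>R \<xi> + v) = (x + q *\<^sub>R (A *v \<xi>)) + A *v v" for A and v :: "real^'n"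
    by (simp add: matrix_vector_right_distrib matrix_vector_mult_scaleR)
  have "AE A in haar_SO. \<Psi> (plane e A (x + q *\<^sub>R (A *v \<xi>))) = (LINT v|subspace_lborel B0. f (x + A *v (q *\<^sub>R \<xi> + v)))"
    using AE_plane_avoids_null_set[OF N less_imp_le[OF q], of x] AE_plane_avoids_origin[OF q, of x] AE_space
  proof eventually_elim
    fix A :: "real^'n^'n"
    assume "AE v in subspace_lborel B0. x + A *v (q *\<^sub>R \<xi> + v) \<notin> N" "0 \<notin> plane e A (x + q *\<^sub>R (A *v \<xi>))" "A \<in> space haar_SO"
    then show "\<Psi> (plane e A (x + q *\<^sub>R (A *v \<xi>))) = (LINT v|subspace_lborel B0. f (x + A *v (q *\<^sub>R \<xi> + v)))"
      unfolding split by (intro eq) (simp_all add: space_haar_SO)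
  qed
  then have "mean_value e \<Psi> x q = (LINT A|haar_SO. LINT v|subspace_lborel B0. f (x + A *v (q *\<^sub>R \<xi> + v)))"
    unfolding mean_value_def by (intro integral_completion_AE(1)) measurable
  also have "\<dots> = (LINT s|lborel. radial_weight (card B0) q s * sph_mean \<xi> f x s)"
  proof (rule integral_rotated_planes(2)[OF n2 B0 B0_ne xi_norm B0_xi less_imp_le[OF q]])
    show "(\<integral>\<^sup>+s. ennreal (radial_weight (card B0) q s) * sph_nn \<xi> (\<lambda>y. ennreal \<bar>f y\<bar>) x s \<partial>lborel) < \<infinity>"
      using fin unfolding card_B0 .
    show "\<And>b. b \<in> B0 \<Longrightarrow> b \<in> B0" .
  qed measurable
  finally show ?thesis unfolding EK_mean_def card_B0 .
qed

lemma approx_inverse_eq: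
  assumes \<Psi>: "recoverable \<Psi> f" and f: "tame f" and r: "r > 0" and leb: "lebesgue_point (sph_mean \<xi> f x) r"
  shows "approx_inverse e \<Psi> r x = sph_mean \<xi> f x r"
proof -
  note n2 = two_le_card
  have fm: "f \<in> borel_measurable borel" by (rule tame_borel[OF n2 xi_norm f])
  show ?thesis
    unfolding approx_inverse_def
  proof (rule EK_deriv_inversion[OF n3 _ _ _ r leb])
    show "tail_integrable (CARD('n) - 2) (sph_mean \<xi> f x)" by (rule tame_sph_mean_tail_integrable[OF n2 xi_norm n3 f])
    show "mean_value e \<Psi> x q = EK_mean (CARD('n) - 2) (sph_mean \<xi> f x) q" if "even CARD('n)" "q > 0" for q
    proof (rule mean_value_eq[OF \<Psi> fm that(2)])
      \<comment> \<open>Even n \<ge> 3 excludes n = 3, the dimension whose weight is singular at s =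
        q.\<close>
      have "CARD('n) > 3" using n3 that(1) by (cases "CARD('n) = 3") auto
      then show "(\<integral>\<^sup>+s. ennreal (radial_weight (CARD('n) - 2) q s) * sph_nn \<xi> (\<lambda>y. ennreal \<bar>f y\<bar>) x s \<partial>lborel) < \<infinity>"
        by (rule tame_radial_weight_finite[OF n2 xi_norm _ f that(2)])
    qed
    show "AE q in lborel. 0 < q \<longrightarrow> mean_value e \<Psi> x q = EK_mean (CARD('n) - 2) (sph_mean \<xi> f x) q"
      using tame_AE_radial_weight_finite[OF n2 xi_norm n3 f, of x]
      by eventually_elim (auto intro: mean_value_eq[OF \<Psi> fm])
  qed
qed

lemma sigma_finite_B0: "sigma_finite_measure (subspace_lborel B0)"
  by (rule sigma_finite_subspace_lborel[OF B0])

lemma rotated_plane_point: "x + A *v (q *\<^sub>R \<xi> + v) = (x + q *\<^sub>R (A *v \<xi>)) + A *v (v :: real^'n)"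
  by (simp add: matrix_vector_right_distrib matrix_vector_mult_scaleR)

section \<open>Plane integrals in coordinates of the base plane\<close>

lemma radon_john_eq_integral:
  assumes A: "rotation_matrix A" and [measurable]: "g \<in> borel_measurable borel"
    and N: "N \<in> sets borel" "\<And>x. x \<notin> N \<Longrightarrow> f x = g x" and ae: "AE v in subspace_lborel B0. y + A *v v \<notin> N"
  shows "radon_john f (plane e A y) = (LINT v|subspace_lborel B0. g (y + A *v v))"
    and "integrable (completion (plane_lborel (plane e A y))) f \<longleftrightarrow> integrable (subspace_lborel B0) (\<lambda>v. g (y + A *v v))"
proof -
  note P = plane_lborel_plane[OF A]
  have [measurable]: "N \<in> sets borel" by fact
  have "AE x in plane_lborel (plane e A y). x \<notin> N"
    unfolding P using ae by (subst AE_distr_iff) auto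
  then have ae: "AE x in plane_lborel (plane e A y). f x = g x" by eventually_elim (rule N(2))
  have gm: "g \<in> borel_measurable (plane_lborel (plane e A y))" unfolding P by measurable
  show "radon_john f (plane e A y) = (LINT v|subspace_lborel B0. g (y + A *v v))"
    unfolding radon_john_def integral_completion_AE(1)[OF gm ae] unfolding P by (rule integral_distr) measurable
  show "integrable (completion (plane_lborel (plane e A y))) f \<longleftrightarrow> integrable (subspace_lborel B0) (\<lambda>v. g (y + A *v v))"
    unfolding integral_completion_AE(2)[OF gm ae] unfolding P by (rule integrable_distr_eq) measurable
qed

lemma recoverable_Phi:
  assumes [measurable]: "f \<in> borel_measurable borel" and ae: "AE x in lborel. point_fun \<phi> x = f x"
  shows "recoverable (Phi \<phi>) f"
proof -
  obtain N where N: "N \<in> null_sets lborel" "\<And>x. x \<in> space lborel \<Longrightarrow> x \<notin> N \<Longrightarrow> point_fun \<phi> x = f x"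
    using AE_null_superset[OF ae] by blast
  have [measurable]: "N \<in> sets borel" using N(1) by auto
  have "Phi \<phi> (plane e A y) = (LINT v|subspace_lborel B0. f (y + A *v v))"
    if A: "rotation_matrix A" and 0: "0 \<notin> plane e A y" and ae: "AE v in subspace_lborel B0. y + A *v v \<notin> N" for A y
  proof -
    note P = plane_lborel_plane[OF A]
    have "AE x in plane_lborel (plane e A y). x \<notin> N"
      unfolding P using ae by (subst AE_distr_iff) auto
    then have "AE x in plane_lborel (plane e A y). point_fun \<phi> x = f x" by eventually_elim (simp add: N(2))
    then have "Phi \<phi> (plane e A y) = (LINT x|plane_lborel (plane e A y). f x)"
      by (intro Phi_eq_integral[OF A 0]) auto
    also have "\<dots> = (LINT v|subspace_lborel B0. f (y + A *v v))" unfolding P by (rule integral_distr) measurable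
    finally show ?thesis .
  qed
  then show ?thesis unfolding recoverable_def using N(1) by blast
qed

section \<open>Null sets in the space of planes\<close>

text \<open>Invariance under translations transfers null sets between pairs \<open>(A, y)\<close> and triples \<open>(x, q, A)\<close>
  with \<open>y = x + q A e\<^sub>n\<close>, the planes that occur in the mean values.\<close>

lemma null_set_planes_iff:
  fixes Z :: "((real^'n^'n) \<times> (real^'n)) set"
  assumes [measurable]: "Z \<in> sets (haar_SO \<Otimes>\<^sub>M lborel)"
  shows "Z \<in> null_sets (haar_SO \<Otimes>\<^sub>M lborel) \<longleftrightarrow>
    (AE x in lborel. AE q in lborel. 0 < q \<longrightarrow> (AE A in haar_SO. (A, x + q *\<^sub>R (A *v \<xi>)) \<notin> Z))"
proof -
  interpret prob_space "haar_SO :: (real^'n^'n) measure" by (rule prob_space_haar_SO)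
  interpret P: pair_sigma_finite "haar_SO :: (real^'n^'n) measure" "lborel :: (real^'n) measure" ..
  define I :: "(real^'n^'n) \<times> (real^'n) \<Rightarrow> ennreal" where "I = indicator Z"
  have [measurable]: "I \<in> borel_measurable (haar_SO \<Otimes>\<^sub>M lborel)" unfolding I_def by measurable
  define J where "J = (\<lambda>x (q::real). \<integral>\<^sup>+A. I (A, x + q *\<^sub>R (A *v \<xi>)) \<partial>haar_SO)"
  have J[measurable (raw)]: "(\<lambda>w. J (X w) (Q w)) \<in> borel_measurable M" if [measurable]: "X \<in> borel_measurable M" "Q \<in> borel_measurable M"
    for X :: "'w \<Rightarrow> real^'n" and Q M
    unfolding J_def by measurable
  have "(\<integral>\<^sup>+x. (\<integral>\<^sup>+q. indicator {0<..} q * J x q \<partial>lborel) \<partial>lborel) = (\<integral>\<^sup>+q. (\<integral>\<^sup>+x. indicator {0<..} q * J x q \<partial>lborel) \<partial>lborel)"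
    by (rule lborel_pair.Fubini'[symmetric]) measurable
  also have "\<dots> = (\<integral>\<^sup>+q. indicator {0<..} q * emeasure (haar_SO \<Otimes>\<^sub>M lborel) Z \<partial>(lborel :: real measure))"
  proof (rule nn_integral_cong)
    fix q :: real
    have "(\<integral>\<^sup>+x. J x q \<partial>lborel) = (\<integral>\<^sup>+A. (\<integral>\<^sup>+x. I (A, x + q *\<^sub>R (A *v \<xi>)) \<partial>lborel) \<partial>haar_SO)"
      unfolding J_def by (rule P.Fubini') measurable
    also have "\<dots> = (\<integral>\<^sup>+A. (\<integral>\<^sup>+y. I (A, y) \<partial>lborel) \<partial>haar_SO)"
    proof (rule nn_integral_cong)
      fix A :: "real^'n^'n" assume [measurable]: "A \<in> space haar_SO"
      have "(\<lambda>y. I (A, y)) \<in> borel_measurable borel" by measurable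
      from nn_integral_lborel_translation[OF this, of "q *\<^sub>R (A *v \<xi>)"]
      show "(\<integral>\<^sup>+x. I (A, x + q *\<^sub>R (A *v \<xi>)) \<partial>lborel) = (\<integral>\<^sup>+y. I (A, y) \<partial>lborel)" by (simp add: add.commute)
    qed
    also have "\<dots> = emeasure (haar_SO \<Otimes>\<^sub>M lborel) Z"
      unfolding I_def lborel.emeasure_pair_measure[OF assms] ..
    finally show "(\<integral>\<^sup>+x. indicator {0<..} q * J x q \<partial>lborel) = indicator {0<..} q * emeasure (haar_SO \<Otimes>\<^sub>M lborel) Z"
      by (subst nn_integral_cmult) auto
  qed
  also have "\<dots> = emeasure lborel {0::real<..} * emeasure (haar_SO \<Otimes>\<^sub>M lborel) Z"
    by (subst nn_integral_multc) auto
  finally have eq: "(\<integral>\<^sup>+x. (\<integral>\<^sup>+q. indicator {0<..} q * J x q \<partial>lborel) \<partial>lborel) = emeasure lborel {0::real<..} * emeasure (haar_SO \<Otimes>\<^sub>M lborel) Z" .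
  have "emeasure lborel {0::real<..<1} \<le> emeasure lborel {0::real<..}" by (rule emeasure_mono) auto
  then have pos: "emeasure lborel {0::real<..} \<noteq> 0" by auto
  have JA: "J x q = 0 \<longleftrightarrow> (AE A in haar_SO. (A, x + q *\<^sub>R (A *v \<xi>)) \<notin> Z)" for x q
    unfolding J_def by (subst nn_integral_0_iff_AE) (auto simp: I_def indicator_def)
  have "Z \<in> null_sets (haar_SO \<Otimes>\<^sub>M lborel) \<longleftrightarrow> (\<integral>\<^sup>+x. (\<integral>\<^sup>+q. indicator {0<..} q * J x q \<partial>lborel) \<partial>lborel) = 0"
    unfolding eq using pos assms unfolding null_sets_def mult_eq_0_iff mem_Collect_eq by blast
  also have "\<dots> \<longleftrightarrow> (AE x in lborel. (\<integral>\<^sup>+q. indicator {0<..} q * J x q \<partial>lborel) = 0)"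
    by (rule nn_integral_0_iff_AE) measurable
  also have "\<dots> \<longleftrightarrow> (AE x in lborel. AE q in lborel. 0 < q \<longrightarrow> (AE A in haar_SO. (A, x + q *\<^sub>R (A *v \<xi>)) \<notin> Z))"
  proof (rule AE_cong)
    fix x :: "real^'n"
    have "(\<lambda>q. indicator {0<..} q * J x q) \<in> borel_measurable lborel" by measurable
    then have "(\<integral>\<^sup>+q. indicator {0<..} q * J x q \<partial>lborel) = 0 \<longleftrightarrow> (AE q in lborel. indicator {0<..} q * J x q = 0)"
      by (rule nn_integral_0_iff_AE)
    also have "\<dots> \<longleftrightarrow> (AE q in lborel. 0 < q \<longrightarrow> (AE A in haar_SO. (A, x + q *\<^sub>R (A *v \<xi>)) \<notin> Z))"
      by (intro AE_cong) (auto simp: JA indicator_def)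
    finally show "(\<integral>\<^sup>+q. indicator {0<..} q * J x q \<partial>lborel) = 0 \<longleftrightarrow> (AE q in lborel. 0 < q \<longrightarrow> (AE A in haar_SO. (A, x + q *\<^sub>R (A *v \<xi>)) \<notin> Z))" .
  qed
  finally show ?thesis .
qed

lemma AE_planes_avoid_null_set:
  assumes N: "N \<in> null_sets lborel"
  shows "AE (A, y) in haar_SO \<Otimes>\<^sub>M lborel. AE v in subspace_lborel B0. y + A *v v \<notin> N"
proof -
  interpret S: sigma_finite_measure "subspace_lborel B0" by (rule sigma_finite_B0)
  have [measurable]: "N \<in> sets borel" using N by auto
  define I :: "real^'n \<Rightarrow> ennreal" where "I = indicator N"
  have [measurable]: "I \<in> borel_measurable borel" unfolding I_def by measurable
  define J where "J = (\<lambda>(A, y). \<integral>\<^sup>+v. I (y + A *v v) \<partial>subspace_lborel B0)"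
  have [measurable]: "J \<in> borel_measurable (haar_SO \<Otimes>\<^sub>M lborel)" unfolding J_def case_prod_beta by measurable
  define Z where "Z = {p \<in> space (haar_SO \<Otimes>\<^sub>M lborel). J p \<noteq> 0}"
  have Zm: "Z \<in> sets (haar_SO \<Otimes>\<^sub>M lborel)" unfolding Z_def by measurable
  have JA: "J (A, y) = 0 \<longleftrightarrow> (AE v in subspace_lborel B0. y + A *v v \<notin> N)" for A y
    unfolding J_def split by (subst nn_integral_0_iff_AE) (auto simp: I_def indicator_def)
  have "AE q in lborel. 0 < q \<longrightarrow> (AE A in haar_SO. (A, x + q *\<^sub>R (A *v \<xi>)) \<notin> Z)" for x
  proof (rule AE_I2, rule impI)
    fix q :: real assume q: "0 < q"
    show "AE A in haar_SO. (A, x + q *\<^sub>R (A *v \<xi>)) \<notin> Z"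
      using AE_plane_avoids_null_set[OF N less_imp_le[OF q], of x]
      unfolding rotated_plane_point by eventually_elim (simp add: Z_def JA)
  qed
  then have "Z \<in> null_sets (haar_SO \<Otimes>\<^sub>M lborel)" unfolding null_set_planes_iff[OF Zm] by simp
  from AE_not_in[OF this] AE_space show ?thesis
  proof eventually_elim
    fix p :: "(real^'n^'n) \<times> (real^'n)" assume "p \<notin> Z" "p \<in> space (haar_SO \<Otimes>\<^sub>M lborel)"
    then show "case p of (A, y) \<Rightarrow> AE v in subspace_lborel B0. y + A *v v \<notin> N"
      by (cases p) (simp add: Z_def JA)
  qed
qed

text \<open>A plane through 0 forces y \<bullet> A \<eta> = 0, a condition that displacement along A
  \<xi> does not change, so it is excluded by x \<bullet> A \<eta> \<noteq> 0.\<close>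

lemma AE_planes_avoid_origin: "AE (A, y) in haar_SO \<Otimes>\<^sub>M lborel. 0 \<notin> plane e A y"
proof -
  define Z where "Z = {p \<in> space (haar_SO \<Otimes>\<^sub>M lborel). snd p \<bullet> (fst p *v \<eta>) = 0}"
  have Zm: "Z \<in> sets (haar_SO \<Otimes>\<^sub>M lborel)" unfolding Z_def by measurable
  have "AE x in lborel. AE q in lborel. 0 < q \<longrightarrow> (AE A in haar_SO. (A, x + q *\<^sub>R (A *v \<xi>)) \<notin> Z)"
    using AE_lborel_singleton[of "0::real^'n"]
  proof eventually_elim
    fix x :: "real^'n" assume x: "x \<noteq> 0"
    have "AE A in haar_SO. (A, x + q *\<^sub>R (A *v \<xi>)) \<notin> Z" for q
      using AE_rotated_not_orthogonal[OF x] AE_space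
    proof eventually_elim
      fix A :: "real^'n^'n" assume "x \<bullet> (A *v \<eta>) \<noteq> 0" "A \<in> space haar_SO"
      moreover have "(x + q *\<^sub>R (A *v \<xi>)) \<bullet> (A *v \<eta>) = x \<bullet> (A *v \<eta>)" if "rotation_matrix A"
        unfolding inner_add_left inner_scaleR_left rotation_inner[OF that] xi_eta by simp
      ultimately show "(A, x + q *\<^sub>R (A *v \<xi>)) \<notin> Z" by (simp add: Z_def space_haar_SO)
    qed
    then show "AE q in lborel. 0 < q \<longrightarrow> (AE A in haar_SO. (A, x + q *\<^sub>R (A *v \<xi>)) \<notin> Z)" by simp
  qed
  then have "Z \<in> null_sets (haar_SO \<Otimes>\<^sub>M lborel)" unfolding null_set_planes_iff[OF Zm] .
  from AE_not_in[OF this] AE_space show ?thesis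
  proof eventually_elim
    fix p :: "(real^'n^'n) \<times> (real^'n)" assume p: "p \<notin> Z" "p \<in> space (haar_SO \<Otimes>\<^sub>M lborel)"
    then have A: "rotation_matrix (fst p)" by (auto simp: space_pair_measure space_haar_SO)
    show "case p of (A, y) \<Rightarrow> 0 \<notin> plane e A y"
      using p by (auto simp: Z_def mem_plane_iff[OF A] split_beta)
  qed
qed

lemma AE_planes_integrable:
  assumes f: "tame f"
  shows "AE (A, y) in haar_SO \<Otimes>\<^sub>M lborel. integrable (subspace_lborel B0) (\<lambda>v. f (y + A *v v))"
proof -
  interpret prob_space "haar_SO :: (real^'n^'n) measure" by (rule prob_space_haar_SO)
  interpret S: sigma_finite_measure "subspace_lborel B0" by (rule sigma_finite_B0)
  note n2 = two_le_card and \<xi> = xi_norm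
  have [measurable]: "f \<in> borel_measurable borel" by (rule tame_borel[OF n2 \<xi> f])
  define J where "J = (\<lambda>(A, y). \<integral>\<^sup>+v. ennreal \<bar>f (y + A *v v)\<bar> \<partial>subspace_lborel B0)"
  have [measurable]: "J \<in> borel_measurable (haar_SO \<Otimes>\<^sub>M lborel)" unfolding J_def case_prod_beta by measurable
  define Z where "Z = {p \<in> space (haar_SO \<Otimes>\<^sub>M lborel). J p = \<infinity>}"
  have Zm: "Z \<in> sets (haar_SO \<Otimes>\<^sub>M lborel)" unfolding Z_def by measurable
  have "AE q in lborel. 0 < q \<longrightarrow> (AE A in haar_SO. (A, x + q *\<^sub>R (A *v \<xi>)) \<notin> Z)" for x
    using tame_AE_radial_weight_finite[OF n2 \<xi> n3 f, of x]
  proof (eventually_elim, intro impI)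
    fix q :: real assume q: "0 < q" and fin: "0 < q \<longrightarrow> (\<integral>\<^sup>+s. ennreal (radial_weight (CARD('n) - 2) q s) * sph_nn \<xi> (\<lambda>y. ennreal \<bar>f y\<bar>) x s \<partial>lborel) < \<infinity>"
    have "AE A in haar_SO. integrable (subspace_lborel B0) (\<lambda>v. f (x + A *v (q *\<^sub>R \<xi> + v)))"
    proof (rule integral_rotated_planes(1)[OF n2 B0 B0_ne \<xi> B0_xi less_imp_le[OF q]])
      show "(\<integral>\<^sup>+s. ennreal (radial_weight (card B0) q s) * sph_nn \<xi> (\<lambda>y. ennreal \<bar>f y\<bar>) x s \<partial>lborel) < \<infinity>"
        using fin q unfolding card_B0 by blast
      show "\<And>b. b \<in> B0 \<Longrightarrow> b \<in> B0" .
    qed measurable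
    then show "AE A in haar_SO. (A, x + q *\<^sub>R (A *v \<xi>)) \<notin> Z"
      unfolding rotated_plane_point by eventually_elim (auto simp: Z_def J_def integrable_iff_bounded)
  qed
  then have "Z \<in> null_sets (haar_SO \<Otimes>\<^sub>M lborel)" unfolding null_set_planes_iff[OF Zm] by simp
  from AE_not_in[OF this] AE_space show ?thesis
  proof eventually_elim
    fix p :: "(real^'n^'n) \<times> (real^'n)" assume p: "p \<notin> Z" "p \<in> space (haar_SO \<Otimes>\<^sub>M lborel)"
    then have [measurable]: "fst p \<in> space haar_SO" and "J p < \<infinity>" by (auto simp: Z_def less_top[symmetric] space_pair_measure)
    then show "case p of (A, y) \<Rightarrow> integrable (subspace_lborel B0) (\<lambda>v. f (y + A *v v))"
      by (auto simp: integrable_iff_bounded J_def split_beta)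
  qed
qed

lemma is_preimage_ae_iff:
  assumes [measurable]: "g \<in> borel_measurable borel" and ae: "AE x in lborel. f x = g x"
  shows "is_preimage_ae e f \<Psi> \<longleftrightarrow> (AE (A, y) in haar_SO \<Otimes>\<^sub>M lborel.
    integrable (subspace_lborel B0) (\<lambda>v. g (y + A *v v)) \<and> (LINT v|subspace_lborel B0. g (y + A *v v)) = \<Psi> (plane e A y))"
proof -
  obtain N where N: "N \<in> null_sets lborel" "\<And>x. x \<in> space lborel \<Longrightarrow> x \<notin> N \<Longrightarrow> f x = g x"
    using AE_null_superset[OF ae] by blast
  have Nb: "N \<in> sets borel" using N(1) by auto
  have fg: "f x = g x" if "x \<notin> N" for x using N(2) that by simp
  have "AE p in haar_SO \<Otimes>\<^sub>M lborel. (case p of (A, y) \<Rightarrow> integrable (completion (plane_lborel (plane e A y))) f \<and>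
        radon_john f (plane e A y) = \<Psi> (plane e A y)) \<longleftrightarrow>
     (case p of (A, y) \<Rightarrow> integrable (subspace_lborel B0) (\<lambda>v. g (y + A *v v)) \<and> (LINT v|subspace_lborel B0. g (y + A *v v)) = \<Psi> (plane e A y))"
    using AE_planes_avoid_null_set[OF N(1)] AE_space
  proof eventually_elim
    fix p :: "(real^'n^'n) \<times> (real^'n)"
    assume *: "case p of (A, y) \<Rightarrow> AE v in subspace_lborel B0. y + A *v v \<notin> N" and "p \<in> space (haar_SO \<Otimes>\<^sub>M lborel)"
    then obtain A y where p: "p = (A, y)" and A: "rotation_matrix A" by (auto simp: space_pair_measure space_haar_SO)
    have ae: "AE v in subspace_lborel B0. y + A *v v \<notin> N" using * by (simp add: p)
    show "(case p of (A, y) \<Rightarrow> integrable (completion (plane_lborel (plane e A y))) f \<and> radon_john f (plane e A y) = \<Psi> (plane e A y)) \<longleftrightarrow>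
     (case p of (A, y) \<Rightarrow> integrable (subspace_lborel B0) (\<lambda>v. g (y + A *v v)) \<and> (LINT v|subspace_lborel B0. g (y + A *v v)) = \<Psi> (plane e A y))"
      unfolding p split using radon_john_eq_integral[OF A assms(1) Nb _ ae, of f] fg by simp
  qed
  then show ?thesis unfolding is_preimage_ae_def by (rule eventually_cong)
qed

lemma is_preimage_ae_if_recoverable:
  assumes f: "tame f" and \<Psi>: "recoverable \<Psi> f"
  shows "is_preimage_ae e f \<Psi>"
proof -
  have fm: "f \<in> borel_measurable borel" by (rule tame_borel[OF two_le_card xi_norm f])
  obtain N where N: "N \<in> null_sets lborel" and eq: "\<And>A y. rotation_matrix A \<Longrightarrow> 0 \<notin> plane e A y \<Longrightarrow>
     (AE v in subspace_lborel B0. y + A *v v \<notin> N) \<Longrightarrow> \<Psi> (plane e A y) = (LINT v|subspace_lborel B0. f (y + A *v v))"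
    using \<Psi> unfolding recoverable_def by blast
  show ?thesis
    unfolding is_preimage_ae_iff[OF fm AE_I2[OF refl]]
    using AE_planes_avoid_null_set[OF N] AE_planes_avoid_origin AE_planes_integrable[OF f] AE_space
    by eventually_elim (auto simp: eq space_pair_measure space_haar_SO)
qed

section \<open>Uniqueness of the preimage\<close>

lemma EK_mean_eq_of_preimages:
  assumes f: "tame f" "is_preimage_ae e f \<Psi>" and g: "tame g" "is_preimage_ae e g \<Psi>"
  shows "AE x in lborel. AE q in lborel. 0 < q \<longrightarrow>
    EK_mean (CARD('n) - 2) (sph_mean \<xi> f x) q = EK_mean (CARD('n) - 2) (sph_mean \<xi> g x) q"
proof -
  note n2 = two_le_card and \<xi> = xi_norm
  have fm: "f \<in> borel_measurable borel" by (rule tame_borel[OF n2 \<xi> f(1)])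
  have gm: "g \<in> borel_measurable borel" by (rule tame_borel[OF n2 \<xi> g(1)])
  let ?E = "\<lambda>p. case p of (A, y) \<Rightarrow> (LINT v|subspace_lborel B0. f (y + A *v v)) = (LINT v|subspace_lborel B0. g (y + A *v v))"
  have "AE p in haar_SO \<Otimes>\<^sub>M lborel. ?E p"
    using f(2)[unfolded is_preimage_ae_iff[OF fm AE_I2[OF refl]]] g(2)[unfolded is_preimage_ae_iff[OF gm AE_I2[OF refl]]]
    by eventually_elim auto
  from AE_null_superset[OF this] obtain Z where Z: "Z \<in> null_sets (haar_SO \<Otimes>\<^sub>M lborel)" "\<And>p. p \<in> space (haar_SO \<Otimes>\<^sub>M lborel) \<Longrightarrow> p \<notin> Z \<Longrightarrow> ?E p"
    by blast
  have "Z \<in> sets (haar_SO \<Otimes>\<^sub>M lborel)" using Z(1) by auto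
  then have "AE x in lborel. AE q in lborel. 0 < q \<longrightarrow> (AE A in haar_SO. (A, x + q *\<^sub>R (A *v \<xi>)) \<notin> Z)"
    using Z(1) null_set_planes_iff by blast
  then show ?thesis
  proof eventually_elim
    fix x :: "real^'n"
    assume "AE q in lborel. 0 < q \<longrightarrow> (AE A in haar_SO. (A, x + q *\<^sub>R (A *v \<xi>)) \<notin> Z)"
    then show "AE q in lborel. 0 < q \<longrightarrow> EK_mean (CARD('n) - 2) (sph_mean \<xi> f x) q = EK_mean (CARD('n) - 2) (sph_mean \<xi> g x) q"
      using tame_AE_radial_weight_finite[OF n2 \<xi> n3 f(1), of x] tame_AE_radial_weight_finite[OF n2 \<xi> n3 g(1), of x]
    proof (eventually_elim, intro impI)
      fix q :: real
      assume q: "0 < q" and ae: "0 < q \<longrightarrow> (AE A in haar_SO. (A, x + q *\<^sub>R (A *v \<xi>)) \<notin> Z)"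
        and fin: "0 < q \<longrightarrow> (\<integral>\<^sup>+s. ennreal (radial_weight (CARD('n) - 2) q s) * sph_nn \<xi> (\<lambda>y. ennreal \<bar>f y\<bar>) x s \<partial>lborel) < \<infinity>"
          "0 < q \<longrightarrow> (\<integral>\<^sup>+s. ennreal (radial_weight (CARD('n) - 2) q s) * sph_nn \<xi> (\<lambda>y. ennreal \<bar>g y\<bar>) x s \<partial>lborel) < \<infinity>"
      interpret S: sigma_finite_measure "subspace_lborel B0" by (rule sigma_finite_B0)
      have mean: "EK_mean (card B0) (sph_mean \<xi> h x) q = (LINT A|haar_SO. LINT v|subspace_lborel B0. h (x + A *v (q *\<^sub>R \<xi> + v)))"
        if hm: "h \<in> borel_measurable borel" and fin: "(\<integral>\<^sup>+s. ennreal (radial_weight (CARD('n) - 2) q s) * sph_nn \<xi> (\<lambda>y. ennreal \<bar>h y\<bar>) x s \<partial>lborel) < \<infinity>" for h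
        unfolding EK_mean_def
      proof (rule integral_rotated_planes(2)[OF n2 B0 B0_ne \<xi> B0_xi less_imp_le[OF q] hm, symmetric])
        show "(\<integral>\<^sup>+s. ennreal (radial_weight (card B0) q s) * sph_nn \<xi> (\<lambda>y. ennreal \<bar>h y\<bar>) x s \<partial>lborel) < \<infinity>"
          using fin unfolding card_B0 .
      qed
      have "AE A in haar_SO. (A, x + q *\<^sub>R (A *v \<xi>)) \<notin> Z" using ae q by blast
      then have eq: "AE A in haar_SO. (LINT v|subspace_lborel B0. f (x + A *v (q *\<^sub>R \<xi> + v))) = (LINT v|subspace_lborel B0. g (x + A *v (q *\<^sub>R \<xi> + v)))"
        unfolding rotated_plane_point using AE_space by eventually_elim (use Z(2) in \<open>auto simp: space_pair_measure\<close>)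
      have m: "(\<lambda>A. LINT v|subspace_lborel B0. h (x + A *v (q *\<^sub>R \<xi> + v))) \<in> borel_measurable haar_SO"
        if [measurable]: "h \<in> borel_measurable borel" for h :: "real^'n \<Rightarrow> real"
        by measurable
      show "EK_mean (CARD('n) - 2) (sph_mean \<xi> f x) q = EK_mean (CARD('n) - 2) (sph_mean \<xi> g x) q"
        using fin q unfolding mean[OF fm fin(1)[rule_format, OF q], unfolded card_B0] mean[OF gm fin(2)[rule_format, OF q], unfolded card_B0]
        by (intro integral_cong_AE m fm gm eq)
    qed
  qed
qed

text \<open>The inversion formula is applied twice to one and the same function, the mean built from
  f: it returns the spherical mean of f and also that of g, because the two means agree.\<close>

lemma sph_mean_eq_of_preimages:
  assumes f: "tame f" "is_preimage_ae e f \<Psi>" and g: "tame g" "is_preimage_ae e g \<Psi>" and r: "r > 0"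
  shows "AE x in lborel. sph_mean \<xi> f x r = sph_mean \<xi> g x r"
  using EK_mean_eq_of_preimages[OF f g] tame_AE_lebesgue_point[OF two_le_card xi_norm f(1) r]
    tame_AE_lebesgue_point[OF two_le_card xi_norm g(1) r]
proof eventually_elim
  fix x :: "real^'n"
  let ?k = "CARD('n) - 2" and ?F = "sph_mean \<xi> f x" and ?G = "sph_mean \<xi> g x"
  assume ae: "AE q in lborel. 0 < q \<longrightarrow> EK_mean ?k ?F q = EK_mean ?k ?G q" and leb: "lebesgue_point ?F r" "lebesgue_point ?G r"
  have F: "tail_integrable ?k ?F" and G: "tail_integrable ?k ?G"
    using tame_sph_mean_tail_integrable[OF two_le_card xi_norm n3] f(1) g(1) by blast+
  \<comment> \<open>In even dimension the inversion differentiates directly and needs equality at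
    every radius, which continuity supplies.\<close>
  have even: "EK_mean ?k ?F q = EK_mean ?k ?G q" if ev: "even CARD('n)" and q: "q > 0" for q
  proof (rule ccontr)
    assume ne: "EK_mean ?k ?F q \<noteq> EK_mean ?k ?G q"
    define N where "N = ?k div 2"
    have k: "?k = 2 * N" using ev by (simp add: N_def)
    have N: "N \<ge> 1" using k n3 by simp
    have "isCont (\<lambda>q. EK_mean ?k ?F q - EK_mean ?k ?G q) q"
      using isCont_EK_mean_even[OF F[unfolded k] N q] isCont_EK_mean_even[OF G[unfolded k] N q] unfolding k by (intro continuous_intros)
    then have "\<forall>\<^sub>F s in at q. EK_mean ?k ?F s - EK_mean ?k ?G s \<noteq> 0"
      using ne unfolding isCont_def by (intro tendsto_imp_eventually_ne) auto
    then obtain d where d: "d > 0" "\<And>s. s \<noteq> q \<Longrightarrow> dist s q < d \<Longrightarrow> EK_mean ?k ?F s \<noteq> EK_mean ?k ?G s"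
      unfolding eventually_at by auto
    have "AE s in lborel. s \<notin> {q<..<q + d}"
      using ae by eventually_elim (use d q in \<open>auto simp: dist_real_def\<close>)
    then have "{q<..<q + d} \<in> null_sets lborel" by (subst AE_iff_null_sets) auto
    then have "emeasure lborel {q<..<q + d} = 0" by (rule null_setsD1)
    then show False using d(1) by simp
  qed
  have inv: "pi powr (1 - real CARD('n) / 2) * EK_deriv CARD('n) (EK_mean ?k ?F) r = H r"
    if H: "tail_integrable ?k H" and ev: "\<And>q. even CARD('n) \<Longrightarrow> q > 0 \<Longrightarrow> EK_mean ?k ?F q = EK_mean ?k H q"
      and ae: "AE q in lborel. 0 < q \<longrightarrow> EK_mean ?k ?F q = EK_mean ?k H q" and leb: "lebesgue_point H r" for H
    by (rule EK_deriv_inversion[OF n3 H ev ae r leb])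
  show "sph_mean \<xi> f x r = sph_mean \<xi> g x r"
    using inv[OF F refl _ leb(1)] inv[OF G even ae leb(2)] by simp
qed

text \<open>Write f - g = (f - F) + (G - g) with the spherical means F and G of radius r, which
  agree almost everywhere, and let r tend to 0 in L^p.\<close>

lemma preimage_ae_unique:
  assumes p: "1 \<le> p" "p < real CARD('n) / (real CARD('n) - 2)"
    and f: "f \<in> borel_measurable borel" "(\<integral>\<^sup>+x. ennreal (\<bar>f x\<bar> powr p) \<partial>lborel) < \<infinity>" "is_preimage_ae e f \<Psi>"
    and g: "g \<in> borel_measurable borel" "(\<integral>\<^sup>+x. ennreal (\<bar>g x\<bar> powr p) \<partial>lborel) < \<infinity>" "is_preimage_ae e g \<Psi>"
  shows "AE x in lborel. f x = g x"
proof -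
  note [measurable] = f(1) g(1)
  note n2 = two_le_card and \<xi> = xi_norm
  let ?F = "\<lambda>r x. sph_mean \<xi> f x r" and ?G = "\<lambda>r x. sph_mean \<xi> g x r"
  have tame: "tame f" "tame g" using tame_if_powr_integrable[OF n2 \<xi> n3 _ p] f g by blast+
  let ?b = "\<lambda>r. ennreal (2 powr p) * ((\<integral>\<^sup>+x. ennreal (\<bar>?F r x - f x\<bar> powr p) \<partial>lborel) + (\<integral>\<^sup>+x. ennreal (\<bar>?G r x - g x\<bar> powr p) \<partial>lborel))"
  have le: "(\<integral>\<^sup>+x. ennreal (\<bar>f x - g x\<bar> powr p) \<partial>lborel) \<le> ?b r" if r: "r > 0" for r
  proof -
    have "(\<integral>\<^sup>+x. ennreal (\<bar>f x - g x\<bar> powr p) \<partial>lborel) = (\<integral>\<^sup>+x. ennreal (\<bar>(f x - ?F r x) + (?G r x - g x)\<bar> powr p) \<partial>lborel)"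
      using sph_mean_eq_of_preimages[OF tame(1) f(3) tame(2) g(3) r]
      by (intro nn_integral_cong_AE, eventually_elim) simp
    also have "\<dots> \<le> ennreal (2 powr p) * ((\<integral>\<^sup>+x. ennreal (\<bar>f x - ?F r x\<bar> powr p) \<partial>lborel) + (\<integral>\<^sup>+x. ennreal (\<bar>?G r x - g x\<bar> powr p) \<partial>lborel))"
      using p by (intro nn_integral_abs_add_powr_le) auto
    finally show ?thesis by (simp only: abs_minus_commute)
  qed
  have "(?b \<longlongrightarrow> ennreal (2 powr p) * (0 + 0)) (at_right 0)"
    by (intro tendsto_intros ennreal_tendsto_cmult sph_mean_Lp_tendsto[OF n2 \<xi> _ p(1)] f g) auto
  then have "(\<integral>\<^sup>+x. ennreal (\<bar>f x - g x\<bar> powr p) \<partial>lborel) \<le> ennreal (2 powr p) * (0 + 0)"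
    by (rule tendsto_lowerbound) (auto intro!: eventually_at_rightI[of 0 1] le)
  then have "(\<integral>\<^sup>+x. ennreal (\<bar>f x - g x\<bar> powr p) \<partial>lborel) = 0" by simp
  then have "AE x in lborel. ennreal (\<bar>f x - g x\<bar> powr p) = 0" by (subst (asm) nn_integral_0_iff_AE) auto
  then show ?thesis by eventually_elim (auto simp: ennreal_eq_0_iff)
qed

section \<open>Reconstruction in L^p\<close>

lemma Lp_tilde_reconstruction:
  assumes p: "1 \<le> p" "p < real CARD('n) / (real CARD('n) - 2)" and \<phi>: "\<phi> \<in> Lp_tilde p"
  shows "\<exists>f\<in>Lp p. is_preimage_ae e f (Phi \<phi>)"
    and "f \<in> Lp p \<Longrightarrow> is_preimage_ae e f (Phi \<phi>) \<Longrightarrow> Lp_limit p (approx_inverse e (Phi \<phi>)) f \<and>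
      (AE (\<theta>, t) in hyperplane_measure. let h = hyperplane \<theta> t in \<phi> h = dist0 h powr (1 - real CARD('n)) * f (nu_hyperplane h))"
proof -
  note n2 = two_le_card and \<xi> = xi_norm
  obtain f1 where f1[measurable]: "f1 \<in> borel_measurable borel" and ae: "AE x in lborel. point_fun \<phi> x = f1 x"
    and fin: "(\<integral>\<^sup>+x. ennreal (\<bar>f1 x\<bar> powr p) \<partial>lborel) < \<infinity>"
    by (rule Lp_tilde_point_fun[OF n2 \<xi> \<phi> p(1)])
  have tame: "tame f1" by (rule tame_if_powr_integrable[OF n2 \<xi> n3 f1 p fin])
  have rec: "recoverable (Phi \<phi>) f1" by (rule recoverable_Phi[OF f1 ae])
  have pre1: "is_preimage_ae e f1 (Phi \<phi>)" by (rule is_preimage_ae_if_recoverable[OF tame rec])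
  have "integrable lborel (\<lambda>x. \<bar>f1 x\<bar> powr p)" using fin by (intro integrableI_bounded) auto
  then have "f1 \<in> Lp p"
    unfolding Lp_def by (auto intro: measurable_completion integrable_completion[THEN iffD2])
  then show "\<exists>f\<in>Lp p. is_preimage_ae e f (Phi \<phi>)" using pre1 by blast
  assume f: "f \<in> Lp p" and pre: "is_preimage_ae e f (Phi \<phi>)"
  \<comment> \<open>A member of \<open>Lp p\<close> is only Lebesgue measurable; its Borel
    representative is again a preimage, because almost every plane meets the null set of
    disagreement in a null set.\<close>
  obtain f2 where f2[measurable]: "f2 \<in> borel_measurable lborel" and ff2: "AE x in lborel. f x = f2 x"
    using completion_ex_borel_measurable_real[of f lborel] f by (auto simp: Lp_def)
  have f2': "f2 \<in> borel_measurable borel" using f2 by simp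
  have "(\<integral>\<^sup>+x. ennreal (\<bar>f2 x\<bar> powr p) \<partial>lborel) = (\<integral>\<^sup>+x. ennreal (\<bar>f x\<bar> powr p) \<partial>lebesgue)"
    unfolding nn_integral_completion using ff2 by (intro nn_integral_cong_AE, eventually_elim) simp
  also have "\<dots> < \<infinity>" using f by (auto simp: Lp_def integrable_iff_bounded)
  finally have fin2: "(\<integral>\<^sup>+x. ennreal (\<bar>f2 x\<bar> powr p) \<partial>lborel) < \<infinity>" .
  have "is_preimage_ae e f2 (Phi \<phi>)"
    using pre unfolding is_preimage_ae_iff[OF f2' ff2] is_preimage_ae_iff[OF f2' AE_I2[OF refl]] .
  then have "AE x in lborel. f1 x = f2 x" by (intro preimage_ae_unique[OF p f1 fin pre1 f2' fin2])
  with ff2 have ff: "AE x in lborel. f x = f1 x" by eventually_elim simp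
  have inv: "AE x in lborel. approx_inverse e (Phi \<phi>) r x = sph_mean \<xi> f1 x r" if r: "r > 0" for r
    using tame_AE_lebesgue_point[OF n2 \<xi> tame r] by eventually_elim (rule approx_inverse_eq[OF rec tame r])
  have "Lp_limit p (approx_inverse e (Phi \<phi>)) f"
    unfolding Lp_limit_def
  proof
    show "\<forall>\<^sub>F r in at_right 0. approx_inverse e (Phi \<phi>) r \<in> borel_measurable lebesgue"
      by (intro eventually_at_rightI[of 0 1] borel_measurable_completion_AE[OF _ inv]) auto
    have "(\<integral>\<^sup>+x. ennreal (\<bar>sph_mean \<xi> f1 x r - f1 x\<bar> powr p) \<partial>lborel) = (\<integral>\<^sup>+x. ennreal (\<bar>approx_inverse e (Phi \<phi>) r x - f x\<bar> powr p) \<partial>lebesgue)"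
      if r: "r > 0" for r
      unfolding nn_integral_completion using inv[OF r] ff by (intro nn_integral_cong_AE, eventually_elim) simp
    then have "\<forall>\<^sub>F r in at_right 0. (\<integral>\<^sup>+x. ennreal (\<bar>sph_mean \<xi> f1 x r - f1 x\<bar> powr p) \<partial>lborel) = (\<integral>\<^sup>+x. ennreal (\<bar>approx_inverse e (Phi \<phi>) r x - f x\<bar> powr p) \<partial>lebesgue)"
      by (intro eventually_at_rightI[of 0 1]) auto
    then show "((\<lambda>r. \<integral>\<^sup>+x. ennreal (\<bar>approx_inverse e (Phi \<phi>) r x - f x\<bar> powr p) \<partial>lebesgue) \<longlongrightarrow> 0) (at_right 0)"
      by (rule Lim_transform_eventually[OF sph_mean_Lp_tendsto[OF n2 \<xi> f1 p(1) fin]])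
  qed
  moreover have "AE (\<theta>, t) in hyperplane_measure. let h = hyperplane \<theta> t in \<phi> h = dist0 h powr (1 - real CARD('n)) * f (nu_hyperplane h)"
  proof -
    have "AE x in lborel. point_fun \<phi> x = f x" using ae ff by eventually_elim simp
    from AE_null_superset[OF this] obtain N where N: "N \<in> null_sets lborel" "\<And>x. x \<in> space lborel \<Longrightarrow> x \<notin> N \<Longrightarrow> point_fun \<phi> x = f x"
      by blast
    show ?thesis unfolding hyperplane_measure_def
    proof (rule AE_completion)
      show "AE (\<theta>, t) in sphere_prob UNIV \<Otimes>\<^sub>M lborel. let h = hyperplane \<theta> t in \<phi> h = dist0 h powr (1 - real CARD('n)) * f (nu_hyperplane h)"
        using AE_hyperplane_point[OF n2 \<xi> N(1)] AE_sphere_prob_norm[OF n2 \<xi>]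
      proof eventually_elim
        fix q :: "(real^'n) \<times> real"
        assume "case q of (\<theta>, t) \<Rightarrow> - (\<theta> /\<^sub>R t) \<notin> N" "case q of (\<theta>, t) \<Rightarrow> norm \<theta> = 1 \<and> t \<noteq> 0"
        then obtain \<theta> t where q: "q = (\<theta>, t)" "- (\<theta> /\<^sub>R t) \<notin> N" "norm \<theta> = 1" "t \<noteq> 0" by (cases q) auto
        have "point_fun \<phi> (nu_hyperplane (hyperplane \<theta> t)) = f (nu_hyperplane (hyperplane \<theta> t))"
          using N(2) q(2) unfolding coordinates_immaterial(3)[OF q(3)] by simp
        then show "case q of (\<theta>, t) \<Rightarrow> let h = hyperplane \<theta> t in \<phi> h = dist0 h powr (1 - real CARD('n)) * f (nu_hyperplane h)"
          using point_fun_nu_hyperplane[OF q(3,4), of \<phi>] by (simp add: q(1) Let_def)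
      qed
    qed
  qed
  ultimately show "Lp_limit p (approx_inverse e (Phi \<phi>)) f \<and>
      (AE (\<theta>, t) in hyperplane_measure. let h = hyperplane \<theta> t in \<phi> h = dist0 h powr (1 - real CARD('n)) * f (nu_hyperplane h))" ..
qed

section \<open>Continuous functions with decay\<close>

lemma C_decay_bound:
  assumes "f \<in> C_decay \<mu>"
  obtains C R where "R > 0" "C > 0" "\<And>x :: real^'n. norm x \<ge> R \<Longrightarrow> \<bar>f x\<bar> \<le> C * norm x powr - \<mu>"
proof -
  from assms have "f \<in> O[at_infinity](\<lambda>x. norm x powr - \<mu>)" by (simp add: C_decay_def)
  then obtain C where C: "C > 0" "\<forall>\<^sub>F x in at_infinity. norm (f x) \<le> C * norm (norm x powr - \<mu>)"
    by (elim landau_o.bigE)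
  then obtain R where R: "\<And>x. norm x \<ge> R \<Longrightarrow> norm (f x) \<le> C * norm (norm x powr - \<mu>)"
    by (auto simp: eventually_at_infinity)
  show thesis by (rule that[of "max R 1" C]) (use R C in auto)
qed

lemma C_decay_small:
  assumes f: "f \<in> C_decay \<mu>" and \<mu>: "\<mu> > 0" and \<epsilon>: "\<epsilon> > 0"
  obtains R where "\<And>x :: real^'n. norm x \<ge> R \<Longrightarrow> \<bar>f x\<bar> < \<epsilon>"
proof -
  obtain C R where C: "R > 0" "C > 0" "\<And>x :: real^'n. norm x \<ge> R \<Longrightarrow> \<bar>f x\<bar> \<le> C * norm x powr - \<mu>"
    using C_decay_bound[OF f] by blast
  have "((\<lambda>x :: real^'n. C * norm x powr - \<mu>) \<longlongrightarrow> C * 0) at_infinity"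
    using \<mu> by (intro tendsto_intros tendsto_neg_powr[OF _ filterlim_norm_at_top]) auto
  then have "\<forall>\<^sub>F x :: real^'n in at_infinity. C * norm x powr - \<mu> < \<epsilon>"
    using \<epsilon> by (intro order_tendstoD(2)[of _ "C * 0"]) auto
  then obtain R' where R': "\<And>x :: real^'n. norm x \<ge> R' \<Longrightarrow> C * norm x powr - \<mu> < \<epsilon>"
    by (auto simp: eventually_at_infinity)
  show thesis by (rule that[of "max R R'"]) (use C(3) R' in force)
qed

lemma C_decay_bounded:
  assumes f: "f \<in> C_decay \<mu>" and \<mu>: "\<mu> > 0"
  obtains B where "\<And>x :: real^'n. \<bar>f x\<bar> \<le> B"
proof -
  obtain R where R: "\<And>x :: real^'n. norm x \<ge> R \<Longrightarrow> \<bar>f x\<bar> < 1" using C_decay_small[OF f \<mu>, of 1] by auto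
  have "continuous_on (cball 0 R) f" using f by (auto simp: C_decay_def intro: continuous_on_subset)
  then have "bounded (f ` cball 0 R)" by (intro compact_imp_bounded compact_continuous_image) auto
  then obtain b where "\<forall>z\<in>f ` cball 0 R. norm z \<le> b" unfolding bounded_iff by blast
  then have b: "\<bar>f x\<bar> \<le> b" if "x \<in> cball 0 R" for x using that by auto
  have "\<bar>f x\<bar> \<le> max b 1" for x
    using R[of x] b[of x] by (cases "norm x \<le> R") (auto simp: less_imp_le le_max_iff_disj)
  then show thesis by (rule that)
qed

lemma C_decay_borel: "f \<in> C_decay \<mu> \<Longrightarrow> f \<in> borel_measurable borel"
  by (simp add: C_decay_def borel_measurable_continuous_onI)

lemma C_decay_tame:
  assumes f: "f \<in> C_decay \<mu>" and \<mu>: "\<mu> > real CARD('n) - 2"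
  shows "tame (f :: real^'n \<Rightarrow> real)"
proof -
  have \<mu>0: "\<mu> > 0" using \<mu> n3 by linarith
  obtain C R where CR: "R > 0" "C > 0" "\<And>x :: real^'n. norm x \<ge> R \<Longrightarrow> \<bar>f x\<bar> \<le> C * norm x powr - \<mu>"
    using C_decay_bound[OF f] by blast
  obtain B where B: "\<And>x. \<bar>f x\<bar> \<le> B" using C_decay_bounded[OF f \<mu>0] by blast
  show ?thesis by (rule tame_if_decay[OF two_le_card xi_norm C_decay_borel[OF f] \<mu> \<mu>0 B CR(3)])
qed

text \<open>The decay exponent exceeds the dimension n - 2 of the planes, so no plane is
  exceptional.\<close>

lemma C_decay_plane_integrable:
  assumes f: "f \<in> C_decay \<mu>" and \<mu>: "\<mu> > real CARD('n) - 2" and A: "rotation_matrix A"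
  shows "integrable (subspace_lborel B0) (\<lambda>v. f (y + A *v v))"
proof (rule integrableI_bounded)
  note B0 = B0
  have [measurable]: "f \<in> borel_measurable borel" by (rule C_decay_borel[OF f])
  show "(\<lambda>v. f (y + A *v v)) \<in> borel_measurable (subspace_lborel B0)" by measurable
  have \<mu>0: "\<mu> > 0" using \<mu> n3 by linarith
  obtain C R where CR: "R > 0" "C > 0" "\<And>x :: real^'n. norm x \<ge> R \<Longrightarrow> \<bar>f x\<bar> \<le> C * norm x powr - \<mu>"
    using C_decay_bound[OF f] by blast
  obtain B where B: "\<And>x. \<bar>f x\<bar> \<le> B" using C_decay_bounded[OF f \<mu>0] by blast
  \<comment> \<open>For |v| \<ge> r the point y + A v has norm at least |v| / 2 and at least R, so
    the decay estimate applies in terms of |v|.\<close>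
  define r where "r = 2 * norm y + 2 * R"
  have r: "r > 0" using CR(1) by (simp add: r_def add_nonneg_pos)
  have cb[measurable]: "cball (0::real^'n) r \<in> sets borel" by simp
  let ?c = "C * 2 powr \<mu>"
  have le: "ennreal (norm (f (y + A *v v))) \<le> ennreal B * indicator (cball 0 r) v + ennreal ?c * (indicator {r..} (norm v) * ennreal (norm v powr - \<mu>))" for v
  proof (cases "norm v \<ge> r")
    case True
    have "norm v = norm (A *v v)" using rotation_matrix_orthogonal_transformation[OF A] by (simp add: orthogonal_transformation)
    also have "\<dots> \<le> norm (y + A *v v) + norm y" using norm_triangle_ineq4[of "y + A *v v" y] by simp
    finally have half: "norm v / 2 \<le> norm (y + A *v v)" "R \<le> norm (y + A *v v)" using True CR(1) norm_ge_zero[of y] unfolding r_def by linarith+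
    have v: "norm v > 0" using True r by linarith
    have "\<bar>f (y + A *v v)\<bar> \<le> C * norm (y + A *v v) powr - \<mu>" by (rule CR(3)[OF half(2)])
    also have "\<dots> \<le> C * (norm v / 2) powr - \<mu>"
      using half(1) v \<mu>0 CR(2) by (intro mult_left_mono powr_mono2') auto
    also have "\<dots> = ?c * norm v powr - \<mu>" using v by (simp add: powr_divide powr_minus_divide)
    finally have "ennreal (norm (f (y + A *v v))) \<le> ennreal (?c * norm v powr - \<mu>)" by (simp add: ennreal_leI)
    also have "\<dots> = ennreal ?c * ennreal (norm v powr - \<mu>)" using CR(2) by (intro ennreal_mult) auto
    also have "\<dots> = ennreal ?c * (indicator {r..} (norm v) * ennreal (norm v powr - \<mu>))" using True by simp
    also have "\<dots> \<le> ennreal B * indicator (cball 0 r) v + \<dots>" by simp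
    finally show ?thesis .
  next
    case False
    then have "ennreal (norm (f (y + A *v v))) \<le> ennreal B * indicator (cball 0 r) v" using B by (simp add: ennreal_leI)
    then show ?thesis by (simp add: add_increasing2)
  qed
  have "(\<integral>\<^sup>+v. ennreal (norm (f (y + A *v v))) \<partial>subspace_lborel B0) \<le>
    (\<integral>\<^sup>+v. ennreal B * indicator (cball 0 r) v + ennreal ?c * (indicator {r..} (norm v) * ennreal (norm v powr - \<mu>)) \<partial>subspace_lborel B0)"
    by (intro nn_integral_mono le)
  also have "\<dots> = ennreal B * emeasure (subspace_lborel B0) (cball 0 r) + ennreal ?c * (\<integral>\<^sup>+v. indicator {r..} (norm v) * ennreal (norm v powr - \<mu>) \<partial>subspace_lborel B0)"
    by (subst nn_integral_add) (auto simp: nn_integral_cmult nn_integral_cmult_indicator)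
  also have "\<dots> < \<infinity>"
  proof -
    have "real (card B0) < \<mu>" using \<mu> n3 unfolding card_B0 by (simp add: of_nat_diff)
    then have "(\<integral>\<^sup>+v. indicator {r..} (norm v) * ennreal (norm v powr - \<mu>) \<partial>subspace_lborel B0) < \<infinity>"
      by (rule nn_integral_subspace_powr_outside_ball[OF B0 B0_ne r])
    then show ?thesis unfolding emeasure_subspace_lborel_cball[OF B0 r]
      by (auto simp: ennreal_mult_less_top)
  qed
  finally show "(\<integral>\<^sup>+v. ennreal (norm (f (y + A *v v))) \<partial>subspace_lborel B0) < \<infinity>" .
qed

lemma is_preimage_iff:
  assumes f: "f \<in> C_decay \<mu>" and \<mu>: "\<mu> > real CARD('n) - 2"
  shows "is_preimage e f \<Psi> \<longleftrightarrow> (\<forall>A y. rotation_matrix A \<longrightarrow> 0 \<notin> plane e A y \<longrightarrow>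
    (LINT v|subspace_lborel B0. f (y + A *v v)) = \<Psi> (plane e A y))"
proof -
  have *: "integrable (completion (plane_lborel (plane e A y))) f" "radon_john f (plane e A y) = (LINT v|subspace_lborel B0. f (y + A *v v))"
    if A: "rotation_matrix A" for A y
    using radon_john_eq_integral[OF A C_decay_borel[OF f], of "{}" f y] C_decay_plane_integrable[OF f \<mu> A] by simp_all
  show ?thesis
  proof
    assume "is_preimage e f \<Psi>"
    then have "radon_john f (plane e A y) = \<Psi> (plane e A y)" if "rotation_matrix A" "0 \<notin> plane e A y" for A y
      using that unfolding is_preimage_def planes_def by blast
    then show "\<forall>A y. rotation_matrix A \<longrightarrow> 0 \<notin> plane e A y \<longrightarrow> (LINT v|subspace_lborel B0. f (y + A *v v)) = \<Psi> (plane e A y)"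
      using *(2) by simp
  next
    assume "\<forall>A y. rotation_matrix A \<longrightarrow> 0 \<notin> plane e A y \<longrightarrow> (LINT v|subspace_lborel B0. f (y + A *v v)) = \<Psi> (plane e A y)"
    then have "radon_john f (plane e A y) = \<Psi> (plane e A y)" if "rotation_matrix A" "0 \<notin> plane e A y" for A y
      using that *(2) by simp
    then show "is_preimage e f \<Psi>" using *(1) unfolding is_preimage_def planes_def by blast
  qed
qed

lemma sph_mean_uniform:
  assumes f: "f \<in> C_decay \<mu>" and \<mu>: "\<mu> > 0" and \<epsilon>: "\<epsilon> > 0"
  obtains d where "d > 0" "\<And>x s r. \<bar>s - r\<bar> < d \<Longrightarrow> \<bar>sph_mean \<xi> f x s - sph_mean \<xi> f x r\<bar> \<le> \<epsilon>"
proof -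
  obtain R where R: "\<And>x :: real^'n. norm x \<ge> R \<Longrightarrow> \<bar>f x\<bar> < \<epsilon> / 2" using C_decay_small[OF f \<mu>, of "\<epsilon> / 2"] \<epsilon> by auto
  obtain B where B: "\<And>x. \<bar>f x\<bar> \<le> B" using C_decay_bounded[OF f \<mu>] by blast
  have "continuous_on UNIV f" using f by (simp add: C_decay_def)
  moreover have "2 * \<bar>f x\<bar> < \<epsilon>" if "norm x \<ge> R" for x using R[OF that] by simp
  ultimately obtain d where d: "d > 0" "d \<le> 1" "\<And>x y. dist x y < d \<Longrightarrow> \<bar>f x - f y\<bar> < \<epsilon>"
    using uniform_modulus_vanishing_at_infinity[of f R \<epsilon>] \<epsilon> by blast
  show thesis
    by (rule that[OF d(1)], rule sph_mean_uniform_modulus[OF two_le_card xi_norm C_decay_borel[OF f] B d(3)])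
qed

lemma sph_mean_zero: "sph_mean \<xi>' f (x :: real^'n) 0 = f x"
proof -
  interpret prob_space "haar_SO :: (real^'n^'n) measure" by (rule prob_space_haar_SO)
  show ?thesis by (simp add: sph_mean_def prob_space)
qed

text \<open>The spherical means of a uniformly continuous function are continuous in the radius, so
  every r is a Lebesgue point for every x.\<close>

lemma approx_inverse_C_decay:
  assumes f: "f \<in> C_decay \<mu>" and \<mu>: "\<mu> > real CARD('n) - 2" and pre: "is_preimage e f \<Psi>" and r: "r > 0"
  shows "approx_inverse e \<Psi> r x = sph_mean \<xi> f x r"
proof (rule approx_inverse_eq[OF _ C_decay_tame[OF f \<mu>] r])
  have \<mu>0: "\<mu> > 0" using \<mu> n3 by linarith
  show "recoverable \<Psi> f"
    using pre unfolding is_preimage_iff[OF f \<mu>] recoverable_def by (intro exI[of _ "{}"]) auto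
  have "isCont (sph_mean \<xi> f x) r"
    unfolding continuous_at_eps_delta
  proof (intro allI impI)
    fix \<epsilon> :: real assume "\<epsilon> > 0"
    then obtain d where d: "d > 0" "\<And>x s r. \<bar>s - r\<bar> < d \<Longrightarrow> \<bar>sph_mean \<xi> f x s - sph_mean \<xi> f x r\<bar> \<le> \<epsilon> / 2"
      using sph_mean_uniform[OF f \<mu>0, of "\<epsilon> / 2"] by auto
    show "\<exists>d>0. \<forall>s. dist s r < d \<longrightarrow> dist (sph_mean \<xi> f x s) (sph_mean \<xi> f x r) < \<epsilon>"
    proof (intro exI[of _ d] conjI allI impI d(1))
      fix s assume "dist s r < d"
      then have "dist (sph_mean \<xi> f x s) (sph_mean \<xi> f x r) \<le> \<epsilon> / 2" unfolding dist_real_def by (rule d(2))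
      then show "dist (sph_mean \<xi> f x s) (sph_mean \<xi> f x r) < \<epsilon>" using \<open>\<epsilon> > 0\<close> by simp
    qed
  qed
  then show "lebesgue_point (sph_mean \<xi> f x) r" by (rule lebesgue_point_isCont)
qed

text \<open>The spherical mean at radius 0 is f itself, and the modulus of continuity in the radius
  is uniform in x.\<close>

lemma approx_inverse_uniform_limit:
  assumes f: "f \<in> C_decay \<mu>" and \<mu>: "\<mu> > real CARD('n) - 2" and pre: "is_preimage e f \<Psi>"
  shows "uniform_limit UNIV (approx_inverse e \<Psi>) f (at_right 0)"
proof (rule uniform_limitI)
  have \<mu>0: "\<mu> > 0" using \<mu> n3 by linarith
  fix \<epsilon> :: real assume "\<epsilon> > 0"
  then obtain d where d: "d > 0" "\<And>x s r. \<bar>s - r\<bar> < d \<Longrightarrow> \<bar>sph_mean \<xi> f x s - sph_mean \<xi> f x r\<bar> \<le> \<epsilon> / 2"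
    using sph_mean_uniform[OF f \<mu>0, of "\<epsilon> / 2"] by auto
  show "\<forall>\<^sub>F r in at_right 0. \<forall>x\<in>UNIV. dist (approx_inverse e \<Psi> r x) (f x) < \<epsilon>"
  proof (rule eventually_at_rightI[OF _ d(1)], intro ballI)
    fix r x assume r: "r \<in> {0<..<d}"
    have "\<bar>sph_mean \<xi> f x r - sph_mean \<xi> f x 0\<bar> \<le> \<epsilon> / 2" using r by (intro d(2)) auto
    then show "dist (approx_inverse e \<Psi> r x) (f x) < \<epsilon>"
      using r \<open>\<epsilon> > 0\<close> approx_inverse_C_decay[OF f \<mu> pre, of r x] by (simp add: sph_mean_zero dist_real_def)
  qed
qed

lemma preimage_unique:
  assumes \<mu>: "\<mu> > real CARD('n) - 2" and f: "f \<in> C_decay \<mu>" "is_preimage e f \<Psi>" and g: "g \<in> C_decay \<mu>" "is_preimage e g \<Psi>"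
  shows "f = g"
proof
  fix x
  have "((\<lambda>r. approx_inverse e \<Psi> r x) \<longlongrightarrow> f x) (at_right 0)" "((\<lambda>r. approx_inverse e \<Psi> r x) \<longlongrightarrow> g x) (at_right 0)"
    using approx_inverse_uniform_limit[OF f(1) \<mu> f(2)] approx_inverse_uniform_limit[OF g(1) \<mu> g(2)]
    by (auto dest: tendsto_uniform_limitI[of _ _ _ _ x])
  then show "f x = g x" by (intro tendsto_unique[OF trivial_limit_at_right_real])
qed

lemma C_tilde_point_fun:
  assumes \<phi>: "\<phi> \<in> C_tilde \<mu>"
  obtains f :: "real^'n \<Rightarrow> real" where "f \<in> C_decay \<mu>" "\<And>x. x \<noteq> 0 \<Longrightarrow> f x = point_fun \<phi> x"
proof -
  let ?n = "real CARD('n)"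
  define H where "H = (\<lambda>x :: real^'n. hyperplane (sgn x) (- (1 / norm x)))"
  have Hx: "{y. y \<bullet> x = -1} = H x" if "x \<noteq> 0" for x using hyperplane_sgn[OF that] by (simp add: H_def)
  have dH: "dist0 (H x) = inverse (norm x)" if "x \<noteq> 0" for x
    using that by (simp add: H_def dist0_hyperplane norm_sgn divide_inverse)
  have Hh: "H x \<in> hyperplanes" if "x \<noteq> 0" for x
    using that by (auto simp: H_def hyperplanes_def norm_sgn)
  obtain c where c: "((\<lambda>h. dist0 h powr (?n - 1) * \<phi> h) \<longlongrightarrow> c) (inf (filtercomap dist0 at_top) (principal hyperplanes))"
    using \<phi> by (auto simp: C_tilde_def)
  \<comment> \<open>Points near 0 belong to hyperplanes far from the origin, so the limit c of the
    weighted \<phi> at infinity is the value that makes f continuous at 0.\<close>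
  define f where "f = (\<lambda>x. if x = 0 then c else point_fun \<phi> x)"
  have pf: "point_fun \<phi> x = dist0 (H x) powr (?n - 1) * \<phi> (H x)" if "x \<noteq> 0" for x
    using that by (simp add: point_fun_def Hx dH powr_minus[symmetric] inverse_powr)
  \<comment> \<open>As \<open>dist0 (H x)\<close> is 1 / |x|, hyperplanes receding to infinity
    correspond to x tending to 0, and hyperplanes approaching the origin to x tending to
    infinity.\<close>
  have limH: "filterlim H (inf (filtercomap dist0 G) (principal hyperplanes)) F"
    if "filterlim (\<lambda>x. inverse (norm x)) G F" "\<forall>\<^sub>F x in F. x \<noteq> 0" for F and G :: "real filter"
    unfolding filterlim_inf filterlim_principal filterlim_filtercomap_iff
  proof
    show "\<forall>\<^sub>F x in F. H x \<in> hyperplanes" using that(2) by eventually_elim (rule Hh)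
    have "\<forall>\<^sub>F x in F. inverse (norm x) = (dist0 \<circ> H) x" using that(2) by eventually_elim (simp add: dH)
    then show "filterlim (dist0 \<circ> H) G F" using that(1) by (rule filterlim_cong[OF refl refl, THEN iffD1])
  qed
  have "continuous_on (- {0}) (\<lambda>x. norm x powr (1 - ?n) * (\<lambda>(\<theta>, t). \<phi> (hyperplane \<theta> t)) (sgn x, - (1 / norm x)))"
  proof (intro continuous_intros)
    show "continuous_on (- {0}) (\<lambda>x :: real^'n. (\<lambda>(\<theta>, t). \<phi> (hyperplane \<theta> t)) (sgn x, - (1 / norm x)))"
    proof (rule continuous_on_compose2[where t="sphere 0 1 \<times> (- {0})"])
      show "continuous_on (sphere 0 1 \<times> (- {0})) (\<lambda>(\<theta>, t). \<phi> (hyperplane \<theta> t))" using \<phi> by (simp add: C_tilde_def)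
      show "continuous_on (- {0}) (\<lambda>x :: real^'n. (sgn x, - (1 / norm x)))"
        unfolding sgn_div_norm by (intro continuous_intros) auto
    qed (auto simp: norm_sgn)
  qed auto
  then have "continuous_on (- {0}) (point_fun \<phi>)"
    by (rule continuous_on_cong[OF refl, THEN iffD1, rotated]) (auto simp: point_fun_def Hx H_def)
  then have cont: "continuous_on (- {0}) f"
    by (rule continuous_on_cong[OF refl, THEN iffD1, rotated]) (simp add: f_def)
  have "isCont f x" for x
  proof (cases "x = 0")
    case False
    then show ?thesis using cont continuous_on_eq_continuous_at[of "- {0}" f] by auto
  next
    case True
    have "filterlim (\<lambda>x :: real^'n. inverse (norm x)) at_top (at 0)"
      by (rule filterlim_compose[OF filterlim_inverse_at_top_right]) (auto simp: filterlim_at intro!: tendsto_eq_intros eventually_at_filter[THEN iffD2])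
    then have "filterlim H (inf (filtercomap dist0 at_top) (principal hyperplanes)) (at 0)"
      by (rule limH) (auto simp: eventually_at_filter)
    then have "((\<lambda>x. dist0 (H x) powr (?n - 1) * \<phi> (H x)) \<longlongrightarrow> c) (at 0)"
      by (rule filterlim_compose[OF c])
    moreover have "\<forall>\<^sub>F x in at 0. dist0 (H x) powr (?n - 1) * \<phi> (H x) = f x"
      by (auto simp: eventually_at_filter f_def pf)
    ultimately have "(f \<longlongrightarrow> c) (at 0)" by (rule Lim_transform_eventually)
    then show ?thesis using True by (simp add: isCont_def f_def)
  qed
  then have "continuous_on UNIV f" by (simp add: continuous_at_imp_continuous_on)
  moreover have "f \<in> O[at_infinity](\<lambda>x. norm x powr - \<mu>)"
  proof -
    have ne: "\<forall>\<^sub>F x :: real^'n in at_infinity. x \<noteq> 0" unfolding eventually_at_infinity by (intro exI[of _ 1]) auto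
    have "filterlim (\<lambda>x :: real^'n. inverse (norm x)) (at_right 0) at_infinity"
      by (rule filterlim_compose[OF filterlim_inverse_at_right_top filterlim_norm_at_top])
    then have "filterlim H (inf (filtercomap dist0 (at_right 0)) (principal hyperplanes)) at_infinity"
      by (rule limH[OF _ ne])
    moreover have "(\<lambda>h. dist0 h powr (?n - 1 - \<mu>) * \<phi> h) \<in> O[inf (filtercomap dist0 (at_right 0)) (principal hyperplanes)](\<lambda>_. 1)"
      using \<phi> by (simp add: C_tilde_def)
    ultimately have "(\<lambda>x. dist0 (H x) powr (?n - 1 - \<mu>) * \<phi> (H x)) \<in> O[at_infinity](\<lambda>_. 1)"
      by (rule landau_o.big.compose[rotated])
    then have "(\<lambda>x. norm x powr - \<mu> * (dist0 (H x) powr (?n - 1 - \<mu>) * \<phi> (H x))) \<in> O[at_infinity](\<lambda>x. norm x powr - \<mu> * 1)"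
      by (rule landau_o.big.mult[OF landau_o.big_refl])
    moreover have "\<forall>\<^sub>F x in at_infinity. norm x powr - \<mu> * (dist0 (H x) powr (?n - 1 - \<mu>) * \<phi> (H x)) = f x"
      using ne
    proof eventually_elim
      fix x :: "real^'n" assume x: "x \<noteq> 0"
      have "norm x powr - \<mu> * dist0 (H x) powr (?n - 1 - \<mu>) = norm x powr (- \<mu> + - (?n - 1 - \<mu>))"
        unfolding dH[OF x] inverse_powr powr_minus[symmetric] powr_add[symmetric] ..
      then show "norm x powr - \<mu> * (dist0 (H x) powr (?n - 1 - \<mu>) * \<phi> (H x)) = f x"
        using x by (simp add: f_def point_fun_def Hx mult.assoc[symmetric])
    qed
    ultimately show ?thesis by (simp add: landau_o.big.in_cong)
  qed
  ultimately show thesis by (intro that[of f]) (auto simp: C_decay_def f_def)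
qed

lemma is_preimage_point_fun:
  assumes f: "f \<in> C_decay \<mu>" and \<mu>: "\<mu> > real CARD('n) - 2" and eq: "\<And>x. x \<noteq> 0 \<Longrightarrow> f x = point_fun \<phi> x"
  shows "is_preimage e f (Phi \<phi>)"
  unfolding is_preimage_iff[OF f \<mu>]
proof (intro allI impI)
  fix A :: "real^'n^'n" and y assume A: "rotation_matrix A" and 0: "0 \<notin> plane e A y"
  have [measurable]: "f \<in> borel_measurable borel" by (rule C_decay_borel[OF f])
  have "AE x in plane_lborel (plane e A y). x \<in> plane e A y"
    by (rule AE_plane_lborel[OF orthonormal_rotated[OF A] plane_eq])
  then have "AE x in plane_lborel (plane e A y). point_fun \<phi> x = f x"
    by eventually_elim (use 0 in \<open>metis eq\<close>)
  then have "Phi \<phi> (plane e A y) = (LINT x|plane_lborel (plane e A y). f x)"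
    by (intro Phi_eq_integral[OF A 0]) auto
  also have "\<dots> = (LINT v|subspace_lborel B0. f (y + A *v v))"
    unfolding plane_lborel_plane[OF A] by (rule integral_distr) measurable
  finally show "(LINT v|subspace_lborel B0. f (y + A *v v)) = Phi \<phi> (plane e A y)" by simp
qed

lemma C_tilde_reconstruction:
  assumes \<mu>: "real CARD('n) - 2 < \<mu>" and \<phi>: "\<phi> \<in> C_tilde \<mu>"
  shows "\<exists>f\<in>C_decay \<mu>. is_preimage e f (Phi \<phi>)"
    and "f \<in> C_decay \<mu> \<Longrightarrow> is_preimage e f (Phi \<phi>) \<Longrightarrow>
      uniform_limit UNIV (approx_inverse e (Phi \<phi>)) f (at_right 0) \<and>
      (\<forall>h\<in>hyperplanes. 0 \<notin> h \<longrightarrow> \<phi> h = dist0 h powr (1 - real CARD('n)) * f (nu_hyperplane h))"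
proof -
  obtain f0 where f0: "f0 \<in> C_decay \<mu>" "\<And>x. x \<noteq> 0 \<Longrightarrow> f0 x = point_fun \<phi> x"
    using C_tilde_point_fun[OF \<phi>] by blast
  have pre0: "is_preimage e f0 (Phi \<phi>)" by (rule is_preimage_point_fun[OF f0(1) \<mu> f0(2)])
  then show "\<exists>f\<in>C_decay \<mu>. is_preimage e f (Phi \<phi>)" using f0(1) by blast
  assume f: "f \<in> C_decay \<mu>" and pre: "is_preimage e f (Phi \<phi>)"
  have ff: "f = f0" by (rule preimage_unique[OF \<mu> f pre f0(1) pre0])
  have "\<phi> h = dist0 h powr (1 - real CARD('n)) * f (nu_hyperplane h)" if h: "h \<in> hyperplanes" "0 \<notin> h" for h
  proof -
    obtain \<theta> t where \<theta>: "norm \<theta> = 1" and h': "h = hyperplane \<theta> t" using h(1) by (auto simp: hyperplanes_def)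
    have t: "t \<noteq> 0" using h(2) by (auto simp: h' hyperplane_def)
    have "nu_hyperplane h \<noteq> 0" using \<theta> t by (auto simp: h' coordinates_immaterial(3)[OF \<theta>])
    then show ?thesis using point_fun_nu_hyperplane[OF \<theta> t, of \<phi>] by (simp add: ff f0(2) h')
  qed
  then show "uniform_limit UNIV (approx_inverse e (Phi \<phi>)) f (at_right 0) \<and>
      (\<forall>h\<in>hyperplanes. 0 \<notin> h \<longrightarrow> \<phi> h = dist0 h powr (1 - real CARD('n)) * f (nu_hyperplane h))"
    using approx_inverse_uniform_limit[OF f \<mu> pre] by blast
qed

end

theorem theorem4p11:
  fixes e :: "nat \<Rightarrow> real^'n"
  assumes n: "CARD('n) \<ge> 3"
    and e: "bij_betw e {1..CARD('n)} Basis"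
  shows
    "(\<forall>(p::real) \<phi>. 1 \<le> p \<and> p < real CARD('n) / (real CARD('n) - 2) \<and> \<phi> \<in> Lp_tilde p \<longrightarrow>
       (\<exists>f\<in>Lp p. is_preimage_ae e f (Phi \<phi>)) \<and>
       (\<forall>f\<in>Lp p. is_preimage_ae e f (Phi \<phi>) \<longrightarrow>
          Lp_limit p (approx_inverse e (Phi \<phi>)) f \<and>
          (AE (\<theta>, t) in hyperplane_measure. let h = hyperplane \<theta> t in
             \<phi> h = dist0 h powr (1 - real CARD('n)) * f (nu_hyperplane h)))) \<and>
     (\<forall>(\<mu>::real) \<phi>. real CARD('n) - 2 < \<mu> \<and> \<phi> \<in> C_tilde \<mu> \<longrightarrow>
       (\<exists>f\<in>C_decay \<mu>. is_preimage e f (Phi \<phi>)) \<and>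
       (\<forall>f\<in>C_decay \<mu>. is_preimage e f (Phi \<phi>) \<longrightarrow>
          uniform_limit UNIV (approx_inverse e (Phi \<phi>)) f (at_right 0) \<and>
          (\<forall>h\<in>hyperplanes. 0 \<notin> h \<longrightarrow>
             \<phi> h = dist0 h powr (1 - real CARD('n)) * f (nu_hyperplane h))))"
  using Lp_tilde_reconstruction[OF n e] C_tilde_reconstruction[OF n e] by blast

end
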